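(* Let $n$ be a positive integer and $K$ an algebraic number field that is not totally real. Then there is an integer $m\ge n+3$ such that $I_m$ is $n$-universal over $K$ if and only if the discriminant of $K$ is odd.
   Context: $I_m$ is the free $\mathcal{O}_K$-lattice $\mathcal{O}_Kx_1\perp\cdots\perp\mathcal{O}_Kx_m$ with $Q(x_i)=1$ (the sum of $m$ squares). A classic integral $\mathcal{O}_K$-lattice is one whose bilinear form takes values in $\mathcal{O}_K$. Here $I_m$ being $n$-universal means that it represents every classic integral $\mathcal{O}_K$-lattice of rank $n$ that is positive definite at every real place of $K$. *)

theory Defs
  imports
    "Jordan_Normal_Form.Determinant"
    "HOL-Computational_Algebra.Polynomial"
begin

section \<open>Number fields\<close>

text \<open>
  A number field is a type \<open>'k\<close> of class \<^class>\<open>field_char_0\<close> that is a finite-dimensional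
  vector space over the rationals.
\<close>

global_interpretation rat_vs: vector_space "\<lambda>(q::rat) (x::'k::field_char_0). of_rat q * x"
  by unfold_locales (simp_all add: algebra_simps of_rat_add of_rat_mult)

global_interpretation int_mod: Modules.module "\<lambda>(z::int) (x::'k::field_char_0). of_int z * x"
  by unfold_locales (simp_all add: algebra_simps)

definition number_field :: "'k::field_char_0 itself \<Rightarrow> bool" where
  "number_field _ \<longleftrightarrow> (\<exists>B::'k set. finite B \<and> rat_vs.span B = UNIV)"

definition totally_real :: "'k::field_char_0 itself \<Rightarrow> bool" where
  "totally_real _ \<longleftrightarrow> (\<forall>\<sigma>::'k \<Rightarrow> complex. field_hom \<sigma> \<longrightarrow> range \<sigma> \<subseteq> \<real>)"

definition ring_of_integers :: "'k::field_char_0 set" where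
  "ring_of_integers = {x. algebraic_int x}"

text \<open>The trace over the rationals of \<open>x\<close>: the trace of the linear map \<open>y \<mapsto> x * y\<close>,
  read off from an arbitrarily chosen basis of the field.\<close>

definition field_trace :: "'k::field_char_0 \<Rightarrow> rat" where
  "field_trace x =
     (let B = rat_vs.extend_basis {} in \<Sum>b\<in>B. rat_vs.representation B (x * b) b)"

definition integral_basis :: "'k::field_char_0 list \<Rightarrow> bool" where
  "integral_basis bs \<longleftrightarrow>
     distinct bs \<and> int_mod.independent (set bs) \<and> int_mod.span (set bs) = ring_of_integers"

definition field_discriminant :: "'k::field_char_0 itself \<Rightarrow> int" where
  "field_discriminant _ =
     (THE d. \<exists>bs::'k list. integral_basis bs \<and>
        of_int d = det (mat (length bs) (length bs) (\<lambda>(i, j). field_trace (bs ! i * bs ! j))))"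


section \<open>Lattices\<close>

text \<open>
  A quadratic space of dimension \<open>n\<close> is represented in coordinates, as \<open>K\<^sup>n\<close> with the
  symmetric bilinear form given by a Gram matrix. A lattice is a set of points of that space;
  it need not be free over the ring of integers.
\<close>

record 'k quad_lattice =
  rank :: nat
  gram :: "'k mat"
  points :: "'k vec set"

definition bilin :: "'k::field_char_0 quad_lattice \<Rightarrow> 'k vec \<Rightarrow> 'k vec \<Rightarrow> 'k" where
  "bilin L x y = x \<bullet> (gram L *\<^sub>v y)"

definition quad :: "'k::field_char_0 quad_lattice \<Rightarrow> 'k vec \<Rightarrow> 'k" where
  "quad L x = bilin L x x"

definition integer_vecs :: "nat \<Rightarrow> 'k::field_char_0 vec set" where
  "integer_vecs m = {v \<in> carrier_vec m. \<forall>i<m. v $ i \<in> ring_of_integers}"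

text \<open>
  The columns of the matrix \<open>A\<close> below are finitely many module generators of the lattice; the
  last conjunct says that they span the whole space \<open>K\<^sup>n\<close>, so that \<open>rank L\<close> is the rank.
\<close>

definition quadratic_lattice :: "'k::field_char_0 quad_lattice \<Rightarrow> bool" where
  "quadratic_lattice L \<longleftrightarrow>
     gram L \<in> carrier_mat (rank L) (rank L) \<and>
     transpose_mat (gram L) = gram L \<and>
     (\<exists>k. \<exists>A \<in> carrier_mat (rank L) k.
        points L = (\<lambda>c. A *\<^sub>v c) ` integer_vecs k \<and>
        (\<lambda>c. A *\<^sub>v c) ` carrier_vec k = carrier_vec (rank L))"

definition classic_integral :: "'k::field_char_0 quad_lattice \<Rightarrow> bool" where
  "classic_integral L \<longleftrightarrow> (\<forall>x\<in>points L. \<forall>y\<in>points L. bilin L x y \<in> ring_of_integers)"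

text \<open>Positive definiteness of the extension of the space to the reals along a real place,
  i.e. along a field homomorphism \<open>\<sigma>\<close> into the reals.\<close>

definition positive_definite_at :: "('k::field_char_0 \<Rightarrow> real) \<Rightarrow> 'k quad_lattice \<Rightarrow> bool" where
  "positive_definite_at \<sigma> L \<longleftrightarrow>
     (\<forall>x \<in> carrier_vec (rank L). x \<noteq> 0\<^sub>v (rank L) \<longrightarrow> x \<bullet> (map_mat \<sigma> (gram L) *\<^sub>v x) > 0)"

text \<open>
  \<open>M\<close> represents \<open>L\<close> if there is a linear map (with matrix \<open>T\<close>) of the ambient spaces that
  preserves the quadratic forms and maps \<open>L\<close> into \<open>M\<close>. Injectivity is not demanded; it is
  automatic when the form on \<open>L\<close> is nondegenerate.
\<close>

definition represents ::
  "'k::field_char_0 quad_lattice \<Rightarrow> 'k quad_lattice \<Rightarrow> bool" where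
  "represents M L \<longleftrightarrow>
     (\<exists>T \<in> carrier_mat (rank M) (rank L).
        (\<forall>x \<in> carrier_vec (rank L). quad M (T *\<^sub>v x) = quad L x) \<and>
        (\<lambda>x. T *\<^sub>v x) ` points L \<subseteq> points M)"

definition sum_of_squares_lattice :: "nat \<Rightarrow> 'k::field_char_0 quad_lattice" where
  "sum_of_squares_lattice m = \<lparr>rank = m, gram = 1\<^sub>m m, points = integer_vecs m\<rparr>"

definition n_universal :: "nat \<Rightarrow> 'k::field_char_0 quad_lattice \<Rightarrow> bool" where
  "n_universal n M \<longleftrightarrow>
     (\<forall>L. quadratic_lattice L \<and> rank L = n \<and> classic_integral L \<and>
          (\<forall>\<sigma>. field_hom \<sigma> \<longrightarrow> positive_definite_at \<sigma> L)
        \<longrightarrow> represents M L)"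

end

theory Submission
  imports Defs "Jordan_Normal_Form.Char_Poly" "HOL-Computational_Algebra.Fundamental_Theorem_Algebra"
    "HOL-Computational_Algebra.Field_as_Ring"
begin

text \<open>
  If \<open>I\<^sub>m\<close> is \<open>n\<close>-universal, then every integer \<open>x\<close> becomes, after adding a large even natural
  number, a value of \<open>I\<^sub>m\<close>; since a sum of squares is congruent modulo 2 to the square of the sum, squaring is
  surjective modulo 2. By Nakayama's lemma the complex embeddings are then separated modulo 2, which
  makes the discriminant, the squared determinant of the matrix of embeddings, odd. Conversely, an odd
  discriminant makes the matrix of squaring on an integral basis invertible modulo 2.

  Now let squaring be surjective modulo 2. First, totally positive integers are sums of a bounded
  number of squares: as \<open>K\<close> is not totally real, there are integers that are arbitrarily small at all real
  embeddings, so the integers are dense in the space of real embeddings; this permits to subtract a few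
  integral squares and reach \<open>\<eta>\<^sup>2 g\<close>, with \<open>g\<close> so large at the real embeddings that it
  is covered by identities for large integers. By the same density, a
  positive definite form on a free lattice is, up to integral squares, nearly a multiple of the identity, and
  such a form is a sum of boundedly many squares of integral linear forms. Finally an arbitrary lattice
  has at most \<open>n [K : \<rat>]\<close> generators; being projective, it is a direct summand of the free lattice on
  them, and its form extends to a positive definite integral form there.
\<close>

section \<open>Algebraic integers\<close>

text \<open>The difficulty is uniformity: \<open>m\<close> must not depend on the lattice, so no
  step may use a number of squares that grows with the form. Positivity is imposed only at the real
  embeddings, whereas a subtracted square changes the size of an integer at all embeddings. Hence
  the statement proved by induction (\<open>large_sum_sq\<close>) lets the sizes at different
  embeddings be out of balance up to \<open>h ^ E\<close>, and the passage to
  \<open>\<eta>\<^sup>2 * g\<close> succeeds because \<open>E\<close> is fixed in terms of the field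
  alone. In a totally real field the integers are discrete in the space of real embeddings; the
  density used in both approximation steps is what the hypothesis on the field provides. A second
  obstacle is that \<open>M + 2 * w\<close> and \<open>M - 2 * w\<close> must be sums of integral
  squares for some natural \<open>M\<close>; this comes from the preordering of sums of squares in
  the field. The embeddings are found by diagonalising additive maps into the complex numbers, and
  the congruences between them are taken among all complex algebraic integers, which takes the place
  of a normal closure.\<close>

lemma monic_poly_eigenvalue:
  fixes h :: "'r::comm_ring_1 \<Rightarrow> 'a::field" and v :: "nat \<Rightarrow> 'a" and M :: "nat \<Rightarrow> nat \<Rightarrow> 'r"
  assumes h: "comm_ring_hom h"
    and eq: "\<And>i. i < n \<Longrightarrow> z * v i = (\<Sum>j<n. h (M i j) * v j)"
    and nz: "i0 < n" "v i0 \<noteq> 0"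
  shows "\<exists>p. poly (map_poly h p) z = 0 \<and> lead_coeff p = 1"
proof -
  define A where "A = mat n n (\<lambda>(i, j). M i j)"
  have A: "A \<in> carrier_mat n n"
    by (simp add: A_def)
  define B :: "'a mat" where "B = map_mat h A"
  have B: "B \<in> carrier_mat n n"
    using A by (simp add: B_def)
  interpret comm_ring_hom h by fact
  have "eigenvector B (vec n v) z"
    unfolding eigenvector_def
  proof (intro conjI)
    show "vec n v \<noteq> 0\<^sub>v (dim_row B)"
      using nz B by (metis carrier_matD(1) index_vec index_zero_vec(1))
    show "B *\<^sub>v vec n v = z \<cdot>\<^sub>v vec n v"
      using B by (intro eq_vecI) (auto simp: B_def A_def scalar_prod_def eq atLeast0LessThan)
  qed (use B in auto)
  hence "poly (char_poly B) z = 0"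
    using eigenvalue_root_char_poly[OF B] by (auto simp: eigenvalue_def)
  moreover have "char_poly B = map_poly h (char_poly A)"
    unfolding B_def by (rule char_poly_hom[OF A])
  moreover have "lead_coeff (char_poly A) = 1"
    using degree_monic_char_poly[OF A] by simp
  ultimately show ?thesis
    by auto
qed

text \<open>Multiplication by \<open>z\<close> maps the nonzero finitely generated group spanned by
  the \<open>v i\<close> into itself; this is the integrality test behind the closure properties
  below. The general version above, with a homomorphism \<open>h\<close>, is also applied to
  rational matrices.\<close>

lemma algebraic_int_eigenvalue:
  fixes z :: "'a::field_char_0" and v :: "nat \<Rightarrow> 'a" and M :: "nat \<Rightarrow> nat \<Rightarrow> int"
  assumes "\<And>i. i < n \<Longrightarrow> z * v i = (\<Sum>j<n. of_int (M i j) * v j)"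
    and "i0 < n" "v i0 \<noteq> 0"
  shows "algebraic_int z"
proof -
  have "comm_ring_hom (of_int :: int \<Rightarrow> 'a)"
    by unfold_locales auto
  from monic_poly_eigenvalue[OF this assms] show ?thesis
    unfolding algebraic_int_altdef_ipoly by auto
qed

lemma algebraic_int_eigenvalue':
  fixes z :: "'a::field_char_0" and v :: "'b \<Rightarrow> 'a" and M :: "'b \<Rightarrow> 'b \<Rightarrow> int"
  assumes fin: "finite I"
    and eq: "\<And>i. i \<in> I \<Longrightarrow> z * v i = (\<Sum>j\<in>I. of_int (M i j) * v j)"
    and nz: "i0 \<in> I" "v i0 \<noteq> 0"
  shows "algebraic_int z"
proof -
  obtain h where h: "bij_betw h {..<card I} I"
    using ex_bij_betw_nat_finite[OF fin] by (auto simp: atLeast0LessThan)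
  obtain k where k: "k < card I" "h k = i0"
    using h nz(1) by (metis bij_betw_def imageE lessThan_iff)
  show ?thesis
  proof (rule algebraic_int_eigenvalue[of "card I" z "v \<circ> h" "\<lambda>i j. M (h i) (h j)"])
    fix i assume i: "i < card I"
    have "z * v (h i) = (\<Sum>j\<in>I. of_int (M (h i) j) * v j)"
      by (rule eq) (use h i in \<open>auto simp: bij_betw_def\<close>)
    also have "\<dots> = (\<Sum>j<card I. of_int (M (h i) (h j)) * v (h j))"
      by (rule sum.reindex_bij_betw[OF h, symmetric])
    finally show "z * (v \<circ> h) i = (\<Sum>j<card I. of_int (M (h i) (h j)) * (v \<circ> h) j)"
      by simp
  qed (use k nz in auto)
qed

lemma algebraic_int_power_basis:
  fixes x :: "'a::field_char_0"
  assumes "algebraic_int x"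
  obtains a :: nat and M :: "nat \<Rightarrow> nat \<Rightarrow> int" where "a > 0"
    "\<And>i. i < a \<Longrightarrow> x * x ^ i = (\<Sum>j<a. of_int (M i j) * x ^ j)"
proof -
  obtain p where p: "poly (map_poly of_int p) x = 0" "lead_coeff p = 1"
    using assms unfolding algebraic_int_altdef_ipoly by auto
  define a where "a = degree p"
  have a: "a > 0"
  proof (rule ccontr)
    assume "\<not> a > 0"
    hence "p = 1"
      using p(2) by (metis a_def degree_0_id gr0I pCons_one)
    thus False using p(1) by simp
  qed
  have top: "x ^ a = - (\<Sum>j<a. of_int (coeff p j) * x ^ j)"
  proof -
    have "poly (map_poly of_int p) x = (\<Sum>j\<le>a. of_int (coeff p j) * x ^ j)"
      by (subst poly_altdef) (simp add: a_def degree_map_poly coeff_map_poly)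
    also have "{..a} = insert a {..<a}" by auto
    also have "(\<Sum>j\<in>insert a {..<a}. of_int (coeff p j) * x ^ j)
        = x ^ a + (\<Sum>j<a. of_int (coeff p j) * x ^ j)"
      using p(2) by (simp add: a_def)
    finally show ?thesis using p(1) by (simp add: eq_neg_iff_add_eq_0)
  qed
  \<comment> \<open>The companion matrix of \<open>p\<close>: all rows but the last shift the
    exponent, the last one uses the monic relation for \<open>x ^ a\<close>.\<close>
  define M where "M i j = (if Suc i < a then (if j = Suc i then 1 else 0) else - coeff p j)" for i j
  have "x * x ^ i = (\<Sum>j<a. of_int (M i j) * x ^ j)" if "i < a" for i
  proof (cases "Suc i < a")
    case True
    have "(\<Sum>j<a. of_int (M i j) * x ^ j) = (\<Sum>j<a. if j = Suc i then x ^ j else 0)"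
      using True by (intro sum.cong) (auto simp: M_def)
    also have "\<dots> = x ^ Suc i" using True by (subst sum.delta) auto
    finally show ?thesis by simp
  next
    case False
    hence "Suc i = a" using that by simp
    hence "x * x ^ i = x ^ a" by (metis power_Suc)
    thus ?thesis using False by (simp add: top M_def sum_negf)
  qed
  thus thesis using that a by blast
qed

text \<open>The products \<open>x ^ i * y ^ j\<close> with \<open>i < a\<close> and
  \<open>j < b\<close> span a group stable under both factors. In Kronecker notation the matrices
  are \<open>M \<otimes> 1 + 1 \<otimes> N\<close> for the sum and \<open>M \<otimes> N\<close> for
  the product.\<close>

lemma algebraic_int_add_mult:
  fixes x y :: "'a::field_char_0"
  assumes "algebraic_int x" "algebraic_int y"
  shows "algebraic_int (x + y)" "algebraic_int (x * y)"
proof -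
  obtain a M where a: "a > 0" and M: "\<And>i. i < a \<Longrightarrow> x * x ^ i = (\<Sum>j<a. of_int (M i j) * x ^ j)"
    using algebraic_int_power_basis[OF assms(1)] by metis
  obtain b N where b: "b > 0" and N: "\<And>i. i < b \<Longrightarrow> y * y ^ i = (\<Sum>j<b. of_int (N i j) * y ^ j)"
    using algebraic_int_power_basis[OF assms(2)] by metis
  let ?I = "{..<a} \<times> {..<b}"
  let ?v = "\<lambda>(i, j). x ^ i * y ^ j"
  have prod: "(\<Sum>j<a. f j) * (\<Sum>j<b. g j) = (\<Sum>(i,j)\<in>?I. f i * g j)" for f g :: "nat \<Rightarrow> 'a"
    by (simp add: sum_product sum.cartesian_product)
  show "algebraic_int (x + y)"
  proof (rule algebraic_int_eigenvalue'[of ?I _ ?v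
        "\<lambda>(i,j) (k,l). M i k * (if l = j then 1 else 0) + (if k = i then 1 else 0) * N j l" "(0,0)"])
    fix ij assume "ij \<in> ?I"
    then obtain i j where ij: "ij = (i, j)" "i < a" "j < b" by auto
    have d: "c ^ i = (\<Sum>k<n. of_int (if k = i then 1 else 0) * c ^ k)" if "i < n" for n i and c :: 'a
    proof -
      have "(\<Sum>k<n. of_int (if k = i then 1 else 0) * c ^ k) = (\<Sum>k<n. if k = i then c ^ k else 0)"
        by (intro sum.cong) auto
      thus ?thesis using that by (simp add: sum.delta)
    qed
    have "(x + y) * (x ^ i * y ^ j) = (x * x ^ i) * y ^ j + x ^ i * (y * y ^ j)"
      by (simp add: algebra_simps)
    also have "(x * x ^ i) * y ^ j =
        (\<Sum>(k,l)\<in>?I. (of_int (M i k) * x ^ k) * (of_int (if l = j then 1 else 0) * y ^ l))"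
      unfolding M[OF ij(2)] d[OF ij(3), of y] by (rule prod)
    also have "x ^ i * (y * y ^ j) =
        (\<Sum>(k,l)\<in>?I. (of_int (if k = i then 1 else 0) * x ^ k) * (of_int (N j l) * y ^ l))"
      unfolding N[OF ij(3)] d[OF ij(2), of x] by (rule prod)
    finally show "(x + y) * ?v ij = (\<Sum>kl\<in>?I. of_int ((\<lambda>(i,j) (k,l). M i k * (if l = j then 1 else 0)
        + (if k = i then 1 else 0) * N j l) ij kl) * ?v kl)"
      unfolding ij(1) by (simp add: sum.distrib[symmetric] case_prod_unfold algebra_simps)
  qed (use a b in auto)
  show "algebraic_int (x * y)"
  proof (rule algebraic_int_eigenvalue'[of ?I _ ?v "\<lambda>(i,j) (k,l). M i k * N j l" "(0,0)"])
    fix ij assume "ij \<in> ?I"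
    then obtain i j where ij: "ij = (i, j)" "i < a" "j < b" by auto
    have "(x * y) * (x ^ i * y ^ j) = (x * x ^ i) * (y * y ^ j)"
      by (simp add: algebra_simps)
    also have "\<dots> = (\<Sum>(k,l)\<in>?I. (of_int (M i k) * x ^ k) * (of_int (N j l) * y ^ l))"
      unfolding M[OF ij(2)] N[OF ij(3)] by (rule prod)
    finally show "(x * y) * ?v ij = (\<Sum>kl\<in>?I. of_int ((\<lambda>(i,j) (k,l). M i k * N j l) ij kl) * ?v kl)"
      unfolding ij(1) by (simp add: case_prod_unfold algebra_simps)
  qed (use a b in auto)
qed

lemma algebraic_int_hom:
  fixes f :: "'a::field_char_0 \<Rightarrow> 'b::field_char_0"
  assumes "field_hom f" "algebraic_int x"
  shows "algebraic_int (f x)"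
proof -
  interpret field_hom f by fact
  obtain a M where a: "a > 0" and M: "\<And>i. i < a \<Longrightarrow> x * x ^ i = (\<Sum>j<a. of_int (M i j) * x ^ j)"
    using algebraic_int_power_basis[OF assms(2)] by metis
  have "f x * f x ^ i = (\<Sum>j<a. of_int (M i j) * f x ^ j)" if "i < a" for i
    using arg_cong[OF M[OF that], of f] by (simp add: hom_distribs)
  thus ?thesis
    using a by (intro algebraic_int_eigenvalue[of a _ "\<lambda>i. f x ^ i" M 0]) auto
qed

lemma ring_of_integers_iff: "x \<in> ring_of_integers \<longleftrightarrow> algebraic_int x"
  by (simp add: ring_of_integers_def)

lemma roi_add [intro]: "x \<in> ring_of_integers \<Longrightarrow> y \<in> ring_of_integers \<Longrightarrow> x + y \<in> ring_of_integers"
  by (simp add: ring_of_integers_iff algebraic_int_add_mult)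

lemma roi_mult [intro]: "x \<in> ring_of_integers \<Longrightarrow> y \<in> ring_of_integers \<Longrightarrow> x * y \<in> ring_of_integers"
  by (simp add: ring_of_integers_iff algebraic_int_add_mult)

lemma roi_of_int [simp, intro]: "of_int k \<in> ring_of_integers"
  by (simp add: ring_of_integers_iff)

lemma roi_of_nat [simp, intro]: "of_nat k \<in> ring_of_integers"
  using roi_of_int[of "int k"] by simp

lemma roi_numeral [simp, intro]: "numeral k \<in> ring_of_integers"
  using roi_of_int[of "numeral k"] by simp

lemma roi_0 [simp, intro]: "0 \<in> ring_of_integers"
  using roi_of_int[of 0] by simp

lemma roi_1 [simp, intro]: "1 \<in> ring_of_integers"
  using roi_of_int[of 1] by simp

lemma roi_uminus [intro]: "x \<in> ring_of_integers \<Longrightarrow> - x \<in> ring_of_integers"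
  using roi_mult[of "of_int (-1)" x] roi_of_int[of "-1"] by simp

lemma roi_diff [intro]: "x \<in> ring_of_integers \<Longrightarrow> y \<in> ring_of_integers \<Longrightarrow> x - y \<in> ring_of_integers"
  using roi_add[OF _ roi_uminus, of x y] by simp

lemma roi_power [intro]: "x \<in> ring_of_integers \<Longrightarrow> x ^ k \<in> ring_of_integers"
  by (induction k) auto

lemma roi_sum [intro]: "(\<And>i. i \<in> I \<Longrightarrow> f i \<in> ring_of_integers) \<Longrightarrow> sum f I \<in> ring_of_integers"
  by (induction I rule: infinite_finite_induct) auto

lemma roi_prod [intro]: "(\<And>i. i \<in> I \<Longrightarrow> f i \<in> ring_of_integers) \<Longrightarrow> prod f I \<in> ring_of_integers"
  by (induction I rule: infinite_finite_induct) auto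

lemma roi_det:
  assumes "A \<in> carrier_mat n n" "\<And>i j. i < n \<Longrightarrow> j < n \<Longrightarrow> A $$ (i, j) \<in> ring_of_integers"
  shows "det A \<in> ring_of_integers"
proof -
  have "signof p \<in> ring_of_integers" for p :: "nat \<Rightarrow> nat"
    by (cases p rule: sign_cases) auto
  thus ?thesis
    unfolding det_def'[OF assms(1)]
    by (intro roi_sum roi_mult roi_prod) (auto intro!: assms(2) dest: permutes_in_image)
qed

lemma roi_Rats: "x \<in> ring_of_integers \<Longrightarrow> x \<in> \<rat> \<Longrightarrow> x \<in> \<int>"
  by (rule rational_algebraic_int_is_int) (simp_all add: ring_of_integers_iff)

text \<open>Congruences modulo 2 between algebraic integers are not vacuous, since 2 is not a unit
  among them. This is the contradiction that ends the proof that the discriminant is odd.\<close>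

lemma half_notin_roi: "1 / 2 \<notin> (ring_of_integers :: 'a::field_char_0 set)"
proof
  assume "1 / 2 \<in> (ring_of_integers :: 'a set)"
  hence "(1 / 2 :: 'a) \<in> \<int>"
    by (rule roi_Rats) auto
  then obtain k where "(1 / 2 :: 'a) = of_int k" by (auto elim: Ints_cases)
  hence "(of_int (2 * k) :: 'a) = of_int 1" by (simp add: field_simps)
  hence "2 * k = 1" by (simp only: of_int_eq_iff)
  thus False by presburger
qed

section \<open>Complex embeddings of a number field\<close>

definition embeddings :: "('k::field_char_0 \<Rightarrow> complex) set" where
  "embeddings = {\<sigma>. field_hom \<sigma>}"

lemma embeddings_simps:
  assumes "\<sigma> \<in> embeddings"
  shows "\<sigma> 0 = 0" "\<sigma> 1 = 1" "\<sigma> (x + y) = \<sigma> x + \<sigma> y" "\<sigma> (x * y) = \<sigma> x * \<sigma> y"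
    "\<sigma> (- x) = - \<sigma> x" "\<sigma> (x - y) = \<sigma> x - \<sigma> y" "\<sigma> (x ^ n) = \<sigma> x ^ n"
    "\<sigma> (of_int k) = of_int k" "\<sigma> (of_nat n) = of_nat n" "\<sigma> (numeral v) = numeral v"
    "\<sigma> (inverse x) = inverse (\<sigma> x)" "\<sigma> (x / y) = \<sigma> x / \<sigma> y"
    "\<sigma> (sum f I) = (\<Sum>i\<in>I. \<sigma> (f i))"
    "\<sigma> (of_rat q) = of_rat q" "\<sigma> x = 0 \<longleftrightarrow> x = 0"
proof -
  interpret field_hom \<sigma> using assms by (simp add: embeddings_def)
  show "\<sigma> 0 = 0" "\<sigma> 1 = 1" "\<sigma> (x + y) = \<sigma> x + \<sigma> y" "\<sigma> (x * y) = \<sigma> x * \<sigma> y"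
    "\<sigma> (- x) = - \<sigma> x" "\<sigma> (x - y) = \<sigma> x - \<sigma> y" "\<sigma> (x ^ n) = \<sigma> x ^ n"
    "\<sigma> (of_int k) = of_int k" "\<sigma> (of_nat n) = of_nat n"
    "\<sigma> (inverse x) = inverse (\<sigma> x)" "\<sigma> (x / y) = \<sigma> x / \<sigma> y"
    "\<sigma> (sum f I) = (\<Sum>i\<in>I. \<sigma> (f i))"
    by (auto simp: hom_distribs hom_div)
  show "\<sigma> (numeral v) = numeral v"
    using hom_of_int[of "numeral v"] by simp
  show "\<sigma> (of_rat q) = of_rat q"
  proof (cases q)
    case (Fract a b)
    thus ?thesis by (simp add: of_rat_rat hom_div hom_of_int)
  qed
  show "\<sigma> x = 0 \<longleftrightarrow> x = 0"
    by (metis hom_mult hom_one hom_zero mult_zero_left right_inverse zero_neq_one)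
qed

lemma embeddings_algebraic_int: "\<sigma> \<in> embeddings \<Longrightarrow> x \<in> ring_of_integers \<Longrightarrow> \<sigma> x \<in> ring_of_integers"
  by (simp add: embeddings_def ring_of_integers_iff algebraic_int_hom)

lemma embeddings_eqI:
  assumes "\<sigma> \<in> embeddings" "\<tau> \<in> embeddings" "rat_vs.span B = UNIV" "\<And>b. b \<in> B \<Longrightarrow> \<sigma> b = \<tau> b"
  shows "\<sigma> = \<tau>"
proof
  fix x
  have "x \<in> rat_vs.span B" using assms(3) by simp
  thus "\<sigma> x = \<tau> x"
    by (induction rule: rat_vs.span_induct_alt)
       (use assms in \<open>auto simp: embeddings_simps\<close>)
qed

text \<open>Artin's argument: subtracting \<open>\<tau> y\<close> times the relation at
  \<open>x\<close> from the relation at \<open>y * x\<close> removes \<open>\<tau>\<close> and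
  multiplies every other coefficient by \<open>\<sigma> y - \<tau> y\<close>, which is nonzero for a
  suitable \<open>y\<close>.\<close>

lemma dedekind_independence:
  assumes "finite S" "S \<subseteq> embeddings" "\<And>x. (\<Sum>\<sigma>\<in>S. a \<sigma> * \<sigma> x) = 0" "\<sigma> \<in> S"
  shows "a \<sigma> = 0"
  using assms
proof (induction S arbitrary: a \<sigma> rule: finite_induct)
  case (insert \<tau> S)
  have zero: "a \<sigma> = 0" if "\<sigma> \<in> S" for \<sigma>
  proof -
    have "\<sigma> \<noteq> \<tau>" using that insert.hyps by blast
    then obtain y where y: "\<sigma> y \<noteq> \<tau> y" by blast
    have "a \<sigma> * (\<sigma> y - \<tau> y) = 0"
    proof (rule insert.IH[OF _ _ that])
      fix x
      have "0 = (\<Sum>\<sigma>\<in>insert \<tau> S. a \<sigma> * \<sigma> (y * x)) - \<tau> y * (\<Sum>\<sigma>\<in>insert \<tau> S. a \<sigma> * \<sigma> x)"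
        by (simp only: insert.prems(2)) simp
      also have "\<dots> = (\<Sum>\<sigma>\<in>insert \<tau> S. a \<sigma> * (\<sigma> y - \<tau> y) * \<sigma> x)"
        unfolding sum_distrib_left sum_subtractf[symmetric]
        by (intro sum.cong refl) (use insert.prems(1) in \<open>auto simp: embeddings_simps algebra_simps\<close>)
      also have "\<dots> = (\<Sum>\<sigma>\<in>S. a \<sigma> * (\<sigma> y - \<tau> y) * \<sigma> x)"
        using insert.hyps by simp
      finally show "(\<Sum>\<sigma>\<in>S. a \<sigma> * (\<sigma> y - \<tau> y) * \<sigma> x) = 0" by simp
    qed (use insert.prems(1) in auto)
    thus ?thesis using y by simp
  qed
  have "(\<Sum>\<sigma>\<in>insert \<tau> S. a \<sigma> * \<sigma> 1) = a \<tau>"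
    using insert.hyps insert.prems(1) by (simp add: zero embeddings_simps)
  hence "a \<tau> = 0" using insert.prems(2)[of 1] by simp
  thus ?case using zero insert.prems(3) by auto
qed simp

definition rat_basis :: "'k::field_char_0 set \<Rightarrow> bool" where
  "rat_basis B \<longleftrightarrow> finite B \<and> rat_vs.independent B \<and> rat_vs.span B = UNIV"

lemma rat_basis_extend_basis:
  assumes "number_field TYPE('k::field_char_0)"
  shows "rat_basis (rat_vs.extend_basis {} :: 'k set)"
proof -
  obtain T :: "'k set" where T: "finite T" "rat_vs.span T = UNIV"
    using assms unfolding number_field_def by blast
  have ind: "rat_vs.independent (rat_vs.extend_basis {} :: 'k set)"
    by (rule rat_vs.independent_extend_basis) (rule rat_vs.independent_empty)
  moreover have "rat_vs.span (rat_vs.extend_basis {} :: 'k set) = UNIV"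
    by (rule rat_vs.span_extend_basis) (rule rat_vs.independent_empty)
  moreover have "finite (rat_vs.extend_basis {} :: 'k set)"
    using rat_vs.independent_span_bound[OF T(1) ind] T(2) by auto
  ultimately show ?thesis by (simp add: rat_basis_def)
qed

lemma rat_basis_sum:
  assumes "rat_basis B"
  shows "(\<Sum>b\<in>B. of_rat (rat_vs.representation B x b) * b) = x"
  using rat_vs.sum_representation_eq[of B x B] assms by (auto simp: rat_basis_def)

lemma rat_basis_nonempty: "rat_basis B \<Longrightarrow> B \<noteq> {}"
  by (metis rat_basis_sum sum.empty zero_neq_one)

lemma number_field_rational_root:
  fixes x :: "'k::field_char_0"
  assumes "number_field TYPE('k)"
  shows "\<exists>p. p \<noteq> 0 \<and> poly (map_poly of_rat p) x = 0"
proof -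
  obtain B :: "'k set" where B: "rat_basis B" using rat_basis_extend_basis[OF assms] by blast
  have fin: "finite B" using B by (simp add: rat_basis_def)
  obtain h where h: "bij_betw h {..<card B} B"
    using ex_bij_betw_nat_finite[OF fin] by (auto simp: atLeast0LessThan)
  have hom: "comm_ring_hom (of_rat :: rat \<Rightarrow> 'k)"
    by unfold_locales (auto simp: of_rat_add of_rat_mult)
  have card: "0 < card B" using rat_basis_nonempty[OF B] fin by (simp add: card_gt_0_iff)
  have h0: "h 0 \<noteq> 0"
  proof
    assume "h 0 = 0"
    hence "0 \<in> B" using h card by (metis bij_betwE lessThan_iff)
    thus False using B rat_vs.dependent_zero unfolding rat_basis_def by blast
  qed
  have "x * h i = (\<Sum>j<card B. of_rat (rat_vs.representation B (x * h i) (h j)) * h j)" for i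
    using rat_basis_sum[OF B, of "x * h i"] sum.reindex_bij_betw[OF h]
    by (metis (no_types, lifting) sum.cong)
  hence "\<exists>p. poly (map_poly of_rat p) x = 0 \<and> lead_coeff p = 1"
    using monic_poly_eigenvalue[OF hom, of "card B" x h "\<lambda>i j. rat_vs.representation B (x * h i) (h j)" 0] card h0
    by blast
  then obtain p where p: "poly (map_poly of_rat p) x = 0" "lead_coeff p = 1" by blast
  moreover have "p \<noteq> 0" using p(2) by (intro notI) simp
  ultimately show ?thesis by blast
qed

text \<open>A rational annihilating polynomial \<open>p\<close> of least degree is coprime to its
  derivative: the common divisor \<open>d\<close> cannot vanish at \<open>x\<close>, since the
  derivative has smaller degree, so the cofactor \<open>e\<close> does, and \<open>d\<close> is
  constant. Simple complex roots are what the splitting into eigenfunctions requires.\<close>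

lemma number_field_separable_root:
  fixes x :: "'k::field_char_0"
  assumes "number_field TYPE('k)"
  obtains p :: "rat poly" and rs :: "complex list" where "p \<noteq> 0" "poly (map_poly of_rat p) x = 0"
    "distinct rs" "map_poly of_rat p = smult (of_rat (lead_coeff p)) (\<Prod>r\<leftarrow>rs. [:-r, 1:])"
proof -
  define P where "P n \<longleftrightarrow> (\<exists>p. p \<noteq> 0 \<and> poly (map_poly of_rat p) x = 0 \<and> degree p = n)" for n
  have ex: "\<exists>n. P n" using number_field_rational_root[OF assms, of x] by (auto simp: P_def)
  define n where "n = (LEAST n. P n)"
  have "P n" unfolding n_def using ex by (rule LeastI_ex)
  then obtain p where p: "p \<noteq> 0" "poly (map_poly of_rat p) x = 0" "degree p = n"
    by (auto simp: P_def)
  have min: "degree q \<ge> n" if "q \<noteq> 0" "poly (map_poly of_rat q) x = 0" for q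
    unfolding n_def by (rule Least_le) (use that in \<open>auto simp: P_def\<close>)
  have n0: "n > 0"
  proof (rule ccontr)
    assume "\<not> n > 0"
    then obtain c where "p = [:c:]" using p(3) by (metis degree_eq_zeroE gr0I)
    thus False using p by simp
  qed
  interpret hk: field_hom "of_rat :: rat \<Rightarrow> 'k"
    by unfold_locales (auto simp: of_rat_add of_rat_mult)
  interpret hc: field_hom "of_rat :: rat \<Rightarrow> complex"
    by unfold_locales (auto simp: of_rat_add of_rat_mult)
  interpret mk: map_poly_comm_ring_hom "of_rat :: rat \<Rightarrow> 'k" ..
  interpret mc: map_poly_comm_ring_hom "of_rat :: rat \<Rightarrow> complex" ..
  define d where "d = gcd p (pderiv p)"
  have dd: "d dvd p" "d dvd pderiv p" by (simp_all add: d_def)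
  have pd: "pderiv p \<noteq> 0" "degree (pderiv p) < n"
    using n0 p by (auto simp: pderiv_eq_0_iff degree_pderiv)
  obtain e where e: "p = d * e" using dd(1) by blast
  obtain e' where e': "pderiv p = d * e'" using dd(2) by blast
  have "poly (map_poly of_rat d) x \<noteq> 0"
  proof
    assume "poly (map_poly of_rat d) x = 0"
    hence "poly (map_poly of_rat (pderiv p)) x = 0" by (simp add: e' mk.hom_mult)
    thus False using min[OF pd(1)] pd(2) by simp
  qed
  moreover have "poly (map_poly of_rat d) x * poly (map_poly of_rat e) x = 0"
    using p(2) by (simp add: e mk.hom_mult)
  ultimately have "poly (map_poly of_rat e) x = 0" by simp
  moreover have "e \<noteq> 0" "d \<noteq> 0" using e p(1) by auto
  ultimately have "degree d + degree e \<le> degree e"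
    using min[of e] e p(3) by (simp add: degree_mult_eq)
  hence "degree d = 0" by simp
  hence "is_unit d" using \<open>d \<noteq> 0\<close> by (simp add: is_unit_iff_degree)
  hence cop: "gcd p (pderiv p) = 1" unfolding d_def by (metis is_unit_gcd coprime_iff_gcd_eq_1)
  obtain u v where uv: "u * p + v * pderiv p = 1"
    using bezout_coefficients_fst_snd[of p "pderiv p"] cop by metis
  define Q :: "complex poly" where "Q = map_poly of_rat p"
  have Q0: "Q \<noteq> 0" using p(1) by (simp add: Q_def)
  have lcQ: "lead_coeff Q = of_rat (lead_coeff p)" by (simp add: Q_def degree_map_poly coeff_map_poly)
  have pdQ: "pderiv Q = map_poly of_rat (pderiv p)"
    unfolding Q_def by (intro poly_eqI) (simp add: coeff_pderiv coeff_map_poly of_rat_mult of_rat_add)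
  have "map_poly of_rat u * Q + map_poly of_rat v * pderiv Q = 1"
    using arg_cong[OF uv, of "map_poly of_rat :: rat poly \<Rightarrow> complex poly"]
    by (simp add: hom_distribs pdQ Q_def)
  hence nocommon: "\<not> (poly Q a = 0 \<and> poly (pderiv Q) a = 0)" for a
    by (metis add.right_neutral mult_zero_right poly_1 poly_add poly_mult zero_neq_one)
  obtain rs where rs: "smult (coeff Q (degree Q)) (\<Prod>r\<leftarrow>rs. [:-r, 1:]) = Q"
    using fundamental_theorem_algebra_factorized[of Q] by blast
  have "distinct rs"
  proof (rule ccontr)
    assume "\<not> distinct rs"
    then obtain xs ys zs a where "rs = xs @ [a] @ ys @ [a] @ zs"
      using not_distinct_decomp by blast
    hence "Q = [:-a, 1:] * ([:-a, 1:] * smult (lead_coeff Q)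
        ((\<Prod>r\<leftarrow>xs. [:-r, 1:]) * (\<Prod>r\<leftarrow>ys. [:-r, 1:]) * (\<Prod>r\<leftarrow>zs. [:-r, 1:])))"
      using rs by (simp add: algebra_simps)
    then obtain R where R: "Q = [:-a, 1:] * ([:-a, 1:] * R)" by blast
    have "poly Q a = 0" unfolding R by simp
    moreover have "poly (pderiv Q) a = 0" unfolding R pderiv_mult by simp
    ultimately show False using nocommon by blast
  qed
  thus thesis using that[of p rs] p rs lcQ by (simp add: Q_def)
qed

section \<open>The complex dual of the field and its eigenfunctions\<close>

definition additive :: "('k::field_char_0 \<Rightarrow> complex) \<Rightarrow> bool" where
  "additive f \<longleftrightarrow> (\<forall>x y. f (x + y) = f x + f y)"

lemma additiveD:
  assumes "additive f"
  shows "f (x + y) = f x + f y" "f 0 = 0" "f (sum g I) = (\<Sum>i\<in>I. f (g i))"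
    "f (of_int k * x) = of_int k * f x" "f (of_rat q * x) = of_rat q * f x"
proof -
  show add: "f (x + y) = f x + f y" for x y using assms by (simp add: additive_def)
  show zero: "f 0 = 0" using add[of 0 0] by simp
  show "f (sum g I) = (\<Sum>i\<in>I. f (g i))"
    by (induction I rule: infinite_finite_induct) (auto simp: add zero)
  have min: "f (- x) = - f x" for x using add[of x "- x"] zero by (simp add: eq_neg_iff_add_eq_0 add.commute)
  have nat: "f (of_nat n * x) = of_nat n * f x" for n x
    by (induction n) (auto simp: add zero algebra_simps)
  have int: "f (of_int k * x) = of_int k * f x" for k x
    by (cases k rule: int_cases2) (simp_all add: nat min)
  show "f (of_int k * x) = of_int k * f x" by (rule int)
  show "f (of_rat q * x) = of_rat q * f x"
  proof (cases q)
    case (Fract a b)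
    have "of_int b * f (of_rat q * x) = f (of_int b * (of_rat q * x))" by (rule int[symmetric])
    also have "of_int b * (of_rat q * x) = of_int a * x"
      using Fract by (simp add: of_rat_rat)
    also have "f \<dots> = of_int a * f x" by (rule int)
    finally show ?thesis using Fract by (simp add: of_rat_rat field_simps)
  qed
qed

text \<open>This is \<open>p(T)\<close> applied to \<open>f\<close>, taken at \<open>y\<close>,
  where \<open>T\<close> sends \<open>f\<close> to \<open>\<lambda>y. f (b * y)\<close>. The
  coefficients are complex while \<open>b\<close> lies in the field, so \<open>p\<close> cannot be
  evaluated at \<open>b\<close> itself.\<close>

definition poly_act :: "complex poly \<Rightarrow> 'k::field_char_0 \<Rightarrow> ('k \<Rightarrow> complex) \<Rightarrow> 'k \<Rightarrow> complex" where
  "poly_act p b f y = (\<Sum>i\<le>degree p. coeff p i * f (b ^ i * y))"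

lemma poly_act_bound:
  assumes "degree p \<le> N"
  shows "poly_act p b f y = (\<Sum>i\<le>N. coeff p i * f (b ^ i * y))"
  unfolding poly_act_def using assms
  by (intro sum.mono_neutral_left) (auto simp: coeff_eq_0)

lemma poly_act_linear_factor:
  "poly_act ([:-r, 1:] * q) b f y = poly_act q b (\<lambda>y. f (b * y) - r * f y) y"
proof -
  define N where "N = degree q"
  have deg: "degree ([:-r, 1:] * q) \<le> Suc N"
    unfolding N_def by (rule order_trans[OF degree_mult_le]) simp
  have "poly_act ([:-r, 1:] * q) b f y =
      (\<Sum>i\<le>Suc N. (coeff (pCons 0 q) i - r * coeff q i) * f (b ^ i * y))"
    unfolding poly_act_bound[OF deg] by (intro sum.cong) (simp_all add: mult_pCons_left)
  also have "\<dots> = (\<Sum>i\<le>Suc N. coeff (pCons 0 q) i * f (b ^ i * y)) - (\<Sum>i\<le>Suc N. r * coeff q i * f (b ^ i * y))"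
    unfolding sum_subtractf[symmetric] by (intro sum.cong refl) (simp add: algebra_simps)
  also have "(\<Sum>i\<le>Suc N. coeff (pCons 0 q) i * f (b ^ i * y)) = (\<Sum>i\<le>N. coeff q i * f (b ^ Suc i * y))"
    by (subst sum.atMost_Suc_shift) simp
  also have "(\<Sum>i\<le>Suc N. r * coeff q i * f (b ^ i * y)) = (\<Sum>i\<le>N. r * coeff q i * f (b ^ i * y))"
    by (simp add: N_def coeff_eq_0)
  finally show ?thesis
    unfolding poly_act_def N_def[symmetric] sum_subtractf[symmetric]
    by (simp only:) (intro sum.cong refl, simp add: algebra_simps)
qed

lemma poly_act_rational:
  assumes "additive f"
  shows "poly_act (map_poly of_rat p) b f y = f (poly (map_poly of_rat p) b * y)"
proof -
  have "poly_act (map_poly of_rat p) b f y = (\<Sum>i\<le>degree p. of_rat (coeff p i) * f (b ^ i * y))"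
    by (simp add: poly_act_def degree_map_poly coeff_map_poly)
  also have "\<dots> = f (\<Sum>i\<le>degree p. of_rat (coeff p i) * (b ^ i * y))"
    by (simp add: additiveD[OF assms])
  also have "(\<Sum>i\<le>degree p. of_rat (coeff p i) * (b ^ i * y)) = poly (map_poly of_rat p) b * y"
    by (simp add: poly_altdef degree_map_poly coeff_map_poly sum_distrib_right mult.assoc)
  finally show ?thesis .
qed

text \<open>Diagonalisation of \<open>T f = (\<lambda>y. f (b * y))\<close> on a
  \<open>T\<close>-stable subspace \<open>P\<close>, when a product of distinct linear factors kills
  \<open>f\<close>. In the induction \<open>T f - r f\<close> is killed by the remaining factors;
  dividing its component for \<open>s\<close> by \<open>s - r\<close> gives the component of
  \<open>f\<close> itself, and what remains of \<open>f\<close> belongs to \<open>r\<close>. The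
  predicate \<open>P\<close> will record the eigenvalues found earlier for other elements.\<close>

lemma eigen_split:
  fixes P :: "('k::field_char_0 \<Rightarrow> complex) \<Rightarrow> bool"
  assumes shift: "\<And>f. P f \<Longrightarrow> P (\<lambda>y. f (b * y))"
    and lin: "\<And>f g c d. P f \<Longrightarrow> P g \<Longrightarrow> P (\<lambda>y. c * f y + d * g y)"
    and zero: "P (\<lambda>_. 0)"
    and "distinct rs" "P f" "\<And>y. poly_act (\<Prod>r\<leftarrow>rs. [:-r, 1:]) b f y = 0"
  shows "\<exists>\<psi>. (\<forall>r\<in>set rs. P (\<psi> r) \<and> (\<forall>y. \<psi> r (b * y) = r * \<psi> r y)) \<and> (\<forall>y. f y = (\<Sum>r\<in>set rs. \<psi> r y))"
  using assms(4-6)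
proof (induction rs arbitrary: f)
  case Nil
  thus ?case by (simp add: poly_act_def)
next
  case (Cons r rs)
  let ?g = "\<lambda>y. f (b * y) - r * f y"
  have Pg: "P ?g" using lin[OF shift[OF Cons.prems(2)] Cons.prems(2), of 1 "- r"] by simp
  have "\<And>y. poly_act (\<Prod>r\<leftarrow>rs. [:-r, 1:]) b ?g y = 0"
    using Cons.prems(3) by (simp only: list.map prod_list.Cons poly_act_linear_factor)
  then obtain \<psi> where \<psi>: "\<And>s. s \<in> set rs \<Longrightarrow> P (\<psi> s)" "\<And>s y. s \<in> set rs \<Longrightarrow> \<psi> s (b * y) = s * \<psi> s y"
    "\<And>y. ?g y = (\<Sum>s\<in>set rs. \<psi> s y)"
    using Cons.IH[OF _ Pg] Cons.prems(1) by auto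
  have neq: "s \<noteq> r" if "s \<in> set rs" for s using that Cons.prems(1) by auto
  define h where "h y = f y - (\<Sum>s\<in>set rs. \<psi> s y / (s - r))" for y
  have Psum: "P (\<lambda>y. \<Sum>s\<in>S. \<psi> s y / (s - r))" if "S \<subseteq> set rs" for S
    using finite_subset[OF that finite_set] that
  proof (induction S rule: finite_induct)
    case (insert s S)
    have "P (\<lambda>y. (1 / (s - r)) * \<psi> s y + 1 * (\<Sum>s\<in>S. \<psi> s y / (s - r)))"
      using insert by (intro lin \<psi>(1)) auto
    thus ?case using insert by simp
  qed (simp add: zero)
  have Ph: "P h"
    using lin[OF Cons.prems(2) Psum[OF order_refl], of 1 "-1"] by (simp add: h_def[abs_def])
  have hr: "h (b * y) = r * h y" for y
  proof -
    have "h (b * y) - r * h y = ?g y - (\<Sum>s\<in>set rs. \<psi> s (b * y) / (s - r) - r * \<psi> s y / (s - r))"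
      by (simp add: h_def algebra_simps sum_subtractf sum_distrib_left)
    also have "(\<Sum>s\<in>set rs. \<psi> s (b * y) / (s - r) - r * \<psi> s y / (s - r)) = (\<Sum>s\<in>set rs. \<psi> s y)"
    proof (intro sum.cong refl)
      fix s assume s: "s \<in> set rs"
      have "\<psi> s (b * y) / (s - r) - r * \<psi> s y / (s - r) = (s - r) * \<psi> s y / (s - r)"
        unfolding \<psi>(2)[OF s] by (simp add: diff_divide_distrib left_diff_distrib)
      thus "\<psi> s (b * y) / (s - r) - r * \<psi> s y / (s - r) = \<psi> s y" using neq[OF s] by simp
    qed
    finally show ?thesis using \<psi>(3) by simp
  qed
  let ?\<phi> = "\<lambda>s. if s = r then h else (\<lambda>y. \<psi> s y / (s - r))"
  show ?case
  proof (intro exI[of _ ?\<phi>] conjI ballI allI)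
    fix s assume s: "s \<in> set (r # rs)"
    show "P (?\<phi> s)"
    proof (cases "s = r")
      case False
      thus ?thesis using lin[OF \<psi>(1) zero, of s "1 / (s - r)" 0] s by simp
    qed (use Ph in simp)
    show "?\<phi> s (b * y) = s * ?\<phi> s y" for y using hr \<psi>(2) s by auto
  next
    fix y
    have "(\<Sum>s\<in>set (r # rs). ?\<phi> s y) = h y + (\<Sum>s\<in>set rs. ?\<phi> s y)" using Cons.prems(1) by simp
    also have "(\<Sum>s\<in>set rs. ?\<phi> s y) = (\<Sum>s\<in>set rs. \<psi> s y / (s - r))"
      using neq by (intro sum.cong) auto
    finally show "f y = (\<Sum>s\<in>set (r # rs). ?\<phi> s y)" by (simp add: h_def)
  qed
qed

definition emb_comb :: "('k::field_char_0 \<Rightarrow> complex) \<Rightarrow> bool" where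
  "emb_comb f \<longleftrightarrow> (\<exists>c. \<forall>y. f y = (\<Sum>\<sigma>\<in>embeddings. c \<sigma> * \<sigma> y))"

lemma emb_comb_sum:
  assumes "finite I" "\<And>i. i \<in> I \<Longrightarrow> emb_comb (f i)"
  shows "emb_comb (\<lambda>y. \<Sum>i\<in>I. f i y)"
proof -
  obtain c where c: "\<And>i y. i \<in> I \<Longrightarrow> f i y = (\<Sum>\<sigma>\<in>embeddings. c i \<sigma> * \<sigma> y)"
    using assms(2) unfolding emb_comb_def by metis
  have "(\<Sum>i\<in>I. f i y) = (\<Sum>\<sigma>\<in>embeddings. (\<Sum>i\<in>I. c i \<sigma>) * \<sigma> y)" for y
  proof -
    have "(\<Sum>i\<in>I. f i y) = (\<Sum>i\<in>I. \<Sum>\<sigma>\<in>embeddings. c i \<sigma> * \<sigma> y)" using c by simp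
    also have "\<dots> = (\<Sum>\<sigma>\<in>embeddings. \<Sum>i\<in>I. c i \<sigma> * \<sigma> y)" by (rule sum.swap)
    finally show ?thesis by (simp add: sum_distrib_right)
  qed
  thus ?thesis unfolding emb_comb_def by (intro exI[of _ "\<lambda>\<sigma>. \<Sum>i\<in>I. c i \<sigma>"] allI)
qed

context
  assumes nf: "number_field TYPE('k::field_char_0)"
begin

text \<open>An embedding is determined by its values on a rational basis, and each value is one of
  the finitely many complex roots of a rational polynomial.\<close>

lemma finite_embeddings: "finite (embeddings :: ('k \<Rightarrow> complex) set)"
proof -
  obtain B :: "'k set" where B: "rat_basis B" using rat_basis_extend_basis[OF nf] by blast
  have fin: "finite B" using B by (simp add: rat_basis_def)
  define R where "R b = {z::complex. \<exists>\<sigma>\<in>embeddings. z = \<sigma> b}" for b :: 'k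
  have finR: "finite (R b)" for b
  proof -
    obtain p where p: "p \<noteq> 0" "poly (map_poly of_rat p) b = 0"
      using number_field_rational_root[OF nf] by blast
    have "poly (map_poly of_rat p) (\<sigma> b) = 0" if "\<sigma> \<in> embeddings" for \<sigma>
    proof -
      have "poly (map_poly of_rat p) (\<sigma> b) = \<sigma> (poly (map_poly of_rat p) b)"
        using that by (simp add: poly_altdef degree_map_poly coeff_map_poly embeddings_simps)
      thus ?thesis using p(2) that by (simp add: embeddings_simps)
    qed
    hence "R b \<subseteq> {z. poly (map_poly of_rat p) z = 0}" by (auto simp: R_def)
    moreover have "finite {z::complex. poly (map_poly of_rat p) z = 0}"
      using p(1) by (intro poly_roots_finite) (simp add: map_poly_eq_0_iff)
    ultimately show ?thesis by (rule finite_subset)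
  qed
  have "(\<lambda>\<sigma>. restrict \<sigma> B) ` embeddings \<subseteq> PiE B R"
    by (auto simp: R_def)
  hence "finite ((\<lambda>\<sigma>. restrict \<sigma> B) ` (embeddings :: ('k \<Rightarrow> complex) set))"
    using finite_PiE[OF fin finR] by (rule finite_subset)
  moreover have "inj_on (\<lambda>\<sigma>. restrict \<sigma> B) (embeddings :: ('k \<Rightarrow> complex) set)"
  proof (intro inj_onI)
    fix \<sigma> \<tau> :: "'k \<Rightarrow> complex"
    assume "\<sigma> \<in> embeddings" "\<tau> \<in> embeddings" "restrict \<sigma> B = restrict \<tau> B"
    moreover from this(3) have "\<sigma> b = \<tau> b" if "b \<in> B" for b using that by (metis restrict_apply')
    ultimately show "\<sigma> = \<tau>" using B by (intro embeddings_eqI[of \<sigma> \<tau> B]) (auto simp: rat_basis_def)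
  qed
  ultimately show ?thesis by (rule finite_imageD)
qed

text \<open>The eigenvalues on the basis extend linearly to \<open>t\<close> with
  \<open>f (x * y) = t x * f y\<close>. If \<open>f 1\<close> is nonzero, this forces
  \<open>t\<close> to be a field homomorphism and \<open>f\<close> to be \<open>f 1\<close> times
  \<open>t\<close>; if \<open>f 1 = 0\<close>, then \<open>f\<close> vanishes on the basis.\<close>

lemma emb_comb_joint_eigen:
  fixes f :: "'k \<Rightarrow> complex"
  assumes B: "rat_basis B" and add: "additive f" and eig: "\<And>b. b \<in> B \<Longrightarrow> \<exists>r. \<forall>y. f (b * y) = r * f y"
  shows "emb_comb f"
proof (cases "f 1 = 0")
  case False
  obtain r where r: "\<And>b y. b \<in> B \<Longrightarrow> f (b * y) = r b * f y" using eig by metis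
  define t where "t x = (\<Sum>b\<in>B. of_rat (rat_vs.representation B x b) * r b)" for x
  have ft: "f (x * y) = t x * f y" for x y
  proof -
    have "x * y = (\<Sum>b\<in>B. of_rat (rat_vs.representation B x b) * (b * y))"
      by (subst rat_basis_sum[OF B, of x, symmetric]) (simp add: sum_distrib_right mult.assoc)
    hence "f (x * y) = (\<Sum>b\<in>B. of_rat (rat_vs.representation B x b) * (r b * f y))"
      by (simp add: additiveD[OF add] r)
    thus ?thesis by (simp add: t_def sum_distrib_right mult.assoc)
  qed
  have f1: "f x = t x * f 1" for x using ft[of x 1] by simp
  have "field_hom t"
  proof
    show "t (x + y) = t x + t y" for x y
      using f1[of "x + y"] f1[of x] f1[of y] additiveD(1)[OF add, of x y] False by (simp add: ring_distribs(2)[symmetric])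
    show "t (x * y) = t x * t y" for x y
      using f1[of "x * y"] ft[of x y] f1[of y] False by simp
    show "t 1 = 1" using f1[of 1] False by simp
    show "t 0 = 0" using f1[of 0] additiveD(2)[OF add] False by simp
  qed
  hence t: "t \<in> embeddings" by (simp add: embeddings_def)
  have "f y = (\<Sum>\<sigma>\<in>embeddings. (if \<sigma> = t then f 1 else 0) * \<sigma> y)" for y
  proof -
    have "(\<Sum>\<sigma>\<in>embeddings. (if \<sigma> = t then f 1 else 0) * \<sigma> y) = (\<Sum>\<sigma>\<in>embeddings. if \<sigma> = t then f 1 * \<sigma> y else 0)"
      by (intro sum.cong) auto
    thus ?thesis using t finite_embeddings f1[of y] by (simp add: sum.delta)
  qed
  thus ?thesis unfolding emb_comb_def by (intro exI[of _ "\<lambda>\<sigma>. if \<sigma> = t then f 1 else 0"]) blast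
next
  case True
  have "f x = 0" for x
  proof -
    obtain r where r: "\<And>b y. b \<in> B \<Longrightarrow> f (b * y) = r b * f y" using eig by metis
    have "f x = (\<Sum>b\<in>B. of_rat (rat_vs.representation B x b) * f b)"
      by (subst rat_basis_sum[OF B, of x, symmetric]) (simp add: additiveD[OF add])
    also have "\<dots> = 0" using r[of _ 1] True by (intro sum.neutral) simp
    finally show ?thesis .
  qed
  thus ?thesis unfolding emb_comb_def by (intro exI[of _ "\<lambda>_. 0"]) simp
qed

text \<open>Embeddings are obtained here as joint eigenfunctions, instead of by extending
  homomorphisms along a primitive element. That they span the complex dual of the field yields their
  number, the trace formula and the dual coefficients.\<close>

theorem additive_emb_comb:
  fixes f :: "'k \<Rightarrow> complex"
  assumes "additive f"
  shows "emb_comb f"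
proof -
  obtain B :: "'k set" where B: "rat_basis B" using rat_basis_extend_basis[OF nf] by blast
  \<comment> \<open>\<open>D\<close> holds basis elements that already act on \<open>f\<close> by
    scalars, \<open>bs\<close> those still to be treated.\<close>
  have gen: "emb_comb f" if "B \<subseteq> D \<union> set bs" "additive f" "\<And>b. b \<in> D \<Longrightarrow> \<exists>r. \<forall>y. f (b * y) = r * f y" for bs D f
    using that
  proof (induction bs arbitrary: D f)
    case Nil
    show ?case by (rule emb_comb_joint_eigen[OF B Nil(2)]) (use Nil in auto)
  next
    case (Cons b bs)
    obtain r where r: "\<And>d y. d \<in> D \<Longrightarrow> f (d * y) = r d * f y" using Cons.prems(3) by metis
    obtain p :: "rat poly" and rs :: "complex list" where p: "p \<noteq> 0" "poly (map_poly of_rat p) b = 0" "distinct rs"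
      "map_poly of_rat p = smult (of_rat (lead_coeff p)) (\<Prod>r\<leftarrow>rs. [:-r, 1:])"
      by (rule number_field_separable_root[OF nf, of b])
    define P where "P g \<longleftrightarrow> additive g \<and> (\<forall>d\<in>D. \<forall>y. g (d * y) = r d * g y)" for g
    have smult: "poly_act (smult c q) b f y = c * poly_act q b f y" for c q y
      by (cases "c = 0") (simp_all add: poly_act_def sum_distrib_left mult.assoc)
    have "poly_act (\<Prod>r\<leftarrow>rs. [:-r, 1:]) b f y = 0" for y
    proof -
      have "of_rat (lead_coeff p) * poly_act (\<Prod>r\<leftarrow>rs. [:-r, 1:]) b f y = f (poly (map_poly of_rat p) b * y)"
        using poly_act_rational[OF Cons.prems(2), of p b y] by (simp only: p(4) smult)
      thus ?thesis using p(1,2) additiveD(2)[OF Cons.prems(2)] by simp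
    qed
    hence "\<exists>\<psi>. (\<forall>s\<in>set rs. P (\<psi> s) \<and> (\<forall>y. \<psi> s (b * y) = s * \<psi> s y)) \<and> (\<forall>y. f y = (\<Sum>s\<in>set rs. \<psi> s y))"
    proof (intro eigen_split[where P = P])
      show "P (\<lambda>y. g (b * y))" if "P g" for g
        using that unfolding P_def additive_def by (auto simp: algebra_simps mult.left_commute[of b])
      show "P (\<lambda>y. c * g y + d * h y)" if "P g" "P h" for g h c d
        using that unfolding P_def additive_def by (auto simp: algebra_simps)
      show "P (\<lambda>_. 0)" by (simp add: P_def additive_def)
      show "P f" using Cons.prems(2) r by (simp add: P_def)
    qed (use p in auto)
    then obtain \<psi> where \<psi>: "\<And>s. s \<in> set rs \<Longrightarrow> P (\<psi> s)" "\<And>s y. s \<in> set rs \<Longrightarrow> \<psi> s (b * y) = s * \<psi> s y"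
      "\<And>y. f y = (\<Sum>s\<in>set rs. \<psi> s y)" by blast
    have "emb_comb (\<psi> s)" if s: "s \<in> set rs" for s
    proof (rule Cons.IH[of "insert b D"])
      show "B \<subseteq> insert b D \<union> set bs" using Cons.prems(1) by auto
      show "additive (\<psi> s)" using \<psi>(1)[OF s] by (simp add: P_def)
      show "\<exists>r. \<forall>y. \<psi> s (d * y) = r * \<psi> s y" if "d \<in> insert b D" for d
        using that \<psi>(1)[OF s] \<psi>(2)[OF s] unfolding P_def by blast
    qed
    hence "emb_comb (\<lambda>y. \<Sum>s\<in>set rs. \<psi> s y)" by (intro emb_comb_sum) auto
    thus ?case using \<psi>(3) by (simp add: emb_comb_def)
  qed
  obtain bs where "set bs = B" using B finite_list unfolding rat_basis_def by blast
  thus ?thesis using gen[of "{}" bs f] assms by auto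
qed

text \<open>The coefficients \<open>c\<close> invert the matrix of the values
  \<open>\<sigma> b\<close>. The first relation expresses the coordinate functionals through
  embeddings; the second is read off from the expansion of \<open>\<tau> x\<close> in the basis by
  the linear independence of embeddings.\<close>

theorem dual_coefficients:
  fixes B :: "'k set"
  assumes B: "rat_basis B"
  obtains c :: "'k \<Rightarrow> ('k \<Rightarrow> complex) \<Rightarrow> complex" where
    "\<And>b y. (\<Sum>\<sigma>\<in>embeddings. c b \<sigma> * \<sigma> y) = of_rat (rat_vs.representation B y b)"
    "\<And>\<sigma> \<tau>. \<sigma> \<in> embeddings \<Longrightarrow> \<tau> \<in> embeddings \<Longrightarrow> (\<Sum>b\<in>B. c b \<sigma> * \<tau> b) = (if \<sigma> = \<tau> then 1 else 0)"
proof -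
  have ind: "rat_vs.independent B" and sp: "rat_vs.span B = UNIV" using B by (auto simp: rat_basis_def)
  have "additive (\<lambda>y. of_rat (rat_vs.representation B y b))" for b
    unfolding additive_def using rat_vs.representation_add[OF ind] sp by (simp add: of_rat_add)
  hence "\<exists>c. \<forall>y. of_rat (rat_vs.representation B y b) = (\<Sum>\<sigma>\<in>embeddings. c \<sigma> * \<sigma> y)" for b
    using additive_emb_comb unfolding emb_comb_def by blast
  then obtain c :: "'k \<Rightarrow> ('k \<Rightarrow> complex) \<Rightarrow> complex" where c:
    "\<And>b y. (\<Sum>\<sigma>\<in>embeddings. c b \<sigma> * \<sigma> y) = of_rat (rat_vs.representation B y b)" by metis
  have "(\<Sum>b\<in>B. c b \<sigma> * \<tau> b) = (if \<sigma> = \<tau> then 1 else 0)" if "\<sigma> \<in> embeddings" "\<tau> \<in> embeddings" for \<sigma> \<tau>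
  proof -
    have "(\<Sum>b\<in>B. c b \<sigma> * \<tau> b) - (if \<sigma> = \<tau> then 1 else 0) = 0"
    proof (rule dedekind_independence[OF finite_embeddings order_refl _ that(1)])
      fix x
      have "(\<Sum>\<sigma>\<in>embeddings. ((\<Sum>b\<in>B. c b \<sigma> * \<tau> b) - (if \<sigma> = \<tau> then 1 else 0)) * \<sigma> x)
        = (\<Sum>\<sigma>\<in>embeddings. \<Sum>b\<in>B. c b \<sigma> * \<sigma> x * \<tau> b) - (\<Sum>\<sigma>\<in>embeddings. if \<sigma> = \<tau> then \<sigma> x else 0)"
        unfolding sum_subtractf[symmetric] by (intro sum.cong refl) (auto simp: algebra_simps sum_distrib_left sum_distrib_right)
      also have "(\<Sum>\<sigma>\<in>embeddings. if \<sigma> = \<tau> then \<sigma> x else 0) = \<tau> x"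
        using that finite_embeddings by (simp add: sum.delta)
      also have "(\<Sum>\<sigma>\<in>embeddings. \<Sum>b\<in>B. c b \<sigma> * \<sigma> x * \<tau> b) = (\<Sum>b\<in>B. (\<Sum>\<sigma>\<in>embeddings. c b \<sigma> * \<sigma> x) * \<tau> b)"
        by (subst sum.swap) (simp add: sum_distrib_right)
      also have "\<dots> = \<tau> (\<Sum>b\<in>B. of_rat (rat_vs.representation B x b) * b)"
        using that by (simp add: c embeddings_simps)
      also have "\<dots> = \<tau> x" by (simp add: rat_basis_sum[OF B])
      finally show "(\<Sum>\<sigma>\<in>embeddings. ((\<Sum>b\<in>B. c b \<sigma> * \<tau> b) - (if \<sigma> = \<tau> then 1 else 0)) * \<sigma> x) = 0" by simp
    qed
    thus ?thesis by simp
  qed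
  thus thesis using that c by blast
qed

text \<open>The sum of \<open>c b \<sigma> * \<sigma> b\<close> over all pairs counts the basis
  elements when summed over \<open>\<sigma>\<close> first, and the embeddings when summed over
  \<open>b\<close> first.\<close>

lemma card_embeddings:
  fixes B :: "'k set"
  assumes B: "rat_basis B"
  shows "card (embeddings :: ('k \<Rightarrow> complex) set) = card B"
proof -
  obtain c :: "'k \<Rightarrow> ('k \<Rightarrow> complex) \<Rightarrow> complex" where c:
    "\<And>b y. (\<Sum>\<sigma>\<in>embeddings. c b \<sigma> * \<sigma> y) = of_rat (rat_vs.representation B y b)"
    "\<And>\<sigma> \<tau>. \<sigma> \<in> embeddings \<Longrightarrow> \<tau> \<in> embeddings \<Longrightarrow> (\<Sum>b\<in>B. c b \<sigma> * \<tau> b) = (if \<sigma> = \<tau> then 1 else 0)"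
    using dual_coefficients[OF B] by blast
  have rep: "rat_vs.representation B b b = 1" if "b \<in> B" for b
    using that B rat_vs.representation_basis[of B b] by (auto simp: rat_basis_def)
  have "of_nat (card B) = (\<Sum>b\<in>B. (1::complex))" by simp
  also have "\<dots> = (\<Sum>b\<in>B. \<Sum>\<sigma>\<in>embeddings. c b \<sigma> * \<sigma> b)" by (intro sum.cong refl) (simp add: c(1) rep)
  also have "\<dots> = (\<Sum>\<sigma>\<in>embeddings. \<Sum>b\<in>B. c b \<sigma> * \<sigma> b)" by (rule sum.swap)
  also have "\<dots> = (\<Sum>\<sigma>\<in>(embeddings :: ('k \<Rightarrow> complex) set). 1)" by (intro sum.cong refl) (simp add: c(2))
  also have "\<dots> = of_nat (card (embeddings :: ('k \<Rightarrow> complex) set))" by simp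
  finally show ?thesis by (simp only: of_nat_eq_iff)
qed

text \<open>Removes the dependence on the basis chosen in the definition of the trace: the diagonal
  entries of multiplication by \<open>x\<close> are written with the dual coefficients, and the sum
  over the basis collapses.\<close>

lemma field_trace_embeddings:
  fixes x :: 'k
  shows "of_rat (field_trace x) = (\<Sum>\<sigma>\<in>embeddings. \<sigma> x)"
proof -
  define B :: "'k set" where "B = rat_vs.extend_basis {}"
  have B: "rat_basis B" unfolding B_def by (rule rat_basis_extend_basis[OF nf])
  obtain c :: "'k \<Rightarrow> ('k \<Rightarrow> complex) \<Rightarrow> complex" where c:
    "\<And>b y. (\<Sum>\<sigma>\<in>embeddings. c b \<sigma> * \<sigma> y) = of_rat (rat_vs.representation B y b)"
    "\<And>\<sigma> \<tau>. \<sigma> \<in> embeddings \<Longrightarrow> \<tau> \<in> embeddings \<Longrightarrow> (\<Sum>b\<in>B. c b \<sigma> * \<tau> b) = (if \<sigma> = \<tau> then 1 else 0)"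
    using dual_coefficients[OF B] by blast
  have "of_rat (field_trace x) = (\<Sum>b\<in>B. of_rat (rat_vs.representation B (x * b) b))"
    by (simp add: field_trace_def B_def of_rat_sum Let_def)
  also have "\<dots> = (\<Sum>b\<in>B. \<Sum>\<sigma>\<in>embeddings. \<sigma> x * (c b \<sigma> * \<sigma> b))"
    unfolding c(1)[symmetric] by (intro sum.cong refl) (simp add: embeddings_simps)
  also have "\<dots> = (\<Sum>\<sigma>\<in>embeddings. \<sigma> x * (\<Sum>b\<in>B. c b \<sigma> * \<sigma> b))"
    by (subst sum.swap) (simp add: sum_distrib_left)
  also have "\<dots> = (\<Sum>\<sigma>\<in>embeddings. \<sigma> x)" by (intro sum.cong refl) (simp add: c(2))
  finally show ?thesis .
qed

end

section \<open>Integral bases and the discriminant\<close>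

text \<open>Inversion up to the determinant without division, in terms of plain sums; it is applied
  over the integers, the rationals and the complex numbers.\<close>

lemma det_adjugate:
  fixes A :: "nat \<Rightarrow> nat \<Rightarrow> 'a::comm_ring_1"
  shows "\<exists>A'. (\<forall>i<n. \<forall>l<n. (\<Sum>j<n. A i j * A' j l) = (if i = l then det (mat n n (\<lambda>(i, j). A i j)) else 0)) \<and>
    (\<forall>i<n. \<forall>l<n. (\<Sum>j<n. A' i j * A j l) = (if i = l then det (mat n n (\<lambda>(i, j). A i j)) else 0))"
proof -
  define M where "M = mat n n (\<lambda>(i, j). A i j)"
  have M: "M \<in> carrier_mat n n" by (simp add: M_def)
  note adj = adj_mat[OF M]
  define A' where "A' i j = adj_mat M $$ (i, j)" for i j
  have A': "adj_mat M = mat n n (\<lambda>(i, j). A' i j)"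
    using adj(1) by (intro eq_matI) (auto simp: A'_def)
  have 1: "(M * adj_mat M) $$ (i, l) = (\<Sum>j<n. A i j * A' j l)" if "i < n" "l < n" for i l
    using that unfolding A' by (auto simp: M_def scalar_prod_def atLeast0LessThan)
  have 2: "(adj_mat M * M) $$ (i, l) = (\<Sum>j<n. A' i j * A j l)" if "i < n" "l < n" for i l
    using that unfolding A' by (auto simp: M_def scalar_prod_def atLeast0LessThan)
  have 3: "(det M \<cdot>\<^sub>m 1\<^sub>m n) $$ (i, l) = (if i = l then det M else 0)" if "i < n" "l < n" for i l
    using that by simp
  show ?thesis
    by (intro exI[of _ A'] conjI allI impI)
       (simp only: 1[symmetric] adj(2) 3 M_def[symmetric], simp only: 2[symmetric] adj(3) 3 M_def[symmetric])
qed

lemma common_denominator: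
  fixes q :: "'b \<Rightarrow> rat"
  assumes "finite I"
  obtains N :: int and k :: "'b \<Rightarrow> int" where "N > 0" "\<And>i. i \<in> I \<Longrightarrow> of_int N * q i = of_int (k i)"
proof -
  have "\<exists>N::int>0. \<forall>i\<in>I. \<exists>k. of_int N * q i = of_int k"
    using assms
  proof (induction I rule: finite_induct)
    case empty
    thus ?case by (intro exI[of _ 1]) simp
  next
    case (insert x I)
    then obtain N :: int where N: "N > 0" "\<And>i. i \<in> I \<Longrightarrow> \<exists>k. of_int N * q i = of_int k" by blast
    obtain a b where ab: "q x = Rat.Fract a b" "b > 0" by (cases "q x") auto
    have "\<exists>k. of_int (N * b) * q i = of_int k" if "i \<in> insert x I" for i
    proof (cases "i = x")
      case True
      thus ?thesis using ab by (intro exI[of _ "N * a"]) (simp add: Fract_of_int_quotient)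
    next
      case False
      then obtain k where "of_int N * q i = of_int k" using N(2) \<open>i \<in> insert x I\<close> by blast
      moreover have "of_int (N * b) * q i = of_int N * q i * of_int b" by simp
      ultimately have "of_int (N * b) * q i = of_int (k * b)" by simp
      thus ?thesis by blast
    qed
    thus ?case using N(1) ab(2) by (intro exI[of _ "N * b"]) simp
  qed
  then obtain N :: int where "N > 0" "\<forall>i\<in>I. \<exists>k. of_int N * q i = of_int k" by blast
  thus thesis using that by metis
qed

section \<open>The matrix of embeddings of a basis\<close>

abbreviation emb_mat :: "nat \<Rightarrow> (nat \<Rightarrow> 'k \<Rightarrow> complex) \<Rightarrow> (nat \<Rightarrow> 'k::field_char_0) \<Rightarrow> complex mat" where
  "emb_mat d e b \<equiv> mat d d (\<lambda>(i, j). e i (b j))"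

lemma emb_mat_lincomb:
  assumes e: "\<And>i. i < d \<Longrightarrow> e i \<in> embeddings"
    and b': "\<And>j. j < d \<Longrightarrow> b' j = (\<Sum>l<d. of_int (P l j) * b l)"
  shows "det (emb_mat d e b') = det (emb_mat d e b) * of_int (det (mat d d (\<lambda>(i, j). P i j)))"
proof -
  interpret of_int_hom: comm_ring_hom "of_int :: int \<Rightarrow> complex" by unfold_locales auto
  let ?P = "mat d d (\<lambda>(i, j). P i j)"
  have "emb_mat d e b' = emb_mat d e b * map_mat of_int ?P"
    using e by (intro eq_matI) (auto simp: b' scalar_prod_def embeddings_simps atLeast0LessThan mult.commute)
  thus ?thesis by (simp add: det_mult[of _ d])
qed

text \<open>An integral basis together with a numbering of the embeddings. The independence of
  \<open>b\<close> is contained in \<open>D \<noteq> 0\<close>, and \<open>D\<close> will be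
  identified with the discriminant.\<close>

definition integral_frame :: "nat \<Rightarrow> (nat \<Rightarrow> 'k \<Rightarrow> complex) \<Rightarrow> (nat \<Rightarrow> 'k::field_char_0) \<Rightarrow> int \<Rightarrow> bool" where
  "integral_frame d e b D \<longleftrightarrow> bij_betw e {..<d} embeddings \<and> (\<forall>j<d. b j \<in> ring_of_integers) \<and>
     (\<forall>x\<in>ring_of_integers. \<exists>q::nat \<Rightarrow> int. x = (\<Sum>j<d. of_int (q j) * b j)) \<and>
     (det (emb_mat d e b))\<^sup>2 = of_int D \<and> D \<noteq> 0"

context
  assumes nf: "number_field TYPE('k::field_char_0)"
begin

text \<open>Multiplication by \<open>x\<close> has a rational matrix in a rational basis; scaled by
  a common denominator \<open>N\<close> it becomes an integer matrix with eigenvalue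
  \<open>N x\<close>.\<close>

lemma integer_multiple:
  fixes x :: 'k
  obtains N :: int where "N > 0" "of_int N * x \<in> ring_of_integers"
proof -
  obtain B :: "'k set" where B: "rat_basis B" using rat_basis_extend_basis[OF nf] by blast
  have fin: "finite B" using B by (simp add: rat_basis_def)
  let ?q = "\<lambda>(b, b'). rat_vs.representation B (x * b) b'"
  obtain N k where N: "N > 0" "\<And>i. i \<in> B \<times> B \<Longrightarrow> of_int N * ?q i = of_int (k i)"
    using common_denominator[of "B \<times> B" ?q] fin by (metis finite_SigmaI)
  obtain b0 where b0: "b0 \<in> B" using rat_basis_nonempty[OF B] by blast
  have b0': "b0 \<noteq> 0" using b0 B rat_vs.dependent_zero unfolding rat_basis_def by blast
  have "algebraic_int (of_int N * x)"
  proof (rule algebraic_int_eigenvalue'[of B _ "\<lambda>b. b" "\<lambda>b b'. k (b, b')" b0])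
    fix b assume b: "b \<in> B"
    have "of_int N * x * b = of_int N * (\<Sum>b'\<in>B. of_rat (rat_vs.representation B (x * b) b') * b')"
      by (simp add: rat_basis_sum[OF B] mult.assoc)
    also have "\<dots> = (\<Sum>b'\<in>B. of_rat (of_int N * rat_vs.representation B (x * b) b') * b')"
      by (simp add: sum_distrib_left of_rat_mult mult.assoc)
    also have "\<dots> = (\<Sum>b'\<in>B. of_int (k (b, b')) * b')"
      using N(2) b by (intro sum.cong) auto
    finally show "of_int N * x * b = (\<Sum>b'\<in>B. of_int (k (b, b')) * b')" .
  qed (use fin b0 b0' in auto)
  thus thesis using that[OF N(1)] by (simp add: ring_of_integers_iff)
qed

text \<open>The transpose of the embedding matrix times the matrix itself is the Gram matrix of the
  trace form.\<close>

lemma emb_mat_square: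
  fixes b :: "nat \<Rightarrow> 'k"
  assumes e: "bij_betw e {..<d} embeddings"
  shows "(det (emb_mat d e b))\<^sup>2 = of_rat (det (mat d d (\<lambda>(i, j). field_trace (b i * b j))))"
proof -
  interpret of_rat_hom: comm_ring_hom "of_rat :: rat \<Rightarrow> complex"
    by unfold_locales (auto simp: of_rat_add of_rat_mult)
  have ee: "e i \<in> embeddings" if "i < d" for i using e that by (auto simp: bij_betw_def)
  let ?V = "emb_mat d e b"
  have tr: "of_rat (field_trace (b i * b j)) = (\<Sum>l<d. e l (b i) * e l (b j))" for i j
    unfolding field_trace_embeddings[OF nf] sum.reindex_bij_betw[OF e, symmetric]
    using ee by (intro sum.cong) (auto simp: embeddings_simps)
  have "transpose_mat ?V * ?V = map_mat of_rat (mat d d (\<lambda>(i, j). field_trace (b i * b j)))"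
    by (intro eq_matI) (auto simp: scalar_prod_def tr atLeast0LessThan)
  hence "det (transpose_mat ?V * ?V) = of_rat (det (mat d d (\<lambda>(i, j). field_trace (b i * b j))))"
    by simp
  also have "det (transpose_mat ?V * ?V) = det (transpose_mat ?V) * det ?V"
    by (rule det_mult) auto
  also have "det (transpose_mat ?V) = det ?V" by (rule det_transpose) auto
  finally show ?thesis by (simp add: power2_eq_square)
qed

lemma emb_mat_square_int:
  fixes b :: "nat \<Rightarrow> 'k"
  assumes e: "bij_betw e {..<d} embeddings" and b: "\<And>j. j < d \<Longrightarrow> b j \<in> ring_of_integers"
  shows "\<exists>D. (det (emb_mat d e b))\<^sup>2 = of_int D"
proof -
  have ee: "e i \<in> embeddings" if "i < d" for i using e that by (auto simp: bij_betw_def)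
  have "det (emb_mat d e b) \<in> ring_of_integers"
    by (rule roi_det[of _ d]) (simp_all add: embeddings_algebraic_int b ee)
  moreover have "(det (emb_mat d e b))\<^sup>2 \<in> \<rat>"
    unfolding emb_mat_square[OF e] by simp
  ultimately have "(det (emb_mat d e b))\<^sup>2 \<in> \<int>" by (intro roi_Rats) auto
  thus ?thesis by (auto elim: Ints_cases)
qed

lemma emb_mat_basis_nonzero:
  fixes B :: "'k set"
  assumes B: "rat_basis B" and e: "bij_betw e {..<d} embeddings" and h: "bij_betw h {..<d} B"
  shows "det (emb_mat d e h) \<noteq> 0"
proof -
  obtain c :: "'k \<Rightarrow> ('k \<Rightarrow> complex) \<Rightarrow> complex" where c:
    "\<And>b y. (\<Sum>\<sigma>\<in>embeddings. c b \<sigma> * \<sigma> y) = of_rat (rat_vs.representation B y b)"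
    using dual_coefficients[OF nf B] by metis
  have hB: "h i \<in> B" if "i < d" for i using h that by (auto simp: bij_betw_def)
  have hi: "h i = h j \<longleftrightarrow> i = j" if "i < d" "j < d" for i j
    using h that unfolding bij_betw_def inj_on_def by blast
  have rep: "rat_vs.representation B b b' = (if b' = b then 1 else 0)" if "b \<in> B" for b b'
    using that B rat_vs.representation_basis[of B b] by (auto simp: rat_basis_def)
  let ?C = "mat d d (\<lambda>(j, i). c (h j) (e i))"
  have "?C * emb_mat d e h = 1\<^sub>m d"
  proof (intro eq_matI)
    fix i j assume "i < dim_row (1\<^sub>m d :: complex mat)" "j < dim_col (1\<^sub>m d :: complex mat)"
    hence ij: "i < d" "j < d" by auto
    hence "(?C * emb_mat d e h) $$ (i, j) = (\<Sum>l<d. c (h i) (e l) * e l (h j))"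
      by (simp add: scalar_prod_def atLeast0LessThan)
    also have "\<dots> = (\<Sum>\<sigma>\<in>embeddings. c (h i) \<sigma> * \<sigma> (h j))"
      by (rule sum.reindex_bij_betw[OF e])
    also have "\<dots> = (if i = j then 1 else 0)"
      using ij hB hi by (simp add: c rep)
    finally show "(?C * emb_mat d e h) $$ (i, j) = 1\<^sub>m d $$ (i, j)" using ij by simp
  qed auto
  hence "det ?C * det (emb_mat d e h) = 1"
    by (metis det_mult det_one mat_carrier)
  thus ?thesis by auto
qed

text \<open>The coordinates are solved from the Gram matrix of the trace form, which makes them
  rational. The difference \<open>y\<close> then has trace zero against every \<open>b i\<close>,
  and invertibility of the embedding matrix forces all its embeddings to vanish.\<close>

lemma rational_coordinates:
  fixes b :: "nat \<Rightarrow> 'k"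
  assumes e: "bij_betw e {..<d} embeddings" and nz: "det (emb_mat d e b) \<noteq> 0"
  shows "\<exists>q. x = (\<Sum>j<d. of_rat (q j) * b j)"
proof -
  have ee: "e i \<in> embeddings" if "i < d" for i using e that by (auto simp: bij_betw_def)
  let ?T = "\<lambda>i j. field_trace (b i * b j)"
  define \<delta> where "\<delta> = det (mat d d (\<lambda>(i, j). ?T i j))"
  have d0: "\<delta> \<noteq> 0" using nz emb_mat_square[OF e, of b] by (auto simp: \<delta>_def)
  obtain T' where T': "\<And>i l. i < d \<Longrightarrow> l < d \<Longrightarrow> (\<Sum>j<d. ?T i j * T' j l) = (if i = l then \<delta> else 0)"
    using det_adjugate[of d ?T] unfolding \<delta>_def by blast
  define q where "q j = (\<Sum>l<d. T' j l * field_trace (x * b l)) / \<delta>" for j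
  define y where "y = x - (\<Sum>j<d. of_rat (q j) * b j)"
  have Tq: "(\<Sum>j<d. ?T i j * q j) = field_trace (x * b i)" if i: "i < d" for i
  proof -
    have "(\<Sum>j<d. ?T i j * q j) = (\<Sum>j<d. \<Sum>l<d. ?T i j * T' j l * field_trace (x * b l)) / \<delta>"
      by (simp add: q_def sum_divide_distrib sum_distrib_left mult.assoc)
    also have "(\<Sum>j<d. \<Sum>l<d. ?T i j * T' j l * field_trace (x * b l))
       = (\<Sum>l<d. (\<Sum>j<d. ?T i j * T' j l) * field_trace (x * b l))"
      by (subst sum.swap) (simp add: sum_distrib_right)
    also have "\<dots> = (\<Sum>l<d. if i = l then \<delta> * field_trace (x * b l) else 0)"
      using i by (intro sum.cong refl) (simp add: T')
    also have "\<dots> = \<delta> * field_trace (x * b i)" using i by (simp add: sum.delta)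
    finally show ?thesis using d0 by simp
  qed
  have tr: "of_rat (field_trace z) = (\<Sum>l<d. e l z)" for z
    unfolding field_trace_embeddings[OF nf] by (rule sum.reindex_bij_betw[OF e, symmetric])
  have zero: "(\<Sum>l<d. e l y * e l (b i)) = 0" if i: "i < d" for i
  proof -
    have "(\<Sum>l<d. e l y * e l (b i)) = (\<Sum>l<d. e l (x * b i)) - (\<Sum>l<d. \<Sum>j<d. of_rat (q j) * e l (b i * b j))"
      unfolding sum_subtractf[symmetric] using ee
      by (intro sum.cong refl) (simp add: y_def embeddings_simps algebra_simps sum_distrib_left)
    also have "(\<Sum>l<d. \<Sum>j<d. of_rat (q j) * e l (b i * b j)) = (\<Sum>j<d. of_rat (q j) * of_rat (?T i j))"
      by (subst sum.swap) (simp add: tr sum_distrib_left)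
    also have "\<dots> = of_rat (\<Sum>j<d. ?T i j * q j)" by (simp add: of_rat_sum of_rat_mult mult.commute)
    also have "\<dots> = (\<Sum>l<d. e l (x * b i))" by (simp add: Tq[OF i] tr)
    finally show ?thesis by simp
  qed
  obtain W where W: "\<And>i l. i < d \<Longrightarrow> l < d \<Longrightarrow> (\<Sum>j<d. e i (b j) * W j l) = (if i = l then det (emb_mat d e b) else 0)"
    using det_adjugate[of d "\<lambda>i j. e i (b j)"] by blast
  have "e l y = 0" if l: "l < d" for l
  proof -
    have "0 = (\<Sum>i<d. (\<Sum>m<d. e m y * e m (b i)) * W i l)" by (simp add: zero)
    also have "\<dots> = (\<Sum>m<d. e m y * (\<Sum>i<d. e m (b i) * W i l))"
      unfolding sum_distrib_right sum_distrib_left by (subst sum.swap) (simp add: mult.assoc)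
    also have "\<dots> = (\<Sum>m<d. if m = l then e m y * det (emb_mat d e b) else 0)"
      using l by (intro sum.cong refl) (simp add: W)
    also have "\<dots> = e l y * det (emb_mat d e b)" using l by (simp add: sum.delta)
    finally show ?thesis using nz by simp
  qed
  moreover have "d \<noteq> 0"
  proof
    assume "d = 0"
    hence "card (embeddings :: ('k \<Rightarrow> complex) set) = 0" using bij_betw_same_card[OF e] by simp
    moreover obtain B :: "'k set" where B: "rat_basis B" using rat_basis_extend_basis[OF nf] by blast
    ultimately show False
      using card_embeddings[OF nf B] rat_basis_nonempty[OF B] by (simp add: rat_basis_def)
  qed
  ultimately have "y = 0" using ee[of 0] embeddings_simps(15)[of "e 0" y] by auto
  thus ?thesis by (auto simp: y_def)
qed

lemma emb_mat_replace:
  fixes b :: "nat \<Rightarrow> 'k"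
  assumes e: "\<And>i. i < d \<Longrightarrow> e i \<in> embeddings" and l: "l < d" and x: "x = (\<Sum>j<d. of_rat (q j) * b j)"
  shows "det (emb_mat d e (b(l := x))) = of_rat (q l) * det (emb_mat d e b)"
proof -
  let ?q = "vec d (\<lambda>j. of_rat (q j) :: complex)"
  have "emb_mat d e (b(l := x)) = replace_col (emb_mat d e b) (emb_mat d e b *\<^sub>v ?q) l"
    using e unfolding replace_col_def
    by (intro eq_matI) (auto simp: x embeddings_simps scalar_prod_def mult.commute atLeast0LessThan)
  thus ?thesis using cramer_lemma_mat[of "emb_mat d e b" d ?q l] l by simp
qed

text \<open>An integral rational basis of minimal discriminant is an integral basis: if some integer had
  a coordinate with fractional part \<open>0 < f < 1\<close>, exchanging would multiply the discriminant by \<open>f\<^sup>2\<close>.\<close>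

lemma integral_frame_exists: "\<exists>d e (b :: nat \<Rightarrow> 'k) D. integral_frame d e b D"
proof -
  obtain B :: "'k set" where B: "rat_basis B" using rat_basis_extend_basis[OF nf] by blast
  define d where "d = card (embeddings :: ('k \<Rightarrow> complex) set)"
  obtain e :: "nat \<Rightarrow> 'k \<Rightarrow> complex" where e: "bij_betw e {..<d} embeddings"
    using ex_bij_betw_nat_finite[OF finite_embeddings[OF nf]] by (auto simp: atLeast0LessThan d_def)
  have ee: "e i \<in> embeddings" if "i < d" for i using e that by (auto simp: bij_betw_def)
  obtain h where h: "bij_betw h {..<d} B"
    using ex_bij_betw_nat_finite[of B] B card_embeddings[OF nf B] by (auto simp: atLeast0LessThan d_def rat_basis_def)
  have "\<exists>N::int. N > 0 \<and> of_int N * h j \<in> ring_of_integers" for j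
    using integer_multiple[of "h j"] by blast
  then obtain N :: "nat \<Rightarrow> int" where N: "\<And>j. N j > 0" "\<And>j. of_int (N j) * h j \<in> ring_of_integers" by metis
  define P where "P b D \<longleftrightarrow> (\<forall>j<d. b j \<in> ring_of_integers) \<and> (det (emb_mat d e b))\<^sup>2 = of_int D \<and> D \<noteq> 0"
    for b :: "nat \<Rightarrow> 'k" and D :: int
  have ex: "\<exists>n b D. P b D \<and> nat \<bar>D\<bar> = n"
  proof -
    \<comment> \<open>A rational basis scaled into the ring of integers shows that the minimum is
      taken over a nonempty set.\<close>
    let ?b = "\<lambda>j. of_int (N j) * h j"
    have "det (emb_mat d e ?b) = det (emb_mat d e h) * of_int (det (mat d d (\<lambda>(i, j). if i = j then N j else 0)))"
    proof (rule emb_mat_lincomb)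
      fix j assume j: "j < d"
      have "(\<Sum>l<d. of_int (if l = j then N j else 0) * h l) = (\<Sum>l<d. if l = j then of_int (N j) * h l else 0)"
        by (intro sum.cong) auto
      thus "?b j = (\<Sum>l<d. of_int (if l = j then N j else 0) * h l)" using j by (simp add: sum.delta)
    qed (rule ee)
    moreover have "det (mat d d (\<lambda>(i, j). if i = j then N j else 0)) = prod_list (diag_mat (mat d d (\<lambda>(i, j). if i = j then N j else 0)))"
      by (rule det_upper_triangular[of _ d]) (auto simp: upper_triangular_def)
    moreover have "prod_list (diag_mat (mat d d (\<lambda>(i, j). if i = j then N j else 0))) \<noteq> 0"
      using N(1) by (auto simp: prod_list_zero_iff diag_mat_def less_imp_neq[symmetric])
    ultimately have "det (emb_mat d e ?b) \<noteq> 0"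
      using emb_mat_basis_nonzero[OF B e h] by simp
    moreover obtain D where "(det (emb_mat d e ?b))\<^sup>2 = of_int D"
      using emb_mat_square_int[OF e, of ?b] N(2) by blast
    ultimately have "P ?b D" unfolding P_def using N(2) by auto
    thus ?thesis by blast
  qed
  define n where "n = (LEAST n. \<exists>b D. P b D \<and> nat \<bar>D\<bar> = n)"
  obtain b D where bD: "P b D" "nat \<bar>D\<bar> = n"
    using LeastI_ex[OF ex] unfolding n_def by blast
  have min: "n \<le> nat \<bar>D'\<bar>" if "P b' D'" for b' D'
    unfolding n_def by (rule Least_le) (use that in blast)
  have nz: "det (emb_mat d e b) \<noteq> 0" using bD(1) by (auto simp: P_def)
  have "\<exists>q::nat \<Rightarrow> int. x = (\<Sum>j<d. of_int (q j) * b j)" if x: "x \<in> ring_of_integers" for x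
  proof -
    obtain q where q: "x = (\<Sum>j<d. of_rat (q j) * b j)" using rational_coordinates[OF e nz] by blast
    have "q l \<in> \<int>" if l: "l < d" for l
    proof (rule ccontr)
      assume nonint: "q l \<notin> \<int>"
      define f where "f = q l - of_int \<lfloor>q l\<rfloor>"
      have f: "0 < f" "f < 1"
      proof -
        have "q l \<noteq> of_int \<lfloor>q l\<rfloor>" using nonint by (metis Ints_of_int)
        thus "0 < f" "f < 1" unfolding f_def by linarith+
      qed
      define x' where "x' = x - of_int \<lfloor>q l\<rfloor> * b l"
      have x': "x' = (\<Sum>j<d. of_rat ((q(l := f)) j) * b j)"
      proof -
        have "(\<Sum>j<d. of_rat ((q(l := f)) j) * b j) = (\<Sum>j<d. of_rat (q j) * b j - (if j = l then of_int \<lfloor>q l\<rfloor> * b j else 0))"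
          by (intro sum.cong) (auto simp: f_def of_rat_diff algebra_simps)
        thus ?thesis using l by (simp add: x'_def q sum_subtractf sum.delta)
      qed
      have dl: "det (emb_mat d e (b(l := x'))) = of_rat f * det (emb_mat d e b)"
        using emb_mat_replace[OF ee l x'] by simp
      have int: "\<forall>j<d. (b(l := x')) j \<in> ring_of_integers"
        using bD(1) x l by (auto simp: P_def x'_def)
      obtain D' where D': "(det (emb_mat d e (b(l := x'))))\<^sup>2 = of_int D'"
        using emb_mat_square_int[OF e, of "b(l := x')"] int by blast
      have "of_int D' = (of_rat f)\<^sup>2 * (of_int D :: complex)"
        unfolding D'[symmetric] dl using bD(1) by (simp add: power_mult_distrib P_def)
      hence "(of_rat (of_int D') :: complex) = of_rat (f\<^sup>2 * of_int D)"
        by (simp add: of_rat_mult of_rat_power)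
      hence DD: "of_int D' = f\<^sup>2 * of_int D" by (simp only: of_rat_eq_iff)
      have "D' \<noteq> 0" using DD f bD(1) by (auto simp: P_def)
      hence "n \<le> nat \<bar>D'\<bar>" using D' int by (intro min[of "b(l := x')"]) (simp add: P_def)
      hence "\<bar>D\<bar> \<le> \<bar>D'\<bar>" using bD(2) by linarith
      hence "\<bar>of_int D :: rat\<bar> \<le> \<bar>of_int D'\<bar>" by linarith
      also have "\<bar>of_int D' :: rat\<bar> = f\<^sup>2 * \<bar>of_int D\<bar>" by (simp add: DD abs_mult)
      also have "\<dots> < 1 * \<bar>of_int D\<bar>"
        using f bD(1) by (intro mult_strict_right_mono) (auto simp: P_def power_less_one_iff)
      finally show False by simp
    qed
    hence "\<forall>j. \<exists>k::int. j < d \<longrightarrow> q j = of_int k" by (meson Ints_cases)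
    then obtain k :: "nat \<Rightarrow> int" where "\<And>j. j < d \<Longrightarrow> q j = of_int (k j)" by metis
    hence "x = (\<Sum>j<d. of_int (k j) * b j)" unfolding q by (intro sum.cong) auto
    thus ?thesis by blast
  qed
  thus ?thesis unfolding integral_frame_def using e bD(1) unfolding P_def by blast
qed

text \<open>The definition by \<open>THE\<close> requires the value to agree for all integral bases:
  two of them are related by integer matrices in both directions, so the determinants
  \<open>p\<close> and \<open>p'\<close> are mutually inverse integers, and the squared determinant
  of the embeddings does not change.\<close>

lemma integral_frame_discriminant:
  fixes b :: "nat \<Rightarrow> 'k"
  assumes F: "integral_frame d e b D"
  shows "field_discriminant TYPE('k) = D"
proof -
  have e: "bij_betw e {..<d} embeddings" and bO: "\<And>j. j < d \<Longrightarrow> b j \<in> ring_of_integers"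
    and sp: "\<And>x. x \<in> ring_of_integers \<Longrightarrow> \<exists>q::nat \<Rightarrow> int. x = (\<Sum>j<d. of_int (q j) * b j)"
    and D: "(det (emb_mat d e b))\<^sup>2 = of_int D" "D \<noteq> 0"
    using F by (auto simp: integral_frame_def)
  have ee: "e i \<in> embeddings" if "i < d" for i using e that by (auto simp: bij_betw_def)
  have nz: "det (emb_mat d e b) \<noteq> 0" using D by auto
  have indep: "\<forall>j<d. q j = 0" if "(\<Sum>j<d. of_int (q j) * b j) = 0" for q :: "nat \<Rightarrow> int"
  proof (intro allI impI)
    fix j assume j: "j < d"
    obtain W where W: "\<And>i l. i < d \<Longrightarrow> l < d \<Longrightarrow> (\<Sum>j<d. W i j * e j (b l)) = (if i = l then det (emb_mat d e b) else 0)"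
      using det_adjugate[of d "\<lambda>i j. e i (b j)"] by blast
    have "0 = (\<Sum>i<d. W j i * e i (\<Sum>l<d. of_int (q l) * b l))"
      unfolding that using ee by (simp add: embeddings_simps)
    also have "\<dots> = (\<Sum>i<d. \<Sum>l<d. of_int (q l) * (W j i * e i (b l)))"
      using ee by (intro sum.cong refl) (simp add: embeddings_simps sum_distrib_left mult.left_commute)
    also have "\<dots> = (\<Sum>l<d. of_int (q l) * (\<Sum>i<d. W j i * e i (b l)))"
      by (subst sum.swap) (simp add: sum_distrib_left)
    also have "\<dots> = (\<Sum>l<d. if j = l then of_int (q l) * det (emb_mat d e b) else 0)"
      using j by (intro sum.cong refl) (simp add: W)
    also have "\<dots> = of_int (q j) * det (emb_mat d e b)" using j by (simp add: sum.delta)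
    finally show "q j = 0" using nz by simp
  qed
  have inj: "inj_on b {..<d}"
  proof (intro inj_onI)
    fix i j assume ij: "i \<in> {..<d}" "j \<in> {..<d}" "b i = b j"
    show "i = j"
    proof (rule ccontr)
      assume "i \<noteq> j"
      let ?q = "\<lambda>l. (if l = i then 1 else 0) - (if l = j then 1 else 0 :: int)"
      have "(\<Sum>l<d. of_int (?q l) * b l) = (\<Sum>l<d. (if l = i then b l else 0) - (if l = j then b l else 0))"
        by (intro sum.cong) auto
      also have "\<dots> = 0" using ij by (simp add: sum_subtractf sum.delta)
      finally have "\<forall>l<d. ?q l = 0" by (rule indep)
      hence "?q i = 0" using ij by blast
      thus False using \<open>i \<noteq> j\<close> by simp
    qed
  qed
  define bs where "bs = map b [0..<d]"
  have set_bs: "set bs = b ` {..<d}" by (auto simp: bs_def)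
  have ib: "integral_basis bs"
    unfolding integral_basis_def
  proof (intro conjI)
    show "distinct bs" using inj by (simp add: bs_def distinct_map atLeast0LessThan)
    show "int_mod.independent (set bs)"
    proof
      assume "int_mod.dependent (set bs)"
      then obtain t u where t: "finite t" "t \<subseteq> set bs" "(\<Sum>v\<in>t. of_int (u v) * v) = 0" "\<exists>v\<in>t. u v \<noteq> 0"
        unfolding int_mod.dependent_explicit by blast
      let ?q = "\<lambda>j. if b j \<in> t then u (b j) else 0"
      have "(\<Sum>j<d. of_int (?q j) * b j) = (\<Sum>v\<in>set bs. of_int (if v \<in> t then u v else 0) * v)"
        unfolding set_bs by (subst sum.reindex[OF inj]) simp
      also have "\<dots> = (\<Sum>v\<in>t. of_int (u v) * v)"
        using t(2) by (intro sum.mono_neutral_cong_right) auto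
      finally have "\<forall>j<d. ?q j = 0" using t(3) by (intro indep) simp
      thus False using t(2,4) unfolding set_bs by fastforce
    qed
    show "int_mod.span (set bs) = ring_of_integers"
    proof
      show "int_mod.span (set bs) \<subseteq> ring_of_integers"
      proof
        fix x assume "x \<in> int_mod.span (set bs)"
        thus "x \<in> ring_of_integers"
          by (induction rule: int_mod.span_induct_alt) (auto simp: set_bs bO intro!: roi_add roi_mult)
      qed
      show "ring_of_integers \<subseteq> int_mod.span (set bs)"
      proof
        fix x :: 'k assume "x \<in> ring_of_integers"
        then obtain q :: "nat \<Rightarrow> int" where "x = (\<Sum>j<d. of_int (q j) * b j)" using sp by blast
        moreover have "(\<Sum>j<d. of_int (q j) * b j) \<in> int_mod.span (set bs)"
          by (rule int_mod.span_sum) (rule int_mod.span_scale, rule int_mod.span_base, simp add: set_bs)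
        ultimately show "x \<in> int_mod.span (set bs)" by simp
      qed
    qed
  qed
  have disc: "of_int D = det (mat (length bs') (length bs') (\<lambda>(i, j). field_trace (bs' ! i * bs' ! j)))"
    if "integral_basis bs'" for bs' :: "'k list"
  proof -
    have dist: "distinct bs'" and ind: "int_mod.independent (set bs')"
      and span: "int_mod.span (set bs') = ring_of_integers"
      using that by (auto simp: integral_basis_def)
    have inO: "x \<in> ring_of_integers" if "x \<in> set bs'" for x
      using that span int_mod.span_base by blast
    \<comment> \<open>Clearing denominators turns independence and spanning over the integers into
      the same over the rationals; the length of \<open>bs'\<close> is then the number of
      embeddings.\<close>
    have "rat_basis (set bs')"
      unfolding rat_basis_def
    proof (intro conjI)
      show "rat_vs.independent (set bs')"
      proof
        assume "rat_vs.dependent (set bs')"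
        then obtain t u where t: "finite t" "t \<subseteq> set bs'" "(\<Sum>v\<in>t. of_rat (u v) * v) = 0" "\<exists>v\<in>t. u v \<noteq> 0"
          unfolding rat_vs.dependent_explicit by blast
        obtain N k where N: "N > 0" "\<And>v. v \<in> t \<Longrightarrow> of_int N * u v = of_int (k v)"
          using common_denominator[OF t(1), of u] by metis
        have "(\<Sum>v\<in>t. of_int (k v) * v) = (\<Sum>v\<in>t. of_int N * (of_rat (u v) * v))"
        proof (intro sum.cong refl)
          fix v assume v: "v \<in> t"
          have "(of_int (k v) :: 'k) = of_rat (of_int (k v))" by simp
          also have "\<dots> = of_int N * of_rat (u v)" unfolding N(2)[OF v, symmetric] by (simp add: of_rat_mult)
          finally show "of_int (k v) * v = of_int N * (of_rat (u v) * v)" by simp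
        qed
        also have "\<dots> = 0" by (simp add: sum_distrib_left[symmetric] t(3))
        finally have "(\<Sum>v\<in>t. of_int (k v) * v) = 0" .
        moreover obtain v where v: "v \<in> t" "u v \<noteq> 0" using t(4) by blast
        hence "k v \<noteq> 0" using N(1) N(2)[of v] by auto
        ultimately show False using ind t(1,2) v(1) unfolding int_mod.dependent_explicit by blast
      qed
      show "rat_vs.span (set bs') = UNIV"
      proof (intro equalityI subsetI UNIV_I)
        fix x :: 'k
        obtain N where N: "N > 0" "of_int N * x \<in> ring_of_integers" using integer_multiple[of x] .
        have "of_int N * x \<in> int_mod.span (set bs')" using N(2) span by simp
        hence "of_int N * x \<in> rat_vs.span (set bs')"
        proof (induction rule: int_mod.span_induct_alt)
          case (step c v y)
          thus ?case using rat_vs.span_scale[OF rat_vs.span_base, of v "set bs'" "of_int c"]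
            by (intro rat_vs.span_add) auto
        qed (rule rat_vs.span_zero)
        hence "of_rat (1 / of_int N) * (of_int N * x) \<in> rat_vs.span (set bs')"
          by (rule rat_vs.span_scale)
        moreover have "of_rat (1 / of_int N) * (of_int N * x) = x"
          using N(1) by (simp add: of_rat_divide)
        ultimately show "x \<in> rat_vs.span (set bs')" by simp
      qed
    qed simp
    hence "length bs' = d"
      using card_embeddings[OF nf] bij_betw_same_card[OF e] distinct_card[OF dist] by fastforce
    note len = this
    have "\<forall>l. \<exists>q::nat \<Rightarrow> int. l < d \<longrightarrow> bs' ! l = (\<Sum>j<d. of_int (q j) * b j)"
      using sp inO len by (meson nth_mem)
    from choice[OF this] obtain P :: "nat \<Rightarrow> nat \<Rightarrow> int"
      where P: "\<And>l. l < d \<Longrightarrow> bs' ! l = (\<Sum>j<d. of_int (P l j) * b j)" by blast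
    have "\<forall>l. \<exists>q::nat \<Rightarrow> int. l < d \<longrightarrow> b l = (\<Sum>j<d. of_int (q j) * bs' ! j)"
    proof -
      have "\<exists>q. b l = (\<Sum>j<d. of_int (q j :: int) * bs' ! j)" if "l < d" for l
      proof -
        have "b l \<in> int_mod.span (set bs')" using bO[OF that] span by simp
        then obtain u where u: "b l = (\<Sum>v\<in>set bs'. of_int (u v) * v)"
          unfolding int_mod.span_finite[OF finite_set] by blast
        have "bij_betw ((!) bs') {..<d} (set bs')" using bij_betw_nth[OF dist] len by simp
        hence "(\<Sum>j<d. of_int (u (bs' ! j)) * bs' ! j) = b l"
          unfolding u by (rule sum.reindex_bij_betw)
        thus ?thesis by (intro exI[of _ "\<lambda>j. u (bs' ! j)"]) simp
      qed
      thus ?thesis by blast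
    qed
    from choice[OF this] obtain P' :: "nat \<Rightarrow> nat \<Rightarrow> int"
      where P': "\<And>l. l < d \<Longrightarrow> b l = (\<Sum>j<d. of_int (P' l j) * bs' ! j)" by blast
    let ?v = "det (emb_mat d e b)" and ?v' = "det (emb_mat d e ((!) bs'))"
    define p where "p = det (mat d d (\<lambda>(j, l). P l j))"
    define p' where "p' = det (mat d d (\<lambda>(j, l). P' l j))"
    have p: "?v' = ?v * of_int p" "?v = ?v' * of_int p'"
      unfolding p_def p'_def by (rule emb_mat_lincomb[OF ee P]; assumption) (rule emb_mat_lincomb[OF ee P']; assumption)
    have "?v * of_int (p * p') = ?v" using p by (metis mult.assoc of_int_mult)
    hence "of_int (p * p') = (1::complex)" using nz by simp
    hence "p * p' = 1" by (simp only: of_int_eq_1_iff)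
    hence "p\<^sup>2 = 1" by (metis zmult_eq_1_iff power_one power2_eq_1_iff)
    hence "?v'\<^sup>2 = of_int D" using D(1) unfolding p(1) by (simp add: power_mult_distrib flip: of_int_power)
    hence "of_rat (of_int D) = (of_rat (det (mat d d (\<lambda>(i, j). field_trace (bs' ! i * bs' ! j)))) :: complex)"
      unfolding emb_mat_square[OF e] by simp
    thus ?thesis by (simp only: of_rat_eq_iff len)
  qed
  show ?thesis
    unfolding field_discriminant_def
  proof (rule the_equality)
    show "\<exists>bs::'k list. integral_basis bs \<and>
        of_int D = det (mat (length bs) (length bs) (\<lambda>(i, j). field_trace (bs ! i * bs ! j)))"
      using ib disc[OF ib] by blast
  next
    fix D' assume "\<exists>bs::'k list. integral_basis bs \<and>
        of_int D' = det (mat (length bs) (length bs) (\<lambda>(i, j). field_trace (bs ! i * bs ! j)))"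
    then obtain bs' :: "'k list" where "integral_basis bs'"
      "of_int D' = det (mat (length bs') (length bs') (\<lambda>(i, j). field_trace (bs' ! i * bs' ! j)))" by blast
    hence "(of_int D' :: rat) = of_int D" using disc by metis
    thus "D' = D" by (simp only: of_int_eq_iff)
  qed
qed

end

section \<open>Odd discriminants and squares modulo 2\<close>

lemma integral_frameD:
  assumes "integral_frame d e b D"
  shows "bij_betw e {..<d} embeddings" "\<And>j. j < d \<Longrightarrow> b j \<in> ring_of_integers"
    "\<And>x. x \<in> ring_of_integers \<Longrightarrow> \<exists>q::nat \<Rightarrow> int. x = (\<Sum>j<d. of_int (q j) * b j)"
    "(det (emb_mat d e b))\<^sup>2 = of_int D" "D \<noteq> 0"
  using assms by (simp_all only: integral_frame_def Ball_def simp_thms)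

text \<open>Squaring is additive modulo 2, the cross terms being even.\<close>

lemma square_sum_mod_2:
  assumes "finite I" "\<And>i. i \<in> I \<Longrightarrow> f i \<in> ring_of_integers"
  shows "\<exists>w\<in>ring_of_integers. (sum f I)\<^sup>2 = (\<Sum>i\<in>I. (f i)\<^sup>2) + 2 * w"
  using assms
proof (induction I rule: finite_induct)
  case empty
  thus ?case by (intro bexI[of _ 0]) auto
next
  case (insert x I)
  then obtain w where w: "w \<in> ring_of_integers" "(sum f I)\<^sup>2 = (\<Sum>i\<in>I. (f i)\<^sup>2) + 2 * w" by auto
  have "(sum f (insert x I))\<^sup>2 = (f x)\<^sup>2 + (sum f I)\<^sup>2 + 2 * (f x * sum f I)"
    using insert by (simp add: power2_eq_square algebra_simps)
  also have "\<dots> = (\<Sum>i\<in>insert x I. (f i)\<^sup>2) + 2 * (w + f x * sum f I)"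
    using insert w by (simp add: algebra_simps)
  finally show ?case
    using w(1) insert.prems by (intro bexI[of _ "w + f x * sum f I"]) (auto intro!: roi_add roi_mult roi_sum)
qed

text \<open>In the Leibniz formula every sign is congruent to 1 modulo 2, and squaring the sum
  squares the summands modulo 2.\<close>

lemma det_square_mod_2:
  assumes a: "\<And>i j. i < n \<Longrightarrow> j < n \<Longrightarrow> a i j \<in> ring_of_integers"
  shows "\<exists>w\<in>ring_of_integers. det (mat n n (\<lambda>(i, j). (a i j)\<^sup>2)) = (det (mat n n (\<lambda>(i, j). a i j)))\<^sup>2 + 2 * w"
proof -
  let ?P = "{p. p permutes {0..<n}}"
  let ?t = "\<lambda>p. \<Prod>i = 0..<n. a i (p i)"
  have prm: "p i < n" if "p permutes {0..<n}" "i < n" for p i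
    using permutes_in_image[OF that(1), of i] that(2) by simp
  have t: "?t p \<in> ring_of_integers" if "p \<in> ?P" for p
    using that by (intro roi_prod a) (simp_all add: prm)
  have s: "(signof p :: 'a) \<in> ring_of_integers \<and> (signof p :: 'a)\<^sup>2 = 1 \<and>
    (\<exists>v\<in>ring_of_integers. (signof p :: 'a) = 1 + 2 * v)" for p :: "nat \<Rightarrow> nat"
  proof -
    consider "(signof p :: 'a) = 1" | "(signof p :: 'a) = -1"
      by (cases p rule: sign_cases) auto
    thus ?thesis
    proof cases
      case 1
      thus ?thesis by (auto intro!: bexI[of _ 0])
    next
      case 2
      have "(-1 :: 'a) \<in> ring_of_integers" by (rule roi_uminus) simp
      thus ?thesis unfolding 2 by (auto intro!: bexI[of _ "-1"])
    qed
  qed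
  have d1: "det (mat n n (\<lambda>(i, j). a i j)) = (\<Sum>p\<in>?P. signof p * ?t p)"
    by (subst det_def'[of _ n]) (auto intro!: sum.cong prod.cong simp: prm)
  have d2: "det (mat n n (\<lambda>(i, j). (a i j)\<^sup>2)) = (\<Sum>p\<in>?P. signof p * (?t p)\<^sup>2)"
    by (subst det_def'[of _ n]) (auto intro!: sum.cong prod.cong simp: prm prod_power_distrib)
  obtain v :: "(nat \<Rightarrow> nat) \<Rightarrow> 'a" where v: "\<And>p. v p \<in> ring_of_integers" "\<And>p. signof p = 1 + 2 * v p"
    using s by metis
  have "det (mat n n (\<lambda>(i, j). (a i j)\<^sup>2)) = (\<Sum>p\<in>?P. (?t p)\<^sup>2) + 2 * (\<Sum>p\<in>?P. v p * (?t p)\<^sup>2)"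
    unfolding d2 v(2) sum_distrib_left sum.distrib[symmetric] by (intro sum.cong refl) (simp add: algebra_simps)
  moreover obtain w where w: "w \<in> ring_of_integers"
    "(\<Sum>p\<in>?P. signof p * ?t p)\<^sup>2 = (\<Sum>p\<in>?P. (signof p * ?t p)\<^sup>2) + 2 * w"
    using square_sum_mod_2[of ?P "\<lambda>p. signof p * ?t p"] s t by (auto intro: finite_permutations)
  moreover have "(\<Sum>p\<in>?P. (signof p * ?t p)\<^sup>2) = (\<Sum>p\<in>?P. (?t p)\<^sup>2)"
    by (simp add: power_mult_distrib s)
  ultimately have "det (mat n n (\<lambda>(i, j). (a i j)\<^sup>2)) =
      (det (mat n n (\<lambda>(i, j). a i j)))\<^sup>2 + 2 * ((\<Sum>p\<in>?P. v p * (?t p)\<^sup>2) - w)"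
    unfolding d1 by (simp add: algebra_simps)
  thus ?thesis using w(1) v(1) t
    by (intro bexI[of _ "(\<Sum>p\<in>?P. v p * (?t p)\<^sup>2) - w"]) (auto intro!: roi_diff roi_sum roi_mult roi_power)
qed

section \<open>Congruences modulo an ideal of algebraic integers\<close>

lemma prod_cong_ideal:
  fixes f g :: "'b \<Rightarrow> 'a::field_char_0"
  assumes I: "0 \<in> I" "\<And>x y. x \<in> I \<Longrightarrow> y \<in> I \<Longrightarrow> x + y \<in> I"
      "\<And>x c. x \<in> I \<Longrightarrow> c \<in> ring_of_integers \<Longrightarrow> c * x \<in> I"
    and S: "finite S" "\<And>i. i \<in> S \<Longrightarrow> f i \<in> ring_of_integers" "\<And>i. i \<in> S \<Longrightarrow> g i \<in> ring_of_integers"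
      "\<And>i. i \<in> S \<Longrightarrow> f i - g i \<in> I"
  shows "prod f S - prod g S \<in> I"
  using S
proof (induction S rule: finite_induct)
  case empty
  thus ?case using I(1) by simp
next
  case (insert x S)
  have "prod f (insert x S) - prod g (insert x S) = f x * (prod f S - prod g S) + prod g S * (f x - g x)"
    using insert.hyps by (simp add: algebra_simps)
  thus ?case using insert by (auto intro!: I roi_prod)
qed

text \<open>Leibniz formula modulo \<open>I\<close>. The ideal is given by closure properties
  because two ideals occur: the one generated by 2 and the differences of two embeddings, and the
  one generated by 2 alone.\<close>

lemma det_cong_ideal:
  fixes a b :: "nat \<Rightarrow> nat \<Rightarrow> 'a::field_char_0"
  assumes I: "0 \<in> I" "\<And>x y. x \<in> I \<Longrightarrow> y \<in> I \<Longrightarrow> x + y \<in> I"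
      "\<And>x c. x \<in> I \<Longrightarrow> c \<in> ring_of_integers \<Longrightarrow> c * x \<in> I"
    and a: "\<And>i j. i < n \<Longrightarrow> j < n \<Longrightarrow> a i j \<in> ring_of_integers"
    and b: "\<And>i j. i < n \<Longrightarrow> j < n \<Longrightarrow> b i j \<in> ring_of_integers"
    and ab: "\<And>i j. i < n \<Longrightarrow> j < n \<Longrightarrow> a i j - b i j \<in> I"
  shows "det (mat n n (\<lambda>(i, j). a i j)) - det (mat n n (\<lambda>(i, j). b i j)) \<in> I"
proof -
  let ?P = "{p. p permutes {0..<n}}"
  have prm: "p i < n" if "p permutes {0..<n}" "i < n" for p i
    using permutes_in_image[OF that(1), of i] that(2) by simp
  have d: "det (mat n n (\<lambda>(i, j). a i j)) = (\<Sum>p\<in>?P. signof p * (\<Prod>i = 0..<n. a i (p i)))" for a :: "nat \<Rightarrow> nat \<Rightarrow> 'a"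
    by (subst det_def'[of _ n]) (auto intro!: sum.cong prod.cong simp: prm)
  have sum: "sum f S \<in> I" if "\<And>i. i \<in> S \<Longrightarrow> f i \<in> I" for f and S :: "(nat \<Rightarrow> nat) set"
    using that by (induction S rule: infinite_finite_induct) (auto intro: I)
  have s: "(signof p :: 'a) \<in> ring_of_integers" for p :: "nat \<Rightarrow> nat"
    by (cases p rule: sign_cases) auto
  show ?thesis
    unfolding d sum_subtractf[symmetric] right_diff_distrib[symmetric]
    by (intro sum I(3) s prod_cong_ideal[OF I]) (auto intro!: a b ab simp: prm)
qed

context
  assumes nf: "number_field TYPE('k::field_char_0)"
begin

text \<open>Let \<open>P\<close> be the matrix of squaring on the basis, \<open>p\<close> its
  determinant, and \<open>v\<close> the determinant of the embeddings, so
  \<open>v\<^sup>2 = D\<close>. The embeddings of the squared basis have determinant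
  \<open>v * p\<close>, which is also congruent to \<open>v\<^sup>2 = D\<close> modulo 2. Squaring
  shows that \<open>D * p\<^sup>2\<close> and \<open>D\<^sup>2\<close> have the same parity; hence
  \<open>p\<close> is odd and \<open>P\<close> is invertible modulo 2.\<close>

theorem squares_mod_2_if_odd_discriminant:
  fixes x :: 'k and b :: "nat \<Rightarrow> 'k"
  assumes F: "integral_frame d e b D" and odd: "odd D" and x: "x \<in> ring_of_integers"
  shows "\<exists>s\<in>ring_of_integers. \<exists>w\<in>ring_of_integers. x = s\<^sup>2 + 2 * w"
proof -
  note e = integral_frameD(1)[OF F] and bO = integral_frameD(2)[OF F] and sp = integral_frameD(3)[OF F]
    and D = integral_frameD(4)[OF F]
  have ee: "e i \<in> embeddings" if "i < d" for i using bij_betwE[OF e] that by simp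
  have "\<forall>j. \<exists>q::nat \<Rightarrow> int. j < d \<longrightarrow> (b j)\<^sup>2 = (\<Sum>l<d. of_int (q l) * b l)"
    using sp[OF roi_power[OF bO]] by blast
  from choice[OF this] obtain P' :: "nat \<Rightarrow> nat \<Rightarrow> int"
    where P': "\<And>j. j < d \<Longrightarrow> (b j)\<^sup>2 = (\<Sum>l<d. of_int (P' j l) * b l)" by blast
  define P where "P l j = P' j l" for l j
  define p where "p = det (mat d d (\<lambda>(i, j). P i j))"
  let ?v = "det (emb_mat d e b)"
  have vO: "?v \<in> ring_of_integers"
    by (rule roi_det[of _ d]) (simp_all add: embeddings_algebraic_int bO ee)
  have "det (emb_mat d e (\<lambda>j. (b j)\<^sup>2)) = ?v * of_int p"
    unfolding p_def by (rule emb_mat_lincomb) (use ee P' in \<open>auto simp: P_def\<close>)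
  moreover have "emb_mat d e (\<lambda>j. (b j)\<^sup>2) = mat d d (\<lambda>(i, j). (e i (b j))\<^sup>2)"
    by (intro eq_matI) (auto simp: embeddings_simps ee)
  moreover obtain w where w: "w \<in> ring_of_integers"
    "det (mat d d (\<lambda>(i, j). (e i (b j))\<^sup>2)) = (det (mat d d (\<lambda>(i, j). e i (b j))))\<^sup>2 + 2 * w"
    using det_square_mod_2[of d "\<lambda>i j. e i (b j)"] bO ee embeddings_algebraic_int by blast
  ultimately have "?v * of_int p = of_int D + 2 * w" using D(1) by simp
  \<comment> \<open>The determinant of the embeddings need not be rational; only after squaring does
    the congruence lead to rational integers.\<close>
  hence "(?v * of_int p)\<^sup>2 = (of_int D + 2 * w)\<^sup>2" by (rule arg_cong)
  moreover have "(?v * of_int p)\<^sup>2 = of_int D * (of_int p)\<^sup>2" by (simp only: power_mult_distrib D)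
  moreover have "(of_int D + 2 * w)\<^sup>2 = of_int D ^ 2 + 4 * of_int D * w + 4 * w\<^sup>2"
    by (simp add: power2_sum power_mult_distrib)
  ultimately have "of_int D * (of_int p)\<^sup>2 = of_int D ^ 2 + 4 * of_int D * w + 4 * w\<^sup>2" by metis
  hence eq: "of_int (D * p\<^sup>2 - D\<^sup>2) = 2 * (2 * of_int D * w + 2 * w\<^sup>2)" by simp
  have "2 * of_int D * w + 2 * w\<^sup>2 = of_int (D * p\<^sup>2 - D\<^sup>2) / 2" unfolding eq by simp
  also have "\<dots> \<in> \<rat>" by auto
  finally have "2 * of_int D * w + 2 * w\<^sup>2 \<in> \<int>"
    using w(1) by (intro roi_Rats) (auto intro!: roi_add roi_mult roi_power)
  then obtain u where "2 * of_int D * w + 2 * w\<^sup>2 = of_int u" by (auto elim: Ints_cases)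
  hence "(of_int (D * p\<^sup>2 - D\<^sup>2) :: complex) = of_int (2 * u)" using eq by simp
  hence "D * p\<^sup>2 - D\<^sup>2 = 2 * u" by (simp only: of_int_eq_iff)
  hence "even (D * p\<^sup>2 - D\<^sup>2)" by simp
  hence oddp: "odd p" using odd by auto
  obtain xs :: "nat \<Rightarrow> int" where xs: "x = (\<Sum>j<d. of_int (xs j) * b j)" using sp[OF x] by blast
  obtain Q where Q: "\<And>i l. i < d \<Longrightarrow> l < d \<Longrightarrow> (\<Sum>j<d. P i j * Q j l) = (if i = l then p else 0)"
    using det_adjugate[of d P] unfolding p_def by blast
  \<comment> \<open>With \<open>Q\<close> the adjugate of \<open>P\<close>, the vector
    \<open>y\<close> solves \<open>P y = p xs\<close>, which is \<open>xs\<close> modulo 2.\<close>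
  define y where "y j = (\<Sum>l<d. Q j l * xs l)" for j
  have Py: "(\<Sum>j<d. P i j * y j) = p * xs i" if i: "i < d" for i
  proof -
    have "(\<Sum>j<d. P i j * y j) = (\<Sum>l<d. (\<Sum>j<d. P i j * Q j l) * xs l)"
      unfolding y_def sum_distrib_left sum_distrib_right by (subst sum.swap) (simp add: mult.assoc)
    also have "\<dots> = (\<Sum>l<d. if i = l then p * xs l else 0)" using i by (intro sum.cong refl) (simp add: Q)
    finally show ?thesis using i by (simp add: sum.delta)
  qed
  define s where "s = (\<Sum>j<d. of_int (y j) * b j)"
  have sO: "s \<in> ring_of_integers" unfolding s_def by (intro roi_sum roi_mult) (auto simp: bO)
  obtain w1 where w1: "w1 \<in> ring_of_integers" "s\<^sup>2 = (\<Sum>j<d. (of_int (y j) * b j)\<^sup>2) + 2 * w1"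
    using square_sum_mod_2[of "{..<d}" "\<lambda>j. of_int (y j) * b j"] bO unfolding s_def by (auto intro!: roi_mult)
  \<comment> \<open>Integer coordinates equal their squares modulo 2, so modulo 2 the square of
    \<open>s\<close> depends on \<open>y\<close> linearly, through \<open>P\<close>.\<close>
  have "\<exists>z. (y j)\<^sup>2 = y j + 2 * z" for j
  proof -
    have "even ((y j)\<^sup>2 - y j)" by simp
    then obtain z where "(y j)\<^sup>2 - y j = 2 * z" by blast
    hence "(y j)\<^sup>2 = y j + 2 * z" by linarith
    thus ?thesis by blast
  qed
  then obtain z where z: "\<And>j. (y j)\<^sup>2 = y j + 2 * z j" by metis
  define w2 where "w2 = (\<Sum>j<d. of_int (z j) * (b j)\<^sup>2)"
  have w2: "w2 \<in> ring_of_integers" unfolding w2_def by (intro roi_sum roi_mult roi_power) (auto simp: bO)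
  have "(\<Sum>j<d. (of_int (y j) * b j)\<^sup>2) = (\<Sum>j<d. of_int ((y j)\<^sup>2) * (b j)\<^sup>2)"
    by (simp add: power_mult_distrib)
  also have "\<dots> = (\<Sum>j<d. of_int (y j) * (b j)\<^sup>2) + 2 * w2"
    unfolding w2_def z sum_distrib_left sum.distrib[symmetric] by (intro sum.cong refl) (simp add: algebra_simps)
  also have "(\<Sum>j<d. of_int (y j) * (b j)\<^sup>2) = (\<Sum>j<d. \<Sum>l<d. of_int (P l j * y j) * b l)"
    by (intro sum.cong refl) (simp add: P' P_def sum_distrib_left mult_ac)
  also have "\<dots> = (\<Sum>l<d. of_int (\<Sum>j<d. P l j * y j) * b l)"
    by (subst sum.swap) (simp add: sum_distrib_right)
  also have "\<dots> = (\<Sum>l<d. of_int p * (of_int (xs l) * b l))"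
    by (intro sum.cong refl) (simp add: Py)
  also have "\<dots> = of_int p * x" by (simp add: xs sum_distrib_left)
  finally have s2: "s\<^sup>2 = of_int p * x + 2 * w2 + 2 * w1" using w1(2) by simp
  obtain h where h: "p = 2 * h + 1" using oddp by (elim oddE)
  have "x = s\<^sup>2 + 2 * (- of_int h * x - w2 - w1)" unfolding s2 h by (simp add: algebra_simps)
  moreover have "- of_int h * x - w2 - w1 \<in> ring_of_integers"
    using w1(1) w2 x by (auto intro!: roi_diff roi_mult roi_uminus)
  ultimately show ?thesis using sO by blast
qed

text \<open>The ideal of algebraic integers generated by \<open>2\<close> and all \<open>e\<^sub>i x - e\<^sub>j x\<close> is the unit ideal.
  Writing \<open>x = s\<^sup>2 + 2 w\<close> shows that the ideal \<open>J\<close> of all \<open>e\<^sub>i x - e\<^sub>j x\<close> satisfies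
  \<open>J \<subseteq> (J + (2)) J\<close>, and \<open>J\<close> is finitely generated and nonzero, so that Nakayama's lemma applies.\<close>

lemma embeddings_separated_mod_2:
  fixes b :: "nat \<Rightarrow> 'k"
  assumes F: "integral_frame d e b D"
    and sq: "\<And>x::'k. x \<in> ring_of_integers \<Longrightarrow> \<exists>s\<in>ring_of_integers. \<exists>w\<in>ring_of_integers. x = s\<^sup>2 + 2 * w"
    and ij: "i < d" "j < d" "i \<noteq> j"
  shows "\<exists>c c0. (\<forall>l. c l \<in> ring_of_integers) \<and> c0 \<in> ring_of_integers \<and>
    (\<Sum>l<d. c l * (e i (b l) - e j (b l))) = 1 + 2 * c0"
proof -
  note e = integral_frameD(1)[OF F] and bO = integral_frameD(2)[OF F] and sp = integral_frameD(3)[OF F]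
    and D = integral_frameD(4)[OF F]
  have ei: "e i \<in> embeddings" and ej: "e j \<in> embeddings" using bij_betwE[OF e] ij by simp_all
  define g where "g l = e i (b l) - e j (b l)" for l
  define I where "I = {z. \<exists>c c0. (\<forall>l. c l \<in> ring_of_integers) \<and> c0 \<in> ring_of_integers \<and> z = (\<Sum>l<d. c l * g l) + 2 * c0}"
  have I0: "0 \<in> I" unfolding I_def by (intro CollectI exI[of _ "\<lambda>_. 0"] exI[of _ 0]) simp
  have Iadd: "x + y \<in> I" if xy: "x \<in> I" "y \<in> I" for x y
  proof -
    obtain c c0 where 1: "\<forall>l. c l \<in> ring_of_integers" "c0 \<in> ring_of_integers" "x = (\<Sum>l<d. c l * g l) + 2 * c0"
      using xy(1) unfolding I_def by blast
    obtain c' c0' where 2: "\<forall>l. c' l \<in> ring_of_integers" "c0' \<in> ring_of_integers" "y = (\<Sum>l<d. c' l * g l) + 2 * c0'"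
      using xy(2) unfolding I_def by blast
    have "x + y = (\<Sum>l<d. (c l + c' l) * g l) + 2 * (c0 + c0')"
      using 1 2 by (simp add: sum.distrib algebra_simps)
    thus ?thesis unfolding I_def using 1 2 by (intro CollectI exI[of _ "\<lambda>l. c l + c' l"] exI[of _ "c0 + c0'"]) auto
  qed
  have Imult: "r * x \<in> I" if xy: "x \<in> I" "r \<in> ring_of_integers" for x r
  proof -
    obtain c c0 where 1: "\<forall>l. c l \<in> ring_of_integers" "c0 \<in> ring_of_integers" "x = (\<Sum>l<d. c l * g l) + 2 * c0"
      using xy(1) unfolding I_def by blast
    have "r * x = (\<Sum>l<d. (r * c l) * g l) + 2 * (r * c0)"
      using 1 by (simp add: sum_distrib_left algebra_simps)
    thus ?thesis unfolding I_def using 1 xy(2) by (intro CollectI exI[of _ "\<lambda>l. r * c l"] exI[of _ "r * c0"]) auto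
  qed
  have I2: "2 * x \<in> I" if "x \<in> ring_of_integers" for x
    using that unfolding I_def by (intro CollectI exI[of _ "\<lambda>_. 0"] exI[of _ x]) simp
  have gO: "g l \<in> ring_of_integers" if "l < d" for l
    unfolding g_def using that
    by (intro roi_diff embeddings_algebraic_int[OF ei] embeddings_algebraic_int[OF ej] bO)
  have diff: "\<exists>q::nat \<Rightarrow> int. e i x - e j x = (\<Sum>l<d. of_int (q l) * g l)" if x: "x \<in> ring_of_integers" for x
  proof -
    obtain q :: "nat \<Rightarrow> int" where q: "x = (\<Sum>l<d. of_int (q l) * b l)" using sp[OF x] by blast
    have "e i x - e j x = (\<Sum>l<d. of_int (q l) * g l)"
      unfolding q g_def using ei ej by (simp add: embeddings_simps right_diff_distrib sum_subtractf)
    thus ?thesis by blast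
  qed
  have diffI: "e i x - e j x \<in> I" if x: "x \<in> ring_of_integers" for x
  proof -
    obtain q :: "nat \<Rightarrow> int" where "e i x - e j x = (\<Sum>l<d. of_int (q l) * g l)" using diff[OF x] by blast
    thus ?thesis unfolding I_def by (intro CollectI exI[of _ "\<lambda>l. of_int (q l)"] exI[of _ 0]) simp
  qed
  have "\<exists>\<Theta>. (\<forall>m. \<Theta> m \<in> I \<and> \<Theta> m \<in> ring_of_integers) \<and> g l = (\<Sum>m<d. \<Theta> m * g m)" if l: "l < d" for l
  proof -
    obtain s w where s: "s \<in> ring_of_integers" and w: "w \<in> ring_of_integers" and bl: "b l = s\<^sup>2 + 2 * w"
      using sq[OF bO[OF l]] by blast
    obtain p :: "nat \<Rightarrow> int" where p: "e i s - e j s = (\<Sum>l<d. of_int (p l) * g l)" using diff[OF s] by blast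
    obtain r :: "nat \<Rightarrow> int" where r: "e i w - e j w = (\<Sum>l<d. of_int (r l) * g l)" using diff[OF w] by blast
    \<comment> \<open>In \<open>(e i s)\<^sup>2 - (e j s)\<^sup>2 = (e i s - e j s) * t\<close> the
      factor \<open>t\<close> lies in \<open>I\<close>, being a difference plus
      \<open>2 * e j s\<close>. This is what puts the coefficients \<open>\<Theta>\<close> of every
      generator into \<open>I\<close>.\<close>
    define t where "t = e i s + e j s"
    have tO: "t \<in> ring_of_integers" unfolding t_def
      by (intro roi_add embeddings_algebraic_int[OF ei] embeddings_algebraic_int[OF ej] s)
    have "t = (e i s - e j s) + 2 * e j s" by (simp add: t_def)
    hence tI: "t \<in> I" using diffI[OF s] I2[of "e j s"] Iadd embeddings_algebraic_int[OF ej s] by metis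
    let ?\<Theta> = "\<lambda>m. of_int (p m) * t + 2 * of_int (r m)"
    have "g l = (e i s)\<^sup>2 - (e j s)\<^sup>2 + 2 * (e i w - e j w)"
      unfolding g_def bl using ei ej by (simp add: embeddings_simps algebra_simps)
    also have "(e i s)\<^sup>2 - (e j s)\<^sup>2 = (e i s - e j s) * t"
      by (simp add: t_def power2_eq_square algebra_simps)
    also have "\<dots> + 2 * (e i w - e j w) = (\<Sum>m<d. ?\<Theta> m * g m)"
      unfolding p r by (simp add: sum_distrib_left sum_distrib_right sum.distrib algebra_simps)
    finally have "g l = (\<Sum>m<d. ?\<Theta> m * g m)" .
    moreover have "?\<Theta> m \<in> I" "?\<Theta> m \<in> ring_of_integers" for m
      by (auto intro!: Iadd Imult tI I2 roi_add roi_mult tO)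
    ultimately show ?thesis by (intro exI[of _ ?\<Theta>]) blast
  qed
  hence "\<forall>l. \<exists>\<Theta>. l < d \<longrightarrow> (\<forall>m. \<Theta> m \<in> I \<and> \<Theta> m \<in> ring_of_integers) \<and> g l = (\<Sum>m<d. \<Theta> m * g m)" by blast
  from choice[OF this] obtain \<Theta> where \<Theta>: "\<And>l m. l < d \<Longrightarrow> \<Theta> l m \<in> I" "\<And>l m. l < d \<Longrightarrow> \<Theta> l m \<in> ring_of_integers"
    "\<And>l. l < d \<Longrightarrow> g l = (\<Sum>m<d. \<Theta> l m * g m)" by blast
  \<comment> \<open>Determinant trick: \<open>1 - \<Theta>\<close> annihilates the nonzero vector
    \<open>g\<close>, so its determinant vanishes; modulo \<open>I\<close> the same determinant is
    1.\<close>
  define A where "A l m = (if l = m then 1 else 0) - \<Theta> l m" for l m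
  define \<delta> where "\<delta> = det (mat d d (\<lambda>(l, m). A l m))"
  have Ag: "(\<Sum>m<d. A l m * g m) = 0" if l: "l < d" for l
  proof -
    have "(\<Sum>m<d. A l m * g m) = (\<Sum>m<d. (if l = m then g m else 0) - \<Theta> l m * g m)"
      by (intro sum.cong refl) (simp add: A_def algebra_simps)
    thus ?thesis using l \<Theta>(3)[OF l] by (simp add: sum_subtractf sum.delta)
  qed
  have "\<exists>m<d. g m \<noteq> 0"
  proof (rule ccontr)
    assume "\<not> (\<exists>m<d. g m \<noteq> 0)"
    hence zero: "e i x = e j x" if "x \<in> ring_of_integers" for x using diff[OF that] by auto
    have "e i x = e j x" for x
    proof -
      obtain N :: int where N: "N > 0" "of_int N * x \<in> ring_of_integers" using integer_multiple[OF nf, of x] by blast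
      have "e i (of_int N * x) = e j (of_int N * x)" by (rule zero[OF N(2)])
      thus ?thesis using N(1) ei ej by (simp add: embeddings_simps)
    qed
    hence "e i = e j" by blast
    thus False using e ij by (auto simp: bij_betw_def inj_on_def)
  qed
  then obtain m where m: "m < d" "g m \<noteq> 0" by blast
  obtain A' where A': "\<And>i l. i < d \<Longrightarrow> l < d \<Longrightarrow> (\<Sum>j<d. A' i j * A j l) = (if i = l then \<delta> else 0)"
    using det_adjugate[of d A] unfolding \<delta>_def by blast
  have "0 = (\<Sum>l<d. A' m l * (\<Sum>k<d. A l k * g k))" by (simp add: Ag)
  also have "\<dots> = (\<Sum>k<d. (\<Sum>l<d. A' m l * A l k) * g k)"
    unfolding sum_distrib_left sum_distrib_right by (subst sum.swap) (simp add: mult.assoc)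
  also have "\<dots> = (\<Sum>k<d. if m = k then \<delta> * g k else 0)" using m by (intro sum.cong refl) (simp add: A')
  also have "\<dots> = \<delta> * g m" using m by (simp add: sum.delta)
  finally have "\<delta> = 0" using m by simp
  have "det (mat d d (\<lambda>(i, j). if i = j then 1 else 0 :: complex)) = det (1\<^sub>m d)"
    by (rule arg_cong[of _ _ det]) (intro eq_matI, auto)
  moreover have "det (mat d d (\<lambda>(i, j). if i = j then 1 else 0)) - \<delta> \<in> I"
    unfolding \<delta>_def
  proof (rule det_cong_ideal[OF I0 Iadd Imult])
    show "(if i = j then 1 else 0) - A i j \<in> I" if "i < d" for i j using \<Theta>(1)[OF that] by (simp add: A_def)
    show "A i j \<in> ring_of_integers" if "i < d" for i j using \<Theta>(2)[OF that] by (auto simp: A_def intro!: roi_diff roi_uminus)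
  qed auto
  ultimately have "1 \<in> I" using \<open>\<delta> = 0\<close> by simp
  then obtain c c0 where "\<forall>l. c l \<in> ring_of_integers" "c0 \<in> ring_of_integers" "1 = (\<Sum>l<d. c l * g l) + 2 * c0"
    unfolding I_def by blast
  thus ?thesis unfolding g_def
    by (intro exI[of _ c] exI[of _ "- c0"]) (auto intro!: roi_uminus simp: algebra_simps)
qed

text \<open>The separating elements interpolate: there are combinations \<open>H i\<close> of the
  columns of the embedding matrix that are 1 modulo 2 at \<open>e i\<close> and exactly 0 at the
  other embeddings. So the embedding matrix is invertible modulo 2 over the algebraic integers, and
  its determinant is a unit modulo 2.\<close>

theorem odd_discriminant_if_squares_mod_2:
  fixes b :: "nat \<Rightarrow> 'k"
  assumes F: "integral_frame d e b D"
    and sq: "\<And>x::'k. x \<in> ring_of_integers \<Longrightarrow> \<exists>s\<in>ring_of_integers. \<exists>w\<in>ring_of_integers. x = s\<^sup>2 + 2 * w"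
  shows "odd D"
proof
  assume even: "even D"
  note e = integral_frameD(1)[OF F] and bO = integral_frameD(2)[OF F] and sp = integral_frameD(3)[OF F]
    and D = integral_frameD(4)[OF F]
  have ee: "e i \<in> embeddings" if "i < d" for i using bij_betwE[OF e] that by simp
  have eO: "e i (b j) \<in> ring_of_integers" if "i < d" "j < d" for i j
    by (rule embeddings_algebraic_int[OF ee[OF that(1)] bO[OF that(2)]])
  \<comment> \<open>\<open>R f\<close> says that \<open>f\<close> is a combination of the columns of
    the embedding matrix over the algebraic integers. These \<open>f\<close> are the image of the
    tensor product of the integers of the field with all algebraic integers, hence closed under
    multiplication; multiplying by one column at a time builds the products
    \<open>H\<close>.\<close>
  define R where "R f \<longleftrightarrow> (\<exists>\<mu>. (\<forall>k. \<mu> k \<in> ring_of_integers) \<and> (\<forall>l<d. f l = (\<Sum>k<d. \<mu> k * e l (b k))))" for f :: "nat \<Rightarrow> complex"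
  have Relem: "R (\<lambda>l. e l x)" if x: "x \<in> ring_of_integers" for x
  proof -
    obtain q :: "nat \<Rightarrow> int" where q: "x = (\<Sum>k<d. of_int (q k) * b k)" using sp[OF x] by blast
    show ?thesis unfolding R_def q
      by (intro exI[of _ "\<lambda>k. of_int (q k)"]) (auto simp: embeddings_simps ee)
  qed
  have Radd: "R (\<lambda>l. f l + g l)" if fg: "R f" "R g" for f g
  proof -
    obtain \<mu> where 1: "\<forall>k. \<mu> k \<in> ring_of_integers" "\<forall>l<d. f l = (\<Sum>k<d. \<mu> k * e l (b k))" using fg(1) unfolding R_def by blast
    obtain \<nu> where 2: "\<forall>k. \<nu> k \<in> ring_of_integers" "\<forall>l<d. g l = (\<Sum>k<d. \<nu> k * e l (b k))" using fg(2) unfolding R_def by blast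
    show ?thesis unfolding R_def
      by (intro exI[of _ "\<lambda>k. \<mu> k + \<nu> k"]) (use 1 2 in \<open>auto simp: sum.distrib algebra_simps\<close>)
  qed
  have Rsmult: "R (\<lambda>l. c * f l)" if fg: "R f" "c \<in> ring_of_integers" for f c
  proof -
    obtain \<mu> where 1: "\<forall>k. \<mu> k \<in> ring_of_integers" "\<forall>l<d. f l = (\<Sum>k<d. \<mu> k * e l (b k))" using fg(1) unfolding R_def by blast
    show ?thesis unfolding R_def
      by (intro exI[of _ "\<lambda>k. c * \<mu> k"]) (use 1 fg(2) in \<open>auto simp: sum_distrib_left mult.assoc\<close>)
  qed
  have Rsum: "R (\<lambda>l. \<Sum>i\<in>S. f i l)" if "\<And>i. i \<in> S \<Longrightarrow> R (f i)" for f and S :: "nat set"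
    using that
  proof (induction S rule: infinite_finite_induct)
    case (insert x S)
    thus ?case using Radd[of "f x" "\<lambda>l. \<Sum>i\<in>S. f i l"] by simp
  qed (auto simp: R_def intro!: exI[of _ "\<lambda>_. 0"])
  have Rmult: "R (\<lambda>l. f l * e l (b m))" if f: "R f" and m: "m < d" for f m
  proof -
    obtain \<mu> where 1: "\<forall>k. \<mu> k \<in> ring_of_integers" "\<forall>l<d. f l = (\<Sum>k<d. \<mu> k * e l (b k))" using f unfolding R_def by blast
    have "R (\<lambda>l. \<Sum>k<d. \<mu> k * e l (b k * b m))"
      using 1(1) m by (intro Rsum Rsmult Relem) (auto intro!: roi_mult bO)
    moreover have "(\<Sum>k<d. \<mu> k * e l (b k * b m)) = f l * e l (b m)" if "l < d" for l
      using 1(2) that by (simp add: embeddings_simps ee sum_distrib_right mult.assoc)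
    ultimately show ?thesis unfolding R_def by simp
  qed
  have "\<forall>p. \<exists>r. case p of (i, j) \<Rightarrow> i < d \<and> j < d \<and> i \<noteq> j \<longrightarrow>
      (\<forall>l. fst r l \<in> ring_of_integers) \<and> snd r \<in> ring_of_integers \<and>
      (\<Sum>l<d. fst r l * (e i (b l) - e j (b l))) = 1 + 2 * snd r"
    using embeddings_separated_mod_2[OF F sq] by fastforce
  from choice[OF this] obtain r where r: "\<And>i j. i < d \<and> j < d \<and> i \<noteq> j \<longrightarrow>
      (\<forall>l. fst (r (i, j)) l \<in> ring_of_integers) \<and> snd (r (i, j)) \<in> ring_of_integers \<and>
      (\<Sum>l<d. fst (r (i, j)) l * (e i (b l) - e j (b l))) = 1 + 2 * snd (r (i, j))"
    by fast
  define c where "c i j = fst (r (i, j))" for i j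
  define c0 where "c0 i j = snd (r (i, j))" for i j
  have c: "\<And>i j l. i < d \<Longrightarrow> j < d \<Longrightarrow> i \<noteq> j \<Longrightarrow> c i j l \<in> ring_of_integers"
    "\<And>i j. i < d \<Longrightarrow> j < d \<Longrightarrow> i \<noteq> j \<Longrightarrow> c0 i j \<in> ring_of_integers"
    "\<And>i j. i < d \<Longrightarrow> j < d \<Longrightarrow> i \<noteq> j \<Longrightarrow> (\<Sum>l<d. c i j l * (e i (b l) - e j (b l))) = 1 + 2 * c0 i j"
    using r by (simp_all add: c_def c0_def)
  \<comment> \<open>Vanishes at \<open>l = j\<close> and equals \<open>1 + 2 * c0 i j\<close> at
    \<open>l = i\<close>.\<close>
  define G where "G i j l = (\<Sum>m<d. c i j m * (e l (b m) - e j (b m)))" for i j l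
  have RG: "R (\<lambda>l. \<Prod>j\<in>S. G i j l)" if "i < d" "finite S" "S \<subseteq> {..<d} - {i}" for i S
    using that(2,3)
  proof (induction S rule: finite_induct)
    case empty
    show ?case using Relem[of 1] by (simp add: R_def embeddings_simps ee)
  next
    case (insert j S)
    define f where "f l = (\<Prod>j\<in>S. G i j l)" for l
    have f: "R f" using insert by (simp add: f_def[abs_def])
    have j: "j < d" "i \<noteq> j" using insert by auto
    have "R (\<lambda>l. \<Sum>m<d. c i j m * (f l * e l (b m) + - e j (b m) * f l))"
      using c(1)[OF that(1) j] j eO by (intro Rsum Rsmult Radd Rmult f) (auto intro!: roi_uminus)
    moreover have "(\<Sum>m<d. c i j m * (f l * e l (b m) + - e j (b m) * f l)) = G i j l * f l" for l
      unfolding G_def sum_distrib_right by (intro sum.cong refl) (simp add: algebra_simps)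
    ultimately show ?case using insert.hyps by (simp add: f_def)
  qed
  define H where "H i l = (\<Prod>j\<in>{..<d} - {i}. G i j l)" for i l
  have "R (H i)" if "i < d" for i
    using RG[OF that _ order_refl] by (simp add: H_def[abs_def])
  hence "\<forall>i. \<exists>\<mu>. i < d \<longrightarrow> (\<forall>k. \<mu> k \<in> ring_of_integers) \<and> (\<forall>l<d. H i l = (\<Sum>k<d. \<mu> k * e l (b k)))"
    unfolding R_def by blast
  from choice[OF this] obtain \<mu> where \<mu>: "\<And>i k. i < d \<Longrightarrow> \<mu> i k \<in> ring_of_integers"
    "\<And>i l. i < d \<Longrightarrow> l < d \<Longrightarrow> H i l = (\<Sum>k<d. \<mu> i k * e l (b k))" by blast
  have H0: "H i l = 0" if "i < d" "l < d" "l \<noteq> i" for i l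
    unfolding H_def using that by (intro prod_zero bexI[of _ l]) (auto simp: G_def)
  define E :: "complex set" where "E = {2 * w |w. w \<in> ring_of_integers}"
  have E1: "0 \<in> E" by (auto simp: E_def intro!: exI[of _ 0])
  have E2: "x + y \<in> E" if xy: "x \<in> E" "y \<in> E" for x y
  proof -
    obtain v w where "x = 2 * v" "v \<in> ring_of_integers" "y = 2 * w" "w \<in> ring_of_integers"
      using xy unfolding E_def by blast
    thus ?thesis unfolding E_def by (intro CollectI exI[of _ "v + w"]) auto
  qed
  have E3: "c * x \<in> E" if xy: "x \<in> E" "c \<in> ring_of_integers" for x c
  proof -
    obtain v where "x = 2 * v" "v \<in> ring_of_integers" using xy(1) unfolding E_def by blast
    thus ?thesis unfolding E_def using xy(2) by (intro CollectI exI[of _ "c * v"]) auto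
  qed
  note E = E1 E2 E3
  have H1: "H i i - 1 \<in> E" "H i i \<in> ring_of_integers" if i: "i < d" for i
  proof -
    have G1: "G i j i = 1 + 2 * c0 i j" "c0 i j \<in> ring_of_integers" if "j \<in> {..<d} - {i}" for j
      using that c(2,3)[OF i, of j] unfolding G_def by auto
    have "(\<Prod>j\<in>{..<d} - {i}. G i j i) - (\<Prod>j\<in>{..<d} - {i}. 1) \<in> E"
      by (rule prod_cong_ideal[OF E]) (auto simp: G1 E_def intro!: roi_add roi_mult)
    thus "H i i - 1 \<in> E" by (simp add: H_def)
    show "H i i \<in> ring_of_integers" unfolding H_def by (intro roi_prod) (auto simp: G1 intro!: roi_add roi_mult)
  qed
  have HO: "H i l \<in> ring_of_integers" if "i < d" "l < d" for i l
    using H0[OF that] H1(2)[OF that(1)] by (cases "l = i") auto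
  let ?M = "mat d d (\<lambda>(k, i). \<mu> i k)" and ?Dg = "mat d d (\<lambda>(l, i). H i l)"
  have "emb_mat d e b * ?M = ?Dg"
    using \<mu>(2) by (intro eq_matI) (auto simp: scalar_prod_def atLeast0LessThan mult.commute)
  hence "det (emb_mat d e b) * det ?M = det ?Dg" by (metis det_mult mat_carrier)
  moreover have "det ?Dg - det (mat d d (\<lambda>(l, i). if l = i then 1 else 0)) \<in> E"
    by (rule det_cong_ideal[OF E]) (use H0 H1 HO E(1) in \<open>auto split: if_splits\<close>)
  moreover have "det (mat d d (\<lambda>(i, j). if i = j then 1 else 0 :: complex)) = det (1\<^sub>m d)"
    by (rule arg_cong[of _ _ det]) (intro eq_matI, auto)
  ultimately have "det (emb_mat d e b) * det ?M - 1 \<in> E" by simp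
  then obtain w where w: "w \<in> ring_of_integers" "det (emb_mat d e b) * det ?M = 1 + 2 * w"
    unfolding E_def by (auto simp: diff_eq_eq add.commute)
  have MO: "det ?M \<in> ring_of_integers" by (rule roi_det[of _ d]) (auto simp: \<mu>)
  obtain D' where D': "D = 2 * D'" using even by blast
  \<comment> \<open>Squaring replaces the determinant of the embeddings by \<open>D\<close>; with
    \<open>D = 2 * D'\<close>, dividing by 2 makes one half integral.\<close>
  have "of_int D * (det ?M)\<^sup>2 = (1 + 2 * w)\<^sup>2" using w(2) D by (metis power_mult_distrib)
  hence "1 / 2 = of_int D' * (det ?M)\<^sup>2 - 2 * w - 2 * w\<^sup>2"
    by (simp add: D' power2_eq_square field_simps)
  also have "\<dots> \<in> ring_of_integers" using w(1) MO by (auto intro!: roi_diff roi_mult roi_power)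
  finally show False using half_notin_roi by blast
qed

end

section \<open>Sums of four integer squares\<close>

definition four_squares :: "int \<Rightarrow> bool" where
  "four_squares n \<longleftrightarrow> (\<exists>a b c d. n = a\<^sup>2 + b\<^sup>2 + c\<^sup>2 + d\<^sup>2)"

text \<open>Multiplicativity of the quaternion norm, one factor being conjugated. The signs make the
  last three terms vanish for \<open>y = x\<close>, so that in the descent they are divisible by
  \<open>m\<close> when \<open>y\<close> is congruent to \<open>x\<close>.\<close>

lemma euler_four_squares:
  fixes x1 x2 x3 x4 y1 y2 y3 y4 :: "'a::comm_ring_1"
  shows "(x1\<^sup>2 + x2\<^sup>2 + x3\<^sup>2 + x4\<^sup>2) * (y1\<^sup>2 + y2\<^sup>2 + y3\<^sup>2 + y4\<^sup>2) =
    (x1*y1 + x2*y2 + x3*y3 + x4*y4)\<^sup>2 + (x1*y2 - x2*y1 + x3*y4 - x4*y3)\<^sup>2 +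
    (x1*y3 - x3*y1 + x4*y2 - x2*y4)\<^sup>2 + (x1*y4 - x4*y1 + x2*y3 - x3*y2)\<^sup>2"
  by (simp add: power2_eq_square algebra_simps)

lemma four_squares_mult:
  assumes "four_squares m" "four_squares n"
  shows "four_squares (m * n)"
  using assms unfolding four_squares_def by (metis euler_four_squares)

text \<open>Pigeonhole: for arguments in \<open>{0..p div 2}\<close> the values
  \<open>a\<^sup>2\<close> and the values \<open>- 1 - b\<^sup>2\<close> are pairwise distinct
  modulo \<open>p\<close> within each family, and together they are \<open>p + 1\<close> in
  number.\<close>

lemma squares_mod_prime:
  fixes p :: int
  assumes p: "prime p" and odd: "odd p"
  obtains a b where "0 \<le> a" "a \<le> p div 2" "0 \<le> b" "b \<le> p div 2" "p dvd a\<^sup>2 + b\<^sup>2 + 1"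
proof -
  define h where "h = p div 2"
  have p2: "p = 2 * h + 1" and h: "h \<ge> 0" "p > 0"
    using odd prime_gt_0_int[OF p] by (auto simp: h_def)
  let ?A = "(\<lambda>a. a\<^sup>2 mod p) ` {0..h}"
  let ?B = "(\<lambda>b. (- 1 - b\<^sup>2) mod p) ` {0..h}"
  have dist: "a = b" if "a \<in> {0..h}" "b \<in> {0..h}" "p dvd a\<^sup>2 - b\<^sup>2" for a b
  proof -
    have "p dvd (a - b) * (a + b)"
      using that(3) by (simp add: power2_eq_square algebra_simps)
    hence "p dvd a - b \<or> p dvd a + b"
      using p by (simp add: prime_dvd_mult_iff)
    moreover have "\<bar>a - b\<bar> < p" "0 \<le> a + b" "a + b < p"
      using that p2 by auto
    ultimately show ?thesis
      using that by (smt (verit) zdvd_not_zless atLeastAtMost_iff dvd_minus_iff)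
  qed
  have iA: "inj_on (\<lambda>a. a\<^sup>2 mod p) {0..h}"
    by (intro inj_onI dist) (auto simp: mod_eq_dvd_iff)
  have iB: "inj_on (\<lambda>b. (- 1 - b\<^sup>2) mod p) {0..h}"
  proof (intro inj_onI)
    fix a b assume "a \<in> {0..h}" "b \<in> {0..h}" "(- 1 - a\<^sup>2) mod p = (- 1 - b\<^sup>2) mod p"
    thus "a = b"
      using dist[of b a] by (auto simp: mod_eq_dvd_iff)
  qed
  have "?A \<inter> ?B \<noteq> {}"
  proof
    assume "?A \<inter> ?B = {}"
    hence "card (?A \<union> ?B) = card ?A + card ?B"
      by (intro card_Un_disjoint) auto
    also have "\<dots> = nat (h + 1) + nat (h + 1)"
      by (simp only: card_image[OF iA] card_image[OF iB]) simp
    finally have 1: "card (?A \<union> ?B) = nat (h + 1) + nat (h + 1)" .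
    have "?A \<union> ?B \<subseteq> {0..<p}"
      using h by auto
    hence "card (?A \<union> ?B) \<le> card {0..<p}"
      by (intro card_mono) auto
    thus False
      using 1 p2 h by simp
  qed
  then obtain a b where ab: "a \<in> {0..h}" "b \<in> {0..h}" "a\<^sup>2 mod p = (- 1 - b\<^sup>2) mod p"
    by blast
  from ab(3) have "p dvd a\<^sup>2 - (- 1 - b\<^sup>2)"
    by (simp add: mod_eq_dvd_iff)
  hence "p dvd a\<^sup>2 + b\<^sup>2 + 1"
    by (simp add: algebra_simps)
  thus thesis
    using ab by (intro that[of a b]) (auto simp: h_def)
qed

lemma centered_residue:
  fixes x m :: int
  assumes "m > 0"
  obtains y where "m dvd x - y" "2 * \<bar>y\<bar> \<le> m"
proof
  let ?y = "(x + m div 2) mod m - m div 2"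
  have "x - ?y = (x + m div 2) - (x + m div 2) mod m"
    by simp
  thus "m dvd x - ?y"
    by (metis dvd_minus_mod)
  have "0 \<le> (x + m div 2) mod m" "(x + m div 2) mod m < m"
    using assms by auto
  moreover have "2 * (m div 2) \<le> m" "m \<le> 2 * (m div 2) + 1"
    by presburger+
  ultimately show "2 * \<bar>?y\<bar> \<le> m"
    by (simp add: abs_if)
qed

text \<open>Descent on the least positive \<open>m\<close> for which \<open>m * p\<close> is a sum
  of four squares, which is less than \<open>p\<close>. If it exceeds 1, centred residues of the
  four terms have square sum \<open>m * r\<close> with \<open>0 < r < m\<close>, and the four square
  identity divided by \<open>m\<^sup>2\<close> represents \<open>r * p\<close>.\<close>

lemma four_squares_prime:
  fixes p :: int
  assumes p: "prime p"
  shows "four_squares p"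
proof (cases "odd p")
  case False
  hence "p = 2"
    using primes_dvd_imp_eq[of 2 p] p by simp
  also have "(2::int) = 1\<^sup>2 + 1\<^sup>2 + 0\<^sup>2 + 0\<^sup>2"
    by simp
  finally show ?thesis
    unfolding four_squares_def by blast
next
  case True
  have p0: "p > 0" using prime_gt_0_int[OF p] .
  define P where "P m \<longleftrightarrow> m > 0 \<and> four_squares (int m * p)" for m :: nat
  obtain a b where ab: "0 \<le> a" "a \<le> p div 2" "0 \<le> b" "b \<le> p div 2" "p dvd a\<^sup>2 + b\<^sup>2 + 1"
    using squares_mod_prime[OF p True] .
  from ab(5) obtain k where k: "a\<^sup>2 + b\<^sup>2 + 1 = k * p" by (metis dvd_def mult.commute)
  have "a\<^sup>2 \<le> (p div 2)\<^sup>2" "b\<^sup>2 \<le> (p div 2)\<^sup>2"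
    using ab by (auto intro: power_mono)
  moreover have "p\<^sup>2 = 4 * (p div 2)\<^sup>2 + 4 * (p div 2) + 1"
  proof -
    have "p = 2 * (p div 2) + 1" using True by simp
    hence "p\<^sup>2 = (2 * (p div 2) + 1)\<^sup>2" by (rule arg_cong)
    also have "\<dots> = 4 * (p div 2)\<^sup>2 + 4 * (p div 2) + 1" by (simp add: power2_sum power_mult_distrib)
    finally show ?thesis .
  qed
  moreover have "p div 2 \<ge> 1" using prime_ge_2_int[OF p] by linarith
  ultimately have "k * p < p\<^sup>2" using k zero_le_power2[of "p div 2"] by linarith
  hence "k * p < p * p" by (simp only: power2_eq_square)
  hence kp: "k < p" using p0 by simp
  have k0: "k > 0"
    using k p0 by (smt (verit) zero_le_power2 mult_nonpos_nonneg)
  have Pk: "P (nat k)"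
    unfolding P_def four_squares_def
  proof
    show "\<exists>a b c d. int (nat k) * p = a\<^sup>2 + b\<^sup>2 + c\<^sup>2 + d\<^sup>2"
      using k k0 by (intro exI[of _ a] exI[of _ b] exI[of _ 1] exI[of _ 0]) simp
  qed (use k0 in simp)
  define n where "n = (LEAST m. P m)"
  have Pn: "P n" unfolding n_def using Pk by (rule LeastI)
  have min: "\<not> P m" if "m < n" for m
    using that unfolding n_def by (rule not_less_Least)
  have "n \<le> nat k"
    unfolding n_def using Pk by (rule Least_le)
  define m where "m = int n"
  have m: "m > 0" "m < p" using Pn \<open>n \<le> nat k\<close> kp k0 by (auto simp: m_def P_def)
  show ?thesis
  proof (cases "m = 1")
    case True
    thus ?thesis using Pn by (simp add: P_def m_def)
  next
    case False
    have nsq: "\<not> m\<^sup>2 dvd m * p"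
    proof
      assume "m\<^sup>2 dvd m * p"
      hence "m dvd p" using m by (simp add: power2_eq_square)
      thus False using p m False by (metis dvd_refl zdvd_not_zless prime_int_iff le_less linorder_not_less)
    qed
    obtain x1 x2 x3 x4 where x: "m * p = x1\<^sup>2 + x2\<^sup>2 + x3\<^sup>2 + x4\<^sup>2"
      using Pn unfolding P_def four_squares_def m_def by blast
    obtain y1 where y1: "m dvd x1 - y1" "2 * \<bar>y1\<bar> \<le> m" using centered_residue[OF m(1)] .
    obtain y2 where y2: "m dvd x2 - y2" "2 * \<bar>y2\<bar> \<le> m" using centered_residue[OF m(1)] .
    obtain y3 where y3: "m dvd x3 - y3" "2 * \<bar>y3\<bar> \<le> m" using centered_residue[OF m(1)] .
    obtain y4 where y4: "m dvd x4 - y4" "2 * \<bar>y4\<bar> \<le> m" using centered_residue[OF m(1)] .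
    obtain u1 where u1: "x1 = y1 + m * u1" using y1(1) by (metis dvd_def diff_add_cancel add.commute)
    obtain u2 where u2: "x2 = y2 + m * u2" using y2(1) by (metis dvd_def diff_add_cancel add.commute)
    obtain u3 where u3: "x3 = y3 + m * u3" using y3(1) by (metis dvd_def diff_add_cancel add.commute)
    obtain u4 where u4: "x4 = y4 + m * u4" using y4(1) by (metis dvd_def diff_add_cancel add.commute)
    define S where "S = y1\<^sup>2 + y2\<^sup>2 + y3\<^sup>2 + y4\<^sup>2"
    have sq: "4 * y\<^sup>2 \<le> m\<^sup>2" if "2 * \<bar>y\<bar> \<le> m" for y
    proof -
      have "(2 * \<bar>y\<bar>)\<^sup>2 \<le> m\<^sup>2" using that by (intro power_mono) auto
      thus ?thesis by (simp add: power_mult_distrib)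
    qed
    have Sx: "m * p = S + m * (2 * (y1*u1 + y2*u2 + y3*u3 + y4*u4) + m * (u1\<^sup>2 + u2\<^sup>2 + u3\<^sup>2 + u4\<^sup>2))"
      unfolding x S_def u1 u2 u3 u4 by (simp add: power2_eq_square algebra_simps)
    have "m dvd S"
      using Sx by (metis dvd_add_left_iff dvd_triv_left)
    then obtain r where r: "S = m * r" by (metis dvd_def)
    have "S \<ge> 0" by (simp add: S_def)
    have S4: "4 * S \<le> 4 * m\<^sup>2" using sq[OF y1(2)] sq[OF y2(2)] sq[OF y3(2)] sq[OF y4(2)] by (simp add: S_def)
    have r0: "r \<ge> 0" using \<open>S \<ge> 0\<close> m(1) r by (simp add: zero_le_mult_iff)
    have rm: "r \<le> m" using S4 m(1) r by (simp add: power2_eq_square)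
    have "r \<noteq> 0"
    proof
      assume "r = 0"
      hence "S = 0" using r by simp
      hence "y1 = 0 \<and> y2 = 0 \<and> y3 = 0 \<and> y4 = 0"
        unfolding S_def by (smt (verit) zero_le_power2 zero_eq_power2)
      hence "m * p = m\<^sup>2 * (u1\<^sup>2 + u2\<^sup>2 + u3\<^sup>2 + u4\<^sup>2)"
        using Sx \<open>S = 0\<close> by (simp add: power2_eq_square)
      thus False using nsq by simp
    qed
    \<comment> \<open>Equality would force every residue to have absolute value
      \<open>m / 2\<close>; expanding the squares then makes \<open>m * p\<close> divisible by
      \<open>m\<^sup>2\<close>.\<close>
    have "r \<noteq> m"
    proof
      assume "r = m"
      hence SS: "S = m\<^sup>2" using r by (simp add: power2_eq_square)
      hence "4 * y1\<^sup>2 = m\<^sup>2 \<and> 4 * y2\<^sup>2 = m\<^sup>2 \<and> 4 * y3\<^sup>2 = m\<^sup>2 \<and> 4 * y4\<^sup>2 = m\<^sup>2"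
        using sq[OF y1(2)] sq[OF y2(2)] sq[OF y3(2)] sq[OF y4(2)] unfolding S_def by linarith
      hence "(2 * y1)\<^sup>2 = m\<^sup>2 \<and> (2 * y2)\<^sup>2 = m\<^sup>2 \<and> (2 * y3)\<^sup>2 = m\<^sup>2 \<and> (2 * y4)\<^sup>2 = m\<^sup>2"
        by (simp add: power_mult_distrib)
      hence "m dvd 2 * y1 \<and> m dvd 2 * y2 \<and> m dvd 2 * y3 \<and> m dvd 2 * y4"
        by (metis dvd_refl pow_divides_pow_iff zero_less_numeral)
      then obtain w1 w2 w3 w4 where w: "2 * y1 = m * w1" "2 * y2 = m * w2" "2 * y3 = m * w3" "2 * y4 = m * w4"
        by (elim conjE dvdE)
      have "2 * (y1*u1 + y2*u2 + y3*u3 + y4*u4) = (2*y1)*u1 + (2*y2)*u2 + (2*y3)*u3 + (2*y4)*u4"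
        by simp
      hence "m * p = m\<^sup>2 * (1 + (w1*u1 + w2*u2 + w3*u3 + w4*u4) + (u1\<^sup>2 + u2\<^sup>2 + u3\<^sup>2 + u4\<^sup>2))"
        using Sx unfolding SS w by (simp add: power2_eq_square algebra_simps)
      thus False using nsq by simp
    qed
    define z1 where "z1 = r + u1*y1 + u2*y2 + u3*y3 + u4*y4"
    define z2 where "z2 = u1*y2 - u2*y1 + u3*y4 - u4*y3"
    define z3 where "z3 = u1*y3 - u3*y1 + u4*y2 - u2*y4"
    define z4 where "z4 = u1*y4 - u4*y1 + u2*y3 - u3*y2"
    have "x1*y1 + x2*y2 + x3*y3 + x4*y4 = S + m * (u1*y1 + u2*y2 + u3*y3 + u4*y4)"
      unfolding S_def u1 u2 u3 u4 by (simp add: power2_eq_square algebra_simps)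
    hence e1: "x1*y1 + x2*y2 + x3*y3 + x4*y4 = m * z1"
      using r by (simp add: z1_def algebra_simps)
    have e2: "x1*y2 - x2*y1 + x3*y4 - x4*y3 = m * z2"
      unfolding z2_def u1 u2 u3 u4 by (simp add: algebra_simps)
    have e3: "x1*y3 - x3*y1 + x4*y2 - x2*y4 = m * z3"
      unfolding z3_def u1 u2 u3 u4 by (simp add: algebra_simps)
    have e4: "x1*y4 - x4*y1 + x2*y3 - x3*y2 = m * z4"
      unfolding z4_def u1 u2 u3 u4 by (simp add: algebra_simps)
    have "(m * p) * S = (m * z1)\<^sup>2 + (m * z2)\<^sup>2 + (m * z3)\<^sup>2 + (m * z4)\<^sup>2"
      unfolding x S_def euler_four_squares e1 e2 e3 e4 ..
    hence "m\<^sup>2 * (r * p) = m\<^sup>2 * (z1\<^sup>2 + z2\<^sup>2 + z3\<^sup>2 + z4\<^sup>2)"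
      unfolding r by (simp add: power2_eq_square algebra_simps)
    hence "r * p = z1\<^sup>2 + z2\<^sup>2 + z3\<^sup>2 + z4\<^sup>2" using m by simp
    hence "P (nat r)"
      unfolding P_def four_squares_def using r0 \<open>r \<noteq> 0\<close> by (auto intro!: exI)
    moreover have "nat r < n" using rm \<open>r \<noteq> m\<close> r0 by (simp add: m_def)
    ultimately show ?thesis using min by blast
  qed
qed

theorem lagrange_four_squares:
  fixes n :: nat
  shows "\<exists>a b c d::int. int n = a\<^sup>2 + b\<^sup>2 + c\<^sup>2 + d\<^sup>2"
proof -
  have "four_squares (int n)"
  proof (induction n rule: less_induct)
    case (less n)
    show ?case
    proof (cases "n \<le> 1")
      case True
      hence "int n = (int n)\<^sup>2 + 0\<^sup>2 + 0\<^sup>2 + 0\<^sup>2"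
        by (cases n) auto
      thus ?thesis unfolding four_squares_def by blast
    next
      case False
      then obtain p where p: "prime p" "p dvd n" using prime_factor_nat[of n] by auto
      then obtain k where k: "n = p * k" by blast
      have "k < n" using k False prime_gt_1_nat[OF p(1)] by (cases "k = 0") auto
      hence "four_squares (int k)" by (rule less.IH)
      moreover have "four_squares (int p)" using p(1) by (intro four_squares_prime) simp
      ultimately show ?thesis unfolding k by (simp add: four_squares_mult)
    qed
  qed
  thus ?thesis by (simp add: four_squares_def)
qed

section \<open>Positive definite real forms\<close>

definition qform :: "nat \<Rightarrow> (nat \<Rightarrow> nat \<Rightarrow> 'a::comm_ring_1) \<Rightarrow> (nat \<Rightarrow> 'a) \<Rightarrow> 'a" where
  "qform k M x = (\<Sum>i<k. \<Sum>j<k. M i j * x i * x j)"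

definition pos_def :: "nat \<Rightarrow> (nat \<Rightarrow> nat \<Rightarrow> real) \<Rightarrow> bool" where
  "pos_def k M \<longleftrightarrow> (\<forall>x. (\<exists>i<k. x i \<noteq> 0) \<longrightarrow> qform k M x > 0)"

lemma qform_cong: "(\<And>i. i < k \<Longrightarrow> x i = y i) \<Longrightarrow> qform k M x = qform k M y"
  by (simp add: qform_def)

lemma complete_square:
  fixes a s y :: real
  assumes "a \<noteq> 0"
  shows "a * (y + s / a)\<^sup>2 = a * y\<^sup>2 + 2 * y * s + s * s / a"
proof -
  define t where "t = s / a"
  have s: "s = a * t" using assms by (simp add: t_def)
  show ?thesis unfolding s using assms by (simp add: power2_eq_square algebra_simps)
qed

lemma Cauchy_Schwarz_sum:
  fixes f g :: "nat \<Rightarrow> real"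
  shows "(\<Sum>i<k. f i * g i)\<^sup>2 \<le> (\<Sum>i<k. (f i)\<^sup>2) * (\<Sum>i<k. (g i)\<^sup>2)"
proof -
  have "0 \<le> (\<Sum>i<k. \<Sum>j<k. (f i * g j - f j * g i)\<^sup>2)" by (intro sum_nonneg) auto
  also have "\<dots> = (\<Sum>i<k. \<Sum>j<k. (f i)\<^sup>2 * (g j)\<^sup>2) + (\<Sum>i<k. \<Sum>j<k. (f j)\<^sup>2 * (g i)\<^sup>2)
      - 2 * (\<Sum>i<k. \<Sum>j<k. (f i * g i) * (f j * g j))"
    by (simp add: sum.distrib sum_subtractf sum_distrib_left power2_diff power_mult_distrib mult_ac)
  also have "(\<Sum>i<k. \<Sum>j<k. (f j)\<^sup>2 * (g i)\<^sup>2) = (\<Sum>i<k. \<Sum>j<k. (f i)\<^sup>2 * (g j)\<^sup>2)" by (rule sum.swap)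
  finally show ?thesis by (simp only: sum_product[symmetric] power2_eq_square[of "sum _ _"])
qed

text \<open>Completion of the square in the last variable; what remains is the Schur
  complement.\<close>

lemma qform_schur:
  fixes M :: "nat \<Rightarrow> nat \<Rightarrow> real"
  assumes sym: "\<And>i j. i < Suc k \<Longrightarrow> j < Suc k \<Longrightarrow> M i j = M j i" and a: "M k k \<noteq> 0"
  shows "qform (Suc k) M x = M k k * (x k + (\<Sum>i<k. M i k / M k k * x i))\<^sup>2
    + qform k (\<lambda>i j. M i j - M i k * M j k / M k k) x"
proof -
  define s where "s = (\<Sum>i<k. M i k * x i)"
  have 1: "(\<Sum>i<k. M i k / M k k * x i) = s / M k k"
    by (simp add: s_def sum_divide_distrib)
  have 2: "qform k (\<lambda>i j. M i j - M i k * M j k / M k k) x = qform k M x - s * s / M k k"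
  proof -
    have "qform k (\<lambda>i j. M i j - M i k * M j k / M k k) x
      = qform k M x - (\<Sum>i<k. \<Sum>j<k. (M i k * x i) * (M j k * x j)) / M k k"
      unfolding qform_def sum_divide_distrib sum_subtractf[symmetric]
      by (intro sum.cong refl) (simp add: field_simps)
    also have "(\<Sum>i<k. \<Sum>j<k. (M i k * x i) * (M j k * x j)) = s * s"
      unfolding s_def by (rule sum_product[symmetric])
    finally show ?thesis .
  qed
  have "(\<Sum>j<k. M k j * x k * x j) = x k * s"
    unfolding s_def sum_distrib_left by (intro sum.cong) (auto simp: sym)
  moreover have "(\<Sum>i<k. M i k * x i * x k) = x k * s"
    unfolding s_def sum_distrib_left by (intro sum.cong) auto
  ultimately have "qform (Suc k) M x = qform k M x + 2 * x k * s + M k k * (x k)\<^sup>2"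
    by (simp add: qform_def sum.distrib power2_eq_square algebra_simps)
  thus ?thesis unfolding 1 2 complete_square[OF a] by simp
qed

lemma pos_def_schur:
  assumes sym: "\<And>i j. i < Suc k \<Longrightarrow> j < Suc k \<Longrightarrow> M i j = M j i" and pd: "pos_def (Suc k) M"
  shows "M k k > 0" "pos_def k (\<lambda>i j. M i j - M i k * M j k / M k k)"
proof -
  have d: "(\<Sum>i<Suc k. f i * (if i = k then 1 else 0)) = f k" for f :: "nat \<Rightarrow> real"
    by simp
  have "qform (Suc k) M (\<lambda>i. if i = k then 1 else 0) = M k k"
    unfolding qform_def by simp
  moreover have "qform (Suc k) M (\<lambda>i. if i = k then 1 else 0) > 0"
    using pd unfolding pos_def_def by (elim allE impE) (auto intro!: exI[of _ k])
  ultimately show a: "M k k > 0" by simp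
  show "pos_def k (\<lambda>i j. M i j - M i k * M j k / M k k)"
    unfolding pos_def_def
  proof (intro allI impI)
    fix x :: "nat \<Rightarrow> real" assume "\<exists>i<k. x i \<noteq> 0"
    then obtain i where i: "i < k" "x i \<noteq> 0" by blast
    \<comment> \<open>This value of the last variable annihilates the completed square.\<close>
    let ?x = "x(k := - (\<Sum>i<k. M i k / M k k * x i))"
    have "\<exists>i<Suc k. ?x i \<noteq> 0" using i by (intro exI[of _ i]) auto
    hence "qform (Suc k) M ?x > 0"
      using pd unfolding pos_def_def by blast
    also have "qform (Suc k) M ?x = qform k (\<lambda>i j. M i j - M i k * M j k / M k k) ?x"
      using qform_schur[OF sym, where x = ?x] a by simp
    also have "\<dots> = qform k (\<lambda>i j. M i j - M i k * M j k / M k k) x"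
      by (rule qform_cong) auto
    finally show "qform k (\<lambda>i j. M i j - M i k * M j k / M k k) x > 0" .
  qed
qed

text \<open>An induction on Schur complements takes the place of compactness of the unit
  sphere.\<close>

lemma pos_def_lower_bound:
  assumes "\<And>i j. i < k \<Longrightarrow> j < k \<Longrightarrow> M i j = M j i" "pos_def k M"
  shows "\<exists>c>0. \<forall>x. c * (\<Sum>i<k. (x i)\<^sup>2) \<le> qform k M x"
  using assms
proof (induction k arbitrary: M)
  case 0
  thus ?case by (intro exI[of _ 1]) (simp add: qform_def)
next
  case (Suc k)
  let ?D = "\<lambda>i j. M i j - M i k * M j k / M k k"
  define a where "a = M k k"
  have a: "a > 0" and D: "pos_def k ?D"
    using pos_def_schur[OF Suc.prems] by (auto simp: a_def)
  obtain c where c: "c > 0" "\<And>x. c * (\<Sum>i<k. (x i)\<^sup>2) \<le> qform k ?D x"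
    using Suc.IH[OF _ D] Suc.prems(1) by (auto simp: mult.commute)
  define B where "B = (\<Sum>i<k. (M i k / a)\<^sup>2)"
  have B: "B \<ge> 0" by (simp add: B_def sum_nonneg)
  \<comment> \<open>From \<open>(x k)\<^sup>2 \<le> 2 * (x k + s)\<^sup>2 + 2 * s\<^sup>2\<close>
    and \<open>s\<^sup>2 \<le> B * X\<close>, the sum of squares is at most
    \<open>(1 + 2 * B) / c\<close> times \<open>q\<close> plus \<open>2 / a\<close> times
    \<open>a * (x k + s)\<^sup>2\<close>; the sum of the two factors serves for both terms.\<close>
  define e where "e = (1 + 2 * B) / c + 2 / a"
  have e: "e > 0" using a B c(1) by (simp add: e_def add_nonneg_pos)
  have "(\<Sum>i<Suc k. (x i)\<^sup>2) \<le> e * qform (Suc k) M x" for x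
  proof -
    define s where "s = (\<Sum>i<k. M i k / a * x i)"
    define X where "X = (\<Sum>i<k. (x i)\<^sup>2)"
    define q where "q = qform k ?D x"
    have cs: "s\<^sup>2 \<le> B * X"
      unfolding s_def B_def X_def by (rule Cauchy_Schwarz_sum)
    have Q: "qform (Suc k) M x = a * (x k + s)\<^sup>2 + q"
      using qform_schur[OF Suc.prems(1), where x = x] a by (simp add: a_def s_def q_def)
    have "c * X \<le> q" unfolding X_def q_def by (rule c(2))
    hence Xq: "X \<le> q / c" using c(1) by (simp add: field_simps)
    have X0: "X \<ge> 0" by (simp add: X_def sum_nonneg)
    have q0: "q \<ge> 0" using \<open>c * X \<le> q\<close> c(1) X0 by (smt (verit) mult_nonneg_nonneg)
    have "0 \<le> (x k + 2 * s)\<^sup>2" by simp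
    hence "(x k)\<^sup>2 \<le> 2 * (x k + s)\<^sup>2 + 2 * s\<^sup>2"
      by (simp add: power2_eq_square algebra_simps)
    hence "(\<Sum>i<Suc k. (x i)\<^sup>2) \<le> X + 2 * (x k + s)\<^sup>2 + 2 * (B * X)"
      using cs by (simp add: X_def)
    also have "\<dots> = (1 + 2 * B) * X + 2 * (x k + s)\<^sup>2" by (simp add: algebra_simps)
    also have "\<dots> \<le> (1 + 2 * B) * (q / c) + 2 * (x k + s)\<^sup>2"
      using Xq B by (intro add_right_mono mult_left_mono) auto
    also have "\<dots> \<le> e * qform (Suc k) M x"
    proof -
      have "e * qform (Suc k) M x - ((1 + 2 * B) * (q / c) + 2 * (x k + s)\<^sup>2)
         = (1 + 2 * B) / c * (a * (x k + s)\<^sup>2) + 2 / a * q"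
        unfolding Q e_def using a c(1) by (simp add: field_simps)
      also have "\<dots> \<ge> 0" using a c(1) B q0 by simp
      finally show ?thesis by simp
    qed
    finally show ?thesis .
  qed
  thus ?case using e by (intro exI[of _ "1 / e"]) (simp add: field_simps)
qed

lemma pos_def_cholesky:
  assumes "\<And>i j. i < k \<Longrightarrow> j < k \<Longrightarrow> M i j = M j i" "pos_def k M"
  shows "\<exists>l. \<forall>i<k. \<forall>j<k. M i j = (\<Sum>t<k. l t i * l t j)"
  using assms
proof (induction k arbitrary: M)
  case 0
  thus ?case by simp
next
  case (Suc k)
  let ?D = "\<lambda>i j. M i j - M i k * M j k / M k k"
  have a: "M k k > 0" and D: "pos_def k ?D"
    using pos_def_schur[OF Suc.prems] by auto
  obtain l where l: "\<And>i j. i < k \<Longrightarrow> j < k \<Longrightarrow> ?D i j = (\<Sum>t<k. l t i * l t j)"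
    using Suc.IH[OF _ D] Suc.prems(1) by (auto simp: mult.commute)
  let ?l = "\<lambda>t i. if t < k then (if i < k then l t i else 0)
      else (if i < k then M i k / sqrt (M k k) else sqrt (M k k))"
  have sq: "sqrt (M k k) * sqrt (M k k) = M k k" "sqrt (M k k) \<noteq> 0" using a by auto
  have "M i j = (\<Sum>t<Suc k. ?l t i * ?l t j)" if "i < Suc k" "j < Suc k" for i j
  proof (cases "i < k"; cases "j < k")
    assume ij: "i < k" "j < k"
    have "(\<Sum>t<Suc k. ?l t i * ?l t j) = ?D i j + M i k * M j k / (sqrt (M k k) * sqrt (M k k))"
      using ij l[OF ij] by simp
    thus ?thesis using sq(1) by simp
  next
    assume "i < k" "\<not> j < k"
    moreover from this have "j = k" using that by simp
    ultimately show ?thesis using sq by simp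
  next
    assume "\<not> i < k" "j < k"
    moreover from this have "i = k" using that by simp
    ultimately show ?thesis using sq Suc.prems(1)[of k j] by simp
  next
    assume "\<not> i < k" "\<not> j < k"
    moreover from this have "i = k" "j = k" using that by simp_all
    ultimately show ?thesis using sq by simp
  qed
  thus ?case by (intro exI[of _ ?l]) blast
qed

text \<open>The multiple of the identity is the room for later replacing the real coefficients
  \<open>l\<close> by nearby integers of the field. Only half of the lower bound is split off, so
  that the rest is still positive definite.\<close>

lemma pos_def_decomp:
  assumes sym: "\<And>i j. i < k \<Longrightarrow> j < k \<Longrightarrow> M i j = M j i" and pd: "pos_def k M"
  obtains c l where "c > 0"
    "\<And>i j. i < k \<Longrightarrow> j < k \<Longrightarrow> M i j = (if i = j then c else 0) + (\<Sum>t<k. l t i * l t j)"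
proof -
  obtain c where c: "c > 0" "\<And>x. c * (\<Sum>i<k. (x i)\<^sup>2) \<le> qform k M x"
    using pos_def_lower_bound[OF assms] by blast
  let ?N = "\<lambda>i j. M i j - (if i = j then c / 2 else 0)"
  have "pos_def k ?N"
    unfolding pos_def_def
  proof (intro allI impI)
    fix x :: "nat \<Rightarrow> real" assume "\<exists>i<k. x i \<noteq> 0"
    then obtain i where i: "i < k" "x i \<noteq> 0" by blast
    have pos: "(\<Sum>i<k. (x i)\<^sup>2) > 0"
      using i by (intro sum_pos2[of _ i]) auto
    have "qform k ?N x = qform k M x - (\<Sum>i<k. \<Sum>j<k. (if i = j then c / 2 else 0) * x i * x j)"
      unfolding qform_def sum_subtractf[symmetric] by (intro sum.cong refl) (simp add: algebra_simps)
    also have "(\<Sum>i<k. \<Sum>j<k. (if i = j then c / 2 else 0) * x i * x j) = (\<Sum>i<k. c / 2 * (x i)\<^sup>2)"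
    proof (intro sum.cong refl)
      fix i assume "i \<in> {..<k}"
      have "(\<Sum>j<k. (if i = j then c / 2 else 0) * x i * x j) = (\<Sum>j<k. if i = j then c / 2 * x i * x j else 0)"
        by (intro sum.cong) auto
      also have "\<dots> = c / 2 * (x i)\<^sup>2" using \<open>i \<in> {..<k}\<close> by (simp add: power2_eq_square)
      finally show "(\<Sum>j<k. (if i = j then c / 2 else 0) * x i * x j) = c / 2 * (x i)\<^sup>2" .
    qed
    also have "\<dots> = c / 2 * (\<Sum>i<k. (x i)\<^sup>2)" by (rule sum_distrib_left[symmetric])
    finally show "qform k ?N x > 0" using c(2)[of x] mult_pos_pos[OF c(1) pos] by simp
  qed
  moreover have "?N i j = ?N j i" if "i < k" "j < k" for i j
    using sym[OF that] by auto
  ultimately obtain l where l: "\<forall>i<k. \<forall>j<k. ?N i j = (\<Sum>t<k. l t i * l t j)"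
    using pos_def_cholesky[of k ?N] by blast
  show thesis
  proof (rule that[of "c / 2" l])
    fix i j assume "i < k" "j < k"
    with l have "?N i j = (\<Sum>t<k. l t i * l t j)" by blast
    thus "M i j = (if i = j then c / 2 else 0) + (\<Sum>t<k. l t i * l t j)" by simp
  qed (use c(1) in simp)
qed


section \<open>The geometry of the ring of integers\<close>

definition real_embeddings :: "('k::field_char_0 \<Rightarrow> complex) set" where
  "real_embeddings = {\<sigma> \<in> embeddings. range \<sigma> \<subseteq> \<real>}"

abbreviation conj_emb :: "('k \<Rightarrow> complex) \<Rightarrow> 'k \<Rightarrow> complex" where
  "conj_emb \<sigma> \<equiv> \<lambda>x. cnj (\<sigma> x)"

lemma conj_emb_embeddings: "\<sigma> \<in> embeddings \<Longrightarrow> conj_emb \<sigma> \<in> embeddings"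
proof -
  assume \<sigma>: "\<sigma> \<in> embeddings"
  have "field_hom (conj_emb \<sigma>)"
    by unfold_locales (use \<sigma> in \<open>auto simp: embeddings_simps\<close>)
  thus ?thesis by (simp add: embeddings_def)
qed

lemma real_embeddings_Im: "\<sigma> \<in> real_embeddings \<Longrightarrow> Im (\<sigma> x) = 0"
  by (auto simp: real_embeddings_def complex_is_Real_iff image_subset_iff)

lemma real_embeddings_conj: "\<sigma> \<in> real_embeddings \<Longrightarrow> conj_emb \<sigma> = \<sigma>"
  by (rule ext, rule complex_eqI) (simp_all add: real_embeddings_Im)

lemma conj_emb_real_iff: "\<sigma> \<in> embeddings \<Longrightarrow> conj_emb \<sigma> \<in> real_embeddings \<longleftrightarrow> \<sigma> \<in> real_embeddings"
  using conj_emb_embeddings[of \<sigma>]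
  by (auto simp: real_embeddings_def complex_is_Real_iff image_subset_iff)

lemma real_embeddings_of_real: "\<sigma> \<in> real_embeddings \<Longrightarrow> \<sigma> x = of_real (Re (\<sigma> x))"
  by (rule complex_eqI) (simp_all add: real_embeddings_Im)

lemma real_embeddings_subset: "\<sigma> \<in> real_embeddings \<Longrightarrow> \<sigma> \<in> embeddings"
  by (simp add: real_embeddings_def)

context
  assumes nf: "number_field TYPE('k::field_char_0)"
begin

text \<open>By Cramer's rule the coordinates in an integral basis are fixed linear functions of the
  embeddings.\<close>

lemma integral_coordinates_bound:
  "\<exists>d (w :: nat \<Rightarrow> 'k) C::real. C > 0 \<and> (\<forall>j<d. w j \<in> ring_of_integers) \<and>
    (\<forall>x M. x \<in> ring_of_integers \<longrightarrow> (\<forall>\<sigma>\<in>embeddings. norm (\<sigma> x) \<le> M) \<longrightarrow>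
      (\<exists>q::nat \<Rightarrow> int. x = (\<Sum>j<d. of_int (q j) * w j) \<and> (\<forall>j<d. of_int \<bar>q j\<bar> \<le> C * M)))"
proof -
  obtain d e b D where F: "integral_frame d e (b :: nat \<Rightarrow> 'k) D" using integral_frame_exists[OF nf] by blast
  note e = integral_frameD(1)[OF F] and bO = integral_frameD(2)[OF F] and sp = integral_frameD(3)[OF F]
  have ee: "e i \<in> embeddings" if "i < d" for i using bij_betwE[OF e] that by simp
  define v where "v = det (emb_mat d e b)"
  have v: "v \<noteq> 0" using integral_frameD(4,5)[OF F] by (auto simp: v_def)
  obtain W where W: "\<And>i l. i < d \<Longrightarrow> l < d \<Longrightarrow> (\<Sum>j<d. W i j * e j (b l)) = (if i = l then v else 0)"
    using det_adjugate[of d "\<lambda>i j. e i (b j)"] unfolding v_def by blast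
  define C where "C = (\<Sum>j<d. \<Sum>l<d. norm (W j l)) / norm v + 1"
  have "C > 0" unfolding C_def by (intro add_nonneg_pos divide_nonneg_nonneg sum_nonneg) auto
  moreover have "\<exists>q::nat \<Rightarrow> int. x = (\<Sum>j<d. of_int (q j) * b j) \<and> (\<forall>j<d. of_int \<bar>q j\<bar> \<le> C * M)"
    if x: "x \<in> ring_of_integers" and M: "\<And>\<sigma>. \<sigma> \<in> embeddings \<Longrightarrow> norm (\<sigma> x) \<le> M" for x M
  proof -
    obtain q :: "nat \<Rightarrow> int" where q: "x = (\<Sum>j<d. of_int (q j) * b j)" using sp[OF x] by blast
    have "of_int \<bar>q j\<bar> \<le> C * M" if j: "j < d" for j
    proof -
      have M0: "M \<ge> 0" using M[OF ee[OF j]] norm_ge_zero order_trans by blast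
      have "(\<Sum>l<d. W j l * e l x) = (\<Sum>l<d. \<Sum>i<d. of_int (q i) * (W j l * e l (b i)))"
        unfolding q by (intro sum.cong refl) (simp add: ee embeddings_simps sum_distrib_left mult.left_commute)
      also have "\<dots> = (\<Sum>i<d. of_int (q i) * (\<Sum>l<d. W j l * e l (b i)))"
        by (subst sum.swap) (simp add: sum_distrib_left)
      also have "\<dots> = (\<Sum>i<d. if j = i then of_int (q i) * v else 0)"
        using j by (intro sum.cong refl) (simp add: W)
      also have "\<dots> = of_int (q j) * v" using j by (simp add: sum.delta)
      finally have "norm (of_int (q j) * v) = norm (\<Sum>l<d. W j l * e l x)" by simp
      also have "\<dots> \<le> (\<Sum>l<d. norm (W j l) * M)"
        by (intro order_trans[OF norm_sum] sum_mono) (auto simp: norm_mult intro!: mult_left_mono M ee)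
      also have "\<dots> = (\<Sum>l<d. norm (W j l)) * M" by (simp add: sum_distrib_right)
      also have "\<dots> \<le> (\<Sum>j<d. \<Sum>l<d. norm (W j l)) * M"
        using j M0 by (intro mult_right_mono member_le_sum[of j "{..<d}" "\<lambda>j. \<Sum>l<d. norm (W j l)"]) (auto intro: sum_nonneg)
      finally have "of_int \<bar>q j\<bar> * norm v \<le> (\<Sum>j<d. \<Sum>l<d. norm (W j l)) * M" by (simp add: norm_mult)
      hence "of_int \<bar>q j\<bar> \<le> (\<Sum>j<d. \<Sum>l<d. norm (W j l)) / norm v * M"
        using v by (simp add: field_simps)
      also have "\<dots> \<le> C * M" using M0 by (intro mult_right_mono) (auto simp: C_def)
      finally show ?thesis .
    qed
    thus ?thesis using q by blast
  qed
  ultimately show ?thesis using bO by (intro exI[of _ d] exI[of _ b] exI[of _ C] conjI allI impI) auto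
qed

text \<open>The vectors indexed by the embeddings and compatible with conjugation form the real span
  of the integers. Compatibility is what makes the coordinates \<open>t\<close> real, so that they
  can be rounded.\<close>

lemma integral_covering:
  obtains R :: real where "R \<ge> 1"
    "\<And>z. (\<And>\<sigma> :: 'k \<Rightarrow> complex. \<sigma> \<in> embeddings \<Longrightarrow> z (conj_emb \<sigma>) = cnj (z \<sigma>)) \<Longrightarrow>
      \<exists>x\<in>ring_of_integers. \<forall>\<sigma>\<in>embeddings. norm (\<sigma> (x :: 'k) - z \<sigma>) \<le> R"
proof -
  obtain d e b D where F: "integral_frame d e (b :: nat \<Rightarrow> 'k) D" using integral_frame_exists[OF nf] by blast
  note e = integral_frameD(1)[OF F] and bO = integral_frameD(2)[OF F]
  have ee: "e i \<in> embeddings" if "i < d" for i using bij_betwE[OF e] that by simp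
  have idx: "\<exists>i<d. \<sigma> = e i" if "\<sigma> \<in> embeddings" for \<sigma> using e that by (auto simp: bij_betw_def)
  define v where "v = det (emb_mat d e b)"
  have v: "v \<noteq> 0" using integral_frameD(4,5)[OF F] by (auto simp: v_def)
  obtain W where W1: "\<And>i l. i < d \<Longrightarrow> l < d \<Longrightarrow> (\<Sum>j<d. e i (b j) * W j l) = (if i = l then v else 0)"
    and W2: "\<And>i l. i < d \<Longrightarrow> l < d \<Longrightarrow> (\<Sum>j<d. W i j * e j (b l)) = (if i = l then v else 0)"
    using det_adjugate[of d "\<lambda>i j. e i (b j)"] unfolding v_def by blast
  define R where "R = (\<Sum>\<sigma>\<in>embeddings. \<Sum>j<d. norm (\<sigma> (b j))) + 1"
  have "R \<ge> 1" by (auto simp: R_def intro!: sum_nonneg)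
  moreover have "\<exists>x\<in>ring_of_integers. \<forall>\<sigma>\<in>embeddings. norm (\<sigma> x - z \<sigma>) \<le> R"
    if z: "\<And>\<sigma> :: 'k \<Rightarrow> complex. \<sigma> \<in> embeddings \<Longrightarrow> z (conj_emb \<sigma>) = cnj (z \<sigma>)" for z
  proof -
    define t where "t j = (\<Sum>l<d. W j l * z (e l)) / v" for j
    have te: "(\<Sum>j<d. t j * e i (b j)) = z (e i)" if i: "i < d" for i
    proof -
      have "(\<Sum>j<d. t j * e i (b j)) = (\<Sum>j<d. \<Sum>l<d. e i (b j) * W j l * z (e l)) / v"
        by (simp add: t_def sum_divide_distrib sum_distrib_right sum_distrib_left mult_ac)
      also have "(\<Sum>j<d. \<Sum>l<d. e i (b j) * W j l * z (e l)) = (\<Sum>l<d. (\<Sum>j<d. e i (b j) * W j l) * z (e l))"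
        by (subst sum.swap) (simp add: sum_distrib_right)
      also have "\<dots> = (\<Sum>l<d. if i = l then v * z (e l) else 0)"
        using i by (intro sum.cong refl) (simp add: W1)
      also have "\<dots> = v * z (e i)" using i by (simp add: sum.delta)
      finally show ?thesis using v by simp
    qed
    have ts: "(\<Sum>j<d. t j * \<sigma> (b j)) = z \<sigma>" if "\<sigma> \<in> embeddings" for \<sigma>
      using te idx[OF that] by blast
    have "cnj (t j) = t j" if j: "j < d" for j
    proof -
      have zero: "(\<Sum>l<d. (t l - cnj (t l)) * e i (b l)) = 0" if i: "i < d" for i
      proof -
        have "(\<Sum>l<d. cnj (t l) * e i (b l)) = cnj (\<Sum>l<d. t l * conj_emb (e i) (b l))" by simp
        also have "\<dots> = cnj (z (conj_emb (e i)))" by (subst ts[OF conj_emb_embeddings[OF ee[OF i]]]) simp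
        also have "\<dots> = z (e i)" using z[OF ee[OF i]] by simp
        finally show ?thesis using te[OF i] by (simp add: left_diff_distrib sum_subtractf)
      qed
      have "0 = (\<Sum>i<d. W j i * (\<Sum>l<d. (t l - cnj (t l)) * e i (b l)))" by (simp add: zero)
      also have "\<dots> = (\<Sum>i<d. \<Sum>l<d. (t l - cnj (t l)) * (W j i * e i (b l)))"
        by (simp add: sum_distrib_left mult.left_commute)
      also have "\<dots> = (\<Sum>l<d. (t l - cnj (t l)) * (\<Sum>i<d. W j i * e i (b l)))"
        by (subst sum.swap) (simp add: sum_distrib_left)
      also have "\<dots> = (\<Sum>l<d. if j = l then (t l - cnj (t l)) * v else 0)"
        using j by (intro sum.cong refl) (simp add: W2)
      also have "\<dots> = (t j - cnj (t j)) * v" using j by (simp add: sum.delta)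
      finally show ?thesis using v by simp
    qed
    hence tr: "t j = of_real (Re (t j))" if "j < d" for j
      using that by (simp add: complex_eq_iff)
    define x where "x = (\<Sum>j<d. of_int (round (Re (t j))) * b j)"
    have "x \<in> ring_of_integers" unfolding x_def by (intro roi_sum roi_mult) (auto simp: bO)
    moreover have "norm (\<sigma> x - z \<sigma>) \<le> R" if \<sigma>: "\<sigma> \<in> embeddings" for \<sigma>
    proof -
      have "\<sigma> x - z \<sigma> = (\<Sum>j<d. (of_int (round (Re (t j))) - t j) * \<sigma> (b j))"
        unfolding x_def ts[OF \<sigma>, symmetric] using \<sigma> by (simp add: embeddings_simps left_diff_distrib sum_subtractf)
      also have "norm \<dots> \<le> (\<Sum>j<d. norm (\<sigma> (b j)))"
      proof (intro order_trans[OF norm_sum] sum_mono)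
        fix j assume j: "j \<in> {..<d}"
        have "of_int (round (Re (t j))) - t j = of_real (of_int (round (Re (t j))) - Re (t j))"
          using tr[of j] j by (simp add: complex_eq_iff)
        hence "norm (of_int (round (Re (t j))) - t j) = \<bar>of_int (round (Re (t j))) - Re (t j)\<bar>"
          by (simp only: norm_of_real real_norm_def)
        also have "\<dots> \<le> 1" using of_int_round_abs_le[of "Re (t j)"] by linarith
        finally show "norm ((of_int (round (Re (t j))) - t j) * \<sigma> (b j)) \<le> norm (\<sigma> (b j))"
          by (simp add: norm_mult mult_left_le_one_le)
      qed
      also have "\<dots> \<le> (\<Sum>\<sigma>\<in>embeddings. \<Sum>j<d. norm (\<sigma> (b j)))"
        using \<sigma> finite_embeddings[OF nf] by (intro member_le_sum[of \<sigma> embeddings "\<lambda>\<sigma>. \<Sum>j<d. norm (\<sigma> (b j))"]) (auto intro: sum_nonneg)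
      finally show ?thesis by (simp add: R_def)
    qed
    ultimately show ?thesis by blast
  qed
  ultimately show thesis using that by blast
qed

text \<open>Since some embedding is not real, a box principle in the space of the real embeddings alone
  produces an integer that is small at all of them.\<close>

lemma small_at_real_embeddings:
  assumes ntr: "\<not> totally_real TYPE('k)"
  obtains \<alpha> :: 'k and a :: real where "\<alpha> \<in> ring_of_integers" "\<alpha> \<noteq> 0" "0 < a" "a < 1"
    "\<And>\<sigma>. \<sigma> \<in> real_embeddings \<Longrightarrow> norm (\<sigma> \<alpha>) \<le> a"
proof -
  obtain d e b D where F: "integral_frame d e (b :: nat \<Rightarrow> 'k) D" using integral_frame_exists[OF nf] by blast
  note e = integral_frameD(1)[OF F] and bO = integral_frameD(2)[OF F]
  have ee: "e i \<in> embeddings" if "i < d" for i using bij_betwE[OF e] that by simp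
  define v where "v = det (emb_mat d e b)"
  have v: "v \<noteq> 0" using integral_frameD(4,5)[OF F] by (auto simp: v_def)
  obtain W where W2: "\<And>i l. i < d \<Longrightarrow> l < d \<Longrightarrow> (\<Sum>j<d. W i j * e j (b l)) = (if i = l then v else 0)"
    using det_adjugate[of d "\<lambda>i j. e i (b j)"] unfolding v_def by blast
  have indep: "q j = 0" if q: "(\<Sum>j<d. of_int (q j) * b j) = 0" and j: "j < d" for q :: "nat \<Rightarrow> int" and j
  proof -
    have "0 = (\<Sum>i<d. W j i * e i (\<Sum>l<d. of_int (q l) * b l))"
      unfolding q using ee by (simp add: embeddings_simps)
    also have "\<dots> = (\<Sum>i<d. \<Sum>l<d. of_int (q l) * (W j i * e i (b l)))"
      using ee by (intro sum.cong refl) (simp add: embeddings_simps sum_distrib_left mult.left_commute)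
    also have "\<dots> = (\<Sum>l<d. of_int (q l) * (\<Sum>i<d. W j i * e i (b l)))"
      by (subst sum.swap) (simp add: sum_distrib_left)
    also have "\<dots> = (\<Sum>l<d. if j = l then of_int (q l) * v else 0)"
      using j by (intro sum.cong refl) (simp add: W2)
    also have "\<dots> = of_int (q j) * v" using j by (simp add: sum.delta)
    finally show "q j = 0" using v by simp
  qed
  let ?R = "real_embeddings :: ('k \<Rightarrow> complex) set"
  have finR: "finite ?R" using finite_embeddings[OF nf] by (rule finite_subset[rotated]) (auto simp: real_embeddings_def)
  define r where "r = card ?R"
  have "r < d"
  proof -
    have "?R \<subset> embeddings"
      using ntr unfolding totally_real_def real_embeddings_def embeddings_def by blast
    hence "card ?R < card (embeddings :: ('k \<Rightarrow> complex) set)" using finite_embeddings[OF nf] by (rule psubset_card_mono[rotated])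
    thus ?thesis using bij_betw_same_card[OF e] by (simp add: r_def)
  qed
  define S where "S = nat \<lceil>\<Sum>\<sigma>\<in>?R. \<Sum>j<d. norm (\<sigma> (b j))\<rceil>"
  \<comment> \<open>Chosen so that \<open>(2 * (H * S) + 3) ^ r \<le> (H + 1) ^ r * H < (H + 1) ^
    Suc r\<close>: as \<open>r < d\<close>, there are fewer boxes than coefficient vectors.
    Coefficients up to \<open>H\<close> give values up to \<open>H * S\<close>, and the 3 allows for
    taking floors at both ends.\<close>
  define H where "H = (2 * S + 3) ^ r"
  define A where "A = PiE {..<d} (\<lambda>_. {0..int H})"
  define x where "x a = (\<Sum>j<d. of_int (a j) * b j)" for a :: "nat \<Rightarrow> int"
  define f where "f a = restrict (\<lambda>\<sigma>. \<lfloor>Re (\<sigma> (x a))\<rfloor>) ?R" for a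
  define I where "I = {- int (H * S) - 1 .. int (H * S) + 1}"
  have bound: "norm (\<sigma> (x a)) \<le> of_nat (H * S)" if a: "a \<in> A" and \<sigma>: "\<sigma> \<in> ?R" for a \<sigma>
  proof -
    have \<sigma>': "\<sigma> \<in> embeddings" using \<sigma> by (simp add: real_embeddings_def)
    have "norm (\<sigma> (x a)) = norm (\<Sum>j<d. of_int (a j) * \<sigma> (b j))" using \<sigma>' by (simp add: x_def embeddings_simps)
    also have "\<dots> \<le> (\<Sum>j<d. of_nat H * norm (\<sigma> (b j)))"
    proof (intro order_trans[OF norm_sum] sum_mono)
      fix j assume "j \<in> {..<d}"
      hence "0 \<le> a j" "a j \<le> int H" using a by (auto simp: A_def PiE_iff)
      hence "\<bar>real_of_int (a j)\<bar> \<le> of_nat H" by linarith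
      thus "norm (of_int (a j) * \<sigma> (b j)) \<le> of_nat H * norm (\<sigma> (b j))"
        by (simp add: norm_mult mult_right_mono)
    qed
    also have "\<dots> = of_nat H * (\<Sum>j<d. norm (\<sigma> (b j)))" by (simp add: sum_distrib_left)
    also have "(\<Sum>j<d. norm (\<sigma> (b j))) \<le> (\<Sum>\<sigma>\<in>?R. \<Sum>j<d. norm (\<sigma> (b j)))"
      using \<sigma> finR by (intro member_le_sum[of \<sigma> ?R "\<lambda>\<sigma>. \<Sum>j<d. norm (\<sigma> (b j))"]) (auto intro: sum_nonneg)
    also have "\<dots> \<le> of_nat S" by (simp add: S_def of_nat_ceiling)
    finally show ?thesis by (simp add: mult_left_mono)
  qed
  have "f ` A \<subseteq> PiE ?R (\<lambda>_. I)"
  proof (intro image_subsetI)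
    fix a assume a: "a \<in> A"
    have "\<lfloor>Re (\<sigma> (x a))\<rfloor> \<in> I" if \<sigma>: "\<sigma> \<in> ?R" for \<sigma>
    proof -
      have "\<bar>Re (\<sigma> (x a))\<bar> \<le> of_nat (H * S)" using abs_Re_le_cmod bound[OF a \<sigma>] order_trans by blast
      moreover have "\<lfloor>y\<rfloor> \<in> {- int N - 1 .. int N + 1}" if "\<bar>y\<bar> \<le> of_nat N" for y :: real and N :: nat
        using that by (simp add: le_floor_iff floor_le_iff abs_le_iff)
      ultimately show ?thesis unfolding I_def by blast
    qed
    thus "f a \<in> PiE ?R (\<lambda>_. I)" by (simp add: f_def)
  qed
  hence "card (f ` A) \<le> card (PiE ?R (\<lambda>_. I))"
    using finR by (intro card_mono finite_PiE) (auto simp: I_def)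
  also have "\<dots> = (2 * (H * S) + 3) ^ r"
    by (simp add: card_PiE finR I_def r_def nat_add_distrib nat_mult_distrib add.commute)
  also have "\<dots> \<le> ((H + 1) * (2 * S + 3)) ^ r"
    by (intro power_mono) (auto simp: algebra_simps)
  also have "\<dots> = (H + 1) ^ r * H" by (simp only: power_mult_distrib H_def)
  also have "\<dots> < (H + 1) ^ r * (H + 1)" by simp
  also have "\<dots> = (H + 1) ^ Suc r" by simp
  also have "\<dots> \<le> (H + 1) ^ d" using \<open>r < d\<close> by (intro power_increasing) auto
  also have "\<dots> = card A" by (simp add: A_def card_PiE nat_add_distrib)
  finally have "\<not> inj_on f A" by (rule pigeonhole)
  then obtain a a' where aa: "a \<in> A" "a' \<in> A" "a \<noteq> a'" "f a = f a'" by (auto simp: inj_on_def)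
  define \<alpha> where "\<alpha> = x a - x a'"
  have \<alpha>_eq: "\<alpha> = (\<Sum>j<d. of_int (a j - a' j) * b j)" by (simp add: \<alpha>_def x_def left_diff_distrib sum_subtractf)
  have \<alpha>O: "\<alpha> \<in> ring_of_integers" unfolding \<alpha>_eq by (intro roi_sum roi_mult) (auto simp: bO)
  have "\<alpha> \<noteq> 0"
  proof
    assume "\<alpha> = 0"
    hence "a j = a' j" if "j < d" for j using indep[OF _ that, of "\<lambda>j. a j - a' j"] \<alpha>_eq by simp
    hence "a = a'" using aa(1,2) unfolding A_def by (intro PiE_ext) auto
    thus False using aa(3) by simp
  qed
  have small: "norm (\<sigma> \<alpha>) < 1" if \<sigma>: "\<sigma> \<in> ?R" for \<sigma>
  proof -
    have "\<lfloor>Re (\<sigma> (x a))\<rfloor> = \<lfloor>Re (\<sigma> (x a'))\<rfloor>"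
      using fun_cong[OF aa(4), of \<sigma>] \<sigma> by (simp add: f_def)
    hence "\<bar>Re (\<sigma> (x a)) - Re (\<sigma> (x a'))\<bar> < 1" by linarith
    moreover have "\<sigma> \<alpha> = of_real (Re (\<sigma> (x a)) - Re (\<sigma> (x a')))"
      using real_embeddings_of_real[OF \<sigma>, of "x a"] real_embeddings_of_real[OF \<sigma>, of "x a'"] \<sigma>
      by (simp add: \<alpha>_def real_embeddings_subset embeddings_simps)
    ultimately show ?thesis by (simp only: norm_of_real)
  qed
  \<comment> \<open>The entry \<open>1/2\<close> keeps the maximum defined and positive when there
    are no real embeddings.\<close>
  define m where "m = Max (insert (1/2) ((\<lambda>\<sigma>. norm (\<sigma> \<alpha>)) ` ?R))"
  have "1/2 \<le> m" unfolding m_def using finR by (intro Max_ge) auto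
  moreover have "m < 1" "\<And>\<sigma>. \<sigma> \<in> ?R \<Longrightarrow> norm (\<sigma> \<alpha>) \<le> m"
    using finR small by (auto simp: m_def)
  ultimately show thesis using that[of \<alpha> m] \<alpha>O \<open>\<alpha> \<noteq> 0\<close> by auto
qed

text \<open>Multiplying by \<open>\<alpha> ^ p\<close> shrinks the covering radius \<open>R\<close>
  to \<open>a ^ p * R\<close> at the real embeddings. Nothing is asked at the nonreal ones, so the
  target there is 0.\<close>

lemma dense_at_real_embeddings:
  assumes ntr: "\<not> totally_real TYPE('k)" and \<epsilon>: "\<epsilon> > 0"
  obtains x :: 'k where "x \<in> ring_of_integers" "\<And>\<sigma>. \<sigma> \<in> real_embeddings \<Longrightarrow> \<bar>Re (\<sigma> x) - z \<sigma>\<bar> < \<epsilon>"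
proof -
  obtain \<alpha> :: 'k and a :: real where \<alpha>: "\<alpha> \<in> ring_of_integers" "\<alpha> \<noteq> 0" "0 < a" "a < 1"
    "\<And>\<sigma>. \<sigma> \<in> real_embeddings \<Longrightarrow> norm (\<sigma> \<alpha>) \<le> a" using small_at_real_embeddings[OF ntr] by blast
  obtain R :: real where R: "R \<ge> 1"
    "\<And>z. (\<And>\<sigma> :: 'k \<Rightarrow> complex. \<sigma> \<in> embeddings \<Longrightarrow> z (conj_emb \<sigma>) = cnj (z \<sigma>)) \<Longrightarrow>
      \<exists>x\<in>ring_of_integers. \<forall>\<sigma>\<in>embeddings. norm (\<sigma> (x :: 'k) - z \<sigma>) \<le> R" using integral_covering by blast
  obtain p where p: "a ^ p < \<epsilon> / R" using real_arch_pow_inv[of "\<epsilon> / R" a] \<alpha>(4) \<epsilon> R(1) by auto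
  define y where "y \<sigma> = (if \<sigma> \<in> real_embeddings then of_real (z \<sigma>) / (\<sigma> \<alpha>) ^ p else 0)" for \<sigma> :: "'k \<Rightarrow> complex"
  have "y (conj_emb \<sigma>) = cnj (y \<sigma>)" if "\<sigma> \<in> embeddings" for \<sigma>
  proof (cases "\<sigma> \<in> real_embeddings")
    case True
    have "cnj (\<sigma> \<alpha>) = \<sigma> \<alpha>" using real_embeddings_conj[OF True] by metis
    thus ?thesis using True by (simp add: real_embeddings_conj y_def)
  next
    case False
    thus ?thesis using conj_emb_real_iff[OF that] by (simp add: y_def)
  qed
  then obtain x where x: "x \<in> ring_of_integers" "\<And>\<sigma>. \<sigma> \<in> embeddings \<Longrightarrow> norm (\<sigma> x - y \<sigma>) \<le> R"
    using R(2)[of y] by blast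
  have "\<bar>Re (\<sigma> (\<alpha> ^ p * x)) - z \<sigma>\<bar> < \<epsilon>" if \<sigma>: "\<sigma> \<in> real_embeddings" for \<sigma>
  proof -
    have \<sigma>': "\<sigma> \<in> embeddings" using \<sigma> by (rule real_embeddings_subset)
    have "\<sigma> (\<alpha> ^ p * x) - of_real (z \<sigma>) = (\<sigma> \<alpha>) ^ p * (\<sigma> x - y \<sigma>)"
      using \<sigma> \<sigma>' \<alpha>(2) by (simp add: y_def embeddings_simps right_diff_distrib)
    hence "norm (\<sigma> (\<alpha> ^ p * x) - of_real (z \<sigma>)) = norm (\<sigma> \<alpha>) ^ p * norm (\<sigma> x - y \<sigma>)"
      by (simp add: norm_mult norm_power)
    also have "\<dots> \<le> a ^ p * R" using \<alpha>(3,5) x(2)[OF \<sigma>'] \<sigma> by (intro mult_mono power_mono) auto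
    also have "\<dots> < \<epsilon>" using p R(1) by (simp add: field_simps)
    finally have "norm (\<sigma> (\<alpha> ^ p * x) - of_real (z \<sigma>)) < \<epsilon>" .
    moreover have "\<bar>Re (\<sigma> (\<alpha> ^ p * x)) - z \<sigma>\<bar> \<le> norm (\<sigma> (\<alpha> ^ p * x) - of_real (z \<sigma>))"
      using abs_Re_le_cmod[of "\<sigma> (\<alpha> ^ p * x) - of_real (z \<sigma>)"] by simp
    ultimately show ?thesis by linarith
  qed
  thus thesis using that[of "\<alpha> ^ p * x"] \<alpha>(1) x(1) by blast
qed

end

section \<open>Sums of squares of integers of the field\<close>

definition sum_sq :: "'a::comm_ring_1 set \<Rightarrow> nat \<Rightarrow> 'a \<Rightarrow> bool" where
  "sum_sq A m f \<longleftrightarrow> (\<exists>x. (\<forall>i<m. x i \<in> A) \<and> f = (\<Sum>i<m. (x i)\<^sup>2))"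

lemma sum_sqI: "(\<And>i. i < m \<Longrightarrow> x i \<in> A) \<Longrightarrow> f = (\<Sum>i<m. (x i)\<^sup>2) \<Longrightarrow> sum_sq A m f"
  unfolding sum_sq_def by blast

lemma sum_sq_zero [simp]: "0 \<in> A \<Longrightarrow> sum_sq A m 0"
  by (rule sum_sqI[of _ "\<lambda>_. 0"]) auto

lemma sum_sq_square: "x \<in> A \<Longrightarrow> sum_sq A 1 (x\<^sup>2)"
  by (rule sum_sqI[of _ "\<lambda>_. x"]) auto

lemma sum_lessThan_append:
  fixes m n :: nat
  shows "(\<Sum>i<m + n. if i < m then a i else b (i - m)) = (\<Sum>i<m. a i) + (\<Sum>i<n. b i :: 'a::comm_monoid_add)"
  by (induction n) (auto simp: add.assoc)

lemma sum_sq_add: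
  assumes "sum_sq A m f" "sum_sq A n g"
  shows "sum_sq A (m + n) (f + g)"
proof -
  obtain x y where x: "\<forall>i<m. x i \<in> A" "f = (\<Sum>i<m. (x i)\<^sup>2)" and y: "\<forall>i<n. y i \<in> A" "g = (\<Sum>i<n. (y i)\<^sup>2)"
    using assms unfolding sum_sq_def by blast
  have "f + g = (\<Sum>i<m + n. (if i < m then x i else y (i - m))\<^sup>2)"
    unfolding x(2) y(2) sum_lessThan_append[symmetric] by (intro sum.cong) auto
  thus ?thesis using x(1) y(1) by (intro sum_sqI[of _ "\<lambda>i. if i < m then x i else y (i - m)"]) auto
qed

lemma sum_sq_mono:
  assumes "sum_sq A m f" "m \<le> n" "0 \<in> A"
  shows "sum_sq A n f"
  using sum_sq_add[OF assms(1) sum_sq_zero[OF assms(3), of "n - m"]] assms(2) by simp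

lemma sum_sq_mult_square:
  assumes "sum_sq A m f" "y \<in> A" "\<And>x y. x \<in> A \<Longrightarrow> y \<in> A \<Longrightarrow> x * y \<in> A"
  shows "sum_sq A m (y\<^sup>2 * f)"
proof -
  obtain x where x: "\<forall>i<m. x i \<in> A" "f = (\<Sum>i<m. (x i)\<^sup>2)"
    using assms unfolding sum_sq_def by blast
  thus ?thesis using assms(2,3)
    by (intro sum_sqI[of _ "\<lambda>i. y * x i"]) (auto simp: sum_distrib_left power_mult_distrib)
qed

lemma sum_sq_mult:
  assumes f: "sum_sq A m f" and g: "sum_sq A n g" and A: "\<And>x y. x \<in> A \<Longrightarrow> y \<in> A \<Longrightarrow> x * y \<in> A"
  shows "sum_sq A (n * m) (f * g)"
proof -
  obtain y where y: "\<forall>i<n. y i \<in> A" "g = (\<Sum>i<n. (y i)\<^sup>2)"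
    using g unfolding sum_sq_def by blast
  have "sum_sq A (k * m) (f * (\<Sum>i<k. (y i)\<^sup>2))" if "k \<le> n" for k
    using that
  proof (induction k)
    case 0
    show ?case by (simp add: sum_sq_def)
  next
    case (Suc k)
    have "sum_sq A (m + k * m) ((y k)\<^sup>2 * f + f * (\<Sum>i<k. (y i)\<^sup>2))"
      using Suc y by (intro sum_sq_add sum_sq_mult_square f A) auto
    thus ?case by (simp add: algebra_simps)
  qed
  thus ?thesis using y by simp
qed

lemma sum_sq_sum:
  assumes "finite I" "\<And>i. i \<in> I \<Longrightarrow> sum_sq A m (f i)"
  shows "sum_sq A (card I * m) (sum f I)"
  using assms
proof (induction I rule: finite_induct)
  case empty
  show ?case by (simp add: sum_sq_def)
next
  case (insert x I)
  thus ?case using sum_sq_add[of A m "f x" "card I * m" "sum f I"] by simp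
qed

lemma sum_sq_of_nat: "sum_sq (ring_of_integers :: 'a::field_char_0 set) 4 (of_nat n)"
proof -
  obtain a b c d :: int where "int n = a\<^sup>2 + b\<^sup>2 + c\<^sup>2 + d\<^sup>2"
    using lagrange_four_squares by blast
  hence "(of_int (int n) :: 'a) = (of_int a)\<^sup>2 + (of_int b)\<^sup>2 + (of_int c)\<^sup>2 + (of_int d)\<^sup>2"
    by simp
  moreover have "sum_sq (ring_of_integers :: 'a set) (1 + 1 + 1 + 1) ((of_int a)\<^sup>2 + (of_int b)\<^sup>2 + (of_int c)\<^sup>2 + (of_int d)\<^sup>2)"
    by (intro sum_sq_add sum_sq_square roi_of_int)
  moreover have "(1 + 1 + 1 + 1 :: nat) = 4" by simp
  ultimately show ?thesis by (metis of_int_of_nat_eq)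
qed

subsection \<open>Sums of squares are bounded below\<close>

definition is_sos :: "'a::comm_ring_1 \<Rightarrow> bool" where
  "is_sos f \<longleftrightarrow> (\<exists>m. sum_sq UNIV m f)"

lemma is_sos_add: "is_sos f \<Longrightarrow> is_sos g \<Longrightarrow> is_sos (f + g)"
  unfolding is_sos_def using sum_sq_add by blast

lemma is_sos_mult: "is_sos f \<Longrightarrow> is_sos g \<Longrightarrow> is_sos (f * g)"
  unfolding is_sos_def using sum_sq_mult by blast

lemma is_sos_square: "is_sos (x\<^sup>2)"
  unfolding is_sos_def using sum_sq_square by blast

lemma is_sos_of_nat: "is_sos (of_nat n)"
proof (induction n)
  case 0
  show ?case using is_sos_square[of 0] by simp
next
  case (Suc n)
  thus ?case using is_sos_add[OF is_sos_square[of 1]] by simp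
qed

text \<open>Boundedness for the preordering whose positive elements are the sums of squares in the
  field. It leads to identities that write \<open>M - y\<^sup>2\<close> as a sum of squares.\<close>

definition order_bounded :: "'a::field_char_0 \<Rightarrow> bool" where
  "order_bounded x \<longleftrightarrow> (\<exists>M::nat. is_sos (of_nat M - x) \<and> is_sos (of_nat M + x))"

lemma order_bounded_add: "order_bounded x \<Longrightarrow> order_bounded y \<Longrightarrow> order_bounded (x + y)"
proof -
  assume "order_bounded x" "order_bounded y"
  then obtain M N :: nat where "is_sos (of_nat M - x)" "is_sos (of_nat M + x)" "is_sos (of_nat N - y)" "is_sos (of_nat N + y)"
    unfolding order_bounded_def by blast
  hence "is_sos ((of_nat M - x) + (of_nat N - y))" "is_sos ((of_nat M + x) + (of_nat N + y))"
    by (auto intro: is_sos_add)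
  thus ?thesis unfolding order_bounded_def by (intro exI[of _ "M + N"]) (simp add: algebra_simps)
qed

lemma order_bounded_minus: "order_bounded x \<Longrightarrow> order_bounded (- x)"
  unfolding order_bounded_def by auto

lemma order_bounded_of_int: "order_bounded (of_int k)"
proof -
  have "is_sos (of_nat (nat (\<bar>k\<bar> - k)))" "is_sos (of_nat (nat (\<bar>k\<bar> + k)))" by (rule is_sos_of_nat)+
  hence "is_sos (of_nat (nat \<bar>k\<bar>) - of_int k)" "is_sos (of_nat (nat \<bar>k\<bar>) + of_int k)"
    by (cases "k \<ge> 0"; simp)+
  thus ?thesis unfolding order_bounded_def by blast
qed

lemma order_bounded_square: "order_bounded x \<Longrightarrow> order_bounded (x\<^sup>2)"
proof -
  assume "order_bounded x"
  then obtain M :: nat where M: "is_sos (of_nat M - x)" "is_sos (of_nat M + x)"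
    unfolding order_bounded_def by blast
  have "is_sos ((of_nat M - x) * (of_nat M + x))" by (rule is_sos_mult[OF M])
  moreover have "is_sos (of_nat (M * M) + x\<^sup>2)" by (intro is_sos_add is_sos_of_nat is_sos_square)
  ultimately show ?thesis unfolding order_bounded_def
    by (intro exI[of _ "M * M"]) (simp add: algebra_simps power2_eq_square)
qed

lemma order_bounded_divide:
  fixes x :: "'a::field_char_0"
  assumes "order_bounded x" "N > 0"
  shows "order_bounded (x / of_nat N)"
proof -
  obtain M :: nat where M: "is_sos (of_nat M - x)" "is_sos (of_nat M + x)"
    using assms(1) unfolding order_bounded_def by blast
  have *: "is_sos (of_nat M - y / of_nat N)" if "is_sos (of_nat M - y)" for y :: 'a
  proof -
    have "is_sos ((1 / of_nat N)\<^sup>2 * (of_nat N * (of_nat M - y) + of_nat (N * M * (N - 1))))"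
      by (intro is_sos_mult is_sos_add is_sos_square is_sos_of_nat that)
    moreover have "(1 / of_nat N)\<^sup>2 * (of_nat N * (of_nat M - y) + of_nat (N * M * (N - 1))) = of_nat M - y / of_nat N"
      using assms(2) by (simp add: power2_eq_square of_nat_diff field_simps)
    ultimately show ?thesis by simp
  qed
  from *[of x] *[of "- x"] M show ?thesis unfolding order_bounded_def by auto
qed

lemma order_bounded_mult:
  assumes "order_bounded x" "order_bounded y"
  shows "order_bounded (x * y)"
proof -
  have "order_bounded (((x + y)\<^sup>2 + - ((x + - y)\<^sup>2)) / of_nat 4)"
    by (intro order_bounded_divide order_bounded_add order_bounded_minus order_bounded_square assms) simp
  moreover have "((x + y)\<^sup>2 + - ((x + - y)\<^sup>2)) / of_nat 4 = x * y"
    by (simp add: power2_eq_square algebra_simps)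
  ultimately show ?thesis by simp
qed

lemma order_bounded_power: "order_bounded x \<Longrightarrow> order_bounded (x ^ n)"
  by (induction n) (auto intro: order_bounded_mult simp: order_bounded_of_int[of 1, simplified])

lemma order_bounded_sum: "(\<And>i. i \<in> I \<Longrightarrow> order_bounded (f i)) \<Longrightarrow> order_bounded (sum f I)"
  by (induction I rule: infinite_finite_induct) (auto intro: order_bounded_add simp: order_bounded_of_int[of 0, simplified])

text \<open>With \<open>u = 1 / (1 + y\<^sup>2)\<close> one has
  \<open>u = u\<^sup>2 + (u * y)\<^sup>2\<close> and
  \<open>1 - u = (y * u)\<^sup>2 + (y\<^sup>2 * u)\<^sup>2\<close>, so in this preordering
  \<open>u\<close> lies between 0 and 1.\<close>

lemma order_bounded_inverse_one_plus_square:
  fixes y :: "'a::field_char_0"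
  assumes "1 + y\<^sup>2 \<noteq> 0"
  shows "order_bounded (1 / (1 + y\<^sup>2))"
proof -
  define u where "u = 1 / (1 + y\<^sup>2)"
  have u: "u * (1 + y\<^sup>2) = 1" using assms by (simp add: u_def)
  have yu: "y\<^sup>2 * u = 1 - u" using u by (simp add: algebra_simps eq_diff_eq)
  have "1 - u = (y * u)\<^sup>2 + (y\<^sup>2 * u)\<^sup>2"
  proof -
    have "(y * u)\<^sup>2 + (y\<^sup>2 * u)\<^sup>2 = (y\<^sup>2 * u) * (u * (1 + y\<^sup>2))" by (simp add: power2_eq_square algebra_simps)
    also have "\<dots> = 1 - u" by (simp only: u yu mult_1_right)
    finally show ?thesis by (rule sym)
  qed
  hence 1: "is_sos (1 - u)" by (simp add: is_sos_add is_sos_square)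
  have "u = u\<^sup>2 + (u * y)\<^sup>2"
  proof -
    have "u\<^sup>2 + (u * y)\<^sup>2 = u * (u * (1 + y\<^sup>2))" by (simp add: power2_eq_square algebra_simps)
    also have "\<dots> = u" by (simp only: u mult_1_right)
    finally show ?thesis by (rule sym)
  qed
  hence "is_sos u" by (metis is_sos_add is_sos_square)
  hence "is_sos (1\<^sup>2 + u)" by (intro is_sos_add is_sos_square)
  thus ?thesis unfolding order_bounded_def u_def[symmetric] using 1 by (intro exI[of _ 1]) simp
qed

text \<open>The order bounded elements form a subring that contains every \<open>1 / (1 + y\<^sup>2)\<close>; as the field
  is algebraic, the subring is a field and so contains \<open>1 + y\<^sup>2\<close> too.\<close>

lemma order_bounded_one_plus_square:
  fixes y :: "'k::field_char_0"
  assumes nf: "number_field TYPE('k)"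
  shows "order_bounded (1 + y\<^sup>2)"
proof (cases "1 + y\<^sup>2 = 0")
  case True
  thus ?thesis using order_bounded_of_int[of 0] by simp
next
  case False
  define u where "u = 1 / (1 + y\<^sup>2)"
  have u: "order_bounded u" unfolding u_def by (rule order_bounded_inverse_one_plus_square[OF False])
  obtain N :: int where N: "N > 0" "of_int N * (1 + y\<^sup>2) \<in> ring_of_integers" using integer_multiple[OF nf] by blast
  define w where "w = of_int N * (1 + y\<^sup>2)"
  have w0: "w \<noteq> 0" using False N(1) by (simp add: w_def)
  have "1 / w = u / of_nat (nat N)" using N(1) by (simp add: u_def w_def)
  hence iw: "order_bounded (1 / w)" using order_bounded_divide[OF u, of "nat N"] N(1) by simp
  have "algebraic_int w" using N(2) by (simp add: ring_of_integers_iff w_def)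
  then obtain a M where a: "a > 0" and M: "\<And>i. i < a \<Longrightarrow> w * w ^ i = (\<Sum>j<a. of_int (M i j) * w ^ j)"
    using algebraic_int_power_basis by metis
  have "w * w ^ (a - 1) = (\<Sum>j<a. of_int (M (a - 1) j) * w ^ j)" using M[of "a - 1"] a by simp
  \<comment> \<open>The integral equation divided by \<open>w ^ (a - 1)\<close> writes
    \<open>w\<close> as an integer polynomial in \<open>1 / w\<close>, which is already known to be
    bounded.\<close>
  hence "w = (\<Sum>j<a. of_int (M (a - 1) j) * w ^ j) / w ^ (a - 1)" using w0 by (simp add: field_simps)
  also have "\<dots> = (\<Sum>j<a. of_int (M (a - 1) j) * (1 / w) ^ (a - 1 - j))"
    unfolding sum_divide_distrib
  proof (intro sum.cong refl)
    fix j assume "j \<in> {..<a}"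
    hence "w ^ (a - 1) = w ^ j * w ^ (a - 1 - j)" by (simp flip: power_add)
    thus "of_int (M (a - 1) j) * w ^ j / w ^ (a - 1) = of_int (M (a - 1) j) * (1 / w) ^ (a - 1 - j)"
      using w0 by (simp add: power_one_over divide_simps)
  qed
  also have "order_bounded \<dots>"
    by (intro order_bounded_sum order_bounded_mult order_bounded_of_int order_bounded_power iw)
  finally have "order_bounded (w / of_nat (nat N))" using N(1) by (intro order_bounded_divide) auto
  thus ?thesis using N(1) by (simp add: w_def)
qed

context
  assumes nf: "number_field TYPE('k::field_char_0)"
begin

text \<open>Squares in the field have denominators; clearing them multiplies the difference by a
  square integer \<open>k\<close>. Adding \<open>(k - 1) * y\<^sup>2\<close> brings the coefficient
  of \<open>y\<^sup>2\<close> back to \<open>- 1\<close>, at the price of four more squares.\<close>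

lemma nat_minus_square_sum_sq:
  fixes y :: 'k
  assumes y: "y \<in> ring_of_integers"
  shows "\<exists>M m. sum_sq ring_of_integers m (of_nat M - y\<^sup>2)"
proof -
  obtain M0 :: nat where "is_sos (of_nat M0 - (1 + y\<^sup>2))"
    using order_bounded_one_plus_square[OF nf, of y] unfolding order_bounded_def by blast
  hence "is_sos (of_nat M0 - (1 + y\<^sup>2) + 1\<^sup>2)" by (intro is_sos_add is_sos_square)
  then obtain m :: nat and x where "of_nat M0 - (1 + y\<^sup>2) + 1\<^sup>2 = (\<Sum>i<m. (x i)\<^sup>2)"
    unfolding is_sos_def sum_sq_def by blast
  hence x: "of_nat M0 - y\<^sup>2 = (\<Sum>i<m. (x i)\<^sup>2)" by simp
  have "\<exists>N::int. N > 0 \<and> (\<forall>i<m. of_int N * x i \<in> ring_of_integers)"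
  proof (induction m)
    case 0
    show ?case by (intro exI[of _ 1]) simp
  next
    case (Suc m)
    then obtain N where N: "N > 0" "\<forall>i<m. of_int N * x i \<in> ring_of_integers" by blast
    obtain N' where N': "N' > 0" "of_int N' * x m \<in> ring_of_integers" using integer_multiple[OF nf] by blast
    have "of_int (N * N') * x i \<in> ring_of_integers" if "i < Suc m" for i
    proof (cases "i = m")
      case True
      have "of_int N * (of_int N' * x m) \<in> ring_of_integers" by (rule roi_mult[OF roi_of_int N'(2)])
      moreover have "of_int (N * N') * x i = of_int N * (of_int N' * x m)"
        by (simp only: True of_int_mult mult.assoc)
      ultimately show ?thesis by (simp only:)
    next
      case False
      hence "of_int N * x i \<in> ring_of_integers" using N(2) that by simp
      hence "of_int N' * (of_int N * x i) \<in> ring_of_integers" by (rule roi_mult[OF roi_of_int])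
      moreover have "of_int (N * N') * x i = of_int N' * (of_int N * x i)"
        by (simp only: of_int_mult mult.commute[of "of_int N"] mult.assoc)
      ultimately show ?thesis by (simp only:)
    qed
    thus ?case using N(1) N'(1) by (intro exI[of _ "N * N'"]) simp
  qed
  then obtain N :: int where N: "N > 0" "\<And>i. i < m \<Longrightarrow> of_int N * x i \<in> ring_of_integers" by blast
  define k where "k = nat (N\<^sup>2)"
  have k: "(of_nat k :: 'k) = (of_int N)\<^sup>2" "k \<ge> 1" using N(1) zero_less_power[of N 2] by (simp_all add: k_def Suc_le_eq del: zero_less_power)
  have "sum_sq ring_of_integers m (of_nat k * (of_nat M0 - y\<^sup>2))"
    using N(2) by (intro sum_sqI[of _ "\<lambda>i. of_int N * x i"]) (auto simp: x k sum_distrib_left power_mult_distrib)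
  moreover have "sum_sq ring_of_integers 4 (y\<^sup>2 * of_nat (k - 1))"
    by (intro sum_sq_mult_square sum_sq_of_nat y) auto
  ultimately have "sum_sq ring_of_integers (m + 4) (of_nat k * (of_nat M0 - y\<^sup>2) + y\<^sup>2 * of_nat (k - 1))"
    by (rule sum_sq_add)
  moreover have "of_nat k * (of_nat M0 - y\<^sup>2) + y\<^sup>2 * of_nat (k - 1) = of_nat (k * M0) - y\<^sup>2"
    using k(2) by (simp add: of_nat_diff algebra_simps)
  ultimately have "sum_sq ring_of_integers (m + 4) (of_nat (k * M0) - y\<^sup>2)" by (simp only:)
  thus ?thesis by blast
qed

text \<open>Uses \<open>M - w\<^sup>2 + (w \<plusminus> 1)\<^sup>2 = M + 1 \<plusminus> 2 *
  w\<close>, which works without any assumption modulo 2 because only even multiples appear.\<close>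

lemma nat_plus_double_sum_sq:
  fixes w :: 'k
  assumes w: "w \<in> ring_of_integers"
  shows "\<exists>M m. sum_sq ring_of_integers m (of_nat M + 2 * w) \<and> sum_sq ring_of_integers m (of_nat M - 2 * w)"
proof -
  obtain M m where M: "sum_sq ring_of_integers m (of_nat M - w\<^sup>2)" using nat_minus_square_sum_sq[OF w] by blast
  have "sum_sq ring_of_integers (m + 1) (of_nat M - w\<^sup>2 + (w + 1)\<^sup>2)"
    "sum_sq ring_of_integers (m + 1) (of_nat M - w\<^sup>2 + (w - 1)\<^sup>2)"
    using w by (intro sum_sq_add M sum_sq_square; auto)+
  moreover have "of_nat M - w\<^sup>2 + (w + 1)\<^sup>2 = of_nat (M + 1) + 2 * w" "of_nat M - w\<^sup>2 + (w - 1)\<^sup>2 = of_nat (M + 1) - 2 * w"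
    by (simp_all add: power2_eq_square algebra_simps)
  ultimately show ?thesis by metis
qed

subsection \<open>Large integers\<close>

text \<open>The principal root does not commute with conjugation on the negative real axis. So one
  member of each conjugate pair uses \<open>csqrt\<close> and the other its conjugate, told apart by
  the sign of the imaginary part at an element \<open>x \<sigma>\<close> common to both; at real
  embeddings nonnegativity makes the root real.\<close>

lemma symmetric_square_root:
  fixes u :: "('k \<Rightarrow> complex) \<Rightarrow> complex"
  assumes sym: "\<And>\<sigma>. \<sigma> \<in> embeddings \<Longrightarrow> u (conj_emb \<sigma>) = cnj (u \<sigma>)"
    and real: "\<And>\<sigma>. \<sigma> \<in> real_embeddings \<Longrightarrow> 0 \<le> Re (u \<sigma>)"
  obtains z where "\<And>\<sigma>. \<sigma> \<in> embeddings \<Longrightarrow> z (conj_emb \<sigma>) = cnj (z \<sigma>)" "\<And>\<sigma>. (z \<sigma>)\<^sup>2 = u \<sigma>"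
proof -
  define x where "x \<sigma> = (SOME x. Im (\<sigma> x) \<noteq> 0)" for \<sigma> :: "'k \<Rightarrow> complex"
  have x_conj: "x (conj_emb \<sigma>) = x \<sigma>" for \<sigma> by (simp add: x_def)
  define z where "z \<sigma> = (if Im (\<sigma> (x \<sigma>)) \<ge> 0 then csqrt (u \<sigma>) else cnj (csqrt (cnj (u \<sigma>))))" for \<sigma>
  have "(z \<sigma>)\<^sup>2 = u \<sigma>" for \<sigma> by (simp add: z_def flip: complex_cnj_power)
  moreover have "z (conj_emb \<sigma>) = cnj (z \<sigma>)" if \<sigma>: "\<sigma> \<in> embeddings" for \<sigma>
  proof (cases "\<sigma> \<in> real_embeddings")
    case True
    have "Im (u \<sigma>) = 0" using sym[OF \<sigma>] real_embeddings_conj[OF True] by (simp add: complex_eq_iff)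
    hence "u \<sigma> = of_real (Re (u \<sigma>))" by (simp add: complex_eq_iff)
    hence "csqrt (u \<sigma>) = of_real (sqrt (Re (u \<sigma>)))" using real[OF True] \<open>Im (u \<sigma>) = 0\<close> by (intro csqrt_of_real_nonneg)
    thus ?thesis using real_embeddings_conj[OF True] real_embeddings_Im[OF True] by (simp add: z_def)
  next
    case False
    hence "\<exists>x. Im (\<sigma> x) \<noteq> 0" using \<sigma> by (auto simp: real_embeddings_def complex_is_Real_iff)
    hence "Im (\<sigma> (x \<sigma>)) \<noteq> 0" unfolding x_def by (rule someI_ex)
    thus ?thesis using sym[OF \<sigma>] by (auto simp: z_def x_conj)
  qed
  ultimately show thesis using that by blast
qed

text \<open>An integer within the covering radius of a root \<open>z\<close> of \<open>u\<close>
  satisfies \<open>(\<sigma> x)\<^sup>2 - u \<sigma> = (\<sigma> x - z \<sigma>) * (2 * z \<sigma> +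
  (\<sigma> x - z \<sigma>))\<close>. The error grows only like the root of \<open>u\<close>, so
  subtracting a square roughly halves the exponent of the size.\<close>

lemma approximate_square_root:
  "\<exists>R\<ge>1. \<forall>u. (\<forall>\<sigma>\<in>(embeddings :: ('k \<Rightarrow> complex) set). u (conj_emb \<sigma>) = cnj (u \<sigma>)) \<longrightarrow>
      (\<forall>\<sigma>\<in>real_embeddings. 0 \<le> Re (u \<sigma>)) \<longrightarrow>
      (\<exists>x\<in>ring_of_integers. \<forall>\<sigma>\<in>embeddings. norm ((\<sigma> x)\<^sup>2 - u \<sigma>) \<le> R * (2 * sqrt (norm (u \<sigma>)) + R))"
proof -
  obtain R :: real where R: "R \<ge> 1"
    "\<And>z. (\<And>\<sigma> :: 'k \<Rightarrow> complex. \<sigma> \<in> embeddings \<Longrightarrow> z (conj_emb \<sigma>) = cnj (z \<sigma>)) \<Longrightarrow>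
      \<exists>x\<in>ring_of_integers. \<forall>\<sigma>\<in>embeddings. norm (\<sigma> (x :: 'k) - z \<sigma>) \<le> R"
    using integral_covering[OF nf] by blast
  show ?thesis
  proof (intro exI[of _ R] conjI allI impI R(1))
    fix u :: "('k \<Rightarrow> complex) \<Rightarrow> complex"
    assume u: "\<forall>\<sigma>\<in>embeddings. u (conj_emb \<sigma>) = cnj (u \<sigma>)" "\<forall>\<sigma>\<in>real_embeddings. 0 \<le> Re (u \<sigma>)"
    obtain z where z: "\<And>\<sigma>. \<sigma> \<in> embeddings \<Longrightarrow> z (conj_emb \<sigma>) = cnj (z \<sigma>)" "\<And>\<sigma>. (z \<sigma>)\<^sup>2 = u \<sigma>"
      using symmetric_square_root[of u] u by blast
    obtain x where x: "x \<in> ring_of_integers" "\<And>\<sigma>. \<sigma> \<in> embeddings \<Longrightarrow> norm (\<sigma> x - z \<sigma>) \<le> R"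
      using R(2)[of z] z(1) by blast
    have "norm ((\<sigma> x)\<^sup>2 - u \<sigma>) \<le> R * (2 * sqrt (norm (u \<sigma>)) + R)" if \<sigma>: "\<sigma> \<in> embeddings" for \<sigma>
    proof -
      have nz: "norm (z \<sigma>) = sqrt (norm (u \<sigma>))" by (simp add: z(2)[symmetric] norm_power)
      have "(\<sigma> x)\<^sup>2 - u \<sigma> = (\<sigma> x - z \<sigma>) * (2 * z \<sigma> + (\<sigma> x - z \<sigma>))"
        by (simp add: z(2)[symmetric] power2_eq_square algebra_simps)
      hence "norm ((\<sigma> x)\<^sup>2 - u \<sigma>) = norm (\<sigma> x - z \<sigma>) * norm (2 * z \<sigma> + (\<sigma> x - z \<sigma>))" by (simp add: norm_mult)
      also have "\<dots> \<le> R * (norm (2 * z \<sigma>) + norm (\<sigma> x - z \<sigma>))"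
        using x(2)[OF \<sigma>] R(1) by (intro mult_mono norm_triangle_ineq) auto
      also have "\<dots> \<le> R * (2 * sqrt (norm (u \<sigma>)) + R)"
        using x(2)[OF \<sigma>] R(1) by (intro mult_left_mono add_mono) (auto simp: norm_mult nz)
      finally show ?thesis .
    qed
    thus "\<exists>x\<in>ring_of_integers. \<forall>\<sigma>\<in>embeddings. norm ((\<sigma> x)\<^sup>2 - u \<sigma>) \<le> R * (2 * sqrt (norm (u \<sigma>)) + R)"
      using x(1) by blast
  qed
qed

end

text \<open>\<open>E\<close> measures how far the upper bound may exceed the lower bound at the real
  embeddings. The exponent 4 leaves room for the base case: a square approximates a number of size
  \<open>h ^ 6\<close> up to an error of order \<open>h ^ 3\<close>, which \<open>h ^ 4\<close>
  dominates.\<close>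

definition large_sum_sq :: "'k::field_char_0 itself \<Rightarrow> nat \<Rightarrow> nat \<Rightarrow> bool" where
  "large_sum_sq _ m E \<longleftrightarrow> (\<exists>H. \<forall>h::real. h \<ge> H \<longrightarrow> (\<forall>f::'k. f \<in> ring_of_integers \<longrightarrow>
     (\<forall>\<sigma>\<in>real_embeddings. h ^ 4 \<le> Re (\<sigma> f)) \<longrightarrow> (\<forall>\<sigma>\<in>embeddings. norm (\<sigma> f) \<le> h ^ E) \<longrightarrow>
     sum_sq ring_of_integers m f))"

context
  assumes nf: "number_field TYPE('k::field_char_0)"
    and sq: "\<And>x::'k. x \<in> ring_of_integers \<Longrightarrow> \<exists>s\<in>ring_of_integers. \<exists>w\<in>ring_of_integers. x = s\<^sup>2 + 2 * w"
begin

text \<open>Subtract a square close to \<open>f - h\<^sup>4 / 2\<close> at all embeddings. What remains is a large natural number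
  plus a comparatively small integer, whose coordinates are absorbed by the sums of squares \<open>M \<plusminus> 2 w\<^sub>j\<close>.\<close>

lemma large_sum_sq_base: "\<exists>m. large_sum_sq TYPE('k) m 6"
proof -
  obtain d and w :: "nat \<Rightarrow> 'k" and C :: real where C: "C > 0" and w0: "\<forall>j<d. w j \<in> ring_of_integers"
    and coord0: "\<forall>x M. x \<in> ring_of_integers \<longrightarrow> (\<forall>\<sigma>\<in>embeddings. norm (\<sigma> x) \<le> M) \<longrightarrow>
      (\<exists>q::nat \<Rightarrow> int. x = (\<Sum>j<d. of_int (q j) * w j) \<and> (\<forall>j<d. of_int \<bar>q j\<bar> \<le> C * M))"
    using integral_coordinates_bound[OF nf] by (elim exE conjE)
  note w = w0[rule_format] and coord = coord0[rule_format]
  obtain R :: real where R: "R \<ge> 1" and "\<forall>u. (\<forall>\<sigma>\<in>(embeddings :: ('k \<Rightarrow> complex) set). u (conj_emb \<sigma>) = cnj (u \<sigma>)) \<longrightarrow>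
      (\<forall>\<sigma>\<in>real_embeddings. 0 \<le> Re (u \<sigma>)) \<longrightarrow>
      (\<exists>x\<in>ring_of_integers. \<forall>\<sigma>\<in>embeddings. norm ((\<sigma> x)\<^sup>2 - u \<sigma>) \<le> R * (2 * sqrt (norm (u \<sigma>)) + R))"
    using approximate_square_root[OF nf] by (elim exE conjE)
  note root = this(2)[rule_format]
  have fin: "finite (embeddings :: ('k \<Rightarrow> complex) set)" by (rule finite_embeddings[OF nf])
  \<comment> \<open>Up to even multiples the remainder \<open>e\<close> will be the sum of the
    \<open>w j\<close> over the set \<open>J\<close> of odd coordinates. There are finitely many
    \<open>J\<close>, so a square plus an even integer can be fixed for each, with the squares
    bounded by a constant \<open>T\<close>.\<close>
  have "\<forall>J. \<exists>p. J \<subseteq> {..<d} \<longrightarrow> fst p \<in> ring_of_integers \<and> snd p \<in> ring_of_integers \<and> (\<Sum>j\<in>J. w j) = (fst p)\<^sup>2 + 2 * snd p"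
  proof
    fix J
    show "\<exists>p. J \<subseteq> {..<d} \<longrightarrow> fst p \<in> ring_of_integers \<and> snd p \<in> ring_of_integers \<and> (\<Sum>j\<in>J. w j) = (fst p)\<^sup>2 + 2 * snd p"
    proof (cases "J \<subseteq> {..<d}")
      case True
      hence "(\<Sum>j\<in>J. w j) \<in> ring_of_integers" by (intro roi_sum w) auto
      from sq[OF this] show ?thesis by force
    qed simp
  qed
  from choice[OF this] obtain p where p: "\<And>J. J \<subseteq> {..<d} \<Longrightarrow> fst (p J) \<in> ring_of_integers"
    "\<And>J. J \<subseteq> {..<d} \<Longrightarrow> snd (p J) \<in> ring_of_integers"
    "\<And>J. J \<subseteq> {..<d} \<Longrightarrow> (\<Sum>j\<in>J. w j) = (fst (p J))\<^sup>2 + 2 * snd (p J)" by blast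
  define T where "T = 1 + (\<Sum>J\<in>Pow {..<d}. \<Sum>\<sigma>\<in>embeddings. norm (\<sigma> (fst (p J))) ^ 2)"
  have T: "norm (\<sigma> (fst (p J))) ^ 2 \<le> T" if "J \<subseteq> {..<d}" "\<sigma> \<in> embeddings" for J \<sigma>
  proof -
    have "norm (\<sigma> (fst (p J))) ^ 2 \<le> (\<Sum>\<sigma>\<in>embeddings. norm (\<sigma> (fst (p J))) ^ 2)"
      using that fin by (intro member_le_sum[of \<sigma> embeddings "\<lambda>\<sigma>. norm (\<sigma> (fst (p J))) ^ 2"]) auto
    also have "\<dots> \<le> (\<Sum>J\<in>Pow {..<d}. \<Sum>\<sigma>\<in>embeddings. norm (\<sigma> (fst (p J))) ^ 2)"
      using that by (intro member_le_sum[of J "Pow {..<d}" "\<lambda>J. \<Sum>\<sigma>\<in>embeddings. norm (\<sigma> (fst (p J))) ^ 2"]) (auto intro: sum_nonneg)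
    finally show ?thesis by (simp add: T_def)
  qed
  have "T \<ge> 1" by (auto simp: T_def intro!: sum_nonneg)
  have "\<forall>j. \<exists>q. j < d \<longrightarrow> sum_sq ring_of_integers (snd q) (of_nat (fst q) + 2 * w j) \<and>
      sum_sq ring_of_integers (snd q) (of_nat (fst q) - 2 * w j)"
    using nat_plus_double_sum_sq[OF nf w] by fastforce
  from choice[OF this] obtain q where q:
    "\<And>j. j < d \<Longrightarrow> sum_sq ring_of_integers (snd (q j)) (of_nat (fst (q j)) + 2 * w j)"
    "\<And>j. j < d \<Longrightarrow> sum_sq ring_of_integers (snd (q j)) (of_nat (fst (q j)) - 2 * w j)" by blast
  define M where "M j = fst (q j)" for j
  define m1 where "m1 = (\<Sum>j<d. snd (q j))"
  have m1: "snd (q j) \<le> m1" if "j < d" for j unfolding m1_def using that by (intro member_le_sum) auto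
  have q': "sum_sq ring_of_integers m1 (of_nat (M j) + 2 * w j)" "sum_sq ring_of_integers m1 (of_nat (M j) - 2 * w j)"
    if "j < d" for j
    unfolding M_def using q[OF that] m1[OF that] by (auto intro: sum_sq_mono)
  define A where "A = real (\<Sum>j<d. M j)"
  \<comment> \<open>In units of \<open>h ^ 3\<close>, \<open>4 * R + R\<^sup>2\<close> bounds the
    remainder and \<open>T\<close> the square removed from it. \<open>H\<close> ensures that the
    natural number \<open>N\<close> spent on the coordinates, at most
    \<open>A * C * K * h ^ 3\<close>, does not exceed \<open>h ^ 4 / 2 - 1\<close> and hence not
    \<open>l\<close>.\<close>
  define K where "K = 4 * R + R\<^sup>2 + T"
  define H where "H = 2 * (A * C * K) + 2"
  have K: "K > 0" using R \<open>T \<ge> 1\<close> by (auto simp: K_def intro!: add_pos_pos)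
  have A: "A \<ge> 0" by (simp add: A_def sum_nonneg)
  \<comment> \<open>One square near \<open>f - l\<close>, one for \<open>J\<close>, four for
    \<open>l - N\<close>, and for each basis element the \<open>m1\<close> squares of
    \<open>y j\<close> times four squares for its multiplicity.\<close>
  define m where "m = 1 + 1 + 4 + d * (m1 * 4)"
  have main: "sum_sq ring_of_integers m f"
    if h: "h \<ge> H" and f: "f \<in> ring_of_integers" and fr: "\<And>\<sigma>. \<sigma> \<in> real_embeddings \<Longrightarrow> h ^ 4 \<le> Re (\<sigma> f)"
      and fm: "\<And>\<sigma>. \<sigma> \<in> embeddings \<Longrightarrow> norm (\<sigma> f) \<le> h ^ 6" for h :: real and f :: 'k
  proof -
    have h1: "h \<ge> 1" using h A C K unfolding H_def by (smt (verit) mult_nonneg_nonneg)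
    define l where "l = nat \<lfloor>h ^ 4 / 2\<rfloor>"
    have h4: "h ^ 4 \<ge> 1" using h1 by (rule one_le_power)
    have l: "real l \<le> h ^ 4 / 2" "real l \<ge> h ^ 4 / 2 - 1" using h4 by (simp_all add: l_def) linarith+
    have "h ^ 4 \<le> h ^ 6" using h1 by (rule power_increasing[rotated]) simp
    define u where "u \<sigma> = \<sigma> f - of_nat l" for \<sigma> :: "'k \<Rightarrow> complex"
    have "\<exists>x\<in>ring_of_integers. \<forall>\<sigma>\<in>embeddings. norm ((\<sigma> x)\<^sup>2 - u \<sigma>) \<le> R * (2 * sqrt (norm (u \<sigma>)) + R)"
    proof (rule root)
      show "u (conj_emb \<sigma>) = cnj (u \<sigma>)" for \<sigma> by (simp add: u_def)
      show "0 \<le> Re (u \<sigma>)" if "\<sigma> \<in> real_embeddings" for \<sigma> using fr[OF that] l(1) h4 by (simp add: u_def)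
    qed
    then obtain x where x: "x \<in> ring_of_integers"
      "\<And>\<sigma>. \<sigma> \<in> embeddings \<Longrightarrow> norm ((\<sigma> x)\<^sup>2 - u \<sigma>) \<le> R * (2 * sqrt (norm (u \<sigma>)) + R)" by blast
    define e where "e = f - x\<^sup>2 - of_nat l"
    have eO: "e \<in> ring_of_integers" unfolding e_def using f x(1) by (intro roi_diff roi_power) auto
    have h3: "h ^ 3 \<ge> 1" using h1 by (rule one_le_power)
    have ebound: "norm (\<sigma> e) \<le> (4 * R + R\<^sup>2) * h ^ 3" if \<sigma>: "\<sigma> \<in> embeddings" for \<sigma>
    proof -
      have "norm (u \<sigma>) \<le> norm (\<sigma> f) + norm (of_nat l :: complex)" unfolding u_def by (rule norm_triangle_ineq4)
      also have "\<dots> \<le> 4 * h ^ 6" using fm[OF \<sigma>] l(1) \<open>h ^ 4 \<le> h ^ 6\<close> h4 by simp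
      also have "\<dots> = (2 * h ^ 3)\<^sup>2" by (simp add: power_mult_distrib flip: power_mult)
      finally have "sqrt (norm (u \<sigma>)) \<le> 2 * h ^ 3" using h1 h3 by (intro real_le_lsqrt) auto
      hence "R * (2 * sqrt (norm (u \<sigma>)) + R) \<le> R * (2 * (2 * h ^ 3) + R * h ^ 3)"
        using R h3 by (intro mult_left_mono add_mono) auto
      also have "\<dots> = (4 * R + R\<^sup>2) * h ^ 3" by (simp add: power2_eq_square algebra_simps)
      finally have "norm ((\<sigma> x)\<^sup>2 - u \<sigma>) \<le> (4 * R + R\<^sup>2) * h ^ 3" using x(2)[OF \<sigma>] by linarith
      moreover have "\<sigma> e = - ((\<sigma> x)\<^sup>2 - u \<sigma>)" using \<sigma> by (simp add: e_def u_def embeddings_simps)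
      ultimately show ?thesis by (simp add: norm_minus_commute)
    qed
    have "\<exists>r::nat \<Rightarrow> int. e = (\<Sum>j<d. of_int (r j) * w j) \<and> (\<forall>j<d. of_int \<bar>r j\<bar> \<le> C * ((4 * R + R\<^sup>2) * h ^ 3))"
      by (rule coord) (rule eO, erule ebound)
    then obtain r :: "nat \<Rightarrow> int" where r: "e = (\<Sum>j<d. of_int (r j) * w j)" by blast
    define J where "J = {j. j < d \<and> odd (r j)}"
    have J: "J \<subseteq> {..<d}" by (auto simp: J_def)
    define b where "b = snd (p J) + (\<Sum>j<d. of_int (r j div 2) * w j)"
    have bO: "b \<in> ring_of_integers" unfolding b_def using p(2)[OF J] by (intro roi_add roi_sum roi_mult) (auto simp: w)
    have "e = (\<Sum>j\<in>J. w j) + 2 * (\<Sum>j<d. of_int (r j div 2) * w j)"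
    proof -
      have "(\<Sum>j\<in>J. w j) = (\<Sum>j<d. if odd (r j) then w j else 0)"
        by (rule sum.mono_neutral_cong_left) (auto simp: J_def)
      moreover have "of_int (r j) * w j = (if odd (r j) then w j else 0) + 2 * (of_int (r j div 2) * w j)" for j
      proof -
        have "r j = (if odd (r j) then 1 else 0) + 2 * (r j div 2)" by presburger
        hence "(of_int (r j) :: 'k) = of_int ((if odd (r j) then 1 else 0) + 2 * (r j div 2))" by simp
        also have "\<dots> = (if odd (r j) then 1 else 0) + 2 * of_int (r j div 2)" by simp
        finally have "of_int (r j) * w j = ((if odd (r j) then 1 else 0) + 2 * of_int (r j div 2)) * w j" by simp
        thus ?thesis by (simp add: algebra_simps)
      qed
      ultimately show ?thesis unfolding r by (simp add: sum.distrib sum_distrib_left)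
    qed
    hence e: "e = (fst (p J))\<^sup>2 + 2 * b" unfolding b_def using p(3)[OF J] by (simp add: algebra_simps)
    have bbound: "norm (\<sigma> b) \<le> K * h ^ 3" if \<sigma>: "\<sigma> \<in> embeddings" for \<sigma>
    proof -
      have "2 * \<sigma> b = \<sigma> e - (\<sigma> (fst (p J)))\<^sup>2" unfolding e using \<sigma> by (simp add: embeddings_simps)
      hence "norm (2 * \<sigma> b) \<le> norm (\<sigma> e) + norm ((\<sigma> (fst (p J)))\<^sup>2)" by (metis norm_triangle_ineq4)
      moreover have "T \<le> T * h ^ 3" using mult_left_mono[OF h3, of T] \<open>T \<ge> 1\<close> by simp
      ultimately have "norm (2 * \<sigma> b) \<le> (4 * R + R\<^sup>2) * h ^ 3 + T * h ^ 3"
        using ebound[OF \<sigma>] T[OF J \<sigma>] unfolding norm_power by linarith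
      also have "\<dots> = K * h ^ 3" by (simp add: K_def algebra_simps)
      finally have "2 * norm (\<sigma> b) \<le> K * h ^ 3" by (simp add: norm_mult)
      thus ?thesis using norm_ge_zero[of "\<sigma> b"] by linarith
    qed
    have "\<exists>c::nat \<Rightarrow> int. b = (\<Sum>j<d. of_int (c j) * w j) \<and> (\<forall>j<d. of_int \<bar>c j\<bar> \<le> C * (K * h ^ 3))"
      by (rule coord) (rule bO, erule bbound)
    then obtain c :: "nat \<Rightarrow> int" where c: "b = (\<Sum>j<d. of_int (c j) * w j)" "\<And>j. j < d \<Longrightarrow> of_int \<bar>c j\<bar> \<le> C * (K * h ^ 3)"
      by blast
    define N where "N = (\<Sum>j<d. nat \<bar>c j\<bar> * M j)"
    have "real N = (\<Sum>j<d. of_int \<bar>c j\<bar> * real (M j))" by (simp add: N_def)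
    also have "\<dots> \<le> (\<Sum>j<d. C * (K * h ^ 3) * real (M j))" by (intro sum_mono mult_right_mono c(2)) auto
    also have "\<dots> = A * C * K * h ^ 3" by (simp add: A_def sum_distrib_left mult_ac)
    also have "\<dots> \<le> h ^ 4 / 2 - 1"
    proof -
      have "(A * C * K + 1) * h ^ 3 \<le> (h / 2) * h ^ 3" using h h1 h3 by (intro mult_right_mono) (auto simp: H_def)
      also have "\<dots> = h ^ 4 / 2" by (simp add: power_Suc[symmetric] eval_nat_numeral)
      finally show ?thesis using h3 by (simp add: algebra_simps)
    qed
    finally have "N \<le> l" using l(2) by linarith
    \<comment> \<open>The sign follows \<open>c j\<close>, so that \<open>\<bar>c j\<bar>\<close>
      copies of \<open>y j\<close> add up to \<open>2 * c j * w j\<close> plus a natural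
      number.\<close>
    define y where "y j = of_nat (M j) + (if c j \<ge> 0 then 2 else - 2) * w j" for j
    have yj: "sum_sq ring_of_integers m1 (y j)" if "j < d" for j using q'[OF that] by (auto simp: y_def)
    have "2 * b = (\<Sum>j<d. of_nat (nat \<bar>c j\<bar>) * y j) - of_nat N"
    proof -
      have "of_nat (nat \<bar>c j\<bar>) * y j = 2 * (of_int (c j) * w j) + of_nat (nat \<bar>c j\<bar> * M j)" for j
        by (cases "c j \<ge> 0") (auto simp: y_def algebra_simps)
      thus ?thesis by (simp add: c(1) N_def sum.distrib sum_distrib_left)
    qed
    hence "f = x\<^sup>2 + (fst (p J))\<^sup>2 + of_nat (l - N) + (\<Sum>j<d. of_nat (nat \<bar>c j\<bar>) * y j)"
      using e \<open>N \<le> l\<close> by (simp add: e_def of_nat_diff algebra_simps)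
    moreover have "sum_sq ring_of_integers (1 + 1 + 4 + card {..<d} * (m1 * 4))
        (x\<^sup>2 + (fst (p J))\<^sup>2 + of_nat (l - N) + (\<Sum>j<d. of_nat (nat \<bar>c j\<bar>) * y j))"
      by (intro sum_sq_add sum_sq_square sum_sq_of_nat sum_sq_sum sum_sq_mult x(1) p(1)[OF J] roi_mult) (auto intro: yj)
    ultimately show ?thesis by (simp add: m_def)
  qed
  show ?thesis unfolding large_sum_sq_def
    by (intro exI[of _ m] exI[of _ H] allI impI) (rule main; blast)
qed

text \<open>Put \<open>P = h ^ (E - 1)\<close>. Subtracting a square close to \<open>f\<close>,
  which has size at most \<open>P\<^sup>2\<close>, leaves a remainder of order \<open>P\<close>,
  below \<open>(h / 2) ^ E\<close> for large \<open>h\<close>; the induction hypothesis is applied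
  with \<open>h / 2\<close>. At real embeddings the square must stay below \<open>f\<close>, so its
  target is lowered there.\<close>

lemma large_sum_sq_step:
  assumes E: "E \<ge> 5" and IH: "large_sum_sq TYPE('k) m E"
  shows "large_sum_sq TYPE('k) (m + 1) (2 * E - 2)"
proof -
  obtain R :: real where R: "R \<ge> 1" and "\<forall>u. (\<forall>\<sigma>\<in>(embeddings :: ('k \<Rightarrow> complex) set). u (conj_emb \<sigma>) = cnj (u \<sigma>)) \<longrightarrow>
      (\<forall>\<sigma>\<in>real_embeddings. 0 \<le> Re (u \<sigma>)) \<longrightarrow>
      (\<exists>x\<in>ring_of_integers. \<forall>\<sigma>\<in>embeddings. norm ((\<sigma> x)\<^sup>2 - u \<sigma>) \<le> R * (2 * sqrt (norm (u \<sigma>)) + R))"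
    using approximate_square_root[OF nf] by (elim exE conjE)
  note root = this(2)[rule_format]
  obtain H where "\<forall>h::real. h \<ge> H \<longrightarrow> (\<forall>f::'k. f \<in> ring_of_integers \<longrightarrow>
     (\<forall>\<sigma>\<in>real_embeddings. h ^ 4 \<le> Re (\<sigma> f)) \<longrightarrow> (\<forall>\<sigma>\<in>embeddings. norm (\<sigma> f) \<le> h ^ E) \<longrightarrow>
     sum_sq ring_of_integers m f)"
    using IH unfolding large_sum_sq_def by (elim exE)
  note H = this[rule_format]
  define K where "K = 1 + 6 * R + R\<^sup>2"
  define H' where "H' = max (max 1 (8 * R)) (max (2 * H) (2 ^ E * K))"
  have main: "sum_sq ring_of_integers (m + 1) f"
    if h: "h \<ge> H'" and f: "f \<in> ring_of_integers" and fr: "\<And>\<sigma>. \<sigma> \<in> real_embeddings \<Longrightarrow> h ^ 4 \<le> Re (\<sigma> f)"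
      and fm: "\<And>\<sigma>. \<sigma> \<in> embeddings \<Longrightarrow> norm (\<sigma> f) \<le> h ^ (2 * E - 2)" for h :: real and f :: 'k
  proof -
    have hs: "h \<ge> 1" "h \<ge> 8 * R" "h \<ge> 2 * H" "h \<ge> 2 ^ E * K" using h by (auto simp: H'_def)
    define P where "P = h ^ (E - 1)"
    have P4: "h ^ 4 \<le> P" unfolding P_def using hs(1) E by (intro power_increasing) auto
    have h4: "h ^ 4 \<ge> 1" using hs(1) by (rule one_le_power)
    have P1: "P \<ge> 1" using P4 h4 by linarith
    have P2: "h ^ (2 * E - 2) = P\<^sup>2" unfolding P_def power_mult[symmetric] using E by (intro arg_cong[of _ _ "power h"]) simp
    have PK: "P * K \<le> (h / 2) ^ E"
    proof -
      have "P * K * 2 ^ E \<le> P * h" using hs(4) P1 by (simp add: mult.assoc mult.commute[of K])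
      also have "\<dots> = h ^ E" unfolding P_def using E by (metis Suc_diff_1 mult.commute power_Suc less_le_trans zero_less_numeral)
      finally show ?thesis by (simp add: power_divide field_simps)
    qed
    define y where "y \<sigma> = sqrt (Re (\<sigma> f))" for \<sigma>
    have y: "(y \<sigma>)\<^sup>2 = Re (\<sigma> f)" "y \<sigma> \<ge> 8 * R" "y \<sigma> \<le> P" if \<sigma>: "\<sigma> \<in> real_embeddings" for \<sigma>
    proof -
      have pos: "Re (\<sigma> f) \<ge> h ^ 4" by (rule fr[OF \<sigma>])
      thus "(y \<sigma>)\<^sup>2 = Re (\<sigma> f)" using h4 by (simp add: y_def)
      have "h ^ 1 \<le> h ^ 2" using hs(1) by (rule power_increasing[rotated]) simp
      moreover have "h\<^sup>2 \<le> y \<sigma>" unfolding y_def using pos by (intro real_le_rsqrt) (simp flip: power_mult)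
      ultimately show "y \<sigma> \<ge> 8 * R" using hs(2) by simp
      have "Re (\<sigma> f) \<le> P\<^sup>2" using fm[OF real_embeddings_subset[OF \<sigma>]] complex_Re_le_cmod[of "\<sigma> f"] P2 by linarith
      thus "y \<sigma> \<le> P" unfolding y_def using P1 by (intro real_le_lsqrt) auto
    qed
    \<comment> \<open>With \<open>y\<close> the root of \<open>f\<close>, the error
      \<open>R * (2 * y + R)\<close> is at most \<open>3 * R * y\<close>, so lowering the target by
      \<open>h ^ 4 / 2 + 4 * R * y\<close> leaves at least \<open>h ^ 4 / 2\<close>. The target
      stays nonnegative because \<open>8 * R \<le> y\<close>.\<close>
    define u where "u \<sigma> = (if \<sigma> \<in> real_embeddings then of_real (Re (\<sigma> f) - h ^ 4 / 2 - 4 * R * y \<sigma>) else \<sigma> f)" for \<sigma>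
    have u0: "Re (\<sigma> f) - h ^ 4 / 2 - 4 * R * y \<sigma> \<ge> 0" if \<sigma>: "\<sigma> \<in> real_embeddings" for \<sigma>
    proof -
      have "8 * R * y \<sigma> \<le> (y \<sigma>)\<^sup>2" using y(2)[OF \<sigma>] R by (simp add: power2_eq_square mult_right_mono)
      thus ?thesis using fr[OF \<sigma>] y(1)[OF \<sigma>] by linarith
    qed
    have "\<exists>x\<in>ring_of_integers. \<forall>\<sigma>\<in>embeddings. norm ((\<sigma> x)\<^sup>2 - u \<sigma>) \<le> R * (2 * sqrt (norm (u \<sigma>)) + R)"
    proof (rule root)
      show "u (conj_emb \<sigma>) = cnj (u \<sigma>)" if \<sigma>: "\<sigma> \<in> embeddings" for \<sigma>
      proof (cases "\<sigma> \<in> real_embeddings")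
        case True
        thus ?thesis by (simp add: real_embeddings_conj u_def)
      next
        case False
        thus ?thesis using conj_emb_real_iff[OF \<sigma>] by (simp add: u_def)
      qed
      show "0 \<le> Re (u \<sigma>)" if "\<sigma> \<in> real_embeddings" for \<sigma> using u0[OF that] that by (simp add: u_def)
    qed
    then obtain x where x: "x \<in> ring_of_integers"
      "\<And>\<sigma>. \<sigma> \<in> embeddings \<Longrightarrow> norm ((\<sigma> x)\<^sup>2 - u \<sigma>) \<le> R * (2 * sqrt (norm (u \<sigma>)) + R)" by blast
    have "sum_sq ring_of_integers m (f - x\<^sup>2)"
    proof (rule H)
      show "h / 2 \<ge> H" using hs(3) by simp
      show "f - x\<^sup>2 \<in> ring_of_integers" using f x(1) by auto
    next
      fix \<sigma> :: "'k \<Rightarrow> complex" assume \<sigma>: "\<sigma> \<in> real_embeddings"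
      have \<sigma>': "\<sigma> \<in> embeddings" by (rule real_embeddings_subset[OF \<sigma>])
      define v where "v = Re (\<sigma> f) - h ^ 4 / 2 - 4 * R * y \<sigma>"
      have v: "v \<ge> 0" "u \<sigma> = of_real v" using u0[OF \<sigma>] \<sigma> by (auto simp: v_def u_def)
      have "v \<le> (y \<sigma>)\<^sup>2" unfolding v_def using y(1,2)[OF \<sigma>] R h4 by (smt (verit) mult_nonneg_nonneg divide_nonneg_nonneg)
      hence "sqrt v \<le> y \<sigma>" using y(2)[OF \<sigma>] R v(1) by (intro real_le_lsqrt) auto
      hence "R * (2 * sqrt (norm (u \<sigma>)) + R) \<le> R * (2 * y \<sigma> + R)" using R v by (intro mult_left_mono) auto
      hence "norm ((\<sigma> x)\<^sup>2 - u \<sigma>) \<le> R * (2 * y \<sigma> + R)" using x(2)[OF \<sigma>'] by linarith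
      moreover have "\<bar>Re ((\<sigma> x)\<^sup>2) - v\<bar> \<le> norm ((\<sigma> x)\<^sup>2 - u \<sigma>)"
        using abs_Re_le_cmod[of "(\<sigma> x)\<^sup>2 - u \<sigma>"] v(2) by simp
      ultimately have "Re ((\<sigma> x)\<^sup>2) \<le> v + R * (2 * y \<sigma> + R)" by linarith
      moreover have "R * R \<le> R * y \<sigma>" using y(2)[OF \<sigma>] R by (intro mult_left_mono) auto
      moreover have "R * y \<sigma> \<ge> 0" using y(2)[OF \<sigma>] R by simp
      ultimately have "h ^ 4 / 2 \<le> Re (\<sigma> f) - Re ((\<sigma> x)\<^sup>2)" by (simp add: v_def algebra_simps)
      moreover have "(h / 2) ^ 4 \<le> h ^ 4 / 2" using h4 by (simp add: power_divide)
      ultimately show "(h / 2) ^ 4 \<le> Re (\<sigma> (f - x\<^sup>2))" using \<sigma>' by (simp add: embeddings_simps)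
    next
      fix \<sigma> :: "'k \<Rightarrow> complex" assume \<sigma>: "\<sigma> \<in> embeddings"
      have "norm (\<sigma> (f - x\<^sup>2)) \<le> P * K"
      proof (cases "\<sigma> \<in> real_embeddings")
        case False
        hence u: "u \<sigma> = \<sigma> f" by (simp add: u_def)
        have "sqrt (norm (u \<sigma>)) \<le> P" unfolding u using fm[OF \<sigma>] P2 P1 by (intro real_le_lsqrt) auto
        hence "R * (2 * sqrt (norm (u \<sigma>)) + R) \<le> R * (2 * P + R * P)" using R P1 by (intro mult_left_mono add_mono) auto
        also have "\<dots> \<le> P * K" using R P1 by (simp add: K_def power2_eq_square algebra_simps)
        finally have "norm ((\<sigma> x)\<^sup>2 - u \<sigma>) \<le> P * K" using x(2)[OF \<sigma>] by linarith
        thus ?thesis using \<sigma> by (simp add: u embeddings_simps norm_minus_commute)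
      next
        case True
        define v where "v = Re (\<sigma> f) - h ^ 4 / 2 - 4 * R * y \<sigma>"
        have v: "v \<ge> 0" "u \<sigma> = of_real v" using u0[OF True] True by (auto simp: v_def u_def)
        have "v \<le> (y \<sigma>)\<^sup>2" unfolding v_def using y(1,2)[OF True] R h4 by (smt (verit) mult_nonneg_nonneg divide_nonneg_nonneg)
        hence "sqrt v \<le> y \<sigma>" using y(2)[OF True] R v(1) by (intro real_le_lsqrt) auto
        hence "sqrt v \<le> P" using y(3)[OF True] by linarith
        hence "R * (2 * sqrt (norm (u \<sigma>)) + R) \<le> R * (2 * P + R * P)" using R P1 v by (intro mult_left_mono add_mono) auto
        hence 1: "norm ((\<sigma> x)\<^sup>2 - u \<sigma>) \<le> R * (2 * P + R * P)" using x(2)[OF \<sigma>] by linarith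
        have "\<sigma> f - u \<sigma> = of_real (h ^ 4 / 2 + 4 * R * y \<sigma>)"
          unfolding v(2) v_def by (subst real_embeddings_of_real[OF True, of f]) (simp flip: of_real_add of_real_mult of_real_diff)
        hence "norm (\<sigma> f - u \<sigma>) = h ^ 4 / 2 + 4 * R * y \<sigma>" using h4 y(2)[OF True] R by (simp only: norm_of_real) simp
        also have "\<dots> \<le> P + 4 * R * P" using P4 P1 y(3)[OF True] R h4 by (intro add_mono mult_left_mono) auto
        finally have 2: "norm (\<sigma> f - u \<sigma>) \<le> P + 4 * R * P" .
        have "\<sigma> (f - x\<^sup>2) = (\<sigma> f - u \<sigma>) - ((\<sigma> x)\<^sup>2 - u \<sigma>)" using \<sigma> by (simp add: embeddings_simps)
        hence "norm (\<sigma> (f - x\<^sup>2)) \<le> norm (\<sigma> f - u \<sigma>) + norm ((\<sigma> x)\<^sup>2 - u \<sigma>)" by (metis norm_triangle_ineq4)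
        also have "\<dots> \<le> (P + 4 * R * P) + R * (2 * P + R * P)" using 1 2 by linarith
        also have "\<dots> = P * K" by (simp add: K_def power2_eq_square algebra_simps)
        finally show ?thesis .
      qed
      thus "norm (\<sigma> (f - x\<^sup>2)) \<le> (h / 2) ^ E" using PK by linarith
    qed
    hence "sum_sq ring_of_integers (m + 1) ((f - x\<^sup>2) + x\<^sup>2)" by (intro sum_sq_add sum_sq_square x(1))
    thus ?thesis by simp
  qed
  show ?thesis unfolding large_sum_sq_def
    by (intro exI[of _ H'] allI impI) (rule main; blast)
qed

lemma large_sum_sq_mono:
  assumes "large_sum_sq TYPE('k) m E" "E' \<le> E"
  shows "large_sum_sq TYPE('k) m E'"
proof -
  obtain H where "\<forall>h::real. h \<ge> H \<longrightarrow> (\<forall>f::'k. f \<in> ring_of_integers \<longrightarrow>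
     (\<forall>\<sigma>\<in>real_embeddings. h ^ 4 \<le> Re (\<sigma> f)) \<longrightarrow> (\<forall>\<sigma>\<in>embeddings. norm (\<sigma> f) \<le> h ^ E) \<longrightarrow>
     sum_sq ring_of_integers m f)"
    using assms(1) unfolding large_sum_sq_def by (elim exE)
  note H = this[rule_format]
  have "sum_sq ring_of_integers m f"
    if "h \<ge> max 1 H" "f \<in> ring_of_integers" "\<forall>\<sigma>\<in>real_embeddings. h ^ 4 \<le> Re (\<sigma> f)"
      "\<forall>\<sigma>\<in>embeddings. norm (\<sigma> f) \<le> h ^ E'" for h :: real and f :: 'k
  proof (rule H)
    have "h ^ E' \<le> h ^ E" using that(1) assms(2) by (intro power_increasing) auto
    thus "norm (\<sigma> f) \<le> h ^ E" if "\<sigma> \<in> embeddings" for \<sigma> using \<open>\<forall>\<sigma>\<in>embeddings. norm (\<sigma> f) \<le> h ^ E'\<close> that by fastforce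
  qed (use that in auto)
  thus ?thesis unfolding large_sum_sq_def by blast
qed

text \<open>Each step costs one square and replaces \<open>E\<close> by \<open>2 * E - 2\<close>,
  which is a strict increase from the base value 6 on.\<close>

lemma large_sum_sq_exists: "\<exists>m. large_sum_sq TYPE('k) m E"
proof -
  have "\<exists>m. large_sum_sq TYPE('k) m (6 + n)" for n
  proof (induction n)
    case 0
    thus ?case using large_sum_sq_base by simp
  next
    case (Suc n)
    then obtain m where "large_sum_sq TYPE('k) m (6 + n)" by blast
    hence "large_sum_sq TYPE('k) (m + 1) (2 * (6 + n) - 2)" by (intro large_sum_sq_step) auto
    hence "large_sum_sq TYPE('k) (m + 1) (6 + Suc n)" by (rule large_sum_sq_mono) simp
    thus ?case by blast
  qed
  from this[of E] show ?thesis using large_sum_sq_mono[of _ "6 + E" E] by auto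
qed

text \<open>Write \<open>f = t\<^sup>2 + 2 * w\<close> and
  \<open>2 * w = (w + 1)\<^sup>2 - (w\<^sup>2 + 1)\<close>. A natural multiple \<open>N\<close> of
  \<open>\<eta>\<close> turns the coefficient \<open>- 1\<close> into \<open>N - 1\<close> modulo
  \<open>\<eta>\<close>, which is a sum of four squares. Altogether these are
  \<open>1 + 1 + 2 * 4 = 10\<close> squares, whatever \<open>\<eta>\<close> is.\<close>

lemma sum_sq_congruence:
  assumes f: "f \<in> ring_of_integers" and \<eta>: "(\<eta> :: 'k) \<in> ring_of_integers" "\<eta> \<noteq> 0"
  shows "\<exists>y v. (\<forall>i<10. y i \<in> ring_of_integers) \<and> v \<in> ring_of_integers \<and> f = (\<Sum>i<10::nat. (y i)\<^sup>2) + \<eta> * v"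
proof -
  obtain t w where tw: "t \<in> ring_of_integers" "w \<in> ring_of_integers" "f = t\<^sup>2 + 2 * w" using sq[OF f] by blast
  obtain N :: int where N: "N > 0" "of_int N * (1 / \<eta>) \<in> ring_of_integers" using integer_multiple[OF nf] by blast
  define \<mu> where "\<mu> = of_int N * (1 / \<eta>)"
  have \<mu>: "of_int N = \<eta> * \<mu>" "\<mu> \<in> ring_of_integers" using \<eta>(2) N(2) by (simp_all add: \<mu>_def)
  have "sum_sq ring_of_integers (1 + 1 + (1 + 1) * 4) (t\<^sup>2 + (w + 1)\<^sup>2 + of_nat (nat (N - 1)) * (w\<^sup>2 + 1\<^sup>2))"
    by (intro sum_sq_add sum_sq_square sum_sq_mult sum_sq_of_nat) (use tw in auto)
  then obtain y where y: "\<forall>i<10. y i \<in> ring_of_integers"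
    "t\<^sup>2 + (w + 1)\<^sup>2 + of_nat (nat (N - 1)) * (w\<^sup>2 + 1\<^sup>2) = (\<Sum>i<10::nat. (y i)\<^sup>2)"
    unfolding sum_sq_def by auto
  have N1: "(of_nat (nat (N - 1)) :: 'k) = of_int N - 1" using N(1) by simp
  have "f = (\<Sum>i<10::nat. (y i)\<^sup>2) + \<eta> * (- \<mu> * (w\<^sup>2 + 1))"
    unfolding y(2)[symmetric] N1 tw(3) \<mu>(1) by (simp add: power2_eq_square algebra_simps)
  moreover have "- \<mu> * (w\<^sup>2 + 1) \<in> ring_of_integers" using \<mu>(2) tw(2) by (intro roi_mult roi_uminus roi_add roi_power) auto
  ultimately show ?thesis using y(1) by blast
qed

end

lemma finite_real_embeddings:
  "number_field TYPE('k::field_char_0) \<Longrightarrow> finite (real_embeddings :: ('k \<Rightarrow> complex) set)"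
  using finite_embeddings by (rule finite_subset[rotated]) (auto simp: real_embeddings_def)

context
  assumes nf: "number_field TYPE('k::field_char_0)"
    and sq: "\<And>x::'k. x \<in> ring_of_integers \<Longrightarrow> \<exists>s\<in>ring_of_integers. \<exists>w\<in>ring_of_integers. x = s\<^sup>2 + 2 * w"
    and ntr: "\<not> totally_real TYPE('k)"
begin

text \<open>For \<open>\<eta>\<close> tiny at all real embeddings write \<open>f = \<Sum> x\<^sub>i\<^sup>2 + \<eta>\<^sup>2 g\<close> with ten integers \<open>x\<^sub>i\<close> of size
  \<open>O(\<eta>\<^sup>2)\<close>. Then \<open>g\<close> is huge at the real embeddings, and bounded by a fixed power of that size elsewhere.\<close>

theorem totally_positive_sum_sq:
  "\<exists>m. \<forall>f::'k. f \<in> ring_of_integers \<longrightarrow> (\<forall>\<sigma>\<in>real_embeddings. 0 < Re (\<sigma> f)) \<longrightarrow> sum_sq ring_of_integers m f"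
proof -
  have fin: "finite (embeddings :: ('k \<Rightarrow> complex) set)" by (rule finite_embeddings[OF nf])
  have finR: "finite (real_embeddings :: ('k \<Rightarrow> complex) set)" by (rule finite_real_embeddings[OF nf])
  obtain \<alpha> :: 'k and a :: real where \<alpha>: "\<alpha> \<in> ring_of_integers" "\<alpha> \<noteq> 0" "0 < a" "a < 1"
    "\<And>\<sigma>. \<sigma> \<in> real_embeddings \<Longrightarrow> norm (\<sigma> \<alpha>) \<le> a" using small_at_real_embeddings[OF nf ntr] by blast
  obtain R :: real where R: "R \<ge> 1" and cover:
    "\<And>z. (\<And>\<sigma> :: 'k \<Rightarrow> complex. \<sigma> \<in> embeddings \<Longrightarrow> z (conj_emb \<sigma>) = cnj (z \<sigma>)) \<Longrightarrow>
      \<exists>x\<in>ring_of_integers. \<forall>\<sigma>\<in>embeddings. norm (\<sigma> (x :: 'k) - z \<sigma>) \<le> R" using integral_covering[OF nf] by blast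
  define B where "B = 1 + (\<Sum>\<sigma>\<in>embeddings. norm (\<sigma> \<alpha>) + 1 / norm (\<sigma> \<alpha>))"
  have B: "norm (\<sigma> \<alpha>) \<le> B" "1 / norm (\<sigma> \<alpha>) \<le> B" if "\<sigma> \<in> embeddings" for \<sigma>
  proof -
    have "norm (\<sigma> \<alpha>) + 1 / norm (\<sigma> \<alpha>) \<le> (\<Sum>\<sigma>\<in>embeddings. norm (\<sigma> \<alpha>) + 1 / norm (\<sigma> \<alpha>))"
      using that fin by (intro member_le_sum) auto
    moreover have "norm (\<sigma> \<alpha>) \<ge> 0" "1 / norm (\<sigma> \<alpha>) \<ge> 0" by auto
    ultimately show "norm (\<sigma> \<alpha>) \<le> B" "1 / norm (\<sigma> \<alpha>) \<le> B" unfolding B_def by linarith+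
  qed
  have B1: "B \<ge> 1" by (auto simp: B_def intro!: sum_nonneg)
  \<comment> \<open>\<open>\<kappa>\<close> compares the sizes of \<open>\<alpha>\<close> and its
    inverse at all embeddings with the smallness \<open>a\<close> at the real ones. It depends on
    the field and \<open>\<alpha>\<close> only, so \<open>E\<close>, and with it \<open>m\<close>,
    is fixed before \<open>f\<close> is given.\<close>
  obtain \<kappa> where \<kappa>: "B \<le> (1 / a) ^ \<kappa>" using real_arch_pow[of "1 / a" B] \<alpha>(3,4) by (auto intro: less_imp_le)
  define E where "E = 4 * \<kappa> + 1"
  obtain m where "large_sum_sq TYPE('k) m E" using large_sum_sq_exists[OF nf sq] by blast
  then obtain H where "\<forall>h::real. h \<ge> H \<longrightarrow> (\<forall>f::'k. f \<in> ring_of_integers \<longrightarrow>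
     (\<forall>\<sigma>\<in>real_embeddings. h ^ 4 \<le> Re (\<sigma> f)) \<longrightarrow> (\<forall>\<sigma>\<in>embeddings. norm (\<sigma> f) \<le> h ^ E) \<longrightarrow>
     sum_sq ring_of_integers m f)"
    unfolding large_sum_sq_def by (elim exE)
  note H = this[rule_format]
  have "sum_sq ring_of_integers (10 + m) f"
    if f: "f \<in> ring_of_integers" and pos: "\<And>\<sigma>. \<sigma> \<in> real_embeddings \<Longrightarrow> 0 < Re (\<sigma> f)" for f :: 'k
  proof -
    define \<delta> where "\<delta> = Min (insert 1 ((\<lambda>\<sigma>. Re (\<sigma> f)) ` real_embeddings))"
    have \<delta>: "0 < \<delta>" "\<delta> \<le> 1" "\<And>\<sigma>. \<sigma> \<in> real_embeddings \<Longrightarrow> \<delta> \<le> Re (\<sigma> f)"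
      using finR pos by (auto simp: \<delta>_def)
    define F where "F = 1 + (\<Sum>\<sigma>\<in>embeddings. norm (\<sigma> f))"
    have F: "norm (\<sigma> f) \<le> F" if "\<sigma> \<in> embeddings" for \<sigma>
    proof -
      have "norm (\<sigma> f) \<le> (\<Sum>\<sigma>\<in>embeddings. norm (\<sigma> f))" using that fin by (intro member_le_sum) auto
      thus ?thesis by (simp add: F_def)
    qed
    have F1: "F \<ge> 1" by (auto simp: F_def intro!: sum_nonneg)
    define \<delta>' where "\<delta>' = \<delta> / 2"
    have \<delta>': "\<delta>' > 0" "\<delta>' \<le> 1" using \<delta> by (auto simp: \<delta>'_def)
    have "\<delta>' ^ 4 \<le> \<delta>' ^ 1" using \<delta>' by (intro power_decreasing) auto
    hence \<delta>4: "\<delta>' ^ 4 \<le> \<delta> / 2" by (simp add: \<delta>'_def)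
    \<comment> \<open>The summands secure, in this order, \<open>A \<ge> 1\<close>,
      \<open>h \<ge> H\<close>, the upper bound \<open>h ^ E\<close> at all embeddings, and that the
      squares of the \<open>x i\<close> use up at most half of \<open>f\<close> at the real
      embeddings.\<close>
    define N where "N = 1 + \<bar>H\<bar> / \<delta>' + (F + 10 * R\<^sup>2) / \<delta>' ^ E + 20 * R\<^sup>2 / \<delta>"
    obtain p where p: "N < (1 / a) ^ p" using real_arch_pow[of "1 / a" N] \<alpha>(3,4) by auto
    define A where "A = (1 / a) ^ p"
    have parts: "\<bar>H\<bar> / \<delta>' \<ge> 0" "(F + 10 * R\<^sup>2) / \<delta>' ^ E \<ge> 0" "20 * R\<^sup>2 / \<delta> \<ge> 0"
      using \<delta> \<delta>' F1 by (auto intro!: divide_nonneg_nonneg)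
    have A1: "A \<ge> 1" and AH: "\<bar>H\<bar> / \<delta>' \<le> A" and AE: "(F + 10 * R\<^sup>2) / \<delta>' ^ E \<le> A" and AR: "20 * R\<^sup>2 / \<delta> \<le> A"
      using p parts unfolding A_def N_def by linarith+
    have aA: "a ^ p = 1 / A" using \<alpha>(3) by (simp add: A_def power_divide)
    define \<eta> where "\<eta> = \<alpha> ^ (2 * p)"
    have \<eta>: "\<eta> \<in> ring_of_integers" "\<eta> \<noteq> 0" using \<alpha>(1,2) by (auto simp: \<eta>_def)
    have "\<eta>\<^sup>2 \<in> ring_of_integers" "\<eta>\<^sup>2 \<noteq> 0" using \<eta> by auto
    from sum_sq_congruence[OF nf sq f this] obtain y v where y: "\<forall>i<10. y i \<in> ring_of_integers"
      and v: "v \<in> ring_of_integers" and fy: "f = (\<Sum>i<10::nat. (y i)\<^sup>2) + \<eta>\<^sup>2 * v" by blast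
    \<comment> \<open>Each \<open>y i\<close> is reduced modulo \<open>\<eta>\<^sup>2\<close> to an
      \<open>x i\<close> with
      \<open>norm (\<sigma> (x i)) \<le> R * norm (\<sigma> \<eta>) ^ 2\<close> at every embedding;
      \<open>g\<close> absorbs the change.\<close>
    have "\<forall>i. \<exists>w\<in>ring_of_integers. \<forall>\<sigma>\<in>embeddings. norm (\<sigma> w - (- \<sigma> (y i) / (\<sigma> \<eta>)\<^sup>2)) \<le> R"
      by (intro allI cover) simp
    from choice[OF this[unfolded Bex_def]] obtain w where w: "\<And>i. w i \<in> ring_of_integers"
      "\<And>i \<sigma>. \<sigma> \<in> embeddings \<Longrightarrow> norm (\<sigma> (w i) - (- \<sigma> (y i) / (\<sigma> \<eta>)\<^sup>2)) \<le> R" by blast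
    define x where "x i = y i + \<eta>\<^sup>2 * w i" for i
    define g where "g = v - (\<Sum>i<10::nat. 2 * y i * w i + \<eta>\<^sup>2 * (w i)\<^sup>2)"
    have gO: "g \<in> ring_of_integers" unfolding g_def using y v w(1) \<eta>(1)
      by (intro roi_diff roi_sum roi_add roi_mult roi_power) auto
    have xO: "x i \<in> ring_of_integers" if "i < 10" for i unfolding x_def using y w(1) \<eta>(1) that
      by (intro roi_add roi_mult roi_power) auto
    have fg: "f = (\<Sum>i<10::nat. (x i)\<^sup>2) + \<eta>\<^sup>2 * g"
    proof -
      have "(\<Sum>i<10::nat. (x i)\<^sup>2) = (\<Sum>i<10::nat. (y i)\<^sup>2) + \<eta>\<^sup>2 * (\<Sum>i<10::nat. 2 * y i * w i + \<eta>\<^sup>2 * (w i)\<^sup>2)"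
        unfolding sum_distrib_left sum.distrib[symmetric]
        by (intro sum.cong refl) (simp add: x_def power2_eq_square algebra_simps)
      thus ?thesis by (simp add: fy g_def algebra_simps)
    qed
    define X where "X \<sigma> = (\<Sum>i<10::nat. (\<sigma> (x i))\<^sup>2)" for \<sigma> :: "'k \<Rightarrow> complex"
    define t where "t \<sigma> = norm (\<sigma> \<eta>)" for \<sigma> :: "'k \<Rightarrow> complex"
    have t0: "t \<sigma> > 0" if "\<sigma> \<in> embeddings" for \<sigma> using \<eta>(2) that by (simp add: t_def embeddings_simps)
    have X: "norm (X \<sigma>) \<le> 10 * R\<^sup>2 * t \<sigma> ^ 4" if \<sigma>: "\<sigma> \<in> embeddings" for \<sigma>
    proof -
      have "norm ((\<sigma> (x i))\<^sup>2) \<le> R\<^sup>2 * t \<sigma> ^ 4" for i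
      proof -
        have "\<sigma> \<eta> \<noteq> 0" using \<eta>(2) \<sigma> by (simp add: embeddings_simps)
        hence "\<sigma> (x i) = (\<sigma> \<eta>)\<^sup>2 * (\<sigma> (w i) - (- \<sigma> (y i) / (\<sigma> \<eta>)\<^sup>2))"
          using \<sigma> by (simp add: x_def embeddings_simps distrib_left)
        hence "norm (\<sigma> (x i)) = (t \<sigma>)\<^sup>2 * norm (\<sigma> (w i) - (- \<sigma> (y i) / (\<sigma> \<eta>)\<^sup>2))"
          by (simp only: norm_mult norm_power t_def)
        also have "\<dots> \<le> (t \<sigma>)\<^sup>2 * R" using w(2)[OF \<sigma>] by (intro mult_left_mono) auto
        finally have "norm (\<sigma> (x i)) ^ 2 \<le> ((t \<sigma>)\<^sup>2 * R)\<^sup>2" by (intro power_mono) auto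
        thus ?thesis by (simp add: norm_power power_mult_distrib mult.commute flip: power_mult)
      qed
      hence "norm (X \<sigma>) \<le> (\<Sum>i<10::nat. R\<^sup>2 * t \<sigma> ^ 4)" unfolding X_def by (intro order_trans[OF norm_sum] sum_mono)
      thus ?thesis by simp
    qed
    have \<sigma>g: "(\<sigma> \<eta>)\<^sup>2 * \<sigma> g = \<sigma> f - X \<sigma>" if \<sigma>: "\<sigma> \<in> embeddings" for \<sigma>
      using arg_cong[OF fg, of \<sigma>] \<sigma> by (simp add: embeddings_simps X_def)
    \<comment> \<open>At the real embeddings \<open>t \<sigma> \<le> (1 / A)\<^sup>2\<close>, so
      \<open>h ^ 4 * (t \<sigma>)\<^sup>2 \<le> \<delta>' ^ 4 \<le> \<delta> / 2\<close>. For the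
      upper bound, \<open>A ^ (4 * \<kappa>)\<close> covers the powers of \<open>t \<sigma>\<close>,
      and the last factor \<open>A\<close> of \<open>h ^ E\<close> absorbs the constants.\<close>
    define h where "h = \<delta>' * A"
    have hH: "h \<ge> H" using AH \<delta>'(1) by (simp add: h_def field_simps)
    have "sum_sq ring_of_integers m g"
    proof (rule H[OF hH gO])
      fix \<sigma> :: "'k \<Rightarrow> complex" assume \<sigma>: "\<sigma> \<in> real_embeddings"
      have \<sigma>': "\<sigma> \<in> embeddings" by (rule real_embeddings_subset[OF \<sigma>])
      have "t \<sigma> = norm (\<sigma> \<alpha>) ^ (2 * p)" using \<sigma>' by (simp add: t_def \<eta>_def embeddings_simps norm_power)
      also have "\<dots> \<le> a ^ (2 * p)" using \<alpha>(5)[OF \<sigma>] by (intro power_mono) auto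
      also have "\<dots> = (1 / A)\<^sup>2" by (simp add: aA[symmetric] power_mult[symmetric] mult.commute)
      finally have tA: "t \<sigma> \<le> (1 / A)\<^sup>2" .
      have "t \<sigma> ^ 4 \<le> ((1 / A)\<^sup>2) ^ 4" using tA t0[OF \<sigma>'] by (intro power_mono) auto
      also have "\<dots> = (1 / A) ^ 8" by (simp flip: power_mult)
      also have "\<dots> \<le> (1 / A) ^ 1" using A1 by (intro power_decreasing) auto
      finally have t4: "t \<sigma> ^ 4 \<le> 1 / A" by simp
      have "norm (X \<sigma>) \<le> 10 * R\<^sup>2 * (1 / A)" using X[OF \<sigma>'] mult_left_mono[OF t4, of "10 * R\<^sup>2"] by simp
      also have "\<dots> \<le> \<delta> / 2" using AR A1 \<delta>(1) by (simp add: field_simps)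
      finally have "Re (X \<sigma>) \<le> \<delta> / 2" using complex_Re_le_cmod[of "X \<sigma>"] by linarith
      hence fX: "\<delta> / 2 \<le> Re (\<sigma> f - X \<sigma>)" using \<delta>(3)[OF \<sigma>] by simp
      have "(\<sigma> \<eta>)\<^sup>2 = of_real ((t \<sigma>)\<^sup>2)"
        by (subst real_embeddings_of_real[OF \<sigma>, of \<eta>]) (simp add: t_def cmod_def real_embeddings_Im[OF \<sigma>])
      hence e: "Re (\<sigma> f - X \<sigma>) = (t \<sigma>)\<^sup>2 * Re (\<sigma> g)"
        unfolding \<sigma>g[OF \<sigma>', symmetric] by (simp del: of_real_power)
      have "h ^ 4 * (t \<sigma>)\<^sup>2 \<le> h ^ 4 * ((1 / A)\<^sup>2)\<^sup>2"
        using tA t0[OF \<sigma>'] by (intro mult_left_mono power_mono) auto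
      also have "\<dots> = \<delta>' ^ 4" using A1 by (simp add: h_def power_mult_distrib power_divide flip: power_mult)
      also have "\<dots> \<le> (t \<sigma>)\<^sup>2 * Re (\<sigma> g)" using \<delta>4 fX e by linarith
      finally show "h ^ 4 \<le> Re (\<sigma> g)" using t0[OF \<sigma>'] by (simp add: mult.commute)
    next
      fix \<sigma> :: "'k \<Rightarrow> complex" assume \<sigma>: "\<sigma> \<in> embeddings"
      have "B ^ p \<le> ((1 / a) ^ \<kappa>) ^ p" using \<kappa> B1 by (intro power_mono) auto
      also have "\<dots> = A ^ \<kappa>" by (simp add: A_def mult.commute flip: power_mult)
      finally have BA: "B ^ p \<le> A ^ \<kappa>" .
      have Bp: "c ^ (2 * p) \<le> A ^ (2 * \<kappa>)" if c: "0 \<le> c" "c \<le> B" for c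
      proof -
        have "c ^ (2 * p) = (c ^ p)\<^sup>2" by (simp add: mult.commute flip: power_mult)
        also have "\<dots> \<le> (A ^ \<kappa>)\<^sup>2" using power_mono[OF c(2,1), of p] BA c(1) by (intro power_mono) auto
        finally show ?thesis by (simp add: mult.commute flip: power_mult)
      qed
      have t: "t \<sigma> = norm (\<sigma> \<alpha>) ^ (2 * p)" using \<sigma> by (simp add: t_def \<eta>_def embeddings_simps norm_power)
      have t1: "t \<sigma> \<le> A ^ (2 * \<kappa>)" unfolding t using B[OF \<sigma>] by (intro Bp) auto
      have t2: "1 / t \<sigma> \<le> A ^ (2 * \<kappa>)" unfolding t using Bp[OF _ B(2)[OF \<sigma>]] by (simp add: power_divide)
      have tt: "(t \<sigma>)\<^sup>2 \<le> A ^ (4 * \<kappa>)" "(1 / t \<sigma>)\<^sup>2 \<le> A ^ (4 * \<kappa>)"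
      proof -
        have "(t \<sigma>)\<^sup>2 \<le> (A ^ (2 * \<kappa>))\<^sup>2" "(1 / t \<sigma>)\<^sup>2 \<le> (A ^ (2 * \<kappa>))\<^sup>2"
          using t0[OF \<sigma>] t1 t2 by (intro power_mono; simp)+
        thus "(t \<sigma>)\<^sup>2 \<le> A ^ (4 * \<kappa>)" "(1 / t \<sigma>)\<^sup>2 \<le> A ^ (4 * \<kappa>)" by (simp_all flip: power_mult)
      qed
      have "(t \<sigma>)\<^sup>2 * norm (\<sigma> g) = norm (\<sigma> f - X \<sigma>)" by (simp only: \<sigma>g[OF \<sigma>, symmetric] norm_mult norm_power t_def)
      also have "\<dots> \<le> F + 10 * R\<^sup>2 * t \<sigma> ^ 4" using norm_triangle_ineq4[of "\<sigma> f" "X \<sigma>"] F[OF \<sigma>] X[OF \<sigma>] by linarith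
      finally have "norm (\<sigma> g) \<le> (F + 10 * R\<^sup>2 * t \<sigma> ^ 4) / (t \<sigma>)\<^sup>2" using t0[OF \<sigma>] by (simp add: field_simps)
      also have "\<dots> = F * (1 / t \<sigma>)\<^sup>2 + 10 * R\<^sup>2 * (t \<sigma>)\<^sup>2"
        using t0[OF \<sigma>] by (simp add: add_divide_distrib power_divide eval_nat_numeral)
      also have "\<dots> \<le> F * A ^ (4 * \<kappa>) + 10 * R\<^sup>2 * A ^ (4 * \<kappa>)"
        using tt F1 by (intro add_mono mult_left_mono) auto
      also have "\<dots> = (F + 10 * R\<^sup>2) * A ^ (4 * \<kappa>)" by (simp add: algebra_simps)
      also have "\<dots> \<le> (\<delta>' ^ E * A) * A ^ (4 * \<kappa>)"
        using AE A1 \<delta>'(1) by (intro mult_right_mono) (auto simp: field_simps)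
      also have "\<dots> = h ^ E" by (simp add: h_def E_def power_mult_distrib)
      finally show "norm (\<sigma> g) \<le> h ^ E" .
    qed
    hence "sum_sq ring_of_integers m (\<eta>\<^sup>2 * g)" using \<eta>(1) by (intro sum_sq_mult_square) auto
    moreover have "sum_sq ring_of_integers 10 (\<Sum>i<10::nat. (x i)\<^sup>2)" by (rule sum_sqI[of _ x]) (use xO in auto)
    ultimately show ?thesis unfolding fg by (intro sum_sq_add)
  qed
  thus ?thesis by blast
qed

end

section \<open>Lattices over the ring of integers are projective\<close>

lemma bezout_family:
  fixes a :: "nat \<Rightarrow> int"
  shows "\<exists>u g. (\<Sum>j<n. u j * a j) = g \<and> (\<forall>j<n. g dvd a j)"
proof (induction n)
  case 0
  show ?case by simp
next
  case (Suc n)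
  then obtain u g where u: "(\<Sum>j<n. u j * a j) = g" "\<forall>j<n. g dvd a j" by blast
  obtain s t where st: "s * g + t * a n = gcd g (a n)" using bezout_int by blast
  let ?u = "\<lambda>j. if j = n then t else s * u j"
  have "(\<Sum>j<Suc n. ?u j * a j) = s * (\<Sum>j<n. u j * a j) + t * a n"
    by (simp add: sum_distrib_left mult.assoc)
  hence "(\<Sum>j<Suc n. ?u j * a j) = gcd g (a n)" using u(1) st by simp
  moreover have "\<forall>j<Suc n. gcd g (a n) dvd a j"
  proof (intro allI impI)
    fix j assume "j < Suc n"
    hence "j = n \<or> j < n" by linarith
    thus "gcd g (a n) dvd a j"
    proof
      assume "j < n"
      hence "g dvd a j" using u(2) by blast
      thus ?thesis by (rule dvd_trans[OF gcd_dvd1])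
    qed (simp only: gcd_dvd2)
  qed
  ultimately show ?case by (intro exI[of _ ?u] exI[of _ "gcd g (a n)"] conjI)
qed

text \<open>Multiplication by the tail maps the group spanned by the \<open>x ^ i\<close> with
  \<open>i < n\<close> into itself. When an exponent would reach \<open>n\<close>, the relation
  multiplied by \<open>x ^ r\<close>, \<open>r = i + j - n\<close>, replaces the tail by minus the
  complementary head, whose exponents are below \<open>i\<close>.\<close>

lemma integral_tails:
  fixes x :: "'a::field_char_0" and a :: "nat \<Rightarrow> int"
  assumes rel: "(\<Sum>m\<le>n. of_int (a m) * x ^ m) = 0" and n: "n > 0" and j: "j \<le> n"
  shows "(\<Sum>i\<le>j. of_int (a (n - j + i)) * x ^ i) \<in> ring_of_integers"
proof -
  define c where "c = (\<Sum>i\<le>j. of_int (a (n - j + i)) * x ^ i)"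
  define M where "M i k = (if i + j < n then (if i \<le> k \<and> k \<le> i + j then a (n - j + (k - i)) else 0)
     else (if i + j - n \<le> k \<and> k < i then - a (k - (i + j - n)) else 0))" for i k
  have "c * x ^ i = (\<Sum>k<n. of_int (M i k) * x ^ k)" if i: "i < n" for i
  proof (cases "i + j < n")
    case True
    have "c * x ^ i = (\<Sum>l\<le>j. of_int (a (n - j + l)) * x ^ (i + l))"
      unfolding c_def sum_distrib_right by (intro sum.cong refl) (simp add: power_add mult_ac)
    also have "\<dots> = (\<Sum>k\<in>{i..i + j}. of_int (a (n - j + (k - i))) * x ^ k)"
      by (rule sum.reindex_bij_witness[of _ "\<lambda>k. k - i" "\<lambda>l. i + l"]) auto
    also have "\<dots> = (\<Sum>k<n. of_int (M i k) * x ^ k)"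
      using True by (intro sum.mono_neutral_cong_left) (auto simp: M_def)
    finally show ?thesis .
  next
    case False
    define r where "r = i + j - n"
    have r: "r + n = i + j" using False by (simp add: r_def)
    have "0 = x ^ r * (\<Sum>m\<le>n. of_int (a m) * x ^ m)" by (simp add: rel)
    also have "\<dots> = (\<Sum>m\<le>n. of_int (a m) * x ^ (r + m))"
      by (simp add: sum_distrib_left power_add mult_ac)
    also have "{..n} = {..<n - j} \<union> {n - j..n}" using j by auto
    also have "(\<Sum>m\<in>{..<n - j} \<union> {n - j..n}. of_int (a m) * x ^ (r + m)) =
        (\<Sum>m<n - j. of_int (a m) * x ^ (r + m)) + (\<Sum>m\<in>{n - j..n}. of_int (a m) * x ^ (r + m))"
      by (rule sum.union_disjoint) auto
    also have "(\<Sum>m\<in>{n - j..n}. of_int (a m) * x ^ (r + m)) = (\<Sum>l\<le>j. of_int (a (n - j + l)) * x ^ (i + l))"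
      by (rule sum.reindex_bij_witness[of _ "\<lambda>l. n - j + l" "\<lambda>m. m - (n - j)"]) (use j r in \<open>auto intro!: arg_cong2[of _ _ _ _ times] arg_cong[of _ _ "power x"]\<close>)
    also have "\<dots> = c * x ^ i"
      unfolding c_def sum_distrib_right by (intro sum.cong refl) (simp add: power_add mult_ac)
    also have "(\<Sum>m<n - j. of_int (a m) * x ^ (r + m)) = (\<Sum>k\<in>{r..<i}. of_int (a (k - r)) * x ^ k)"
      by (rule sum.reindex_bij_witness[of _ "\<lambda>k. k - r" "\<lambda>m. r + m"]) (use j r in auto)
    finally have "c * x ^ i = (\<Sum>k\<in>{r..<i}. of_int (- a (k - r)) * x ^ k)"
      by (simp add: sum_negf eq_neg_iff_add_eq_0 add.commute)
    also have "\<dots> = (\<Sum>k<n. of_int (M i k) * x ^ k)"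
      using False i by (intro sum.mono_neutral_cong_left) (auto simp: M_def r_def)
    finally show ?thesis .
  qed
  hence "algebraic_int c" using n by (intro algebraic_int_eigenvalue[of n c "\<lambda>i. x ^ i" M 0]) auto
  thus ?thesis by (simp add: c_def ring_of_integers_iff)
qed

context
  assumes nf: "number_field TYPE('k::field_char_0)"
begin

text \<open>Coprimality of the coefficients is stated as a Bezout identity because \<open>u\<close>
  later combines the tails of the relation into a representation of 1.\<close>

lemma primitive_relation:
  fixes x :: 'k
  obtains n and a u :: "nat \<Rightarrow> int" where "n > 0" "(\<Sum>m\<le>n. of_int (a m) * x ^ m) = 0" "(\<Sum>m\<le>n. u m * a m) = 1"
proof -
  obtain p where p: "p \<noteq> 0" "poly (map_poly of_rat p) x = 0" using number_field_rational_root[OF nf] by blast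
  define n where "n = degree p"
  obtain N k where N: "N > 0" "\<And>i. i \<in> {..n} \<Longrightarrow> of_int N * coeff p i = of_int (k i)"
    using common_denominator[of "{..n}" "coeff p"] by (metis finite_atMost)
  have k: "of_int (k i) = of_int N * (of_rat (coeff p i) :: 'k)" if "i \<le> n" for i
  proof -
    have "(of_int (k i) :: 'k) = of_rat (of_int (k i))" by simp
    also have "\<dots> = of_int N * of_rat (coeff p i)" using N(2)[of i] that by (simp add: of_rat_mult flip: N(2))
    finally show ?thesis .
  qed
  have "(\<Sum>m\<le>n. of_int (k m) * x ^ m) = of_int N * poly (map_poly of_rat p) x"
    by (simp add: poly_altdef degree_map_poly coeff_map_poly n_def[symmetric] sum_distrib_left k mult.assoc)
  hence rel: "(\<Sum>m\<le>n. of_int (k m) * x ^ m) = 0" using p(2) by simp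
  have kn: "k n \<noteq> 0"
  proof
    assume "k n = 0"
    hence "of_int N * coeff p n = 0" using N(2)[of n] by simp
    thus False using N(1) p(1) by (simp add: n_def)
  qed
  obtain u g where u: "(\<Sum>m<Suc n. u m * k m) = g" "\<forall>m<Suc n. g dvd k m" using bezout_family[where n = "Suc n" and a = k] by blast
  have g0: "g \<noteq> 0" using u(2) kn by auto
  define a where "a m = k m div g" for m
  have ka: "k m = g * a m" if "m \<le> n" for m using u(2) that by (simp add: a_def)
  have "of_int g * (\<Sum>m\<le>n. of_int (a m) * x ^ m) = (\<Sum>m\<le>n. of_int (k m) * x ^ m)"
    unfolding sum_distrib_left
  proof (rule sum.cong[OF refl])
    fix m assume "m \<in> {..n}"
    hence "k m = g * a m" by (intro ka) simp
    thus "of_int g * (of_int (a m) * x ^ m) = of_int (k m) * x ^ m" by (simp only: of_int_mult mult.assoc)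
  qed
  hence 1: "(\<Sum>m\<le>n. of_int (a m) * x ^ m) = 0" using rel g0 by simp
  have "g * (\<Sum>m\<le>n. u m * a m) = (\<Sum>m\<le>n. u m * k m)"
    unfolding sum_distrib_left
  proof (rule sum.cong[OF refl])
    fix m assume "m \<in> {..n}"
    hence "k m = g * a m" by (intro ka) simp
    thus "g * (u m * a m) = u m * k m" by (simp only: mult.left_commute)
  qed
  hence 2: "(\<Sum>m\<le>n. u m * a m) = 1" using u(1) g0 by (simp add: lessThan_Suc_atMost)
  have "n > 0"
  proof (rule ccontr)
    assume "\<not> n > 0"
    hence "n = 0" by simp
    hence "k n = 0" using rel by simp
    thus False using kn by simp
  qed
  thus thesis using that 1 2 by blast
qed

text \<open>For a primitive relation \<open>\<Sum> a\<^sub>m x\<^sup>m = 0\<close> the tails \<open>c\<^sub>j = a\<^sub>n x\<^sup>j + \<dots> + a\<^bsub>n-j\<^esub>\<close> and their multiples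
  \<open>x c\<^sub>j\<close> are integral, and \<open>a\<^bsub>n-j\<^esub> = c\<^sub>j - x c\<^bsub>j-1\<^esub>\<close>.\<close>

lemma two_generated_invertible:
  fixes x :: 'k
  shows "\<exists>C C'. C \<in> ring_of_integers \<and> C' \<in> ring_of_integers \<and> x * C \<in> ring_of_integers \<and>
    x * C' \<in> ring_of_integers \<and> C + x * C' = 1"
proof -
  obtain n and a u :: "nat \<Rightarrow> int" where n: "n > 0" and rel: "(\<Sum>m\<le>n. of_int (a m) * x ^ m) = 0"
    and u: "(\<Sum>m\<le>n. u m * a m) = 1" using primitive_relation[of x] by blast
  define c where "c j = (\<Sum>i\<le>j. of_int (a (n - j + i)) * x ^ i)" for j
  have cO: "c j \<in> ring_of_integers" if "j \<le> n" for j
    unfolding c_def by (rule integral_tails[OF rel n that])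
  have cn: "c n = 0" using rel by (simp add: c_def)
  have step: "c (Suc j) = of_int (a (n - Suc j)) + x * c j" if "j < n" for j
  proof -
    have "c (Suc j) = of_int (a (n - Suc j)) + (\<Sum>i\<le>j. of_int (a (n - Suc j + Suc i)) * x ^ Suc i)"
      unfolding c_def by (subst sum.atMost_Suc_shift) simp
    also have "(\<Sum>i\<le>j. of_int (a (n - Suc j + Suc i)) * x ^ Suc i) = x * c j"
      unfolding c_def sum_distrib_left using that by (intro sum.cong refl) (simp add: Suc_diff_Suc mult_ac)
    finally show ?thesis .
  qed
  have xc: "x * c j \<in> ring_of_integers" if "j \<le> n" for j
  proof (cases "j = n")
    case False
    hence "x * c j = c (Suc j) - of_int (a (n - Suc j))" using step[of j] that by simp
    moreover have "c (Suc j) \<in> ring_of_integers" using False that by (intro cO) simp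
    ultimately show ?thesis by (simp add: roi_diff)
  qed (simp add: cn)
  \<comment> \<open>In the Bezout identity each coefficient of the relation is written as
    \<open>c j - x * c (j - 1)\<close>; \<open>C\<close> collects the first parts and
    \<open>x * C'\<close> the second.\<close>
  define C where "C = (\<Sum>j\<le>n. of_int (u (n - j)) * c j)"
  define C' where "C' = - (\<Sum>j<n. of_int (u (n - Suc j)) * c j)"
  have "C \<in> ring_of_integers" "C' \<in> ring_of_integers"
    unfolding C_def C'_def by (auto intro!: roi_uminus roi_sum roi_mult cO)
  moreover have "x * C = (\<Sum>j\<le>n. of_int (u (n - j)) * (x * c j))" "x * C' = - (\<Sum>j<n. of_int (u (n - Suc j)) * (x * c j))"
    unfolding C_def C'_def by (simp_all add: sum_distrib_left mult.left_commute)
  moreover from this have "x * C \<in> ring_of_integers" "x * C' \<in> ring_of_integers"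
    by (auto intro!: roi_uminus roi_sum roi_mult xc)
  moreover have "C + x * C' = 1"
  proof -
    have "(1::'k) = of_int (\<Sum>m\<le>n. u m * a m)" by (simp add: u)
    also have "\<dots> = (\<Sum>m\<le>n. of_int (u m) * of_int (a m))" by simp
    also have "\<dots> = (\<Sum>j\<le>n. of_int (u (n - j)) * of_int (a (n - j)))"
      by (rule sum.reindex_bij_witness[of _ "\<lambda>j. n - j" "\<lambda>j. n - j"]) auto
    also have "\<dots> = of_int (u n) * of_int (a n) + (\<Sum>j<n. of_int (u (n - Suc j)) * of_int (a (n - Suc j)))"
      using sum.lessThan_Suc_shift[of "\<lambda>j. of_int (u (n - j)) * of_int (a (n - j)) :: 'k" n]
      by (simp add: lessThan_Suc_atMost)
    also have "(\<Sum>j<n. of_int (u (n - Suc j)) * of_int (a (n - Suc j)) :: 'k)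
        = (\<Sum>j<n. of_int (u (n - Suc j)) * c (Suc j)) - (\<Sum>j<n. of_int (u (n - Suc j)) * (x * c j))"
      unfolding sum_subtractf[symmetric] by (intro sum.cong refl) (simp add: step algebra_simps)
    also have "(\<Sum>j<n. of_int (u (n - Suc j)) * (x * c j)) = - (x * C')"
      by (simp add: C'_def sum_distrib_left mult.left_commute)
    also have "of_int (u n) * of_int (a n) + ((\<Sum>j<n. of_int (u (n - Suc j)) * c (Suc j)) - - (x * C')) = C + x * C'"
      using sum.lessThan_Suc_shift[of "\<lambda>j. of_int (u (n - j)) * c j" n]
      by (simp add: C_def lessThan_Suc_atMost c_def[of 0])
    finally show ?thesis by simp
  qed
  ultimately show ?thesis by blast
qed

text \<open>The fractional ideal generated by the \<open>m i\<close> is invertible, with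
  \<open>s i / m i\<close> in its inverse. When \<open>x\<close> is adjoined, each
  \<open>s i\<close> is split as \<open>s i * C + s i * (m x / m i) * C'\<close> by
  \<open>two_generated_invertible\<close>, and the second part is moved to \<open>x\<close>. Indices
  with \<open>m i = 0\<close> carry \<open>s i = 0\<close>, so division by zero does no
  harm.\<close>

lemma partition_of_unity:
  fixes m :: "'i \<Rightarrow> 'k"
  assumes "finite I" "\<exists>i\<in>I. m i \<noteq> 0"
  shows "\<exists>s. (\<Sum>i\<in>I. s i) = 1 \<and> (\<forall>i\<in>I. s i \<in> ring_of_integers \<and> (m i = 0 \<longrightarrow> s i = 0) \<and>
    (\<forall>j\<in>I. s i * m j / m i \<in> ring_of_integers))"
  using assms
proof (induction I rule: finite_induct)
  case empty
  thus ?case by simp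
next
  case (insert x I)
  show ?case
  proof (cases "\<exists>i\<in>I. m i \<noteq> 0")
    case False
    hence mx: "m x \<noteq> 0" "\<And>i. i \<in> I \<Longrightarrow> m i = 0" using insert.prems by auto
    have "(\<Sum>i\<in>insert x I. if i = x then 1 else 0 :: 'k) = 1" using insert.hyps by (simp add: sum.delta)
    thus ?thesis using mx insert.hyps by (intro exI[of _ "\<lambda>i. if i = x then 1 else 0"]) auto
  next
    case True
    from insert.IH[OF this] obtain s where s: "(\<Sum>i\<in>I. s i) = 1" "\<And>i. i \<in> I \<Longrightarrow> s i \<in> ring_of_integers"
      "\<And>i. i \<in> I \<Longrightarrow> m i = 0 \<Longrightarrow> s i = 0" "\<And>i j. i \<in> I \<Longrightarrow> j \<in> I \<Longrightarrow> s i * m j / m i \<in> ring_of_integers"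
      by blast
    show ?thesis
    proof (cases "m x = 0")
      case mx: True
      let ?s = "\<lambda>i. if i = x then 0 else s i"
      have "(\<Sum>i\<in>insert x I. ?s i) = (\<Sum>i\<in>I. s i)" using insert.hyps by (auto intro!: sum.cong)
      thus ?thesis using s mx insert.hyps by (intro exI[of _ ?s]) auto
    next
      case mx: False
      have "\<forall>i. \<exists>p. fst p \<in> ring_of_integers \<and> snd p \<in> ring_of_integers \<and> m x / m i * fst p \<in> ring_of_integers \<and>
        m x / m i * snd p \<in> ring_of_integers \<and> fst p + m x / m i * snd p = 1"
        (is "\<forall>i. ?P i")
      proof
        fix i
        obtain C C' where "C \<in> ring_of_integers" "C' \<in> ring_of_integers" "m x / m i * C \<in> ring_of_integers"
          "m x / m i * C' \<in> ring_of_integers" "C + m x / m i * C' = 1"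
          using two_generated_invertible[of "m x / m i"] by blast
        thus "?P i" by (intro exI[of _ "(C, C')"]) simp
      qed
      from choice[OF this] obtain p where p: "\<And>i. fst (p i) \<in> ring_of_integers" "\<And>i. snd (p i) \<in> ring_of_integers"
        "\<And>i. m x / m i * fst (p i) \<in> ring_of_integers" "\<And>i. m x / m i * snd (p i) \<in> ring_of_integers"
        "\<And>i. fst (p i) + m x / m i * snd (p i) = 1" by blast
      define t where "t = (\<Sum>i\<in>I. s i * (m x / m i * snd (p i)))"
      let ?s = "\<lambda>i. if i = x then t else s i * fst (p i)"
      have tO: "t \<in> ring_of_integers" unfolding t_def by (intro roi_sum roi_mult s p)
      have "(\<Sum>i\<in>insert x I. ?s i) = t + (\<Sum>i\<in>I. s i * fst (p i))"
        using insert.hyps by (auto intro!: sum.cong)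
      also have "\<dots> = (\<Sum>i\<in>I. s i * (fst (p i) + m x / m i * snd (p i)))"
        by (simp add: t_def distrib_left sum.distrib add.commute)
      also have "\<dots> = 1" by (simp only: p(5) mult_1_right s(1))
      finally have 1: "(\<Sum>i\<in>insert x I. ?s i) = 1" .
      have 2: "?s i \<in> ring_of_integers \<and> (m i = 0 \<longrightarrow> ?s i = 0)" if "i \<in> insert x I" for i
        using that tO mx s(2,3) p(1) by (auto intro!: roi_mult)
      have 3: "?s i * m j / m i \<in> ring_of_integers" if i: "i \<in> insert x I" and j: "j \<in> insert x I" for i j
      proof (cases "i = x")
        case True
        have "?s i * m j / m i = (\<Sum>i\<in>I. s i * (m x / m i * snd (p i)) * m j / m x)"
          using True by (simp add: t_def sum_distrib_right sum_divide_distrib)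
        also have "\<dots> = (\<Sum>i\<in>I. s i * m j / m i * snd (p i))"
          using mx by (intro sum.cong refl) (simp add: field_simps)
        also have "\<dots> \<in> ring_of_integers"
        proof (cases "j = x")
          case True
          have "s i * m j / m i * snd (p i) = s i * (m x / m i * snd (p i))" for i using True by simp
          thus ?thesis by (simp only:) (intro roi_sum roi_mult[OF s(2) p(4)])
        next
          case False
          thus ?thesis using j by (intro roi_sum roi_mult s(4) p(2)) auto
        qed
        finally show ?thesis .
      next
        case False
        show ?thesis
        proof (cases "j = x")
          case True
          have "s i * (m x / m i * fst (p i)) \<in> ring_of_integers" using False i by (intro roi_mult[OF s(2) p(3)]) auto
          thus ?thesis using False True by (simp add: mult_ac)
        next
          case jx: False
          have "s i * m j / m i * fst (p i) \<in> ring_of_integers" using False jx i j by (intro roi_mult[OF s(4) p(1)]) auto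
          thus ?thesis using False by (simp add: mult_ac)
        qed
      qed
      show ?thesis using 1 2 3 by (intro exI[of _ ?s]) blast
    qed
  qed
qed

end

section \<open>Maximal minors and the integral splitting\<close>

lemma adjugate_replace:
  fixes A :: "nat \<Rightarrow> nat \<Rightarrow> 'a::comm_ring_1"
  shows "\<exists>W. (\<forall>i<n. \<forall>l<n. (\<Sum>j<n. A i j * W j l) = (if i = l then det (mat n n (\<lambda>(i, j). A i j)) else 0)) \<and>
    (\<forall>t<n. \<forall>b. (\<Sum>i<n. W t i * b i) = det (mat n n (\<lambda>(i, j). if j = t then b i else A i j)))"
proof -
  define M where "M = mat n n (\<lambda>(i, j). A i j)"
  have M: "M \<in> carrier_mat n n" by (simp add: M_def)
  define W where "W t i = cofactor M i t" for t i
  have A': "adj_mat M = mat n n (\<lambda>(i, j). W i j)" by (intro eq_matI) (auto simp: adj_mat_def W_def M_def)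
  have 1: "(M * adj_mat M) $$ (i, l) = (\<Sum>j<n. A i j * W j l)" if "i < n" "l < n" for i l
    using that unfolding A' by (auto simp: M_def scalar_prod_def atLeast0LessThan)
  have 2: "(det M \<cdot>\<^sub>m 1\<^sub>m n) $$ (i, l) = (if i = l then det M else 0)" if "i < n" "l < n" for i l
    using that by simp
  have 3: "(\<Sum>i<n. W t i * b i) = det (mat n n (\<lambda>(i, j). if j = t then b i else A i j))" if t: "t < n" for t b
  proof -
    let ?N = "mat n n (\<lambda>(i, j). if j = t then b i else A i j)"
    have "det ?N = (\<Sum>i<n. ?N $$ (i, t) * cofactor ?N i t)"
      by (rule laplace_expansion_column[OF _ t]) simp
    also have "\<dots> = (\<Sum>i<n. W t i * b i)"
    proof (intro sum.cong refl)
      fix i assume i: "i \<in> {..<n}"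
      have "mat_delete ?N i t = mat_delete M i t"
        using t i by (intro eq_matI) (auto simp: mat_delete_def M_def)
      thus "?N $$ (i, t) * cofactor ?N i t = W t i * b i"
        using t i by (simp add: cofactor_def W_def mult.commute)
    qed
    finally show ?thesis by simp
  qed
  show ?thesis
  proof (intro exI[of _ W] conjI allI impI)
    show "(\<Sum>j<n. A i j * W j l) = (if i = l then det (mat n n (\<lambda>(i, j). A i j)) else 0)" if "i < n" "l < n" for i l
      by (simp only: M_def[symmetric] 1[OF that, symmetric] adj_mat(2)[OF M] 2[OF that])
  qed (rule 3)
qed

text \<open>Expands \<open>det (A X) = 1\<close> multilinearly over all maps \<open>J\<close>, as in
  the Cauchy-Binet formula; if all minors were zero, the sum would vanish. Maps with repeated values
  contribute zero minors.\<close>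

lemma nonzero_minor:
  fixes A X :: "nat \<Rightarrow> nat \<Rightarrow> 'a::field"
  assumes AX: "\<And>i l. i < n \<Longrightarrow> l < n \<Longrightarrow> (\<Sum>j<k. A i j * X j l) = (if i = l then 1 else 0)"
  shows "\<exists>J\<in>PiE {..<n} (\<lambda>_. {..<k}). det (mat n n (\<lambda>(i, t). A i (J t))) \<noteq> 0"
proof (rule ccontr)
  assume "\<not> ?thesis"
  hence zero: "det (mat n n (\<lambda>(i, t). A i (J t))) = 0" if "J \<in> PiE {..<n} (\<lambda>_. {..<k})" for J using that by blast
  let ?P = "{p. p permutes {0..<n}}"
  have prm: "p i < n" if "p permutes {0..<n}" "i < n" for p i
    using permutes_in_image[OF that(1), of i] that(2) by simp
  have d: "det (mat n n (\<lambda>(i, t). f i t)) = (\<Sum>p\<in>?P. signof p * (\<Prod>t<n. f (p t) t))" for f :: "nat \<Rightarrow> nat \<Rightarrow> 'a"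
    by (subst det_col[of _ n]) (auto intro!: sum.cong prod.cong simp: prm)
  have "det (mat n n (\<lambda>(i, t). if i = t then 1 else 0 :: 'a)) = det (1\<^sub>m n)"
    by (rule arg_cong[of _ _ det]) (intro eq_matI, auto)
  hence "1 = det (mat n n (\<lambda>(i, t). if i = t then 1 else 0 :: 'a))" by simp
  also have "\<dots> = det (mat n n (\<lambda>(i, t). \<Sum>j<k. A i j * X j t))"
    by (rule arg_cong[of _ _ det]) (intro eq_matI, auto simp: AX)
  also have "\<dots> = (\<Sum>p\<in>?P. signof p * (\<Prod>t<n. \<Sum>j<k. A (p t) j * X j t))" by (rule d)
  also have "\<dots> = (\<Sum>p\<in>?P. \<Sum>J\<in>PiE {..<n} (\<lambda>_. {..<k}). signof p * (\<Prod>t<n. A (p t) (J t) * X (J t) t))"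
    by (simp add: prod_sum_PiE sum_distrib_left)
  also have "\<dots> = (\<Sum>J\<in>PiE {..<n} (\<lambda>_. {..<k}). \<Sum>p\<in>?P. signof p * (\<Prod>t<n. A (p t) (J t) * X (J t) t))"
    by (rule sum.swap)
  also have "\<dots> = (\<Sum>J\<in>PiE {..<n} (\<lambda>_. {..<k}). (\<Prod>t<n. X (J t) t) * det (mat n n (\<lambda>(i, t). A i (J t))))"
    unfolding d by (simp add: prod.distrib sum_distrib_left mult_ac)
  also have "\<dots> = 0" using zero by simp
  finally show False by simp
qed

text \<open>The splitting \<open>B\<close> of the projection \<open>A\<close> is glued from the inverses of the invertible maximal
  minors of \<open>A\<close> by a partition of unity; by Cramer's rule the entries of \<open>B A\<close> are then integral.\<close>

theorem integral_splitting:
  fixes A X :: "nat \<Rightarrow> nat \<Rightarrow> 'k::field_char_0"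
  assumes nf: "number_field TYPE('k)"
    and AX: "\<And>i l. i < n \<Longrightarrow> l < n \<Longrightarrow> (\<Sum>j<k. A i j * X j l) = (if i = l then 1 else 0)"
  shows "\<exists>B. (\<forall>i<n. \<forall>l<n. (\<Sum>j<k. A i j * B j l) = (if i = l then 1 else 0)) \<and>
    (\<forall>j<k. \<forall>j'<k. (\<Sum>i<n. B j i * A i j') \<in> ring_of_integers)"
proof -
  let ?I = "PiE {..<n} (\<lambda>_. {..<k})"
  define m where "m J = det (mat n n (\<lambda>(i, t). A i (J t)))" for J
  have fin: "finite ?I" by (intro finite_PiE) auto
  have nz: "\<exists>J\<in>?I. m J \<noteq> 0" using nonzero_minor[where A = A and X = X, OF AX] by (simp add: m_def)
  obtain s where s: "(\<Sum>J\<in>?I. s J) = 1" "\<And>J. J \<in> ?I \<Longrightarrow> m J = 0 \<Longrightarrow> s J = 0"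
    "\<And>J J'. J \<in> ?I \<Longrightarrow> J' \<in> ?I \<Longrightarrow> s J * m J' / m J \<in> ring_of_integers"
    using partition_of_unity[OF nf fin nz] by blast
  define c where "c J = s J / m J" for J
  have c1: "(\<Sum>J\<in>?I. c J * m J) = 1"
    unfolding s(1)[symmetric] by (intro sum.cong refl) (use s(2) in \<open>auto simp: c_def\<close>)
  have c2: "c J * m J' \<in> ring_of_integers" if "J \<in> ?I" "J' \<in> ?I" for J J'
    using s(3)[OF that] by (simp add: c_def)
  have "\<forall>J. \<exists>W. (\<forall>i<n. \<forall>l<n. (\<Sum>t<n. A i (J t) * W t l) = (if i = l then m J else 0)) \<and>
    (\<forall>t<n. \<forall>b. (\<Sum>i<n. W t i * b i) = det (mat n n (\<lambda>(i, j). if j = t then b i else A i (J j))))"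
    unfolding m_def using adjugate_replace[of n "\<lambda>i t. A i (J t)" for J] by blast
  from choice[OF this] obtain W where W1: "\<And>J i l. i < n \<Longrightarrow> l < n \<Longrightarrow> (\<Sum>t<n. A i (J t) * W J t l) = (if i = l then m J else 0)"
    and W2: "\<And>J t b. t < n \<Longrightarrow> (\<Sum>i<n. W J t i * b i) = det (mat n n (\<lambda>(i, j). if j = t then b i else A i (J j)))"
    by blast
  \<comment> \<open>Row \<open>t\<close> of the adjugate of the minor \<open>J\<close> is added into
    row \<open>J t\<close> with weight \<open>c J\<close>. Thus \<open>A B\<close> is the sum of all
    \<open>c J * m J\<close> times the identity, and the weights sum to 1.\<close>
  define B where "B j l = (\<Sum>J\<in>?I. \<Sum>t<n. if J t = j then c J * W J t l else 0)" for j l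
  show ?thesis
  proof (intro exI[of _ B] conjI allI impI)
    fix i l assume il: "i < n" "l < n"
    have "(\<Sum>j<k. A i j * B j l) = (\<Sum>J\<in>?I. \<Sum>t<n. \<Sum>j<k. if J t = j then c J * (A i j * W J t l) else 0)"
    proof -
      have "(\<Sum>j<k. A i j * B j l) = (\<Sum>j<k. \<Sum>J\<in>?I. \<Sum>t<n. if J t = j then c J * (A i j * W J t l) else 0)"
        unfolding B_def sum_distrib_left by (intro sum.cong refl) (simp add: mult.left_commute)
      also have "\<dots> = (\<Sum>J\<in>?I. \<Sum>j<k. \<Sum>t<n. if J t = j then c J * (A i j * W J t l) else 0)"
        by (rule sum.swap)
      also have "\<dots> = (\<Sum>J\<in>?I. \<Sum>t<n. \<Sum>j<k. if J t = j then c J * (A i j * W J t l) else 0)"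
        by (rule sum.cong[OF refl], rule sum.swap)
      finally show ?thesis .
    qed
    also have "\<dots> = (\<Sum>J\<in>?I. c J * (\<Sum>t<n. A i (J t) * W J t l))"
    proof (intro sum.cong refl)
      fix J assume J: "J \<in> ?I"
      have "(\<Sum>t<n. \<Sum>j<k. if J t = j then c J * (A i j * W J t l) else 0) = (\<Sum>t<n. c J * (A i (J t) * W J t l))"
        using J by (intro sum.cong refl) (auto simp: sum.delta' PiE_iff)
      thus "(\<Sum>t<n. \<Sum>j<k. if J t = j then c J * (A i j * W J t l) else 0) = c J * (\<Sum>t<n. A i (J t) * W J t l)"
        by (simp add: sum_distrib_left)
    qed
    also have "\<dots> = (\<Sum>J\<in>?I. if i = l then c J * m J else 0)" using il by (intro sum.cong refl) (simp add: W1)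
    also have "\<dots> = (if i = l then 1 else 0)" using c1 by simp
    finally show "(\<Sum>j<k. A i j * B j l) = (if i = l then 1 else 0)" .
  next
    fix j j' assume j: "j < k" "j' < k"
    have "(\<Sum>i<n. B j i * A i j') = (\<Sum>J\<in>?I. \<Sum>t<n. \<Sum>i<n. if J t = j then c J * (W J t i * A i j') else 0)"
    proof -
      have "(\<Sum>i<n. B j i * A i j') = (\<Sum>i<n. \<Sum>J\<in>?I. \<Sum>t<n. if J t = j then c J * (W J t i * A i j') else 0)"
        unfolding B_def sum_distrib_right by (intro sum.cong refl) (simp add: mult.assoc)
      also have "\<dots> = (\<Sum>J\<in>?I. \<Sum>i<n. \<Sum>t<n. if J t = j then c J * (W J t i * A i j') else 0)"
        by (rule sum.swap)
      also have "\<dots> = (\<Sum>J\<in>?I. \<Sum>t<n. \<Sum>i<n. if J t = j then c J * (W J t i * A i j') else 0)"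
        by (rule sum.cong[OF refl], rule sum.swap)
      finally show ?thesis .
    qed
    also have "\<dots> \<in> ring_of_integers"
    proof (rule roi_sum, rule roi_sum)
      fix J t assume J: "J \<in> ?I" and t: "t \<in> {..<n}"
      have "(\<Sum>i<n. c J * (W J t i * A i j')) = c J * (\<Sum>i<n. W J t i * A i j')" by (simp add: sum_distrib_left)
      \<comment> \<open>Pairing with column \<open>j'\<close> of \<open>A\<close> replaces column
        \<open>t\<close> of the minor, which gives the minor of a modified index map;
        \<open>c J\<close> times any minor is integral.\<close>
      also have "(\<Sum>i<n. W J t i * A i j') = m (J(t := j'))"
        unfolding W2[OF t[simplified], of J "\<lambda>i. A i j'"] m_def
        by (rule arg_cong[of _ _ det]) (intro eq_matI, auto)
      also have "c J * m (J(t := j')) \<in> ring_of_integers"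
        using J t j by (intro c2) (auto simp: PiE_iff extensional_def)
      finally show "(\<Sum>i<n. if J t = j then c J * (W J t i * A i j') else 0) \<in> ring_of_integers"
        by (cases "J t = j") simp_all
    qed
    finally show "(\<Sum>i<n. B j i * A i j') \<in> ring_of_integers" .
  qed
qed

section \<open>Sums of squares of linear forms\<close>

definition mat_sq :: "nat \<Rightarrow> nat \<Rightarrow> (nat \<Rightarrow> nat \<Rightarrow> 'k::field_char_0) \<Rightarrow> bool" where
  "mat_sq k m G \<longleftrightarrow> (\<exists>l. (\<forall>t<m. \<forall>i<k. l t i \<in> ring_of_integers) \<and>
     (\<forall>i<k. \<forall>j<k. G i j = (\<Sum>t<m. l t i * l t j)))"

lemma mat_sqI:
  assumes "\<And>t i. t < m \<Longrightarrow> i < k \<Longrightarrow> l t i \<in> ring_of_integers"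
    and "\<And>i j. i < k \<Longrightarrow> j < k \<Longrightarrow> G i j = (\<Sum>t<m. l t i * l t j)"
  shows "mat_sq k m G"
  unfolding mat_sq_def using assms by (intro exI[of _ l]) blast

lemma mat_sq_cong:
  assumes "mat_sq k m G" "\<And>i j. i < k \<Longrightarrow> j < k \<Longrightarrow> G i j = H i j"
  shows "mat_sq k m H"
  using assms unfolding mat_sq_def by simp

lemma mat_sq_add:
  assumes "mat_sq k m G" "mat_sq k n H"
  shows "mat_sq k (m + n) (\<lambda>i j. G i j + H i j)"
proof -
  obtain l l' where l: "\<forall>t<m. \<forall>i<k. l t i \<in> ring_of_integers" "\<forall>i<k. \<forall>j<k. G i j = (\<Sum>t<m. l t i * l t j)"
    and l': "\<forall>t<n. \<forall>i<k. l' t i \<in> ring_of_integers" "\<forall>i<k. \<forall>j<k. H i j = (\<Sum>t<n. l' t i * l' t j)"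
    using assms unfolding mat_sq_def by blast
  show ?thesis
  proof (rule mat_sqI[of _ _ "\<lambda>t. if t < m then l t else l' (t - m)"])
    fix i j assume "i < k" "j < k"
    hence "G i j + H i j = (\<Sum>t<m + n. if t < m then l t i * l t j else l' (t - m) i * l' (t - m) j)"
      using l(2) l'(2) by (simp add: sum_lessThan_append[of m "\<lambda>t. l t i * l t j" "\<lambda>t. l' t i * l' t j" n])
    thus "G i j + H i j = (\<Sum>t<m + n. (if t < m then l t else l' (t - m)) i * (if t < m then l t else l' (t - m)) j)"
      by (simp add: if_distrib if_distribR cong: if_cong)
  qed (use l(1) l'(1) in auto)
qed

lemma mat_sq_zero: "mat_sq k 0 (\<lambda>_ _. 0)"
  by (rule mat_sqI) auto

lemma mat_sq_sum:
  assumes "finite I" "\<And>p. p \<in> I \<Longrightarrow> mat_sq k m (G p)"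
  shows "mat_sq k (card I * m) (\<lambda>i j. \<Sum>p\<in>I. G p i j)"
  using assms
proof (induction I rule: finite_induct)
  case empty
  show ?case using mat_sq_zero by simp
next
  case (insert x I)
  have "mat_sq k (m + card I * m) (\<lambda>i j. G x i j + (\<Sum>p\<in>I. G p i j))"
    using insert by (intro mat_sq_add) auto
  thus ?case using insert.hyps by simp
qed

lemma mat_sq_rank_one:
  assumes "\<And>i. i < k \<Longrightarrow> v i \<in> ring_of_integers"
  shows "mat_sq k 1 (\<lambda>i j. v i * v j)"
  using assms by (intro mat_sqI[of _ _ "\<lambda>_. v"]) auto

lemma mat_sq_diag:
  assumes "sum_sq ring_of_integers m c"
  shows "mat_sq k m (\<lambda>i j. if i = r \<and> j = r then c else 0)"
proof -
  obtain x where x: "\<forall>t<m. x t \<in> ring_of_integers" "c = (\<Sum>t<m. (x t)\<^sup>2)"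
    using assms unfolding sum_sq_def by blast
  show ?thesis
    by (rule mat_sqI[of _ _ "\<lambda>t i. if i = r then x t else 0"])
       (use x in \<open>auto simp: power2_eq_square\<close>)
qed

definition ordered_pairs :: "nat \<Rightarrow> (nat \<times> nat) set" where
  "ordered_pairs k = {(r, s). r < s \<and> s < k}"

lemma finite_ordered_pairs: "finite (ordered_pairs k)"
  by (rule finite_subset[of _ "{..<k} \<times> {..<k}"]) (auto simp: ordered_pairs_def)

text \<open>A rank one form supported on the variables \<open>fst p\<close> and \<open>snd p\<close>
  meets a single entry above the diagonal, so the off-diagonal entries can be prescribed
  independently.\<close>

lemma pair_vectors_sum:
  fixes a b :: "nat \<times> nat \<Rightarrow> 'a::comm_ring_1"
  defines "V \<equiv> \<lambda>p i. (if i = fst p then a p else 0) + (if i = snd p then b p else 0)"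
  assumes ij: "i < j" "j < k"
  shows "(\<Sum>p\<in>ordered_pairs k. V p i * V p j) = a (i, j) * b (i, j)"
proof -
  have "(\<Sum>p\<in>ordered_pairs k. V p i * V p j) = (\<Sum>p\<in>ordered_pairs k. if p = (i, j) then a p * b p else 0)"
    using ij by (intro sum.cong refl) (auto simp: V_def ordered_pairs_def split: if_splits)
  also have "\<dots> = a (i, j) * b (i, j)"
    using ij finite_ordered_pairs by (subst sum.delta) (auto simp: ordered_pairs_def)
  finally show ?thesis .
qed

context
  assumes nf: "number_field TYPE('k::field_char_0)"
    and ntr: "\<not> totally_real TYPE('k)"
begin

text \<open>With \<open>a\<close> small and \<open>a\<^sub>2 = 1 + a t\<close> small as well, \<open>a\<close> and \<open>a\<^sub>2\<close> are coprime, so that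
  \<open>g = a b\<^sub>1 + a\<^sub>2 b\<^sub>2\<close>; the coefficient \<open>b\<^sub>2\<close> can be reduced modulo \<open>a\<close>.\<close>

lemma small_splitting:
  assumes \<epsilon>: "\<epsilon> > 0"
  shows "\<exists>\<delta>>0. \<forall>g::'k. g \<in> ring_of_integers \<longrightarrow> (\<forall>\<sigma>\<in>real_embeddings. norm (\<sigma> g) < \<delta>) \<longrightarrow>
    (\<exists>a1 b1 a2 b2. a1 \<in> ring_of_integers \<and> b1 \<in> ring_of_integers \<and> a2 \<in> ring_of_integers \<and> b2 \<in> ring_of_integers \<and>
      g = a1 * b1 + a2 * b2 \<and>
      (\<forall>\<sigma>\<in>real_embeddings. norm (\<sigma> a1) < \<epsilon> \<and> norm (\<sigma> b1) < \<epsilon> \<and> norm (\<sigma> a2) < \<epsilon> \<and> norm (\<sigma> b2) < \<epsilon>))"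
proof -
  have finR: "finite (real_embeddings :: ('k \<Rightarrow> complex) set)" by (rule finite_real_embeddings[OF nf])
  obtain \<alpha> :: 'k and c :: real where \<alpha>: "\<alpha> \<in> ring_of_integers" "\<alpha> \<noteq> 0" "0 < c" "c < 1"
    "\<And>\<sigma>. \<sigma> \<in> real_embeddings \<Longrightarrow> norm (\<sigma> \<alpha>) \<le> c" using small_at_real_embeddings[OF nf ntr] by blast
  obtain R :: real where R: "R \<ge> 1" and cover:
    "\<And>z. (\<And>\<sigma> :: 'k \<Rightarrow> complex. \<sigma> \<in> embeddings \<Longrightarrow> z (conj_emb \<sigma>) = cnj (z \<sigma>)) \<Longrightarrow>
      \<exists>x\<in>ring_of_integers. \<forall>\<sigma>\<in>embeddings. norm (\<sigma> (x :: 'k) - z \<sigma>) \<le> R" using integral_covering[OF nf] by blast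
  \<comment> \<open>Large enough for all four factors: in units of \<open>\<tau>\<close> they are
    bounded by 1, \<open>R\<close>, \<open>R\<close> and \<open>1 + R\<^sup>2\<close>.\<close>
  define K where "K = 1 + R + R\<^sup>2"
  have K: "K > 0" using R by (simp add: K_def add_pos_pos)
  obtain p where p: "c ^ p < \<epsilon> / K" using real_arch_pow_inv[of "\<epsilon> / K" c] \<alpha>(4) \<epsilon> K by auto
  define a where "a = \<alpha> ^ p"
  define \<tau> where "\<tau> = c ^ p"
  have \<tau>: "\<tau> > 0" "\<tau> * K < \<epsilon>" using p K \<alpha>(3) by (auto simp: \<tau>_def field_simps)
  have a: "a \<in> ring_of_integers" "a \<noteq> 0" using \<alpha>(1,2) by (auto simp: a_def)
  have a\<tau>: "norm (\<sigma> a) \<le> \<tau>" if \<sigma>: "\<sigma> \<in> real_embeddings" for \<sigma>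
    unfolding a_def \<tau>_def using \<alpha>(5)[OF \<sigma>] real_embeddings_subset[OF \<sigma>]
    by (simp add: embeddings_simps norm_power power_mono)
  have a0: "norm (\<sigma> a) > 0" if "\<sigma> \<in> embeddings" for \<sigma> using a(2) that by (simp add: embeddings_simps)
  \<comment> \<open>With \<open>t\<close> close to \<open>- 1 / a\<close>, the number
    \<open>1 + a * t = a * (t + 1 / a)\<close> is small along with \<open>a\<close>.\<close>
  have "\<exists>t\<in>ring_of_integers. \<forall>\<sigma>\<in>embeddings. norm (\<sigma> t - (- 1 / \<sigma> a)) \<le> R" by (rule cover) simp
  then obtain t where t: "t \<in> ring_of_integers" "\<And>\<sigma>. \<sigma> \<in> embeddings \<Longrightarrow> norm (\<sigma> t - (- 1 / \<sigma> a)) \<le> R"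
    by blast
  define a2 where "a2 = 1 + a * t"
  have a2O: "a2 \<in> ring_of_integers" using a t by (auto simp: a2_def)
  have a2: "norm (\<sigma> a2) \<le> R * \<tau>" if \<sigma>: "\<sigma> \<in> real_embeddings" for \<sigma>
  proof -
    have \<sigma>': "\<sigma> \<in> embeddings" by (rule real_embeddings_subset[OF \<sigma>])
    have nz: "\<sigma> a \<noteq> 0" using a0[OF \<sigma>'] by auto
    have "\<sigma> a2 = 1 + \<sigma> a * \<sigma> t" using \<sigma>' by (simp add: a2_def embeddings_simps)
    also have "\<dots> = \<sigma> a * (\<sigma> t - (- 1 / \<sigma> a))" using nz by (simp add: distrib_left right_diff_distrib)
    finally have "\<sigma> a2 = \<sigma> a * (\<sigma> t - (- 1 / \<sigma> a))" .
    hence "norm (\<sigma> a2) = norm (\<sigma> a) * norm (\<sigma> t - (- 1 / \<sigma> a))" by (simp only: norm_mult)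
    also have "\<dots> \<le> \<tau> * R" using a\<tau>[OF \<sigma>] t(2)[OF \<sigma>'] \<tau>(1) by (intro mult_mono) auto
    finally show ?thesis by (simp add: mult.commute)
  qed
  \<comment> \<open>A lower bound for \<open>a\<close> at the real embeddings: if \<open>g\<close>
    is smaller than \<open>\<tau> * \<mu>\<close>, it is smaller than \<open>\<tau>\<close> times
    \<open>a\<close>, which survives the division by \<open>a\<close> in the bound for
    \<open>b1\<close>.\<close>
  define \<mu> where "\<mu> = Min (insert 1 ((\<lambda>\<sigma>. norm (\<sigma> a)) ` real_embeddings))"
  have \<mu>: "\<mu> > 0" "\<And>\<sigma>. \<sigma> \<in> real_embeddings \<Longrightarrow> \<mu> \<le> norm (\<sigma> a)"
    using finR a0 real_embeddings_subset by (auto simp: \<mu>_def)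
  define \<delta> where "\<delta> = \<tau> * \<mu>"
  have \<delta>: "\<delta> > 0" using \<tau>(1) \<mu>(1) by (simp add: \<delta>_def)
  have main: "\<exists>a1 b1 a2 b2. a1 \<in> ring_of_integers \<and> b1 \<in> ring_of_integers \<and> a2 \<in> ring_of_integers \<and> b2 \<in> ring_of_integers \<and>
      g = a1 * b1 + a2 * b2 \<and>
      (\<forall>\<sigma>\<in>real_embeddings. norm (\<sigma> a1) < \<epsilon> \<and> norm (\<sigma> b1) < \<epsilon> \<and> norm (\<sigma> a2) < \<epsilon> \<and> norm (\<sigma> b2) < \<epsilon>)"
    if g: "g \<in> ring_of_integers" and gs: "\<And>\<sigma>. \<sigma> \<in> real_embeddings \<Longrightarrow> norm (\<sigma> g) < \<delta>" for g :: 'k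
  proof -
    have "\<exists>w\<in>ring_of_integers. \<forall>\<sigma>\<in>embeddings. norm (\<sigma> w - \<sigma> g / \<sigma> a) \<le> R" by (rule cover) simp
    then obtain w where w: "w \<in> ring_of_integers" "\<And>\<sigma>. \<sigma> \<in> embeddings \<Longrightarrow> norm (\<sigma> w - \<sigma> g / \<sigma> a) \<le> R"
      by blast
    define b2 where "b2 = g - a * w"
    \<comment> \<open>Forced by \<open>g = a * b1 + a2 * b2\<close>: as
      \<open>1 - a2 = - a * t\<close>, the difference \<open>g - a2 * b2\<close> is a multiple of
      \<open>a\<close>.\<close>
    define b1 where "b1 = a2 * w - t * g"
    have O: "b1 \<in> ring_of_integers" "b2 \<in> ring_of_integers" using a t w g a2O by (auto simp: b1_def b2_def)
    have eq: "g = a * b1 + a2 * b2" by (simp add: b1_def b2_def a2_def algebra_simps)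
    have bound: "norm (\<sigma> a) \<le> \<tau> * K" "norm (\<sigma> a2) \<le> \<tau> * K" "norm (\<sigma> b1) \<le> \<tau> * K" "norm (\<sigma> b2) \<le> \<tau> * K"
      if \<sigma>: "\<sigma> \<in> real_embeddings" for \<sigma>
    proof -
      have \<sigma>': "\<sigma> \<in> embeddings" by (rule real_embeddings_subset[OF \<sigma>])
      have TK: "\<tau> * 1 \<le> \<tau> * K" "\<tau> * R \<le> \<tau> * K" "\<tau> * (1 + R\<^sup>2) \<le> \<tau> * K"
        using R \<tau>(1) by (auto simp: K_def intro!: mult_left_mono)
      show "norm (\<sigma> a) \<le> \<tau> * K" using a\<tau>[OF \<sigma>] TK(1) by simp
      show "norm (\<sigma> a2) \<le> \<tau> * K" using a2[OF \<sigma>] TK(2) by (simp add: mult.commute)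
      have nz: "\<sigma> a \<noteq> 0" using a0[OF \<sigma>'] by auto
      have "\<sigma> b2 = \<sigma> g - \<sigma> a * \<sigma> w" using \<sigma>' by (simp add: b2_def embeddings_simps)
      also have "\<dots> = \<sigma> a * - (\<sigma> w - \<sigma> g / \<sigma> a)" using nz by (simp add: right_diff_distrib)
      finally have "\<sigma> b2 = \<sigma> a * - (\<sigma> w - \<sigma> g / \<sigma> a)" .
      hence "norm (\<sigma> b2) = norm (\<sigma> a) * norm (\<sigma> w - \<sigma> g / \<sigma> a)" by (simp only: norm_mult norm_minus_cancel)
      also have "\<dots> \<le> norm (\<sigma> a) * R" using w(2)[OF \<sigma>'] by (intro mult_left_mono) auto
      finally have b2a: "norm (\<sigma> b2) \<le> norm (\<sigma> a) * R" .
      also have "\<dots> \<le> \<tau> * R" using a\<tau>[OF \<sigma>] R by (intro mult_right_mono) auto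
      finally show "norm (\<sigma> b2) \<le> \<tau> * K" using TK(2) by linarith
      have "\<sigma> a * \<sigma> b1 = \<sigma> g - \<sigma> a2 * \<sigma> b2" using \<sigma>' arg_cong[OF eq, of \<sigma>] by (simp add: embeddings_simps)
      hence "norm (\<sigma> a) * norm (\<sigma> b1) \<le> norm (\<sigma> g) + norm (\<sigma> a2) * norm (\<sigma> b2)"
        by (metis norm_mult norm_triangle_ineq4)
      also have "\<dots> \<le> \<tau> * norm (\<sigma> a) + (R * \<tau>) * (norm (\<sigma> a) * R)"
      proof (intro add_mono mult_mono)
        have "norm (\<sigma> g) \<le> \<tau> * \<mu>" using gs[OF \<sigma>] by (simp add: \<delta>_def)
        also have "\<dots> \<le> \<tau> * norm (\<sigma> a)" using \<mu>(2)[OF \<sigma>] \<tau>(1) by (intro mult_left_mono) auto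
        finally show "norm (\<sigma> g) \<le> \<tau> * norm (\<sigma> a)" .
      qed (use a2[OF \<sigma>] b2a R \<tau>(1) in auto)
      also have "\<dots> = norm (\<sigma> a) * (\<tau> * (1 + R\<^sup>2))" by (simp add: power2_eq_square algebra_simps)
      finally have "norm (\<sigma> b1) \<le> \<tau> * (1 + R\<^sup>2)" using a0[OF \<sigma>'] by simp
      thus "norm (\<sigma> b1) \<le> \<tau> * K" using TK(3) by linarith
    qed
    have strict: "norm (\<sigma> a) < \<epsilon> \<and> norm (\<sigma> b1) < \<epsilon> \<and> norm (\<sigma> a2) < \<epsilon> \<and> norm (\<sigma> b2) < \<epsilon>"
      if "\<sigma> \<in> real_embeddings" for \<sigma> using bound[OF that] \<tau>(2) by linarith
    show ?thesis
      by (rule exI[of _ a], rule exI[of _ b1], rule exI[of _ a2], rule exI[of _ b2]) (use a(1) O a2O eq strict in blast)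
  qed
  show ?thesis
    by (rule exI[of _ \<delta>], rule conjI[OF \<delta>], intro allI impI, rule main, assumption, erule bspec)
qed

text \<open>Every off-diagonal entry is produced by the squares of two linear forms in two variables with
  small coefficients, so that the remaining diagonal entries stay totally positive.\<close>

lemma nearly_diagonal_mat_sq:
  assumes m: "\<And>f::'k. f \<in> ring_of_integers \<Longrightarrow> (\<And>\<sigma>. \<sigma> \<in> real_embeddings \<Longrightarrow> 0 < Re (\<sigma> f)) \<Longrightarrow> sum_sq ring_of_integers m f"
    and c: "c > 0"
  shows "\<exists>\<delta>>0. \<forall>G :: nat \<Rightarrow> nat \<Rightarrow> 'k.
    (\<forall>i<k. \<forall>j<k. G i j \<in> ring_of_integers \<and> G i j = G j i) \<longrightarrow>
    (\<forall>\<sigma>\<in>real_embeddings. \<forall>i<k. c \<le> Re (\<sigma> (G i i)) \<and> (\<forall>j<k. i \<noteq> j \<longrightarrow> norm (\<sigma> (G i j)) < \<delta>)) \<longrightarrow>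
    mat_sq k (card (ordered_pairs k) + card (ordered_pairs k) + k * m) G"
proof -
  define P where "P = ordered_pairs k"
  have finP: "finite P" unfolding P_def by (rule finite_ordered_pairs)
  \<comment> \<open>The squares of the forms \<open>V p\<close> and \<open>W p\<close> contribute at
    most \<open>2 * card P * \<epsilon>\<close> to a diagonal entry, which must stay below its lower
    bound \<open>c\<close>; \<open>\<epsilon> \<le> 1\<close> bounds each square by
    \<open>\<epsilon>\<close> itself.\<close>
  define \<epsilon> where "\<epsilon> = min 1 (c / (16 * (real (card P) + 1)))"
  have \<epsilon>: "\<epsilon> > 0" "\<epsilon> \<le> 1" "8 * (real (card P) * \<epsilon>) < c"
  proof -
    show "\<epsilon> > 0" "\<epsilon> \<le> 1" using c by (auto simp: \<epsilon>_def)
    have "8 * (real (card P) * \<epsilon>) \<le> 8 * (real (card P) * (c / (16 * (real (card P) + 1))))"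
      by (intro mult_left_mono) (auto simp: \<epsilon>_def)
    also have "\<dots> < c" using c by (simp add: field_simps add_pos_nonneg)
    finally show "8 * (real (card P) * \<epsilon>) < c" .
  qed
  obtain \<delta> where \<delta>: "\<delta> > 0" and split: "\<forall>g::'k. g \<in> ring_of_integers \<longrightarrow> (\<forall>\<sigma>\<in>real_embeddings. norm (\<sigma> g) < \<delta>) \<longrightarrow>
    (\<exists>a1 b1 a2 b2. a1 \<in> ring_of_integers \<and> b1 \<in> ring_of_integers \<and> a2 \<in> ring_of_integers \<and> b2 \<in> ring_of_integers \<and>
      g = a1 * b1 + a2 * b2 \<and>
      (\<forall>\<sigma>\<in>real_embeddings. norm (\<sigma> a1) < \<epsilon> \<and> norm (\<sigma> b1) < \<epsilon> \<and> norm (\<sigma> a2) < \<epsilon> \<and> norm (\<sigma> b2) < \<epsilon>))"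
    using small_splitting[OF \<epsilon>(1)] by (elim exE conjE)
  have main: "mat_sq k (card P + card P + k * m) G"
    if GO: "\<forall>i<k. \<forall>j<k. G i j \<in> ring_of_integers \<and> G i j = G j i"
      and Gr: "\<forall>\<sigma>\<in>real_embeddings. \<forall>i<k. c \<le> Re (\<sigma> (G i i)) \<and> (\<forall>j<k. i \<noteq> j \<longrightarrow> norm (\<sigma> (G i j)) < \<delta>)" for G :: "nat \<Rightarrow> nat \<Rightarrow> 'k"
  proof -
    have "\<forall>p. \<exists>q. p \<in> P \<longrightarrow> (case q of (a1, b1, a2, b2) \<Rightarrow>
        a1 \<in> ring_of_integers \<and> b1 \<in> ring_of_integers \<and> a2 \<in> ring_of_integers \<and> b2 \<in> ring_of_integers \<and>
        G (fst p) (snd p) = a1 * b1 + a2 * b2 \<and>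
        (\<forall>\<sigma>\<in>real_embeddings. norm (\<sigma> a1) < \<epsilon> \<and> norm (\<sigma> b1) < \<epsilon> \<and> norm (\<sigma> a2) < \<epsilon> \<and> norm (\<sigma> b2) < \<epsilon>))"
      (is "\<forall>p. \<exists>q. p \<in> P \<longrightarrow> ?Q p q")
    proof
      fix p
      show "\<exists>q. p \<in> P \<longrightarrow> ?Q p q"
      proof (cases "p \<in> P")
        case True
        hence p: "fst p < k" "snd p < k" "fst p \<noteq> snd p" by (auto simp: P_def ordered_pairs_def)
        have "G (fst p) (snd p) \<in> ring_of_integers" "\<forall>\<sigma>\<in>real_embeddings. norm (\<sigma> (G (fst p) (snd p))) < \<delta>"
          using GO Gr p by blast+
        from split[THEN spec, THEN mp, THEN mp, OF this] show ?thesis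
          apply (elim exE conjE)
          subgoal for a1 b1 a2 b2 by (rule exI[of _ "(a1, b1, a2, b2)"]) simp
          done
      qed simp
    qed
    from choice[OF this] obtain q where q: "\<forall>p. p \<in> P \<longrightarrow> ?Q p (q p)" by blast
    define a1 where "a1 p = fst (q p)" for p
    define b1 where "b1 p = fst (snd (q p))" for p
    define a2 where "a2 p = fst (snd (snd (q p)))" for p
    define b2 where "b2 p = snd (snd (snd (q p)))" for p
    have O: "a1 p \<in> ring_of_integers" "b1 p \<in> ring_of_integers" "a2 p \<in> ring_of_integers" "b2 p \<in> ring_of_integers"
      and Gp: "G (fst p) (snd p) = a1 p * b1 p + a2 p * b2 p"
      and small: "\<And>\<sigma>. \<sigma> \<in> real_embeddings \<Longrightarrow> norm (\<sigma> (a1 p)) < \<epsilon> \<and> norm (\<sigma> (b1 p)) < \<epsilon> \<and> norm (\<sigma> (a2 p)) < \<epsilon> \<and> norm (\<sigma> (b2 p)) < \<epsilon>"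
      if "p \<in> P" for p
      using q[rule_format, OF that] by (simp_all add: a1_def b1_def a2_def b2_def case_prod_unfold)
    define V where "V p i = (if i = fst p then a1 p else 0) + (if i = snd p then b1 p else 0)" for p and i :: nat
    define W where "W p i = (if i = fst p then a2 p else 0) + (if i = snd p then b2 p else 0)" for p and i :: nat
    have VO: "V p i \<in> ring_of_integers" "W p i \<in> ring_of_integers" if "p \<in> P" for p i
      using O[OF that] by (auto simp: V_def W_def)
    define S where "S i j = (\<Sum>p\<in>P. V p i * V p j) + (\<Sum>p\<in>P. W p i * W p j)" for i j
    define e where "e i = G i i - S i i" for i
    have off: "S i j = G i j" if "i < k" "j < k" "i \<noteq> j" for i j
    proof -
      have lt: "S i j = G i j" if "i < j" "j < k" for i j
      proof -
        have "(i, j) \<in> P" using that by (simp add: P_def ordered_pairs_def)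
        thus ?thesis using Gp[of "(i, j)"]
          unfolding S_def V_def W_def P_def pair_vectors_sum[OF that] by simp
      qed
      have "S i j = S j i" by (simp add: S_def mult.commute)
      thus ?thesis using lt[of i j] lt[of j i] that GO by (cases "i < j") auto
    qed
    have "sum_sq ring_of_integers m (e i)" if i: "i < k" for i
    proof (rule m)
      show "e i \<in> ring_of_integers" unfolding e_def S_def
        using GO i VO by (intro roi_diff roi_add roi_sum roi_mult) auto
    next
      fix \<sigma> :: "'k \<Rightarrow> complex" assume \<sigma>: "\<sigma> \<in> real_embeddings"
      have \<sigma>': "\<sigma> \<in> embeddings" by (rule real_embeddings_subset[OF \<sigma>])
      have V: "norm (\<sigma> (V p i)) \<le> \<epsilon>" "norm (\<sigma> (W p i)) \<le> \<epsilon>" if p: "p \<in> P" for p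
      proof -
        have "fst p \<noteq> snd p" using p by (auto simp: P_def ordered_pairs_def)
        thus "norm (\<sigma> (V p i)) \<le> \<epsilon>" "norm (\<sigma> (W p i)) \<le> \<epsilon>"
          using small[OF p \<sigma>] \<epsilon>(1) \<sigma>' by (auto simp: V_def W_def embeddings_simps)
      qed
      have VV: "norm (\<sigma> (V p i * V p i)) \<le> \<epsilon>" "norm (\<sigma> (W p i * W p i)) \<le> \<epsilon>" if p: "p \<in> P" for p
      proof -
        have "norm (\<sigma> (V p i)) * norm (\<sigma> (V p i)) \<le> \<epsilon> * 1" "norm (\<sigma> (W p i)) * norm (\<sigma> (W p i)) \<le> \<epsilon> * 1"
          using V[OF p] \<epsilon>(1,2) by (intro mult_mono; simp)+
        thus "norm (\<sigma> (V p i * V p i)) \<le> \<epsilon>" "norm (\<sigma> (W p i * W p i)) \<le> \<epsilon>"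
          using \<sigma>' by (simp_all add: embeddings_simps norm_mult)
      qed
      have "norm (\<sigma> (S i i)) \<le> norm (\<Sum>p\<in>P. \<sigma> (V p i * V p i)) + norm (\<Sum>p\<in>P. \<sigma> (W p i * W p i))"
        unfolding S_def embeddings_simps(3)[OF \<sigma>'] embeddings_simps(13)[OF \<sigma>'] by (rule norm_triangle_ineq)
      also have "\<dots> \<le> (\<Sum>p\<in>P. \<epsilon>) + (\<Sum>p\<in>P. \<epsilon>)"
        by (intro add_mono order_trans[OF norm_sum] sum_mono VV)
      also have "\<dots> = 2 * (real (card P) * \<epsilon>)" by simp
      also have "\<dots> < c"
      proof -
        have "0 \<le> real (card P) * \<epsilon>" using \<epsilon>(1) by simp
        thus ?thesis using \<epsilon>(3) by linarith
      qed
      finally have "Re (\<sigma> (S i i)) < c" using complex_Re_le_cmod[of "\<sigma> (S i i)"] by linarith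
      moreover have "c \<le> Re (\<sigma> (G i i))" using Gr \<sigma> i by blast
      ultimately show "0 < Re (\<sigma> (e i))" using \<sigma>' by (simp add: e_def embeddings_simps)
    qed
    hence D: "mat_sq k (card {..<k} * m) (\<lambda>i j. \<Sum>r\<in>{..<k}. if i = r \<and> j = r then e r else 0)"
      by (intro mat_sq_sum mat_sq_diag) auto
    have sum: "mat_sq k (card P * 1 + card P * 1 + card {..<k} * m)
        (\<lambda>i j. ((\<Sum>p\<in>P. V p i * V p j) + (\<Sum>p\<in>P. W p i * W p j)) + (\<Sum>r\<in>{..<k}. if i = r \<and> j = r then e r else 0))"
      by (intro mat_sq_add mat_sq_sum finP mat_sq_rank_one VO D)
    show ?thesis
    proof (rule mat_sq_cong[OF sum[unfolded card_lessThan mult_1_right]])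
      fix i j assume ij: "i < k" "j < k"
      have "(\<Sum>r\<in>{..<k}. if i = r \<and> j = r then e r else 0) = (if i = j then e i else 0)"
      proof -
        have "(\<Sum>r\<in>{..<k}. if i = r \<and> j = r then e r else 0) = (\<Sum>r\<in>{..<k}. if r = i then (if i = j then e i else 0) else 0)"
          by (intro sum.cong) auto
        thus ?thesis using ij by (simp add: sum.delta)
      qed
      thus "((\<Sum>p\<in>P. V p i * V p j) + (\<Sum>p\<in>P. W p i * W p j)) + (\<Sum>r\<in>{..<k}. if i = r \<and> j = r then e r else 0) = G i j"
        using off[OF ij] by (cases "i = j") (auto simp: e_def S_def)
    qed
  qed
  show ?thesis
    by (rule exI[of _ \<delta>], rule conjI[OF \<delta>], intro allI impI, fold P_def, rule main)
qed

end

lemma product_perturbation: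
  fixes x y a b :: real
  assumes "\<bar>x - a\<bar> < e" "\<bar>y - b\<bar> < e" "\<bar>a\<bar> \<le> C" "\<bar>b\<bar> \<le> C" "e \<le> 1"
  shows "\<bar>a * b - x * y\<bar> \<le> e * (2 * C + 1)"
proof -
  have "a * b - x * y = - (x * (y - b) + (x - a) * b)" by (simp add: algebra_simps)
  also have "\<bar>\<dots>\<bar> \<le> \<bar>x\<bar> * \<bar>y - b\<bar> + \<bar>x - a\<bar> * \<bar>b\<bar>"
    by (simp only: abs_minus_cancel flip: abs_mult)
  also have "\<dots> \<le> (C + 1) * e + e * C" using assms by (intro add_mono mult_mono) linarith+
  finally show ?thesis by (simp add: algebra_simps)
qed

context
  assumes nf: "number_field TYPE('k::field_char_0)"
    and ntr: "\<not> totally_real TYPE('k)"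
begin

text \<open>The \<open>k\<close> real squares of a positive definite form minus a small multiple of the identity are
  approximated by squares of integral linear forms; the remainder is nearly diagonal.\<close>

theorem positive_definite_mat_sq:
  fixes m k :: nat
  assumes m: "\<And>f::'k. f \<in> ring_of_integers \<Longrightarrow> (\<And>\<sigma>. \<sigma> \<in> real_embeddings \<Longrightarrow> 0 < Re (\<sigma> f)) \<Longrightarrow> sum_sq ring_of_integers m f"
    and G: "\<And>i j. i < k \<Longrightarrow> j < k \<Longrightarrow> (G i j :: 'k) \<in> ring_of_integers" "\<And>i j. i < k \<Longrightarrow> j < k \<Longrightarrow> G i j = G j i"
    and pd: "\<And>\<sigma>. \<sigma> \<in> real_embeddings \<Longrightarrow> pos_def k (\<lambda>i j. Re (\<sigma> (G i j)))"
  shows "mat_sq k (k + (card (ordered_pairs k) + card (ordered_pairs k) + k * m)) G"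
proof -
  define \<R> where "\<R> = (real_embeddings :: ('k \<Rightarrow> complex) set)"
  have finR: "finite \<R>" unfolding \<R>_def by (rule finite_real_embeddings[OF nf])
  have "\<forall>\<sigma>. \<exists>q. \<sigma> \<in> \<R> \<longrightarrow> (0 < fst q \<and> (\<forall>i<k. \<forall>j<k. Re (\<sigma> (G i j)) = (if i = j then fst q else 0) + (\<Sum>t<k. snd q t i * snd q t j)))"
    (is "\<forall>\<sigma>. \<exists>q. \<sigma> \<in> \<R> \<longrightarrow> ?Q \<sigma> q")
  proof
    fix \<sigma>
    show "\<exists>q. \<sigma> \<in> \<R> \<longrightarrow> ?Q \<sigma> q"
    proof (cases "\<sigma> \<in> \<R>")
      case True
      have "Re (\<sigma> (G i j)) = Re (\<sigma> (G j i))" if "i < k" "j < k" for i j using G(2)[OF that] by simp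
      then obtain c l where "c > 0" "\<And>i j. i < k \<Longrightarrow> j < k \<Longrightarrow> Re (\<sigma> (G i j)) = (if i = j then c else 0) + (\<Sum>t<k. l t i * l t j)"
        using pos_def_decomp[of k "\<lambda>i j. Re (\<sigma> (G i j))"] pd True unfolding \<R>_def by blast
      thus ?thesis by (intro exI[of _ "(c, l)"]) simp
    qed simp
  qed
  from choice[OF this] obtain q where q: "\<forall>\<sigma>. \<sigma> \<in> \<R> \<longrightarrow> ?Q \<sigma> (q \<sigma>)" by blast
  define c where "c \<sigma> = fst (q \<sigma>)" for \<sigma>
  define l where "l \<sigma> = snd (q \<sigma>)" for \<sigma>
  have c: "c \<sigma> > 0" and l: "\<And>i j. i < k \<Longrightarrow> j < k \<Longrightarrow> Re (\<sigma> (G i j)) = (if i = j then c \<sigma> else 0) + (\<Sum>t<k. l \<sigma> t i * l \<sigma> t j)"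
    if "\<sigma> \<in> \<R>" for \<sigma> using q[rule_format, OF that] by (simp_all add: c_def l_def)
  \<comment> \<open>Halving leaves a margin: a diagonal entry within \<open>\<eta> \<le> c1\<close>
    of \<open>c \<sigma> \<ge> 2 * c1\<close> is still at least \<open>c1\<close>.\<close>
  define c1 where "c1 = Min (insert 1 (c ` \<R>)) / 2"
  have c1: "c1 > 0" "\<And>\<sigma>. \<sigma> \<in> \<R> \<Longrightarrow> 2 * c1 \<le> c \<sigma>" using finR c by (auto simp: c1_def)
  have "\<exists>\<delta>>0. \<forall>G :: nat \<Rightarrow> nat \<Rightarrow> 'k.
    (\<forall>i<k. \<forall>j<k. G i j \<in> ring_of_integers \<and> G i j = G j i) \<longrightarrow>
    (\<forall>\<sigma>\<in>real_embeddings. \<forall>i<k. c1 \<le> Re (\<sigma> (G i i)) \<and> (\<forall>j<k. i \<noteq> j \<longrightarrow> norm (\<sigma> (G i j)) < \<delta>)) \<longrightarrow>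
    mat_sq k (card (ordered_pairs k) + card (ordered_pairs k) + k * m) G"
    by (rule nearly_diagonal_mat_sq[OF nf ntr _ c1(1)]) (rule m, assumption, simp)
  then obtain \<delta> where \<delta>: "\<delta> > 0" and near: "\<forall>G :: nat \<Rightarrow> nat \<Rightarrow> 'k.
    (\<forall>i<k. \<forall>j<k. G i j \<in> ring_of_integers \<and> G i j = G j i) \<longrightarrow>
    (\<forall>\<sigma>\<in>real_embeddings. \<forall>i<k. c1 \<le> Re (\<sigma> (G i i)) \<and> (\<forall>j<k. i \<noteq> j \<longrightarrow> norm (\<sigma> (G i j)) < \<delta>)) \<longrightarrow>
    mat_sq k (card (ordered_pairs k) + card (ordered_pairs k) + k * m) G"
    by (elim exE conjE)
  define \<eta> where "\<eta> = min \<delta> c1"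
  have \<eta>: "\<eta> > 0" "\<eta> \<le> \<delta>" "\<eta> \<le> c1" using \<delta> c1(1) by (auto simp: \<eta>_def)
  define C where "C = 1 + (\<Sum>\<sigma>\<in>\<R>. \<Sum>t<k. \<Sum>i<k. \<bar>l \<sigma> t i\<bar>)"
  have C1: "C \<ge> 1" by (simp add: C_def sum_nonneg)
  have C: "\<bar>l \<sigma> t i\<bar> \<le> C" if "\<sigma> \<in> \<R>" "t < k" "i < k" for \<sigma> t i
  proof -
    have "\<bar>l \<sigma> t i\<bar> \<le> (\<Sum>i<k. \<bar>l \<sigma> t i\<bar>)" using that by (intro member_le_sum) auto
    also have "\<dots> \<le> (\<Sum>t<k. \<Sum>i<k. \<bar>l \<sigma> t i\<bar>)"
      using that by (intro member_le_sum[of t _ "\<lambda>t. \<Sum>i<k. \<bar>l \<sigma> t i\<bar>"]) (auto intro: sum_nonneg)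
    also have "\<dots> \<le> (\<Sum>\<sigma>\<in>\<R>. \<Sum>t<k. \<Sum>i<k. \<bar>l \<sigma> t i\<bar>)"
      using that finR by (intro member_le_sum[of \<sigma> _ "\<lambda>\<sigma>. \<Sum>t<k. \<Sum>i<k. \<bar>l \<sigma> t i\<bar>"]) (auto intro: sum_nonneg)
    finally show ?thesis by (simp add: C_def)
  qed
  \<comment> \<open>An entry is a sum of \<open>k\<close> products, each of which is off by at most
    \<open>e * (2 * C + 1)\<close>; the total error must be less than \<open>\<eta>\<close>.\<close>
  define e where "e = min 1 (\<eta> / ((real k + 1) * (2 * C + 1)))"
  have e: "e > 0" "e \<le> 1" "real k * (e * (2 * C + 1)) < \<eta>"
  proof -
    show "e > 0" "e \<le> 1" using \<eta>(1) C1 by (auto simp: e_def)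
    have "e * ((real k + 1) * (2 * C + 1)) \<le> \<eta> / ((real k + 1) * (2 * C + 1)) * ((real k + 1) * (2 * C + 1))"
      using C1 by (intro mult_right_mono) (auto simp: e_def)
    also have "\<dots> = \<eta>" using C1 by simp
    finally have "real k * (e * (2 * C + 1)) + e * (2 * C + 1) \<le> \<eta>" by (simp add: algebra_simps)
    moreover have "e * (2 * C + 1) > 0" using \<open>e > 0\<close> C1 by simp
    ultimately show "real k * (e * (2 * C + 1)) < \<eta>" by linarith
  qed
  have "\<forall>p. \<exists>x::'k. x \<in> ring_of_integers \<and> (\<forall>\<sigma>\<in>\<R>. \<bar>Re (\<sigma> x) - l \<sigma> (fst p) (snd p)\<bar> < e)"
  proof
    fix p
    show "\<exists>x::'k. x \<in> ring_of_integers \<and> (\<forall>\<sigma>\<in>\<R>. \<bar>Re (\<sigma> x) - l \<sigma> (fst p) (snd p)\<bar> < e)"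
      by (rule dense_at_real_embeddings[OF nf ntr e(1), of "\<lambda>\<sigma>. l \<sigma> (fst p) (snd p)"]) (unfold \<R>_def, blast)
  qed
  from choice[OF this] obtain u :: "nat \<times> nat \<Rightarrow> 'k" where u: "\<forall>p. u p \<in> ring_of_integers \<and> (\<forall>\<sigma>\<in>\<R>. \<bar>Re (\<sigma> (u p)) - l \<sigma> (fst p) (snd p)\<bar> < e)"
    by blast
  define L where "L t i = u (t, i)" for t i
  have LO: "L t i \<in> ring_of_integers" for t i using u by (simp add: L_def)
  have Ll: "\<bar>Re (\<sigma> (L t i)) - l \<sigma> t i\<bar> < e" if "\<sigma> \<in> \<R>" for \<sigma> t i
  proof -
    have "\<bar>Re (\<sigma> (u (t, i))) - l \<sigma> (fst (t, i)) (snd (t, i))\<bar> < e" using u that by blast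
    thus ?thesis by (simp add: L_def)
  qed
  define H where "H i j = G i j - (\<Sum>t<k. L t i * L t j)" for i j
  have HO: "H i j \<in> ring_of_integers \<and> H i j = H j i" if "i < k" "j < k" for i j
    using G(1)[OF that] G(2)[OF that] LO by (auto simp: H_def mult.commute intro!: roi_diff roi_sum roi_mult)
  have Hb: "\<bar>Re (\<sigma> (H i j)) - (if i = j then c \<sigma> else 0)\<bar> < \<eta>" if \<sigma>: "\<sigma> \<in> \<R>" and ij: "i < k" "j < k" for \<sigma> i j
  proof -
    have \<sigma>r: "\<sigma> \<in> real_embeddings" using \<sigma> by (simp add: \<R>_def)
    have \<sigma>': "\<sigma> \<in> embeddings" by (rule real_embeddings_subset[OF \<sigma>r])
    have "Re (\<sigma> (H i j)) = Re (\<sigma> (G i j)) - (\<Sum>t<k. Re (\<sigma> (L t i)) * Re (\<sigma> (L t j)))"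
      using \<sigma>' by (simp add: H_def embeddings_simps real_embeddings_Im[OF \<sigma>r])
    hence "Re (\<sigma> (H i j)) - (if i = j then c \<sigma> else 0)
        = (\<Sum>t<k. l \<sigma> t i * l \<sigma> t j - Re (\<sigma> (L t i)) * Re (\<sigma> (L t j)))"
      using l[OF \<sigma> ij] by (simp add: sum_subtractf)
    also have "\<bar>\<dots>\<bar> \<le> (\<Sum>t<k. \<bar>l \<sigma> t i * l \<sigma> t j - Re (\<sigma> (L t i)) * Re (\<sigma> (L t j))\<bar>)" by (rule sum_abs)
    also have "\<dots> \<le> (\<Sum>t<k. e * (2 * C + 1))"
      using ij by (intro sum_mono product_perturbation Ll[OF \<sigma>] C[OF \<sigma>] e(2)) auto
    also have "\<dots> < \<eta>" using e(3) by simp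
    finally show ?thesis .
  qed
  have "mat_sq k (card (ordered_pairs k) + card (ordered_pairs k) + k * m) H"
  proof (rule near[THEN spec, THEN mp, THEN mp])
    show "\<forall>i<k. \<forall>j<k. H i j \<in> ring_of_integers \<and> H i j = H j i" using HO by blast
    show "\<forall>\<sigma>\<in>real_embeddings. \<forall>i<k. c1 \<le> Re (\<sigma> (H i i)) \<and> (\<forall>j<k. i \<noteq> j \<longrightarrow> norm (\<sigma> (H i j)) < \<delta>)"
    proof (intro ballI allI impI conjI)
      fix \<sigma> :: "'k \<Rightarrow> complex" and i assume \<sigma>: "\<sigma> \<in> real_embeddings" and i: "i < k"
      hence \<sigma>R: "\<sigma> \<in> \<R>" by (simp add: \<R>_def)
      have "\<bar>Re (\<sigma> (H i i)) - c \<sigma>\<bar> < \<eta>" using Hb[OF \<sigma>R i i] by simp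
      thus "c1 \<le> Re (\<sigma> (H i i))" using c1(2)[OF \<sigma>R] \<eta>(3) by linarith
      fix j assume j: "j < k" "i \<noteq> j"
      have "norm (\<sigma> (H i j)) = \<bar>Re (\<sigma> (H i j))\<bar>"
        by (subst real_embeddings_of_real[OF \<sigma>]) (rule norm_of_real)
      thus "norm (\<sigma> (H i j)) < \<delta>" using Hb[OF \<sigma>R i j(1)] j(2) \<eta>(2) by simp
    qed
  qed
  moreover have "mat_sq k k (\<lambda>i j. \<Sum>t<k. L t i * L t j)"
    by (rule mat_sqI[of _ _ L]) (use LO in auto)
  ultimately have "mat_sq k (k + (card (ordered_pairs k) + card (ordered_pairs k) + k * m)) (\<lambda>i j. (\<Sum>t<k. L t i * L t j) + H i j)"
    by (rule mat_sq_add[rotated])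
  thus ?thesis by (rule mat_sq_cong) (simp add: H_def)
qed

end

section \<open>Bounding the number of generators\<close>

text \<open>Submodules of a free abelian group of rank \<open>r\<close>, with vectors padded by
  zeros. The values of the last coordinate are the multiples of one value \<open>w r\<close>, and
  subtracting a multiple of \<open>w\<close> reduces to vectors whose last coordinate vanishes. If
  it always vanishes, \<open>w = 0\<close> is listed, so that there are exactly \<open>r\<close>
  generators.\<close>

lemma integer_submodule_generators:
  fixes S :: "(nat \<Rightarrow> int) set"
  assumes "(\<lambda>_. 0) \<in> S" "\<And>v w c. v \<in> S \<Longrightarrow> w \<in> S \<Longrightarrow> (\<lambda>i. v i + c * w i) \<in> S"
    and "\<And>v i. v \<in> S \<Longrightarrow> r \<le> i \<Longrightarrow> v i = 0"
  shows "\<exists>g. (\<forall>l<r. g l \<in> S) \<and> (\<forall>v\<in>S. \<exists>c. \<forall>i. v i = (\<Sum>l<r. c l * g l i))"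
  using assms
proof (induction r arbitrary: S)
  case 0
  show ?case using "0.prems"(3) by (intro exI[of _ undefined]) auto
next
  case (Suc r)
  define S' where "S' = {v \<in> S. v r = 0}"
  have S': "(\<lambda>_. 0) \<in> S'" "\<And>v w c. v \<in> S' \<Longrightarrow> w \<in> S' \<Longrightarrow> (\<lambda>i. v i + c * w i) \<in> S'"
    using Suc.prems(1,2) by (auto simp: S'_def)
  have S'r: "v i = 0" if "v \<in> S'" "r \<le> i" for v i
    using Suc.prems(3)[of v i] that by (cases "i = r") (auto simp: S'_def)
  have "\<exists>g. (\<forall>l<r. g l \<in> S') \<and> (\<forall>v\<in>S'. \<exists>c. \<forall>i. v i = (\<Sum>l<r. c l * g l i))"
    by (rule Suc.IH; (rule S' S'r)?; assumption?)
  then obtain g where g: "\<forall>l<r. g l \<in> S'" "\<forall>v\<in>S'. \<exists>c. \<forall>i. v i = (\<Sum>l<r. c l * g l i)" by blast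
  have "\<exists>w\<in>S. \<forall>v\<in>S. w r dvd v r"
  proof (cases "\<exists>v\<in>S. v r \<noteq> 0")
    case True
    define P where "P h \<longleftrightarrow> h > 0 \<and> (\<exists>w\<in>S. w r = int h)" for h
    have "\<exists>h. P h"
    proof -
      obtain v where v: "v \<in> S" "v r \<noteq> 0" using True by blast
      have "(\<lambda>i. 0 + (- 1) * v i) \<in> S" by (rule Suc.prems(2)[OF Suc.prems(1) v(1)])
      hence v': "(\<lambda>i. - v i) \<in> S" by simp
      show ?thesis
      proof (cases "v r > 0")
        case True
        have "P (nat (v r))" unfolding P_def by (intro conjI bexI[OF _ v(1)]) (use True in auto)
        thus ?thesis by blast
      next
        case False
        have "P (nat (- v r))" unfolding P_def by (intro conjI bexI[OF _ v']) (use False v(2) in auto)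
        thus ?thesis by blast
      qed
    qed
    hence P: "P (LEAST h. P h)" by (rule LeastI_ex)
    define h where "h = (LEAST h. P h)"
    obtain w where w: "w \<in> S" "w r = int h" "h > 0" using P by (auto simp: P_def h_def)
    have "w r dvd v r" if v: "v \<in> S" for v
    proof (rule ccontr)
      assume "\<not> w r dvd v r"
      hence "v r mod int h \<noteq> 0" using w(2) by auto
      moreover have "0 \<le> v r mod int h" using w(3) by (intro pos_mod_sign) simp
      moreover have "v r mod int h < int h" using w(3) by (intro pos_mod_bound) simp
      ultimately have *: "0 < v r mod int h" "v r mod int h < int h" by linarith+
      have "(\<lambda>i. v i + (- (v r div int h)) * w i) \<in> S" by (rule Suc.prems(2)[OF v w(1)])
      moreover have "v r + (- (v r div int h)) * w r = v r mod int h"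
        using w(2) by (simp add: minus_div_mult_eq_mod)
      ultimately have "P (nat (v r mod int h))" unfolding P_def using *(1) by auto
      hence "h \<le> nat (v r mod int h)" unfolding h_def by (rule Least_le)
      thus False using * by linarith
    qed
    thus ?thesis using w(1) by blast
  next
    case False
    thus ?thesis using Suc.prems(1) by (intro bexI[of _ "\<lambda>_. 0"]) auto
  qed
  then obtain w where w: "w \<in> S" "\<And>v. v \<in> S \<Longrightarrow> w r dvd v r" by blast
  define g' where "g' l = (if l = r then w else g l)" for l
  have "\<exists>c. \<forall>i. v i = (\<Sum>l<Suc r. c l * g' l i)" if v: "v \<in> S" for v
  proof -
    obtain a where a: "v r = w r * a" using w(2)[OF v] by (elim dvdE)
    have v': "(\<lambda>i. v i + (- a) * w i) \<in> S'" using Suc.prems(2)[OF v w(1), of "- a"] a by (simp add: S'_def)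
    from bspec[OF g(2) v'] obtain c where c: "\<forall>i. v i + (- a) * w i = (\<Sum>l<r. c l * g l i)" by (elim exE)
    have "v i = (\<Sum>l<Suc r. (if l = r then a else c l) * g' l i)" for i
    proof -
      have "(\<Sum>l<r. (if l = r then a else c l) * g' l i) = (\<Sum>l<r. c l * g l i)"
        by (intro sum.cong) (auto simp: g'_def)
      thus ?thesis using c[rule_format, of i] by (simp add: g'_def)
    qed
    thus ?thesis by (intro exI[of _ "\<lambda>l. if l = r then a else c l"] allI)
  qed
  moreover have "\<forall>l<Suc r. g' l \<in> S" using g(1) w(1) by (auto simp: g'_def S'_def less_Suc_eq)
  ultimately show ?case by blast
qed

lemma sum_if_eq_lessThan:
  fixes m :: nat and f :: "nat \<Rightarrow> 'a::semiring_1"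
  assumes "m < p"
  shows "(\<Sum>j<p. f j * (if j = m then 1 else 0)) = f m"
proof -
  have "(\<Sum>j<p. f j * (if j = m then 1 else 0)) = (\<Sum>j<p. if j = m then f j else 0)" by (intro sum.cong) auto
  thus ?thesis using assms by (simp add: sum.delta)
qed

text \<open>The module generated by the columns of \<open>A\<close> is a free abelian group of rank at most \<open>n d\<close>.\<close>

lemma bounded_generators:
  fixes A :: "nat \<Rightarrow> nat \<Rightarrow> 'k::field_char_0"
  assumes nf: "number_field TYPE('k)" and F: "integral_frame d e (b :: nat \<Rightarrow> 'k) D"
  shows "\<exists>P Q. (\<forall>j l. P j l \<in> ring_of_integers) \<and> (\<forall>l j. Q l j \<in> ring_of_integers) \<and>
    (\<forall>i<n. \<forall>j<p. A i j = (\<Sum>l<n * d. (\<Sum>j'<p. A i j' * P j' l) * Q l j))"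
proof -
  obtain N :: "nat \<Rightarrow> nat \<Rightarrow> int" where N: "\<And>i j. N i j > 0" "\<And>i j. of_int (N i j) * A i j \<in> ring_of_integers"
  proof -
    have "\<forall>q. \<exists>N::int. N > 0 \<and> of_int N * A (fst q) (snd q) \<in> ring_of_integers"
    proof
      fix q
      show "\<exists>N::int. N > 0 \<and> of_int N * A (fst q) (snd q) \<in> ring_of_integers"
        by (rule integer_multiple[OF nf, of "A (fst q) (snd q)"]) blast
    qed
    from choice[OF this] obtain f where "\<forall>q. f q > 0 \<and> of_int (f q) * A (fst q) (snd q) \<in> ring_of_integers" by blast
    note f = this[THEN spec]
    show thesis
    proof (rule that[of "\<lambda>i j. f (i, j)"])
      show "f (i, j) > 0" "of_int (f (i, j)) * A i j \<in> ring_of_integers" for i j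
        using f[of "(i, j)"] by simp_all
    qed
  qed
  define M where "M = (\<Prod>q\<in>{..<n} \<times> {..<p}. N (fst q) (snd q))"
  have M0: "M \<noteq> 0" using N(1) by (simp add: M_def prod_zero_iff less_imp_neq[symmetric])
  have MA: "of_int M * A i j \<in> ring_of_integers" if "i < n" "j < p" for i j
  proof -
    have "N i j dvd M" unfolding M_def using dvd_prodI[of "{..<n} \<times> {..<p}" "(i, j)" "\<lambda>q. N (fst q) (snd q)"] that by simp
    then obtain t where t: "M = N i j * t" by (rule dvdE)
    have eq: "of_int M * A i j = of_int t * (of_int (N i j) * A i j)"
      unfolding t of_int_mult by (simp only: mult_ac)
    show ?thesis unfolding eq by (intro roi_mult roi_of_int N(2))
  qed
  \<comment> \<open>\<open>v\<close> lists, in blocks of \<open>d\<close>, the integer coordinates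
    of \<open>M\<close> times the vector \<open>A c\<close>, where \<open>M\<close> clears the
    denominators of \<open>A\<close>. So \<open>S\<close> is a copy of the module inside the integer
    vectors of length \<open>n * d\<close>; the \<open>P l\<close> below are coefficient vectors
    \<open>c\<close> of its generators.\<close>
  define R where "R v c \<longleftrightarrow> (\<forall>j. c j \<in> ring_of_integers) \<and>
    (\<forall>i<n. of_int M * (\<Sum>j<p. A i j * c j) = (\<Sum>s<d. of_int (v (i * d + s)) * b s))" for v :: "nat \<Rightarrow> int" and c :: "nat \<Rightarrow> 'k"
  define S where "S = {v. (\<forall>i\<ge>n * d. v i = 0) \<and> (\<exists>c. R v c)}"
  have Rlin: "R (\<lambda>i. v i + a * w i) (\<lambda>j. c j + of_int a * c' j)" if "R v c" "R w c'" for v w c c' a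
    unfolding R_def
  proof (intro conjI allI impI)
    show "c j + of_int a * c' j \<in> ring_of_integers" for j
      using that unfolding R_def by (intro roi_add roi_mult roi_of_int) blast+
    fix i assume i: "i < n"
    have "of_int M * (\<Sum>j<p. A i j * (c j + of_int a * c' j))
        = of_int M * (\<Sum>j<p. A i j * c j) + of_int a * (of_int M * (\<Sum>j<p. A i j * c' j))"
      by (simp only: distrib_left sum.distrib sum_distrib_left mult_ac)
    also have "\<dots> = (\<Sum>s<d. of_int (v (i * d + s)) * b s) + of_int a * (\<Sum>s<d. of_int (w (i * d + s)) * b s)"
      using that i by (simp add: R_def)
    also have "\<dots> = (\<Sum>s<d. of_int (v (i * d + s) + a * w (i * d + s)) * b s)"
      by (simp only: of_int_add of_int_mult distrib_right distrib_left sum.distrib sum_distrib_left mult_ac)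
    finally show "of_int M * (\<Sum>j<p. A i j * (c j + of_int a * c' j)) = \<dots>" .
  qed
  have "\<exists>g. (\<forall>l<n * d. g l \<in> S) \<and> (\<forall>v\<in>S. \<exists>c. \<forall>i. v i = (\<Sum>l<n * d. c l * g l i))"
  proof (rule integer_submodule_generators)
    have "R (\<lambda>_. 0) (\<lambda>_. 0)" by (simp add: R_def)
    thus "(\<lambda>_. 0) \<in> S" unfolding S_def by blast
    show "(\<lambda>i. v i + a * w i) \<in> S" if vw: "v \<in> S" "w \<in> S" for v w a
    proof -
      obtain c c' where "R v c" "R w c'" using vw unfolding S_def by blast
      from Rlin[OF this, of a] show ?thesis using vw unfolding S_def by auto
    qed
  qed (auto simp: S_def)
  then obtain g where g: "\<forall>l<n * d. g l \<in> S" "\<forall>v\<in>S. \<exists>c. \<forall>i. v i = (\<Sum>l<n * d. c l * g l i)" by blast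
  have "\<forall>l. \<exists>c. (\<forall>j. c j \<in> ring_of_integers) \<and> (l < n * d \<longrightarrow> R (g l) c)"
  proof
    fix l show "\<exists>c. (\<forall>j. c j \<in> ring_of_integers) \<and> (l < n * d \<longrightarrow> R (g l) c)"
    proof (cases "l < n * d")
      case True
      thus ?thesis using g(1) by (auto simp: S_def R_def)
    next
      case False
      thus ?thesis by (intro exI[of _ "\<lambda>_. 0"]) simp
    qed
  qed
  from choice[OF this] obtain P where P: "\<forall>l. (\<forall>j. P l j \<in> ring_of_integers) \<and> (l < n * d \<longrightarrow> R (g l) (P l))" by blast
  have "\<forall>j. \<exists>c::nat \<Rightarrow> int. j < p \<longrightarrow> (\<forall>i<n. A i j = (\<Sum>l<n * d. (\<Sum>j'<p. A i j' * P l j') * of_int (c l)))"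
  proof
    fix j
    show "\<exists>c::nat \<Rightarrow> int. j < p \<longrightarrow> (\<forall>i<n. A i j = (\<Sum>l<n * d. (\<Sum>j'<p. A i j' * P l j') * of_int (c l)))"
    proof (cases "j < p")
      case True
      have "\<forall>i. \<exists>q::nat \<Rightarrow> int. i < n \<longrightarrow> of_int M * A i j = (\<Sum>s<d. of_int (q s) * b s)"
        using integral_frameD(3)[OF F] MA True by blast
      from choice[OF this] obtain q :: "nat \<Rightarrow> nat \<Rightarrow> int"
        where q: "\<forall>i. i < n \<longrightarrow> of_int M * A i j = (\<Sum>s<d. of_int (q i s) * b s)" by blast
      define v where "v x = (if x < n * d then q (x div d) (x mod d) else 0)" for x
      have vq: "v (i * d + s) = q i s" if "i < n" "s < d" for i s
      proof -
        have "i * d + s < Suc i * d" using that by simp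
        also have "\<dots> \<le> n * d" using that by (intro mult_right_mono) auto
        finally show ?thesis using that by (simp add: v_def)
      qed
      have "R v (\<lambda>j'. if j' = j then 1 else 0)"
        unfolding R_def using q vq by (auto simp: sum_if_eq_lessThan[OF True])
      hence "v \<in> S" unfolding S_def by (auto simp: v_def)
      then obtain c where c: "\<forall>i. v i = (\<Sum>l<n * d. c l * g l i)" using g(2) by blast
      have "A i j = (\<Sum>l<n * d. (\<Sum>j'<p. A i j' * P l j') * of_int (c l))" if i: "i < n" for i
      proof -
        have "of_int M * A i j = (\<Sum>s<d. of_int (v (i * d + s)) * b s)" using q i vq by simp
        also have "\<dots> = (\<Sum>s<d. \<Sum>l<n * d. of_int (c l) * (of_int (g l (i * d + s)) * b s))"
          unfolding c[rule_format] of_int_sum of_int_mult sum_distrib_right mult.assoc ..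
        also have "\<dots> = (\<Sum>l<n * d. of_int (c l) * (\<Sum>s<d. of_int (g l (i * d + s)) * b s))"
          unfolding sum_distrib_left by (rule sum.swap)
        also have "\<dots> = (\<Sum>l<n * d. of_int (c l) * (of_int M * (\<Sum>j'<p. A i j' * P l j')))"
        proof (intro sum.cong refl)
          fix l assume "l \<in> {..<n * d}"
          hence "R (g l) (P l)" using P by simp
          hence "of_int M * (\<Sum>j'<p. A i j' * P l j') = (\<Sum>s<d. of_int (g l (i * d + s)) * b s)"
            using i unfolding R_def by blast
          thus "of_int (c l) * (\<Sum>s<d. of_int (g l (i * d + s)) * b s) = of_int (c l) * (of_int M * (\<Sum>j'<p. A i j' * P l j'))"
            by (simp only:)
        qed
        also have "\<dots> = of_int M * (\<Sum>l<n * d. (\<Sum>j'<p. A i j' * P l j') * of_int (c l))"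
          by (simp only: sum_distrib_left mult_ac)
        finally show ?thesis using M0 by simp
      qed
      thus ?thesis by blast
    qed simp
  qed
  from choice[OF this] obtain c :: "nat \<Rightarrow> nat \<Rightarrow> int"
    where c: "\<forall>j. j < p \<longrightarrow> (\<forall>i<n. A i j = (\<Sum>l<n * d. (\<Sum>j'<p. A i j' * P l j') * of_int (c j l)))" by blast
  show ?thesis
    by (rule exI[of _ "\<lambda>j l. P l j"], rule exI[of _ "\<lambda>l j. of_int (c j l)"]) (use P c in auto)
qed

section \<open>Lattices in coordinates\<close>

lemma mult_mat_vec_index:
  assumes "A \<in> carrier_mat r p" "c \<in> carrier_vec p" "i < r"
  shows "(A *\<^sub>v c) $ i = (\<Sum>j<p. A $$ (i, j) * c $ j)"
  using assms by (simp add: scalar_prod_def row_def atLeast0LessThan)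

lemma scalar_prod_mat_vec:
  fixes M :: "'a::comm_ring_1 mat"
  assumes M: "M \<in> carrier_mat r r" and x: "x \<in> carrier_vec r" and y: "y \<in> carrier_vec r"
  shows "x \<bullet> (M *\<^sub>v y) = (\<Sum>i<r. \<Sum>j<r. M $$ (i, j) * x $ i * y $ j)"
proof -
  have "x \<bullet> (M *\<^sub>v y) = (\<Sum>i<r. x $ i * (M *\<^sub>v y) $ i)"
    using M by (simp add: scalar_prod_def atLeast0LessThan)
  also have "\<dots> = (\<Sum>i<r. \<Sum>j<r. M $$ (i, j) * x $ i * y $ j)"
    using M y by (intro sum.cong) (auto simp: mult_mat_vec_index[OF M y] sum_distrib_left mult_ac simp del: index_mult_mat_vec)
  finally show ?thesis .
qed

lemma scalar_prod_mat_qform: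
  fixes M :: "'a::comm_ring_1 mat"
  assumes "M \<in> carrier_mat r r" "x \<in> carrier_vec r"
  shows "x \<bullet> (M *\<^sub>v x) = qform r (\<lambda>i j. M $$ (i, j)) (\<lambda>i. x $ i)"
  unfolding qform_def by (rule scalar_prod_mat_vec[OF assms assms(2)])

lemma qform_add: "qform k (\<lambda>i j. M i j + N i j) x = qform k M x + qform k N x"
  by (simp add: qform_def sum.distrib distrib_right)

lemma qform_gram:
  fixes m :: nat
  shows "qform k (\<lambda>i j. \<Sum>t<m. l t i * l t j) x = (\<Sum>t<m. (\<Sum>i<k. l t i * x i)\<^sup>2)"
proof -
  have "qform k (\<lambda>i j. \<Sum>t<m. l t i * l t j) x = (\<Sum>i<k. \<Sum>j<k. \<Sum>t<m. (l t i * x i) * (l t j * x j))"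
    by (simp add: qform_def sum_distrib_left sum_distrib_right mult_ac)
  also have "\<dots> = (\<Sum>i<k. \<Sum>t<m. \<Sum>j<k. (l t i * x i) * (l t j * x j))"
    by (intro sum.cong refl sum.swap)
  also have "\<dots> = (\<Sum>t<m. \<Sum>i<k. \<Sum>j<k. (l t i * x i) * (l t j * x j))" by (rule sum.swap)
  finally show ?thesis by (simp add: power2_eq_square sum_product)
qed

lemma qform_pullback:
  "qform k (\<lambda>j j'. \<Sum>i<n. \<Sum>i'<n. g i i' * A i j * A i' j') x = qform n g (\<lambda>i. \<Sum>j<k. A i j * x j)"
proof -
  have "qform k (\<lambda>j j'. \<Sum>i<n. \<Sum>i'<n. g i i' * A i j * A i' j') x
      = (\<Sum>j<k. \<Sum>j'<k. \<Sum>i<n. \<Sum>i'<n. g i i' * (A i j * x j) * (A i' j' * x j'))"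
    by (simp add: qform_def sum_distrib_left sum_distrib_right mult_ac)
  also have "\<dots> = (\<Sum>j<k. \<Sum>i<n. \<Sum>j'<k. \<Sum>i'<n. g i i' * (A i j * x j) * (A i' j' * x j'))"
    by (intro sum.cong refl sum.swap)
  also have "\<dots> = (\<Sum>i<n. \<Sum>j<k. \<Sum>j'<k. \<Sum>i'<n. g i i' * (A i j * x j) * (A i' j' * x j'))"
    by (rule sum.swap)
  also have "\<dots> = (\<Sum>i<n. \<Sum>j<k. \<Sum>i'<n. \<Sum>j'<k. g i i' * (A i j * x j) * (A i' j' * x j'))"
    by (intro sum.cong refl sum.swap)
  also have "\<dots> = (\<Sum>i<n. \<Sum>i'<n. \<Sum>j<k. \<Sum>j'<k. g i i' * (A i j * x j) * (A i' j' * x j'))"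
    by (intro sum.cong refl sum.swap)
  also have "\<dots> = (\<Sum>i<n. \<Sum>i'<n. g i i' * (\<Sum>j<k. A i j * x j) * (\<Sum>j'<k. A i' j' * x j'))"
    by (simp add: sum_distrib_left sum_distrib_right mult_ac)
  finally show ?thesis by (simp add: qform_def)
qed

lemma quad_sum_of_squares:
  fixes x :: "'k::field_char_0 vec"
  assumes x: "x \<in> carrier_vec m"
  shows "quad (sum_of_squares_lattice m) x = (\<Sum>i<m. (x $ i)\<^sup>2)"
proof -
  have "quad (sum_of_squares_lattice m) x = x \<bullet> x"
    using x by (simp add: quad_def bilin_def sum_of_squares_lattice_def)
  thus ?thesis using x by (simp add: scalar_prod_def atLeast0LessThan power2_eq_square)
qed

lemma real_embedding_hom:
  assumes "\<sigma> \<in> real_embeddings"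
  shows "field_hom (\<lambda>x. Re (\<sigma> x))"
  by unfold_locales (use real_embeddings_subset[OF assms] in \<open>simp_all add: embeddings_simps real_embeddings_Im[OF assms]\<close>)

lemma of_real_hom_embeddings:
  fixes \<tau> :: "'k::field_char_0 \<Rightarrow> real"
  assumes "field_hom \<tau>"
  shows "(\<lambda>x. complex_of_real (\<tau> x)) \<in> embeddings"
proof -
  interpret field_hom \<tau> by (rule assms)
  have "field_hom (\<lambda>x. complex_of_real (\<tau> x))" by unfold_locales (simp_all add: hom_add hom_mult)
  thus ?thesis by (simp add: embeddings_def)
qed

section \<open>Universality forces squares modulo 2\<close>

lemma squares_mod_2_if_n_universal:
  fixes x :: "'k::field_char_0"
  assumes nf: "number_field TYPE('k)" and n: "n > 0"
    and univ: "n_universal n (sum_of_squares_lattice m :: 'k quad_lattice)" and x: "x \<in> ring_of_integers"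
  shows "\<exists>s\<in>ring_of_integers. \<exists>w\<in>ring_of_integers. x = s\<^sup>2 + 2 * w"
proof -
  have finE: "finite (embeddings :: ('k \<Rightarrow> complex) set)" by (rule finite_embeddings[OF nf])
  obtain N :: nat where N: "(\<Sum>\<sigma>\<in>embeddings. norm (\<sigma> x)) < real N" using reals_Archimedean2 by blast
  have N\<sigma>: "norm (\<sigma> x) < real N" if "\<sigma> \<in> embeddings" for \<sigma>
    using member_le_sum[OF that, of "\<lambda>\<sigma>. norm (\<sigma> x)"] finE N by simp
  define a where "a = x + 2 * of_nat N"
  have aO: "a \<in> ring_of_integers" using x by (auto simp: a_def)
  have a\<tau>: "\<tau> a > 0" if \<tau>: "field_hom \<tau>" for \<tau> :: "'k \<Rightarrow> real"
  proof -
    interpret field_hom \<tau> by (rule \<tau>)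
    have "\<tau> (2::'k) = 2" using hom_of_int[of 2] by simp
    moreover have "\<tau> (of_nat N) = real N" using hom_of_int[of "int N"] by simp
    ultimately have "\<tau> a = \<tau> x + 2 * real N" by (simp add: a_def hom_add hom_mult)
    moreover have "\<bar>\<tau> x\<bar> < real N" using N\<sigma>[OF of_real_hom_embeddings[OF \<tau>]] by simp
    ultimately show ?thesis by linarith
  qed
  \<comment> \<open>The test lattice is free with diagonal form \<open>a, 1, ..., 1\<close>; a
    representation maps the first unit vector to an integral vector whose \<open>m\<close> entries
    have squares summing to \<open>a\<close>.\<close>
  define G where "G = mat n n (\<lambda>(i, j). if i = j then (if i = 0 then a else 1) else 0)"
  have G: "G \<in> carrier_mat n n" by (simp add: G_def)
  define L where "L = \<lparr>rank = n, gram = G, points = integer_vecs n\<rparr>"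
  have L: "rank L = n" "gram L = G" "points L = integer_vecs n" by (simp_all add: L_def)
  have "quadratic_lattice L"
    unfolding quadratic_lattice_def L
  proof (intro conjI G exI[of _ n] bexI[of _ "1\<^sub>m n"])
    show "transpose_mat G = G" by (rule eq_matI) (auto simp: G_def)
    have id: "1\<^sub>m n *\<^sub>v c = c" if "c \<in> carrier_vec n" for c :: "'k vec" using that by simp
    show "integer_vecs n = (\<lambda>c. 1\<^sub>m n *\<^sub>v c) ` (integer_vecs n :: 'k vec set)"
      by (simp add: integer_vecs_def id cong: image_cong_simp)
    show "(\<lambda>c. 1\<^sub>m n *\<^sub>v c) ` carrier_vec n = (carrier_vec n :: 'k vec set)"
      by (simp add: id cong: image_cong_simp)
  qed simp
  moreover have "classic_integral L"
    unfolding classic_integral_def bilin_def L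
  proof (intro ballI)
    fix u v :: "'k vec" assume uv: "u \<in> integer_vecs n" "v \<in> integer_vecs n"
    hence c: "u \<in> carrier_vec n" "v \<in> carrier_vec n" by (auto simp: integer_vecs_def)
    show "u \<bullet> (G *\<^sub>v v) \<in> ring_of_integers"
      unfolding scalar_prod_mat_vec[OF G c] using uv aO
      by (intro roi_sum roi_mult) (auto simp: G_def integer_vecs_def)
  qed
  moreover have "positive_definite_at \<tau> L" if \<tau>: "field_hom \<tau>" for \<tau>
    unfolding positive_definite_at_def L
  proof (intro ballI impI)
    interpret field_hom \<tau> by (rule \<tau>)
    fix y :: "real vec" assume y: "y \<in> carrier_vec n" "y \<noteq> 0\<^sub>v n"
    have "\<exists>i<n. y $ i \<noteq> 0"
    proof (rule ccontr)
      assume "\<not> (\<exists>i<n. y $ i \<noteq> 0)"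
      hence "y = 0\<^sub>v n" using y(1) by (intro eq_vecI) auto
      thus False using y(2) by blast
    qed
    then obtain i where i: "i < n" "y $ i \<noteq> 0" by blast
    define c where "c i = (if i = 0 then \<tau> a else 1)" for i :: nat
    have c: "c i > 0" for i using a\<tau>[OF \<tau>] by (simp add: c_def)
    have "y \<bullet> (map_mat \<tau> G *\<^sub>v y) = (\<Sum>i<n. \<Sum>j<n. map_mat \<tau> G $$ (i, j) * y $ i * y $ j)"
      using G y(1) by (intro scalar_prod_mat_vec) auto
    also have "\<dots> = (\<Sum>i<n. \<Sum>j<n. if j = i then c i * (y $ i)\<^sup>2 else 0)"
      by (intro sum.cong) (auto simp: G_def c_def power2_eq_square)
    also have "\<dots> = (\<Sum>i<n. c i * (y $ i)\<^sup>2)" by (simp add: sum.delta)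
    also have "\<dots> > 0"
      by (rule sum_pos2[of _ i]) (use i c in \<open>auto simp: less_imp_le\<close>)
    finally show "0 < y \<bullet> (map_mat \<tau> G *\<^sub>v y)" .
  qed
  ultimately have "represents (sum_of_squares_lattice m) L"
    using univ L(1) unfolding n_universal_def by blast
  then obtain T where T: "T \<in> carrier_mat m n"
    "\<And>y. y \<in> carrier_vec n \<Longrightarrow> quad (sum_of_squares_lattice m) (T *\<^sub>v y) = quad L y"
    "\<And>y. y \<in> integer_vecs n \<Longrightarrow> T *\<^sub>v y \<in> integer_vecs m"
    unfolding represents_def L by (auto simp: sum_of_squares_lattice_def)
  define u where "u = (unit_vec n 0 :: 'k vec)"
  have u: "u \<in> carrier_vec n" "u \<in> integer_vecs n" using n by (auto simp: u_def integer_vecs_def)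
  define t where "t = T *\<^sub>v u"
  have tO: "t $ i \<in> ring_of_integers" if "i < m" for i using T(3)[OF u(2)] that by (simp add: t_def integer_vecs_def)
  have "(\<Sum>i<m. (t $ i)\<^sup>2) = quad L u"
    using T(2)[OF u(1)] T(1) u(1) by (subst quad_sum_of_squares[symmetric]) (auto simp: t_def)
  also have "\<dots> = (\<Sum>i<n. \<Sum>j<n. G $$ (i, j) * u $ i * u $ j)"
    unfolding quad_def bilin_def L by (rule scalar_prod_mat_vec[OF G u(1) u(1)])
  also have "\<dots> = (\<Sum>i<n. \<Sum>j<n. if j = 0 then (if i = 0 then a else 0) else 0)"
    using n by (intro sum.cong) (auto simp: G_def u_def)
  also have "\<dots> = a" using n by (simp add: sum.delta)
  finally have ta: "(\<Sum>i<m. (t $ i)\<^sup>2) = a" .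
  obtain w where w: "w \<in> ring_of_integers" "(\<Sum>i<m. t $ i)\<^sup>2 = (\<Sum>i<m. (t $ i)\<^sup>2) + 2 * w"
    using square_sum_mod_2[of "{..<m}" "\<lambda>i. t $ i"] tO by auto
  have "x = (\<Sum>i<m. t $ i)\<^sup>2 + 2 * (- w - of_nat N)" unfolding w(2) ta a_def by (simp add: algebra_simps)
  moreover have "(\<Sum>i<m. t $ i) \<in> ring_of_integers" using tO by (intro roi_sum) auto
  moreover have "- w - of_nat N \<in> ring_of_integers" using w(1) by (intro roi_diff roi_uminus) auto
  ultimately show ?thesis by blast
qed

text \<open>The matrix \<open>E = 1 - B A\<close> is integral, it is the identity on the kernel of \<open>A\<close>, and \<open>E B = 0\<close>. So the
  form \<open>A\<^sup>T g A + E\<^sup>T E\<close> on the free lattice is integral and positive definite, and it restricts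
  to \<open>g\<close> along \<open>B\<close>.\<close>

lemma represents_if_generated:
  fixes L :: "'k::field_char_0 quad_lattice" and A B :: "nat \<Rightarrow> nat \<Rightarrow> 'k"
  assumes g: "gram L \<in> carrier_mat n n" "transpose_mat (gram L) = gram L" "rank L = n"
    and A: "\<And>j. j < k \<Longrightarrow> vec n (\<lambda>i. A i j) \<in> points L"
    and pts: "\<And>y. y \<in> points L \<Longrightarrow> y \<in> carrier_vec n \<and>
      (\<exists>u. (\<forall>j. u j \<in> ring_of_integers) \<and> (\<forall>i<n. y $ i = (\<Sum>j<k. A i j * u j)))"
    and AB: "\<And>i l. i < n \<Longrightarrow> l < n \<Longrightarrow> (\<Sum>j<k. A i j * B j l) = (if i = l then 1 else 0)"
    and BA: "\<And>j j'. j < k \<Longrightarrow> j' < k \<Longrightarrow> (\<Sum>i<n. B j i * A i j') \<in> ring_of_integers"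
    and int: "classic_integral L"
    and pos: "\<And>\<sigma>. field_hom \<sigma> \<Longrightarrow> positive_definite_at \<sigma> L"
    and mat_sq: "\<And>H. (\<And>i j. i < k \<Longrightarrow> j < k \<Longrightarrow> (H i j :: 'k) \<in> ring_of_integers) \<Longrightarrow>
      (\<And>i j. i < k \<Longrightarrow> j < k \<Longrightarrow> H i j = H j i) \<Longrightarrow>
      (\<And>\<sigma>. \<sigma> \<in> real_embeddings \<Longrightarrow> pos_def k (\<lambda>i j. Re (\<sigma> (H i j)))) \<Longrightarrow> mat_sq k m H"
  shows "represents (sum_of_squares_lattice m) L"
proof -
  let ?g = "\<lambda>i i'. gram L $$ (i, i')"
  define E where "E j j' = (if j = j' then 1 else 0) - (\<Sum>i<n. B j i * A i j')" for j j'
  define H1 where "H1 j j' = (\<Sum>i<n. \<Sum>i'<n. ?g i i' * A i j * A i' j')" for j j'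
  define H where "H j j' = H1 j j' + (\<Sum>t<k. E t j * E t j')" for j j'
  have EO: "E j j' \<in> ring_of_integers" if "j < k" "j' < k" for j j'
    using BA[OF that] by (auto simp: E_def intro: roi_diff roi_uminus)
  have gsym: "?g i i' = ?g i' i" if "i < n" "i' < n" for i i'
    using arg_cong[OF g(2), of "\<lambda>M. M $$ (i, i')"] g(1) that by simp
  have H1: "H1 j j' = bilin L (vec n (\<lambda>i. A i j)) (vec n (\<lambda>i. A i j'))" for j j'
    unfolding bilin_def by (subst scalar_prod_mat_vec[OF g(1)]) (simp_all add: H1_def)
  have "mat_sq k m H"
  proof (rule mat_sq)
    show "H i j \<in> ring_of_integers" if "i < k" "j < k" for i j
      unfolding H_def H1 using int A that EO
      by (intro roi_add roi_sum roi_mult) (auto simp: classic_integral_def)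
    have "H1 i j = H1 j i" for i j
      unfolding H1_def by (subst sum.swap) (intro sum.cong refl, simp add: gsym mult_ac)
    thus "H i j = H j i" for i j by (simp add: H_def mult.commute)
  next
    fix \<sigma> :: "'k \<Rightarrow> complex" assume \<sigma>: "\<sigma> \<in> real_embeddings"
    define \<tau> where "\<tau> x = Re (\<sigma> x)" for x
    have \<tau>: "field_hom \<tau>" using real_embedding_hom[OF \<sigma>] unfolding \<tau>_def .
    interpret field_hom \<tau> by (rule \<tau>)
    have H\<tau>: "\<tau> (H j j') = (\<Sum>i<n. \<Sum>i'<n. \<tau> (?g i i') * \<tau> (A i j) * \<tau> (A i' j')) + (\<Sum>t<k. \<tau> (E t j) * \<tau> (E t j'))" for j j'
      by (simp add: H_def H1_def hom_add hom_mult hom_sum)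
    show "pos_def k (\<lambda>i j. Re (\<sigma> (H i j)))"
      unfolding pos_def_def
    proof (intro allI impI)
      fix z assume z: "\<exists>i<k. (z i :: real) \<noteq> 0"
      define v where "v = vec n (\<lambda>i. \<Sum>j<k. \<tau> (A i j) * z j)"
      have q: "qform k (\<lambda>i j. Re (\<sigma> (H i j))) z
          = qform n (\<lambda>i i'. \<tau> (?g i i')) (\<lambda>i. \<Sum>j<k. \<tau> (A i j) * z j) + (\<Sum>t<k. (\<Sum>j<k. \<tau> (E t j) * z j)\<^sup>2)"
        unfolding \<tau>_def[symmetric] H\<tau> qform_add qform_pullback qform_gram ..
      have "qform n (\<lambda>i i'. \<tau> (?g i i')) (\<lambda>i. \<Sum>j<k. \<tau> (A i j) * z j)
          = qform n (\<lambda>i i'. map_mat \<tau> (gram L) $$ (i, i')) (\<lambda>i. v $ i)"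
        using g(1) by (simp add: qform_def v_def)
      also have "\<dots> = v \<bullet> (map_mat \<tau> (gram L) *\<^sub>v v)"
        using g(1) by (intro scalar_prod_mat_qform[symmetric]) (auto simp: v_def)
      finally have qv: "qform n (\<lambda>i i'. \<tau> (?g i i')) (\<lambda>i. \<Sum>j<k. \<tau> (A i j) * z j) = v \<bullet> (map_mat \<tau> (gram L) *\<^sub>v v)" .
      show "qform k (\<lambda>i j. Re (\<sigma> (H i j))) z > 0"
      proof (cases "v = 0\<^sub>v n")
        case False
        have "v \<in> carrier_vec n" by (simp add: v_def)
        hence "v \<bullet> (map_mat \<tau> (gram L) *\<^sub>v v) > 0"
          using pos[OF \<tau>] False g(3) unfolding positive_definite_at_def by blast
        moreover have "(\<Sum>t<k. (\<Sum>j<k. \<tau> (E t j) * z j)\<^sup>2) \<ge> 0" by (intro sum_nonneg) simp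
        ultimately show ?thesis unfolding q qv by linarith
      next
        case True
        have v0: "(\<Sum>j<k. \<tau> (A i j) * z j) = 0" if "i < n" for i
          using arg_cong[OF True, of "\<lambda>v. v $ i"] that by (simp add: v_def)
        have Ez: "(\<Sum>j<k. \<tau> (E t j) * z j) = z t" if t: "t < k" for t
        proof -
          have "(\<Sum>j<k. \<tau> (E t j) * z j) = (\<Sum>j<k. (if j = t then z j else 0) - (\<Sum>i<n. \<tau> (B t i) * (\<tau> (A i j) * z j)))"
            by (intro sum.cong) (auto simp: E_def hom_minus hom_mult hom_sum left_diff_distrib sum_distrib_right mult.assoc)
          also have "\<dots> = z t - (\<Sum>i<n. \<Sum>j<k. \<tau> (B t i) * (\<tau> (A i j) * z j))"
            using t by (simp add: sum_subtractf sum.delta) (rule sum.swap)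
          also have "(\<Sum>i<n. \<Sum>j<k. \<tau> (B t i) * (\<tau> (A i j) * z j)) = (\<Sum>i<n. 0)"
            using v0 by (intro sum.cong) (auto simp flip: sum_distrib_left)
          finally show ?thesis by simp
        qed
        obtain i where i: "i < k" "z i \<noteq> 0" using z by blast
        have "(\<Sum>t<k. (z t)\<^sup>2) > 0" by (rule sum_pos2[of _ i]) (use i in auto)
        thus ?thesis unfolding q qv using Ez True g(1) by simp
      qed
    qed
  qed
  then obtain l where l: "\<forall>t<m. \<forall>i<k. l t i \<in> ring_of_integers" "\<forall>i<k. \<forall>j<k. H i j = (\<Sum>t<m. l t i * l t j)"
    unfolding mat_sq_def by blast
  \<comment> \<open>The integral linear forms \<open>l\<close> live on the free lattice of rank
    \<open>k\<close>; \<open>T\<close> is their restriction along \<open>B\<close>.\<close>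
  define T where "T = mat m n (\<lambda>(t, i). \<Sum>j<k. l t j * B j i)"
  have T: "T \<in> carrier_mat m n" by (simp add: T_def)
  have Tx: "(T *\<^sub>v x) $ t = (\<Sum>j<k. l t j * (\<Sum>i<n. B j i * x $ i))" if "x \<in> carrier_vec n" "t < m" for x t
  proof -
    have "(T *\<^sub>v x) $ t = (\<Sum>i<n. \<Sum>j<k. l t j * (B j i * x $ i))"
      unfolding mult_mat_vec_index[OF T that] using that(2) by (simp add: T_def sum_distrib_right mult.assoc)
    thus ?thesis by (subst (asm) sum.swap) (simp add: sum_distrib_left)
  qed
  have "quad (sum_of_squares_lattice m) (T *\<^sub>v x) = quad L x" if x: "x \<in> carrier_vec n" for x
  proof -
    define w where "w j = (\<Sum>i<n. B j i * x $ i)" for j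
    have Aw: "(\<Sum>j<k. A i j * w j) = x $ i" if i: "i < n" for i
    proof -
      have "(\<Sum>j<k. A i j * w j) = (\<Sum>j<k. \<Sum>l<n. A i j * B j l * x $ l)"
        by (simp add: w_def sum_distrib_left mult.assoc)
      also have "\<dots> = (\<Sum>l<n. \<Sum>j<k. A i j * B j l * x $ l)" by (rule sum.swap)
      also have "\<dots> = (\<Sum>l<n. if l = i then x $ l else 0)"
        using AB[OF i] by (intro sum.cong) (auto simp flip: sum_distrib_right)
      finally show ?thesis using i by (simp add: sum.delta)
    qed
    have Ew: "(\<Sum>j<k. E t j * w j) = 0" if t: "t < k" for t
    proof -
      have "(\<Sum>j<k. E t j * w j) = (\<Sum>j<k. (if j = t then w j else 0) - (\<Sum>i<n. B t i * (A i j * w j)))"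
        by (intro sum.cong) (auto simp: E_def left_diff_distrib sum_distrib_right mult.assoc)
      also have "\<dots> = w t - (\<Sum>i<n. \<Sum>j<k. B t i * (A i j * w j))"
        using t by (simp add: sum_subtractf sum.delta) (rule sum.swap)
      also have "(\<Sum>i<n. \<Sum>j<k. B t i * (A i j * w j)) = w t"
        using Aw by (simp add: w_def flip: sum_distrib_left)
      finally show ?thesis by simp
    qed
    have "quad (sum_of_squares_lattice m) (T *\<^sub>v x) = (\<Sum>t<m. (\<Sum>j<k. l t j * w j)\<^sup>2)"
      using T x by (subst quad_sum_of_squares) (auto simp: Tx w_def simp del: index_mult_mat_vec)
    also have "\<dots> = qform k H w"
      unfolding qform_gram[symmetric] using l(2) by (simp add: qform_def)
    also have "\<dots> = qform n ?g (\<lambda>i. \<Sum>j<k. A i j * w j) + (\<Sum>t<k. (\<Sum>j<k. E t j * w j)\<^sup>2)"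
      unfolding H_def H1_def qform_add qform_pullback qform_gram ..
    also have "\<dots> = qform n ?g (\<lambda>i. x $ i)" using Aw Ew by (simp add: qform_def)
    also have "\<dots> = quad L x"
      unfolding quad_def bilin_def by (rule scalar_prod_mat_qform[OF g(1) x, symmetric])
    finally show ?thesis .
  qed
  moreover have "T *\<^sub>v y \<in> integer_vecs m" if y: "y \<in> points L" for y
  proof -
    have yc: "y \<in> carrier_vec n" using pts[OF y] by blast
    obtain u where u: "\<forall>j. u j \<in> ring_of_integers" "\<forall>i<n. y $ i = (\<Sum>j<k. A i j * u j)"
      using pts[OF y] by blast
    \<comment> \<open>\<open>B\<close> itself need not be integral, but \<open>B y = (B A) u\<close>
      is, because \<open>y = A u\<close> with integral \<open>u\<close>.\<close>
    have "(\<Sum>i<n. B j i * y $ i) \<in> ring_of_integers" if j: "j < k" for j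
    proof -
      have "(\<Sum>i<n. B j i * y $ i) = (\<Sum>i<n. \<Sum>j'<k. B j i * A i j' * u j')"
        using u(2) by (simp add: sum_distrib_left mult.assoc)
      also have "\<dots> = (\<Sum>j'<k. (\<Sum>i<n. B j i * A i j') * u j')"
        by (subst sum.swap) (simp add: sum_distrib_right)
      also have "\<dots> \<in> ring_of_integers" by (rule roi_sum, rule roi_mult) (use BA[OF j] u(1) in auto)
      finally show ?thesis .
    qed
    hence "(T *\<^sub>v y) $ t \<in> ring_of_integers" if "t < m" for t
      unfolding Tx[OF yc that] by - (rule roi_sum, rule roi_mult, use l(1) that in auto)
    thus ?thesis using T yc by (auto simp: integer_vecs_def simp del: index_mult_mat_vec)
  qed
  ultimately show ?thesis
    unfolding represents_def using T g(3) by (intro bexI[of _ T]) (auto simp: sum_of_squares_lattice_def)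
qed

lemma n_universal_if_odd_discriminant:
  assumes nf: "number_field TYPE('k::field_char_0)" and ntr: "\<not> totally_real TYPE('k)"
    and odd: "odd (field_discriminant TYPE('k))"
  shows "\<exists>m\<ge>n + 3. n_universal n (sum_of_squares_lattice m :: 'k quad_lattice)"
proof -
  obtain d e and b :: "nat \<Rightarrow> 'k" and D where F: "integral_frame d e b D"
    using integral_frame_exists[OF nf] by blast
  have D: "odd D" using odd integral_frame_discriminant[OF nf F] by simp
  have sq: "\<exists>s\<in>ring_of_integers. \<exists>w\<in>ring_of_integers. x = s\<^sup>2 + 2 * w" if "x \<in> ring_of_integers" for x :: 'k
    using squares_mod_2_if_odd_discriminant[OF nf F D that] .
  have "\<exists>m. \<forall>f::'k. f \<in> ring_of_integers \<longrightarrow> (\<forall>\<sigma>\<in>real_embeddings. 0 < Re (\<sigma> f)) \<longrightarrow> sum_sq ring_of_integers m f"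
    by (rule totally_positive_sum_sq[OF nf _ ntr]) (rule sq)
  then obtain m0 where m0: "\<forall>f::'k. f \<in> ring_of_integers \<longrightarrow> (\<forall>\<sigma>\<in>real_embeddings. 0 < Re (\<sigma> f)) \<longrightarrow> sum_sq ring_of_integers m0 f"
    by (elim exE)
  \<comment> \<open>Every count is fixed here, before a lattice is given: \<open>k\<close>
    generators suffice for all lattices of rank \<open>n\<close>. The summand \<open>n + 3\<close>
    of \<open>m\<close> is filled with zero forms.\<close>
  define k where "k = n * d"
  define m1 where "m1 = k + (card (ordered_pairs k) + card (ordered_pairs k) + k * m0)"
  define m where "m = m1 + (n + 3)"
  have "represents (sum_of_squares_lattice m) L"
    if ql: "quadratic_lattice L" and L: "rank L = n" and int: "classic_integral L"
      and pos: "\<And>\<sigma>. field_hom \<sigma> \<Longrightarrow> positive_definite_at \<sigma> L" for L :: "'k quad_lattice"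
  proof -
    obtain p A0 where g: "gram L \<in> carrier_mat n n" "transpose_mat (gram L) = gram L"
      and A0: "A0 \<in> carrier_mat n p" "points L = (\<lambda>c. A0 *\<^sub>v c) ` integer_vecs p"
        "(\<lambda>c. A0 *\<^sub>v c) ` carrier_vec p = carrier_vec n"
      using ql unfolding quadratic_lattice_def L by blast
    obtain P Q where P: "\<forall>j l. P j l \<in> ring_of_integers" and Q: "\<forall>l j. Q l j \<in> ring_of_integers"
      and PQ: "\<forall>i<n. \<forall>j<p. A0 $$ (i, j) = (\<Sum>l<k. (\<Sum>j'<p. A0 $$ (i, j') * P j' l) * Q l j)"
      using bounded_generators[OF nf F, of n p "\<lambda>i j. A0 $$ (i, j)"] unfolding k_def by (elim exE conjE)
    define A where "A i l = (\<Sum>j<p. A0 $$ (i, j) * P j l)" for i l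
    have A0A: "(A0 *\<^sub>v c) $ i = (\<Sum>l<k. A i l * (\<Sum>j<p. Q l j * c $ j))"
      if "c \<in> carrier_vec p" "i < n" for c i
    proof -
      have "(A0 *\<^sub>v c) $ i = (\<Sum>j<p. A0 $$ (i, j) * c $ j)"
        by (rule mult_mat_vec_index[OF A0(1) that])
      also have "\<dots> = (\<Sum>j<p. \<Sum>l<k. A i l * Q l j * c $ j)"
        using PQ that(2) by (intro sum.cong refl) (simp add: A_def sum_distrib_right)
      also have "\<dots> = (\<Sum>l<k. \<Sum>j<p. A i l * Q l j * c $ j)" by (rule sum.swap)
      finally show ?thesis by (simp add: sum_distrib_left mult.assoc)
    qed
    have "\<forall>l. \<exists>c. l < n \<longrightarrow> c \<in> carrier_vec p \<and> A0 *\<^sub>v c = unit_vec n l"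
    proof
      fix l
      have "unit_vec n l \<in> (\<lambda>c. A0 *\<^sub>v c) ` carrier_vec p" unfolding A0(3) by simp
      thus "\<exists>c. l < n \<longrightarrow> c \<in> carrier_vec p \<and> A0 *\<^sub>v c = unit_vec n l" by (metis imageE)
    qed
    from choice[OF this] obtain c where c: "\<forall>l. l < n \<longrightarrow> c l \<in> carrier_vec p \<and> A0 *\<^sub>v c l = unit_vec n l" by blast
    \<comment> \<open>A right inverse of \<open>A\<close> over the field, obtained from preimages of
      the unit vectors; these exist because the lattice spans the space.\<close>
    define X where "X j l = (\<Sum>j'<p. Q j j' * c l $ j')" for j l
    have AX: "(\<Sum>j<k. A i j * X j l) = (if i = l then 1 else 0)" if "i < n" "l < n" for i l
    proof -
      have "(\<Sum>j<k. A i j * X j l) = (A0 *\<^sub>v c l) $ i" using A0A[of "c l" i] c that by (simp add: X_def)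
      also have "\<dots> = unit_vec n l $ i" using c that by (simp del: index_mult_mat_vec index_unit_vec)
      finally show ?thesis using that by simp
    qed
    have "\<exists>B. (\<forall>i<n. \<forall>l<n. (\<Sum>j<k. A i j * B j l) = (if i = l then 1 else 0)) \<and>
        (\<forall>j<k. \<forall>j'<k. (\<Sum>i<n. B j i * A i j') \<in> ring_of_integers)"
      by (rule integral_splitting[OF nf, where X = X]) (rule AX)
    then obtain B where B: "\<forall>i<n. \<forall>l<n. (\<Sum>j<k. A i j * B j l) = (if i = l then 1 else 0)"
      "\<forall>j<k. \<forall>j'<k. (\<Sum>i<n. B j i * A i j') \<in> ring_of_integers" by (elim exE conjE)
    show ?thesis
    proof (rule represents_if_generated[OF g L, of k A B])
      fix j assume "j < k"
      have "vec p (\<lambda>j'. P j' j) \<in> integer_vecs p" using P by (simp add: integer_vecs_def)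
      moreover have "vec n (\<lambda>i. A i j) = A0 *\<^sub>v vec p (\<lambda>j'. P j' j)"
      proof (rule eq_vecI)
        fix i assume "i < dim_vec (A0 *\<^sub>v vec p (\<lambda>j'. P j' j))"
        hence i: "i < n" using A0(1) by simp
        show "vec n (\<lambda>i. A i j) $ i = (A0 *\<^sub>v vec p (\<lambda>j'. P j' j)) $ i"
          using i by (subst mult_mat_vec_index[OF A0(1) _ i]) (auto simp: A_def)
      qed (use A0(1) in simp)
      ultimately show "vec n (\<lambda>i. A i j) \<in> points L" unfolding A0(2) by (intro image_eqI)
    next
      fix y assume "y \<in> points L"
      then obtain w where w: "w \<in> integer_vecs p" "y = A0 *\<^sub>v w" unfolding A0(2) by blast
      have wc: "w \<in> carrier_vec p" using w(1) by (simp add: integer_vecs_def)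
      have "\<forall>l. (\<Sum>j<p. Q l j * w $ j) \<in> ring_of_integers"
        using Q w(1) by (auto simp: integer_vecs_def intro!: roi_sum roi_mult)
      moreover have "\<forall>i<n. y $ i = (\<Sum>l<k. A i l * (\<Sum>j<p. Q l j * w $ j))"
        using A0A[OF wc] unfolding w(2) by blast
      moreover have "y \<in> carrier_vec n" using A0(1) wc unfolding w(2) by (rule mult_mat_vec_carrier)
      ultimately show "y \<in> carrier_vec n \<and> (\<exists>u. (\<forall>j. u j \<in> ring_of_integers) \<and> (\<forall>i<n. y $ i = (\<Sum>j<k. A i j * u j)))"
        by (intro conjI exI[of _ "\<lambda>l. \<Sum>j<p. Q l j * w $ j"])
    next
      fix H :: "nat \<Rightarrow> nat \<Rightarrow> 'k"
      assume H: "\<And>i j. i < k \<Longrightarrow> j < k \<Longrightarrow> H i j \<in> ring_of_integers" "\<And>i j. i < k \<Longrightarrow> j < k \<Longrightarrow> H i j = H j i"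
        "\<And>\<sigma>. \<sigma> \<in> real_embeddings \<Longrightarrow> pos_def k (\<lambda>i j. Re (\<sigma> (H i j)))"
      have "mat_sq k m1 H"
        unfolding m1_def
      proof (rule positive_definite_mat_sq[OF nf ntr])
        fix f :: 'k assume "f \<in> ring_of_integers" "\<And>\<sigma>. \<sigma> \<in> real_embeddings \<Longrightarrow> 0 < Re (\<sigma> f)"
        thus "sum_sq ring_of_integers m0 f" using m0 by blast
      qed (use H in blast)+
      moreover have "mat_sq k (n + 3) (\<lambda>_ _. 0 :: 'k)" by (rule mat_sqI[of _ _ "\<lambda>_ _. 0"]) auto
      ultimately have "mat_sq k m (\<lambda>i j. H i j + 0)" unfolding m_def by (rule mat_sq_add)
      thus "mat_sq k m H" by simp
    qed (use B int pos in auto)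
  qed
  hence "n_universal n (sum_of_squares_lattice m :: 'k quad_lattice)"
    unfolding n_universal_def by blast
  moreover have "m \<ge> n + 3" by (simp add: m_def)
  ultimately show ?thesis by blast
qed

theorem theorem1p8:
  fixes n :: nat
  assumes "n > 0"
    and "number_field TYPE('k::field_char_0)"
    and "\<not> totally_real TYPE('k)"
  shows "(\<exists>m\<ge>n + 3. n_universal n (sum_of_squares_lattice m :: 'k quad_lattice))
           \<longleftrightarrow> odd (field_discriminant TYPE('k))"
proof
  assume "\<exists>m\<ge>n + 3. n_universal n (sum_of_squares_lattice m :: 'k quad_lattice)"
  then obtain m where m: "n_universal n (sum_of_squares_lattice m :: 'k quad_lattice)" by blast
  obtain d e and b :: "nat \<Rightarrow> 'k" and D where F: "integral_frame d e b D"
    using integral_frame_exists[OF assms(2)] by blast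
  have "odd D"
    by (rule odd_discriminant_if_squares_mod_2[OF assms(2) F])
       (rule squares_mod_2_if_n_universal[OF assms(2,1) m])
  thus "odd (field_discriminant TYPE('k))" using integral_frame_discriminant[OF assms(2) F] by simp
qed (rule n_universal_if_odd_discriminant[OF assms(2,3)])

end
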